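(* Let $\mathcal O\subseteq\mathbb{R}^d$ be a bounded smooth domain, $\alpha>2$, $\eta>0$, $\mu\ge0$, and let $\varphi$ be the RDS on $H=L^2(\mathcal O)$ associated to $$dX_t=\big(\mathrm{div}(|\nabla X_t|^{\alpha-2}\nabla X_t)+\eta X_t\big)dt+\mu X_t\circ d\beta_t$$ on $\mathcal O$ with Dirichlet boundary conditions (no additive noise). Let $\mathcal A$ be a weak interval random attractor for $\varphi$. Then, $\mathbb{P}$-a.s., the Kolmogorov $\varepsilon$-entropy of $\mathcal A$ is bounded below by $$\mathbb{H}_\delta(\mathcal A(\omega))\ge C(\omega)\,\delta^{\frac{-d(\alpha-2)}{d(\alpha-2)+\alpha}}$$ for all sufficiently small $\delta>0$, where $C(\omega)>0$ is a constant which may depend on $\alpha,d$. In particular, the fractal dimension $d_f(\mathcal A(\omega))$ is infinite $\mathbb{P}$-almost surely.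
   Context: $H=L^2(\mathcal O)$, $V=W_0^{1,\alpha}(\mathcal O)$; $\circ$ is Stratonovich integration. Probability space: the canonical realization of $(W,\beta)$, $W$ a two-sided trace class Wiener process in $H$ (not entering the equation here) and $\beta$ an independent two-sided real Brownian motion, on $\Omega=\{\omega\in C(\mathbb{R};H\times\mathbb{R}):\omega(0)=0\}$ with $(W_t,\beta_t)(\omega)=\omega(t)$, Borel $\sigma$-algebra $\mathcal F$, law $\mathbb{P}$ and shifts $(\theta_t\omega)(\cdot)=\omega(t+\cdot)-\omega(t)$. The RDS: let $z_t(\omega)=-\int_{-\infty}^0e^s\beta_s(\theta_t\omega)ds$ be the strictly stationary, continuous Ornstein--Uhlenbeck process solving $dz_t=-z_tdt+d\beta_t$. For $x\in H$, $\varphi(t,\omega)x:=e^{\mu z_t(\omega)}Z_t$, where $Z\in C([0,\infty);H)\cap L^\alpha_{loc}([0,\infty);V)$ is the unique solution (in $V^*$) of $\frac{d}{dt}Z_t=e^{(\alpha-2)\mu z_t(\omega)}\mathrm{div}(|\nabla Z_t|^{\alpha-2}\nabla Z_t)+\eta Z_t+\mu z_t(\omega)Z_t$, $Z_0=e^{-\mu z_0(\omega)}x$. It satisfies $\varphi(0,\omega)=\mathrm{id}$, $\varphi(t+s,\omega)=\varphi(t,\theta_s\omega)\circ\varphi(s,\omega)$. Order: $x\le y$ in $H$ iff $x(\xi)\le y(\xi)$ for a.e. $\xi\in\mathcal O$; $[x,y]=\{z\in H:x\le z\le y\}$. Let $d(A,B)=\sup_{a\in A}\inf_{b\in B}\|a-b\|_H$.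 A random closed set $\{\mathcal A(\omega)\}$ ($\mathbb{P}$-a.s. closed, $\omega\mapsto d(x,\mathcal A(\omega))$ measurable for each $x\in H$) is a weak interval random attractor for $\varphi$ if (1) $\mathcal A(\omega)$ is nonempty and compact $\mathbb{P}$-a.s.; (2) for all $x\le y$ in $H$, $d(\varphi(t;\cdot)[x,y],\mathcal A(\theta_t\cdot))\to0$ in probability as $t\to\infty$; (3) $\varphi(t,\omega)\mathcal A(\omega)=\mathcal A(\theta_t\omega)$ $\mathbb{P}$-a.s. For precompact $\mathcal A\subseteq H$ let $N_\varepsilon(\mathcal A)$ be the minimal number of balls of radius $\varepsilon$ covering $\mathcal A$; $\mathbb{H}_\varepsilon(\mathcal A):=\ln N_\varepsilon(\mathcal A)$ is the Kolmogorov $\varepsilon$-entropy, and $d_f(\mathcal A)=\limsup_{\varepsilon\to0}\frac{\mathbb{H}_\varepsilon(\mathcal A)}{\ln(1/\varepsilon)}$. *)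

theory Defs
  imports "HOL-Probability.Probability"
begin

section \<open>Square-integrable functions modulo null sets\<close>

definition square_integrable :: "('a::euclidean_space \<Rightarrow> real) \<Rightarrow> bool" where
  "square_integrable f \<longleftrightarrow>
     f \<in> borel_measurable lebesgue \<and> integrable lebesgue (\<lambda>x. (f x)\<^sup>2)"

definition l2_rel :: "('a::euclidean_space \<Rightarrow> real) \<Rightarrow> ('a \<Rightarrow> real) \<Rightarrow> bool" where
  "l2_rel f g \<longleftrightarrow> square_integrable f \<and> square_integrable g \<and> (AE x in lebesgue. f x = g x)"

lemma square_integrable_add:
  assumes "square_integrable f" "square_integrable g"
  shows "square_integrable (\<lambda>x. f x + g x)"
proof -
  have m: "f \<in> borel_measurable lebesgue" "g \<in> borel_measurable lebesgue"
    using assms by (auto simp: square_integrable_def)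
  have "integrable lebesgue (\<lambda>x. 2 * (f x)\<^sup>2 + 2 * (g x)\<^sup>2)"
    using assms by (auto simp: square_integrable_def)
  then have "integrable lebesgue (\<lambda>x. (f x + g x)\<^sup>2)"
  proof (rule Bochner_Integration.integrable_bound)
    show "AE x in lebesgue. norm ((f x + g x)\<^sup>2) \<le> norm (2 * (f x)\<^sup>2 + 2 * (g x)\<^sup>2)"
    proof (rule AE_I2)
      fix x
      have "0 \<le> (f x - g x)\<^sup>2" by simp
      then have "(f x + g x)\<^sup>2 \<le> 2 * (f x)\<^sup>2 + 2 * (g x)\<^sup>2"
        unfolding power2_diff power2_sum by linarith
      then show "norm ((f x + g x)\<^sup>2) \<le> norm (2 * (f x)\<^sup>2 + 2 * (g x)\<^sup>2)"
        by simp
    qed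
  qed (use m in measurable)
  with m show ?thesis by (auto simp: square_integrable_def)
qed

lemma square_integrable_scale:
  "square_integrable f \<Longrightarrow> square_integrable (\<lambda>x. c * f x)"
  by (auto simp: square_integrable_def power_mult_distrib)

lemma square_integrable_mult:
  assumes "square_integrable f" "square_integrable g"
  shows "integrable lebesgue (\<lambda>x. f x * g x)"
proof -
  have m: "f \<in> borel_measurable lebesgue" "g \<in> borel_measurable lebesgue"
    using assms by (auto simp: square_integrable_def)
  have "integrable lebesgue (\<lambda>x. (f x)\<^sup>2 + (g x)\<^sup>2)"
    using assms by (auto simp: square_integrable_def)
  then show ?thesis
  proof (rule Bochner_Integration.integrable_bound)
    show "AE x in lebesgue. norm (f x * g x) \<le> norm ((f x)\<^sup>2 + (g x)\<^sup>2)"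
    proof (rule AE_I2)
      fix x
      have "0 \<le> (\<bar>f x\<bar> - \<bar>g x\<bar>)\<^sup>2" "0 \<le> \<bar>f x\<bar> * \<bar>g x\<bar>" by simp_all
      then have "\<bar>f x\<bar> * \<bar>g x\<bar> \<le> \<bar>f x\<bar>\<^sup>2 + \<bar>g x\<bar>\<^sup>2"
        unfolding power2_diff by linarith
      then show "norm (f x * g x) \<le> norm ((f x)\<^sup>2 + (g x)\<^sup>2)"
        by (simp add: abs_mult)
    qed
  qed (use m in measurable)
qed

lemma equivp_l2_rel: "part_equivp l2_rel"
proof (rule part_equivpI)
  show "\<exists>x. l2_rel x x"
    by (rule exI[of _ "\<lambda>_. 0"]) (simp add: l2_rel_def square_integrable_def)
  show "symp l2_rel"
    by (auto simp: symp_def l2_rel_def elim: AE_mp)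
  show "transp l2_rel"
  proof (rule transpI)
    fix f g h assume "l2_rel f g" "l2_rel g h"
    then show "l2_rel f h" unfolding l2_rel_def
      by (auto elim: AE_mp)
  qed
qed

quotient_type (overloaded) 'a l2 = "'a::euclidean_space \<Rightarrow> real" / partial: l2_rel
  by (rule equivp_l2_rel)

instantiation l2 :: (euclidean_space) real_inner
begin

lift_definition zero_l2 :: "'a l2" is "\<lambda>_. 0"
  by (simp add: l2_rel_def square_integrable_def)

lift_definition plus_l2 :: "'a l2 \<Rightarrow> 'a l2 \<Rightarrow> 'a l2" is "\<lambda>f g x. f x + g x"
  unfolding l2_rel_def by (auto intro: square_integrable_add)

lift_definition uminus_l2 :: "'a l2 \<Rightarrow> 'a l2" is "\<lambda>f x. - f x"
  unfolding l2_rel_def square_integrable_def by auto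

lift_definition minus_l2 :: "'a l2 \<Rightarrow> 'a l2 \<Rightarrow> 'a l2" is "\<lambda>f g x. f x - g x"
  unfolding l2_rel_def
  using square_integrable_add[OF _ square_integrable_scale[where c="-1"]] by auto

lift_definition scaleR_l2 :: "real \<Rightarrow> 'a l2 \<Rightarrow> 'a l2" is "\<lambda>c f x. c * f x"
  unfolding l2_rel_def by (auto intro: square_integrable_scale)

lift_definition inner_l2 :: "'a l2 \<Rightarrow> 'a l2 \<Rightarrow> real"
  is "\<lambda>f g. \<integral>x. f x * g x \<partial>lebesgue"
proof -
  fix f f' g g' :: "'a \<Rightarrow> real"
  assume 1: "l2_rel f f'" "l2_rel g g'"
  then have "integrable lebesgue (\<lambda>x. f x * g x)" "integrable lebesgue (\<lambda>x. f' x * g' x)"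
    by (auto simp: l2_rel_def intro: square_integrable_mult)
  moreover have "AE x in lebesgue. f x * g x = f' x * g' x"
    using 1 by (auto simp: l2_rel_def)
  ultimately show "(\<integral>x. f x * g x \<partial>lebesgue) = (\<integral>x. f' x * g' x \<partial>lebesgue)"
    by (intro integral_cong_AE) auto
qed

definition norm_l2 :: "'a l2 \<Rightarrow> real" where "norm_l2 x = sqrt (inner x x)"
definition dist_l2 :: "'a l2 \<Rightarrow> 'a l2 \<Rightarrow> real" where "dist_l2 x y = norm (x - y)"
definition sgn_l2 :: "'a l2 \<Rightarrow> 'a l2" where "sgn_l2 x = inverse (norm x) *\<^sub>R x"
definition uniformity_l2 :: "('a l2 \<times> 'a l2) filter" where
  "uniformity_l2 = (INF e\<in>{0<..}. principal {(x, y). dist x y < e})"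
definition open_l2 :: "'a l2 set \<Rightarrow> bool" where
  "open_l2 U \<longleftrightarrow> (\<forall>x\<in>U. eventually (\<lambda>(x', y). x' = x \<longrightarrow> y \<in> U) uniformity)"

instance
proof
  fix x y z :: "'a l2" and r s :: real
  show "x + y + z = x + (y + z)"
    by transfer (use square_integrable_add in \<open>auto simp: l2_rel_def algebra_simps\<close>)
  show "x + y = y + x"
    by transfer (use square_integrable_add in \<open>auto simp: l2_rel_def algebra_simps\<close>)
  show "0 + x = x"
    by transfer (auto simp: l2_rel_def)
  show "- x + x = 0"
    by transfer (auto simp: l2_rel_def square_integrable_def)
  show "x - y = x + - y"
    by transfer (use square_integrable_add[OF _ square_integrable_scale[where c="-1"]] in
        \<open>auto simp: l2_rel_def\<close>)
  show "r *\<^sub>R (x + y) = r *\<^sub>R x + r *\<^sub>R y"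
    by transfer (auto simp: l2_rel_def algebra_simps
        intro: square_integrable_add square_integrable_scale)
  show "(r + s) *\<^sub>R x = r *\<^sub>R x + s *\<^sub>R x"
    by transfer (auto simp: l2_rel_def distrib_right
        intro: square_integrable_add square_integrable_scale)
  show "r *\<^sub>R s *\<^sub>R x = (r * s) *\<^sub>R x"
    by transfer (auto simp: l2_rel_def mult.assoc
        intro: square_integrable_add square_integrable_scale
          square_integrable_scale[where c="r * s", simplified mult.assoc])
  show "1 *\<^sub>R x = x"
    by transfer (auto simp: l2_rel_def)
  show "inner x y = inner y x"
    by transfer (simp add: mult.commute)
  show "inner (x + y) z = inner x z + inner y z"
    by transfer (subst Bochner_Integration.integral_add[symmetric],
        auto simp: l2_rel_def distrib_right intro: square_integrable_mult)
  show "inner (r *\<^sub>R x) y = r * inner x y"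
    by transfer (simp add: mult.assoc)
  show "0 \<le> inner x x"
    by transfer simp
  show "inner x x = 0 \<longleftrightarrow> x = 0"
  proof transfer
    fix f :: "'a \<Rightarrow> real" assume "l2_rel f f"
    then have f: "square_integrable f" by (simp add: l2_rel_def)
    have "(\<integral>x. f x * f x \<partial>lebesgue) = 0 \<longleftrightarrow> (AE x in lebesgue. f x * f x = 0)"
      by (rule integral_nonneg_eq_0_iff_AE) (auto intro: square_integrable_mult f)
    with f show "(\<integral>x. f x * f x \<partial>lebesgue) = 0 \<longleftrightarrow> l2_rel f (\<lambda>_. 0)"
      by (simp add: l2_rel_def square_integrable_def)
  qed
qed (simp_all add: norm_l2_def dist_l2_def sgn_l2_def uniformity_l2_def open_l2_def)

end

text \<open>
  \<open>L\<^sup>2(D)\<close> is identified, by extension by zero, with the closed subspace of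
  \<open>L\<^sup>2(\<real>\<^sup>d)\<close> of functions vanishing almost everywhere outside \<open>D\<close>.
\<close>

lift_definition vanishes_outside :: "'a::euclidean_space set \<Rightarrow> 'a l2 \<Rightarrow> bool"
  is "\<lambda>D f. AE x in lebesgue. x \<notin> D \<longrightarrow> f x = 0"
  by (auto simp: l2_rel_def elim: AE_mp)

definition L2 :: "'a::euclidean_space set \<Rightarrow> 'a l2 set" where
  "L2 D = {u. vanishes_outside D u}"

lift_definition le_on :: "'a::euclidean_space set \<Rightarrow> 'a l2 \<Rightarrow> 'a l2 \<Rightarrow> bool"
  is "\<lambda>D f g. AE x in lebesgue. x \<in> D \<longrightarrow> f x \<le> g x"
proof -
  fix D :: "'a set" and f f' g g' :: "'a \<Rightarrow> real"
  assume "l2_rel f f'" "l2_rel g g'"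
  then have "AE x in lebesgue. f x = f' x" "AE x in lebesgue. g x = g' x"
    by (auto simp: l2_rel_def)
  then have "AE x in lebesgue. (x \<in> D \<longrightarrow> f x \<le> g x) = (x \<in> D \<longrightarrow> f' x \<le> g' x)"
    by eventually_elim simp
  then show "(AE x in lebesgue. x \<in> D \<longrightarrow> f x \<le> g x) = (AE x in lebesgue. x \<in> D \<longrightarrow> f' x \<le> g' x)"
    by (rule eventually_cong) simp
qed

definition order_interval :: "'a::euclidean_space set \<Rightarrow> 'a l2 \<Rightarrow> 'a l2 \<Rightarrow> 'a l2 set" where
  "order_interval D x y = {z \<in> L2 D. le_on D x z \<and> le_on D z y}"


section \<open>Smooth functions and bounded smooth domains\<close>

primrec Ck_on :: "nat \<Rightarrow> 'a::euclidean_space set \<Rightarrow> ('a \<Rightarrow> real) \<Rightarrow> bool" where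
  "Ck_on 0 S f \<longleftrightarrow> continuous_on S f"
| "Ck_on (Suc k) S f \<longleftrightarrow>
     (\<forall>x\<in>S. f differentiable (at x)) \<and>
     (\<forall>v. Ck_on k S (\<lambda>x. frechet_derivative f (at x) v))"

text \<open>Only meaningful for open \<open>S\<close>.\<close>

definition smooth_on :: "'a::euclidean_space set \<Rightarrow> ('a \<Rightarrow> real) \<Rightarrow> bool" where
  "smooth_on S f \<longleftrightarrow> (\<forall>k. Ck_on k S f)"

definition gradient :: "('a::euclidean_space \<Rightarrow> real) \<Rightarrow> 'a \<Rightarrow> 'a" where
  "gradient f x = (\<Sum>b\<in>Basis. frechet_derivative f (at x) b *\<^sub>R b)"

text \<open>Near each boundary point the domain is the sublevel set of a local defining function.\<close>

definition smooth_boundary :: "'a::euclidean_space set \<Rightarrow> bool" where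
  "smooth_boundary D \<longleftrightarrow>
     (\<forall>p\<in>frontier D. \<exists>U \<rho>. open U \<and> p \<in> U \<and> smooth_on U \<rho> \<and> gradient \<rho> p \<noteq> 0 \<and>
        D \<inter> U = {x \<in> U. \<rho> x < 0})"

definition bounded_smooth_domain :: "'a::euclidean_space set \<Rightarrow> bool" where
  "bounded_smooth_domain D \<longleftrightarrow>
     D \<noteq> {} \<and> open D \<and> connected D \<and> bounded D \<and> smooth_boundary D"


section \<open>The Sobolev space with zero boundary values\<close>

definition test_function :: "'a::euclidean_space set \<Rightarrow> ('a \<Rightarrow> real) \<Rightarrow> bool" where
  "test_function D \<psi> \<longleftrightarrow>
     smooth_on UNIV \<psi> \<and> (\<exists>K. compact K \<and> K \<subseteq> D \<and> (\<forall>x. x \<notin> K \<longrightarrow> \<psi> x = 0))"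

definition in_Lp :: "'a::euclidean_space set \<Rightarrow> real \<Rightarrow> ('a \<Rightarrow> 'b::euclidean_space) \<Rightarrow> bool" where
  "in_Lp D p f \<longleftrightarrow>
     f \<in> borel_measurable (lebesgue_on D) \<and> integrable (lebesgue_on D) (\<lambda>x. norm (f x) powr p)"

definition is_weak_gradient ::
    "'a::euclidean_space set \<Rightarrow> ('a \<Rightarrow> real) \<Rightarrow> ('a \<Rightarrow> 'a) \<Rightarrow> bool" where
  "is_weak_gradient D u g \<longleftrightarrow>
     (\<forall>\<psi>. test_function D \<psi> \<longrightarrow>
        (\<forall>b\<in>Basis. (\<integral>x. u x * (gradient \<psi> x \<bullet> b) \<partial>lebesgue_on D) =
                   - (\<integral>x. (g x \<bullet> b) * \<psi> x \<partial>lebesgue_on D)))"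

definition W1p :: "'a::euclidean_space set \<Rightarrow> real \<Rightarrow> ('a \<Rightarrow> real) set" where
  "W1p D p = {u. in_Lp D p u \<and> (\<exists>g. in_Lp D p g \<and> is_weak_gradient D u g)}"

text \<open>Determined almost everywhere on \<open>D\<close> for \<open>u \<in> W1p D p\<close>; it is only used under integrals over \<open>D\<close>.\<close>

definition weak_gradient ::
    "'a::euclidean_space set \<Rightarrow> real \<Rightarrow> ('a \<Rightarrow> real) \<Rightarrow> 'a \<Rightarrow> 'a" where
  "weak_gradient D p u = (SOME g. in_Lp D p g \<and> is_weak_gradient D u g)"

definition W1p_norm :: "'a::euclidean_space set \<Rightarrow> real \<Rightarrow> ('a \<Rightarrow> real) \<Rightarrow> real" where
  "W1p_norm D p u =
     ((\<integral>x. \<bar>u x\<bar> powr p \<partial>lebesgue_on D) +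
      (\<integral>x. norm (weak_gradient D p u x) powr p \<partial>lebesgue_on D)) powr (1 / p)"

definition W01p :: "'a::euclidean_space set \<Rightarrow> real \<Rightarrow> ('a \<Rightarrow> real) set" where
  "W01p D p = {u \<in> W1p D p. \<exists>\<psi> :: nat \<Rightarrow> 'a \<Rightarrow> real.
     (\<forall>k. test_function D (\<psi> k)) \<and> (\<lambda>k. W1p_norm D p (\<lambda>x. u x - \<psi> k x)) \<longlonglongrightarrow> 0}"

text \<open>
  For \<open>p \<ge> 2\<close> and bounded \<open>D\<close> this is all of \<open>W\<^sub>0\<^sup>1\<^sup>,\<^sup>p(D)\<close>, since then \<open>L\<^sup>p(D) \<subseteq> L\<^sup>2(D)\<close>.
\<close>

definition V_space :: "'a::euclidean_space set \<Rightarrow> real \<Rightarrow> 'a l2 set" where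
  "V_space D p = {u \<in> L2 D. rep_l2 u \<in> W01p D p}"

definition V_norm :: "'a::euclidean_space set \<Rightarrow> real \<Rightarrow> 'a l2 \<Rightarrow> real" where
  "V_norm D p u = W1p_norm D p (rep_l2 u)"

text \<open>
  The duality pairing in \<open>V\<^sup>*\<close> of \<open>div (|\<nabla>u|\<^sup>p\<^sup>-\<^sup>2 \<nabla>u)\<close> with \<open>v\<close>.
\<close>

definition p_laplace :: "'a::euclidean_space set \<Rightarrow> real \<Rightarrow> 'a l2 \<Rightarrow> 'a l2 \<Rightarrow> real" where
  "p_laplace D p u v =
     - (\<integral>x. norm (weak_gradient D p (rep_l2 u) x) powr (p - 2) *
            (weak_gradient D p (rep_l2 u) x \<bullet> weak_gradient D p (rep_l2 v) x) \<partial>lebesgue_on D)"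

definition strongly_measurable_V ::
    "'a::euclidean_space set \<Rightarrow> real \<Rightarrow> (real \<Rightarrow> 'a l2) \<Rightarrow> bool" where
  "strongly_measurable_V D p Z \<longleftrightarrow>
     (\<exists>s :: nat \<Rightarrow> real \<Rightarrow> 'a l2.
        (\<forall>k. simple_function (lebesgue_on {0..}) (s k) \<and> s k ` {0..} \<subseteq> V_space D p) \<and>
        (AE t in lebesgue_on {0..}. Z t \<in> V_space D p \<and> (\<lambda>k. V_norm D p (Z t - s k t)) \<longlonglongrightarrow> 0))"

definition in_Lp_loc_V ::
    "'a::euclidean_space set \<Rightarrow> real \<Rightarrow> (real \<Rightarrow> 'a l2) \<Rightarrow> bool" where
  "in_Lp_loc_V D p Z \<longleftrightarrow>
     strongly_measurable_V D p Z \<and>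
     (\<forall>T\<ge>0. set_integrable lebesgue {0..T} (\<lambda>t. V_norm D p (Z t) powr p))"


section \<open>The canonical probability space\<close>

type_synonym 'a path = "real \<Rightarrow> 'a l2 \<times> real"

definition paths :: "'a::euclidean_space set \<Rightarrow> 'a path set" where
  "paths D = {\<omega>. continuous_on UNIV \<omega> \<and> \<omega> 0 = 0 \<and> (\<forall>t. fst (\<omega> t) \<in> L2 D)}"

text \<open>The topology of locally uniform convergence.\<close>

definition open_paths :: "'a::euclidean_space set \<Rightarrow> 'a path set \<Rightarrow> bool" where
  "open_paths D U \<longleftrightarrow> U \<subseteq> paths D \<and>
     (\<forall>\<omega>\<in>U. \<exists>T>0. \<exists>\<epsilon>>0. \<forall>\<omega>'\<in>paths D. (\<forall>t\<in>{-T..T}. dist (\<omega>' t) (\<omega> t) < \<epsilon>) \<longrightarrow> \<omega>' \<in> U)"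

definition shift :: "real \<Rightarrow> 'a::euclidean_space path \<Rightarrow> 'a path" where
  "shift t \<omega> = (\<lambda>s. \<omega> (t + s) - \<omega> t)"

definition independent_increments ::
    "'w measure \<Rightarrow> (real \<Rightarrow> 'w \<Rightarrow> 'b::{minus,topological_space}) \<Rightarrow> bool" where
  "independent_increments P X \<longleftrightarrow>
     (\<forall>(n::nat) \<tau>. (\<forall>i<n. \<tau> i < \<tau> (Suc i)) \<longrightarrow>
        prob_space.indep_vars P (\<lambda>_. borel) (\<lambda>i \<omega>. X (\<tau> (Suc i)) \<omega> - X (\<tau> i) \<omega>) {..<n})"

definition centered_gaussian :: "real \<Rightarrow> real measure" where
  "centered_gaussian v =
     (if v = 0 then return borel 0 else density lborel (\<lambda>x. ennreal (normal_density 0 (sqrt v) x)))"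

definition orthonormal_basis_of :: "'b::real_inner set \<Rightarrow> 'b set \<Rightarrow> bool" where
  "orthonormal_basis_of H B \<longleftrightarrow>
     (\<forall>e\<in>B. norm e = 1) \<and> pairwise orthogonal B \<and> closure (span B) = H"

definition trace_class_covariance ::
    "'b::real_inner set \<Rightarrow> ('b \<Rightarrow> 'b) \<Rightarrow> bool" where
  "trace_class_covariance H Q \<longleftrightarrow>
     (\<forall>x\<in>H. Q x \<in> H) \<and>
     (\<forall>x\<in>H. \<forall>y\<in>H. \<forall>a b. Q (a *\<^sub>R x + b *\<^sub>R y) = a *\<^sub>R Q x + b *\<^sub>R Q y) \<and>
     (\<exists>K. \<forall>x\<in>H. norm (Q x) \<le> K * norm x) \<and>
     (\<forall>x\<in>H. \<forall>y\<in>H. inner (Q x) y = inner x (Q y)) \<and>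
     (\<forall>x\<in>H. 0 \<le> inner (Q x) x) \<and>
     (\<exists>B. orthonormal_basis_of H B \<and> (\<lambda>e. inner (Q e) e) summable_on B)"

text \<open>
  In the two predicates below, path continuity and the value \<open>0\<close> at time \<open>0\<close> are not repeated:
  they are part of the definition of \<^const>\<open>paths\<close>.
\<close>

definition wiener_process ::
    "'b::real_inner set \<Rightarrow> ('b \<Rightarrow> 'b) \<Rightarrow> 'w measure \<Rightarrow> (real \<Rightarrow> 'w \<Rightarrow> 'b) \<Rightarrow> bool" where
  "wiener_process H Q P W \<longleftrightarrow>
     independent_increments P W \<and>
     (\<forall>s t. s < t \<longrightarrow> (\<forall>h\<in>H.
        distr P borel (\<lambda>\<omega>. inner (W t \<omega> - W s \<omega>) h) = centered_gaussian ((t - s) * inner (Q h) h)))"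

definition brownian_motion :: "'w measure \<Rightarrow> (real \<Rightarrow> 'w \<Rightarrow> real) \<Rightarrow> bool" where
  "brownian_motion P \<beta> \<longleftrightarrow>
     independent_increments P \<beta> \<and>
     (\<forall>s t. s < t \<longrightarrow> distr P borel (\<lambda>\<omega>. \<beta> t \<omega> - \<beta> s \<omega>) = centered_gaussian (t - s))"

definition canonical_noise_space ::
    "'a::euclidean_space set \<Rightarrow> ('a l2 \<Rightarrow> 'a l2) \<Rightarrow> 'a path measure \<Rightarrow> bool" where
  "canonical_noise_space D Q P \<longleftrightarrow>
     prob_space P \<and>
     space P = paths D \<and>
     sets P = sigma_sets (paths D) {U. open_paths D U} \<and>
     trace_class_covariance (L2 D) Q \<and>
     wiener_process (L2 D) Q P (\<lambda>t \<omega>. fst (\<omega> t)) \<and>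
     brownian_motion P (\<lambda>t \<omega>. snd (\<omega> t)) \<and>
     prob_space.indep_set P
       {(\<lambda>\<omega> t. fst (\<omega> t)) -` A \<inter> space P | A. A \<in> sets (PiM UNIV (\<lambda>_. borel))}
       {(\<lambda>\<omega> t. snd (\<omega> t)) -` A \<inter> space P | A. A \<in> sets (PiM UNIV (\<lambda>_. borel))}"


section \<open>The random dynamical system\<close>

text \<open>
  The integral converges for almost every path. Convergence is invariant under shifts, so on the
  exceptional null set the convention for divergent integrals gives \<open>z \<equiv> 0\<close>; in particular
  \<open>t \<mapsto> z\<^sub>t(\<omega>)\<close> is continuous and \<open>z\<^sub>t(\<theta>\<^sub>s \<omega>) = z\<^bsub>t+s\<^esub>(\<omega>)\<close> for every path.
\<close>

definition ou_process :: "'a::euclidean_space path \<Rightarrow> real \<Rightarrow> real" where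
  "ou_process \<omega> t = - (LINT s:{..0}|lborel. exp s * snd (shift t \<omega> s))"

text \<open>
  The equation holds in \<open>V\<^sup>*\<close> in integrated form, which is spelled out by testing with \<open>v \<in> V\<close>.
\<close>

definition is_solution ::
    "'a::euclidean_space set \<Rightarrow> real \<Rightarrow> real \<Rightarrow> real \<Rightarrow> (real \<Rightarrow> real) \<Rightarrow> 'a l2 \<Rightarrow> (real \<Rightarrow> 'a l2) \<Rightarrow> bool"
  where
  "is_solution D \<alpha> \<eta> \<mu> z x Z \<longleftrightarrow>
     continuous_on {0..} Z \<and> (\<forall>t\<ge>0. Z t \<in> L2 D) \<and> in_Lp_loc_V D \<alpha> Z \<and>
     Z 0 = exp (- \<mu> * z 0) *\<^sub>R x \<and>
     (\<forall>t\<ge>0. \<forall>v\<in>V_space D \<alpha>.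
        inner (Z t) v = inner (Z 0) v +
          (LINT s:{0..t}|lebesgue.
             exp ((\<alpha> - 2) * \<mu> * z s) * p_laplace D \<alpha> (Z s) v
             + \<eta> * inner (Z s) v + \<mu> * z s * inner (Z s) v))"

definition is_rds_of_equation ::
    "'a::euclidean_space set \<Rightarrow> real \<Rightarrow> real \<Rightarrow> real \<Rightarrow> (real \<Rightarrow> 'a path \<Rightarrow> 'a l2 \<Rightarrow> 'a l2) \<Rightarrow> bool"
  where
  "is_rds_of_equation D \<alpha> \<eta> \<mu> \<phi> \<longleftrightarrow>
     (\<forall>\<omega>\<in>paths D. \<forall>x\<in>L2 D. \<exists>Z.
        is_solution D \<alpha> \<eta> \<mu> (ou_process \<omega>) x Z \<and>
        (\<forall>Z'. is_solution D \<alpha> \<eta> \<mu> (ou_process \<omega>) x Z' \<longrightarrow> (\<forall>t\<ge>0. Z' t = Z t)) \<and>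
        (\<forall>t\<ge>0. \<phi> t \<omega> x = exp (\<mu> * ou_process \<omega> t) *\<^sub>R Z t))"


section \<open>Weak interval random attractors\<close>

text \<open>Extended-valued, so that the supremum and the infimum need no side conditions.\<close>

definition semidist :: "'b::metric_space set \<Rightarrow> 'b set \<Rightarrow> ennreal" where
  "semidist A B = (SUP a\<in>A. INF b\<in>B. ennreal (dist a b))"

definition tends_to_0_in_probability :: "'w measure \<Rightarrow> (real \<Rightarrow> 'w \<Rightarrow> ennreal) \<Rightarrow> bool" where
  "tends_to_0_in_probability P X \<longleftrightarrow>
     (\<forall>t\<ge>0. X t \<in> borel_measurable P) \<and>
     (\<forall>\<epsilon>>0. ((\<lambda>t. measure P {\<omega> \<in> space P. X t \<omega> > ennreal \<epsilon>}) \<longlongrightarrow> 0) at_top)"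

definition random_closed_set ::
    "'w measure \<Rightarrow> 'b::metric_space set \<Rightarrow> ('w \<Rightarrow> 'b set) \<Rightarrow> bool" where
  "random_closed_set P H \<A> \<longleftrightarrow>
     (\<forall>\<omega>\<in>space P. \<A> \<omega> \<subseteq> H) \<and>
     (AE \<omega> in P. closed (\<A> \<omega>)) \<and>
     (\<forall>x\<in>H. (\<lambda>\<omega>. semidist {x} (\<A> \<omega>)) \<in> borel_measurable P)"

definition weak_interval_random_attractor ::
    "'a::euclidean_space set \<Rightarrow> 'a path measure \<Rightarrow> (real \<Rightarrow> 'a path \<Rightarrow> 'a l2 \<Rightarrow> 'a l2) \<Rightarrow>
     ('a path \<Rightarrow> 'a l2 set) \<Rightarrow> bool" where
  "weak_interval_random_attractor D P \<phi> \<A> \<longleftrightarrow>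
     random_closed_set P (L2 D) \<A> \<and>
     (AE \<omega> in P. \<A> \<omega> \<noteq> {} \<and> compact (\<A> \<omega>)) \<and>
     (\<forall>x\<in>L2 D. \<forall>y\<in>L2 D. le_on D x y \<longrightarrow>
        tends_to_0_in_probability P
          (\<lambda>t \<omega>. semidist (\<phi> t \<omega> ` order_interval D x y) (\<A> (shift t \<omega>)))) \<and>
     (\<forall>t\<ge>0. AE \<omega> in P. \<phi> t \<omega> ` \<A> \<omega> = \<A> (shift t \<omega>))"


section \<open>Kolmogorov entropy and fractal dimension\<close>

text \<open>Balls have their centres in the ambient space \<open>H\<close>, not necessarily in \<open>A\<close>.\<close>

definition covering_number :: "'b::metric_space set \<Rightarrow> real \<Rightarrow> 'b set \<Rightarrow> nat" where
  "covering_number H \<epsilon> A =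
     (LEAST n. \<exists>C. finite C \<and> card C = n \<and> C \<subseteq> H \<and> A \<subseteq> (\<Union>c\<in>C. ball c \<epsilon>))"

definition kolmogorov_entropy :: "'b::metric_space set \<Rightarrow> real \<Rightarrow> 'b set \<Rightarrow> real" where
  "kolmogorov_entropy H \<epsilon> A = ln (real (covering_number H \<epsilon> A))"

definition fractal_dimension :: "'b::metric_space set \<Rightarrow> 'b set \<Rightarrow> ereal" where
  "fractal_dimension H A =
     Limsup (at_right 0) (\<lambda>\<epsilon>. ereal (kolmogorov_entropy H \<epsilon> A / ln (1 / \<epsilon>)))"

end

theory Submission
  imports Defs
begin

text \<open>
  Sums of Barenblatt solutions with disjoint supports solve the equation without noise and without
  the linear term for as long as the supports stay disjoint and inside \<open>D\<close>. Multiplying such a sum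
  by \<open>exp (\<rho> t)\<close> and running it in the time \<open>\<sigma> t\<close> gives solutions of the full equation. As \<open>\<eta> > 0\<close>,
  a small multiple of a fixed configuration of bumps is amplified until, at time \<open>n\<close>, it is the
  configuration itself, spread only for the intrinsic time \<open>\<tau>\<^sub>n = \<integral> exp ((\<alpha> - 2) (\<eta> s + \<mu> \<beta>\<^sub>s)) ds\<close>
  over \<open>{- n..0}\<close>, evaluated at the shifted path; it increases to a finite limit \<open>\<tau>\<close>. All the small
  multiples lie in one order interval, so attraction in probability and the shift invariance of the
  noise put every configuration, spread for the time \<open>\<tau>(\<omega>)\<close>, into \<open>\<A>(\<omega>)\<close>. A cube in \<open>D\<close> has room
  for \<open>n\<^sup>d\<close> bumps of radius of order \<open>1 / n\<close>, and the \<open>2 ^ n\<^sup>d\<close> subsets of them have mutual distances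
  of order at least \<open>n powr - (\<alpha> / (\<alpha> - 2) + d / 2)\<close>, which bounds the entropy from below by a multiple
  of \<open>\<delta> powr - (2 d (\<alpha> - 2) / (d (\<alpha> - 2) + 2 \<alpha>))\<close>, slightly more than required.
\<close>

section \<open>Representatives of square-integrable classes\<close>

text \<open>Attraction holds only in probability and along the forward path, so for a single
  \<omega> no limit can be taken directly. What can be compared are probabilities: shift invariance
  moves the event that a grown configuration is far from the attractor from time n back to time 0,
  and events whose probabilities tend to 0 are almost surely avoided for infinitely many n. This
  requires the grown configuration to be a measurable function of the path, which it is because it
  depends on the path only through the clock. The operator is homogeneous of degree \<alpha> - 1;
  this puts the factor \<alpha> - 2 into the exponent of the clock, while the linear terms are
  absorbed by \<rho>. The flow is accessible only through uniqueness of solutions; hence weak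
  gradients, membership in V and measurability in time have to be verified in full for the explicit
  functions. The power of n has two sources: a Barenblatt bump of radius 1 / n has height of order
  \<open>n powr - (\<alpha> / (\<alpha> - 2))\<close>, and the volume of its support contributes the
  factor \<open>n powr - (d / 2)\<close> to the L2 norm. One bump is all that can be used, since two
  configurations may differ in a single one.\<close>

lemma l2_rel_self: "l2_rel f f \<longleftrightarrow> square_integrable f"
  by (auto simp: l2_rel_def)

lemma rep_l2_square_integrable [simp]: "square_integrable (rep_l2 u)"
  using Quotient3_rep_reflp[OF Quotient3_l2] by (auto simp: l2_rel_def)

lemma abs_rep_l2 [simp]: "abs_l2 (rep_l2 u) = u"
  by (rule Quotient3_abs_rep[OF Quotient3_l2])

lemma rep_abs_l2: "square_integrable f \<Longrightarrow> AE x in lebesgue. rep_l2 (abs_l2 f) x = f x"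
  using rep_abs_rsp_left[OF Quotient3_l2, of f f] by (auto simp: l2_rel_self l2_rel_def)

lemma square_integrable_measurable [measurable_dest]:
  "square_integrable f \<Longrightarrow> f \<in> borel_measurable lebesgue"
  by (simp add: square_integrable_def)

lemma rep_l2_measurable [measurable]: "rep_l2 u \<in> borel_measurable lebesgue"
  using rep_l2_square_integrable square_integrable_def by blast

lemma rep_l2_integrable_sq [simp]: "integrable lebesgue (\<lambda>x. (rep_l2 u x)\<^sup>2)"
  using rep_l2_square_integrable square_integrable_def by blast

lemma rep_l2_cases:
  obtains f where "square_integrable f" "u = abs_l2 f"
  by (metis abs_rep_l2 rep_l2_square_integrable)

lemma square_integrable_diff:
  "square_integrable f \<Longrightarrow> square_integrable g \<Longrightarrow> square_integrable (\<lambda>x. f x - g x)"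
  using square_integrable_add[of f "\<lambda>x. - 1 * g x"] square_integrable_scale[of g "-1"] by simp

lemma abs_l2_add: "square_integrable f \<Longrightarrow> square_integrable g \<Longrightarrow>
    abs_l2 f + abs_l2 g = abs_l2 (\<lambda>x. f x + g x)"
  by (rule plus_l2.abs_eq) (auto simp: l2_rel_self)

lemma abs_l2_diff: "square_integrable f \<Longrightarrow> square_integrable g \<Longrightarrow>
    abs_l2 f - abs_l2 g = abs_l2 (\<lambda>x. f x - g x)"
  by (rule minus_l2.abs_eq) (auto simp: l2_rel_self)

lemma abs_l2_scaleR: "square_integrable f \<Longrightarrow> c *\<^sub>R abs_l2 f = abs_l2 (\<lambda>x. c * f x)"
  by (rule scaleR_l2.abs_eq) (auto simp: l2_rel_self)

lemma square_integrable_0 [simp]: "square_integrable (\<lambda>_. 0)"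
  by (simp add: square_integrable_def)

lemma rep_l2_add: "AE x in lebesgue. rep_l2 (u + v) x = rep_l2 u x + rep_l2 v x"
  using rep_abs_l2[OF square_integrable_add[of "rep_l2 u" "rep_l2 v"]]
    abs_l2_add[of "rep_l2 u" "rep_l2 v"] by simp

lemma rep_l2_diff: "AE x in lebesgue. rep_l2 (u - v) x = rep_l2 u x - rep_l2 v x"
  using rep_abs_l2[OF square_integrable_diff[of "rep_l2 u" "rep_l2 v"]]
    abs_l2_diff[of "rep_l2 u" "rep_l2 v"] by simp

lemma rep_l2_scaleR: "AE x in lebesgue. rep_l2 (c *\<^sub>R u) x = c * rep_l2 u x"
  using rep_abs_l2[OF square_integrable_scale[of "rep_l2 u" c]]
    abs_l2_scaleR[of "rep_l2 u" c] by simp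

lemma inner_l2_rep: "inner u v = (\<integral>x. rep_l2 u x * rep_l2 v x \<partial>lebesgue)"
  by (rule inner_l2.rep_eq)

lemma inner_abs_l2_rep:
  assumes "square_integrable f"
  shows "inner (abs_l2 f) v = (\<integral>x. f x * rep_l2 v x \<partial>lebesgue)"
  unfolding inner_l2_rep
  by (rule integral_cong_AE) (use assms rep_abs_l2[OF assms] in \<open>auto simp: square_integrable_def\<close>)

lemma norm_l2_sq: "(norm u)\<^sup>2 = (\<integral>x. (rep_l2 u x)\<^sup>2 \<partial>lebesgue)"
  by (simp add: power2_norm_eq_inner inner_l2_rep) (simp add: power2_eq_square)

lemma norm_abs_l2_sq:
  assumes "square_integrable f"
  shows "(norm (abs_l2 f))\<^sup>2 = (\<integral>x. (f x)\<^sup>2 \<partial>lebesgue)"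
  unfolding norm_l2_sq
  by (rule integral_cong_AE) (use assms rep_abs_l2[OF assms] in \<open>auto simp: square_integrable_def\<close>)

lemma vanishes_outside_rep: "vanishes_outside D u \<longleftrightarrow> (AE x in lebesgue. x \<notin> D \<longrightarrow> rep_l2 u x = 0)"
  by (rule vanishes_outside.rep_eq)

lemma le_on_rep: "le_on D u v \<longleftrightarrow> (AE x in lebesgue. x \<in> D \<longrightarrow> rep_l2 u x \<le> rep_l2 v x)"
  by (rule le_on.rep_eq)

lemma L2_iff: "u \<in> L2 D \<longleftrightarrow> (AE x in lebesgue. x \<notin> D \<longrightarrow> rep_l2 u x = 0)"
  by (simp add: L2_def vanishes_outside_rep)

lemma abs_l2_in_L2:
  assumes "square_integrable f" "\<And>x. x \<notin> D \<Longrightarrow> f x = 0"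
  shows "abs_l2 f \<in> L2 D"
  unfolding L2_iff using rep_abs_l2[OF assms(1)] by eventually_elim (use assms in auto)

lemma L2_scaleR: "u \<in> L2 D \<Longrightarrow> c *\<^sub>R u \<in> L2 D"
  unfolding L2_iff using rep_l2_scaleR[of c u] by (auto elim: eventually_elim2)

lemma L2_add: "u \<in> L2 D \<Longrightarrow> v \<in> L2 D \<Longrightarrow> u + v \<in> L2 D"
  unfolding L2_iff
proof -
  assume "AE x in lebesgue. x \<notin> D \<longrightarrow> rep_l2 u x = 0" "AE x in lebesgue. x \<notin> D \<longrightarrow> rep_l2 v x = 0"
  then show "AE x in lebesgue. x \<notin> D \<longrightarrow> rep_l2 (u + v) x = 0"
    using rep_l2_add[of u v] by eventually_elim auto
qed

lemma L2_diff: "u \<in> L2 D \<Longrightarrow> v \<in> L2 D \<Longrightarrow> u - v \<in> L2 D"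
  using L2_add[of u D "- 1 *\<^sub>R v"] L2_scaleR[of v D "-1"] by simp

lemma square_integrable_indicator:
  assumes "A \<in> lmeasurable"
  shows "square_integrable (indicator A)"
proof -
  have "(\<lambda>x. (indicator A x)\<^sup>2) = (indicator A :: 'a \<Rightarrow> real)"
    by (auto simp: indicator_def)
  with assms show ?thesis
    unfolding square_integrable_def by (auto simp: fmeasurable_def)
qed

lemma square_integrable_sum:
  "(\<And>i. i \<in> I \<Longrightarrow> square_integrable (f i)) \<Longrightarrow> square_integrable (\<lambda>x. \<Sum>i\<in>I. f i x)"
  by (induction I rule: infinite_finite_induct) (auto intro: square_integrable_add)

lemma abs_l2_sum:
  "(\<And>i. i \<in> I \<Longrightarrow> square_integrable (f i)) \<Longrightarrow>
    abs_l2 (\<lambda>x. \<Sum>i\<in>I. f i x) = (\<Sum>i\<in>I. abs_l2 (f i))"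
proof (induction I rule: infinite_finite_induct)
  case (insert i I)
  then show ?case
    by (simp add: abs_l2_add[symmetric] square_integrable_sum)
qed (auto simp: zero_l2_def)


section \<open>Separability\<close>

lemma dist_abs_l2_tendsto:
  assumes f: "square_integrable f" and g: "\<And>n. square_integrable (g n)"
    and lim: "\<And>x. (\<lambda>n. g n x) \<longlonglongrightarrow> f x"
    and w: "integrable lebesgue w" and bd: "\<And>n x. (g n x - f x)\<^sup>2 \<le> w x"
  shows "(\<lambda>n. abs_l2 (g n)) \<longlonglongrightarrow> abs_l2 f"
proof -
  have [measurable]: "f \<in> borel_measurable lebesgue" "\<And>n. g n \<in> borel_measurable lebesgue"
    using f g by (auto simp: square_integrable_def)
  have "(\<lambda>n. \<integral>x. (g n x - f x)\<^sup>2 \<partial>lebesgue) \<longlonglongrightarrow> (\<integral>x. 0 \<partial>(lebesgue :: 'a measure))"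
  proof (rule integral_dominated_convergence[where w = w])
    have "(\<lambda>n. (g n x - f x)\<^sup>2) \<longlonglongrightarrow> 0" for x
      using tendsto_power[OF tendsto_diff[OF lim[of x] tendsto_const[of "f x"]], of 2] by simp
    then show "AE x in lebesgue. (\<lambda>n. (g n x - f x)\<^sup>2) \<longlonglongrightarrow> 0" by simp
    show "AE x in lebesgue. norm ((g n x - f x)\<^sup>2) \<le> w x" for n
      using bd[of n] by simp
  qed (use w in auto)
  then have "(\<lambda>n. (norm (abs_l2 (g n) - abs_l2 f))\<^sup>2) \<longlonglongrightarrow> 0"
    using f g by (simp add: abs_l2_diff norm_abs_l2_sq square_integrable_diff)
  then have "(\<lambda>n. norm (abs_l2 (g n) - abs_l2 f)) \<longlonglongrightarrow> 0"
    using tendsto_real_sqrt by fastforce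
  then show ?thesis
    by (rule LIM_zero_cancel[OF tendsto_norm_zero_cancel])
qed

text \<open>Lists instead of finite sets of pairs: countability is that of \<open>lists\<close>, and
  the sum of two combinations is the concatenation of their lists.\<close>

definition rat_combinations :: "'b::real_vector set \<Rightarrow> 'b set" where
  "rat_combinations E = (\<lambda>l. \<Sum>(q, e)\<leftarrow>l. real_of_rat q *\<^sub>R e) ` lists (UNIV \<times> E)"

lemma countable_rat_combinations: "countable E \<Longrightarrow> countable (rat_combinations E)"
  unfolding rat_combinations_def by auto

lemma rat_combinations_add:
  "x \<in> rat_combinations E \<Longrightarrow> y \<in> rat_combinations E \<Longrightarrow> x + y \<in> rat_combinations E"
  unfolding rat_combinations_def
proof (elim imageE)
  fix l m assume "x = (\<Sum>(q, e)\<leftarrow>l. real_of_rat q *\<^sub>R e)" "l \<in> lists (UNIV \<times> E)"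
    "y = (\<Sum>(q, e)\<leftarrow>m. real_of_rat q *\<^sub>R e)" "m \<in> lists (UNIV \<times> E)"
  then show "x + y \<in> (\<lambda>l. \<Sum>(q, e)\<leftarrow>l. real_of_rat q *\<^sub>R e) ` lists (UNIV \<times> E)"
    by (intro image_eqI[of _ _ "l @ m"]) auto
qed

lemma closure_rat_combinations_add:
  fixes E :: "'b::real_normed_vector set"
  assumes "x \<in> closure (rat_combinations E)" "y \<in> closure (rat_combinations E)"
  shows "x + y \<in> closure (rat_combinations E)"
  using assms unfolding closure_sequential
  by (metis (no_types, lifting) rat_combinations_add tendsto_add)

lemma closure_rat_combinations_scaleR:
  fixes E :: "'b::real_normed_vector set"
  assumes "e \<in> E"
  shows "c *\<^sub>R e \<in> closure (rat_combinations E)"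
proof -
  have "c \<in> closure (range real_of_rat)"
    using Rats_closure_real by (simp add: Rats_def)
  then obtain q where q: "\<And>n. q n \<in> range real_of_rat" "q \<longlonglongrightarrow> c"
    by (auto simp: closure_sequential)
  have "q n *\<^sub>R e \<in> rat_combinations E" for n
    using q(1)[of n] assms unfolding rat_combinations_def
    by (auto intro!: image_eqI[of _ _ "[(_, e)]"])
  moreover have "(\<lambda>n. q n *\<^sub>R e) \<longlonglongrightarrow> c *\<^sub>R e"
    by (intro tendsto_intros q)
  ultimately show ?thesis
    unfolding closure_sequential by (intro exI[of _ "\<lambda>n. q n *\<^sub>R e"]) simp
qed

lemma eq_Union_subsets: "(\<And>x. x \<in> U \<Longrightarrow> \<exists>b\<in>B. x \<in> b \<and> b \<subseteq> U) \<Longrightarrow> U = \<Union>{b\<in>B. b \<subseteq> U}"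
  by blast

text \<open>The balls with rational radii around a countable dense set are a base; the conclusion
  has the form that the class \<open>second_countable_topology\<close> demands.\<close>

lemma second_countable_if_dense:
  fixes E :: "'b::metric_space set"
  assumes "countable E" "closure E = UNIV"
  shows "\<exists>B::'b set set. countable B \<and> open = generate_topology B"
proof (intro exI conjI)
  let ?B = "(\<lambda>(e, q). ball e (real_of_rat q)) ` (E \<times> UNIV)"
  show "countable ?B"
    using assms by auto
  show "open = generate_topology ?B"
  proof (intro ext iffI)
    fix U :: "'b set" assume "open U"
    have "\<exists>b\<in>?B. x \<in> b \<and> b \<subseteq> U" if x: "x \<in> U" for x
    proof -
      obtain r where r: "r > 0" "ball x r \<subseteq> U"
        using \<open>open U\<close> x by (meson open_contains_ball)
      obtain q where q: "0 < real_of_rat q" "real_of_rat q < r / 2"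
        using of_rat_dense[of 0 "r/2"] r by auto
      have "x \<in> closure E" using assms by simp
      then obtain e where e: "e \<in> E" "dist e x < real_of_rat q"
        using q unfolding closure_approachable by blast
      have "ball e (real_of_rat q) \<subseteq> ball x r"
      proof
        fix y assume "y \<in> ball e (real_of_rat q)"
        then show "y \<in> ball x r"
          using dist_triangle[of x y e] e q by (auto simp: dist_commute)
      qed
      then show ?thesis using e q r
        by (intro bexI[of _ "ball e (real_of_rat q)"]) (auto simp: dist_commute)
    qed
    then have "U = \<Union>{b\<in>?B. b \<subseteq> U}"
      by (rule eq_Union_subsets)
    also have "generate_topology ?B \<dots>"
      by (rule generate_topology.UN) (auto intro: generate_topology.Basis)
    finally show "generate_topology ?B U" .
  next
    fix U assume "generate_topology ?B U"
    then show "open U"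
      by induction auto
  qed
qed

text \<open>The measurability of sums of H-valued random variables and the determination of their
  laws by projections, both used for the noise, rest on second countability. A countable dense set
  is reached in successive approximations: finite unions of basic open sets, open sets and then
  measurable sets of finite measure, simple functions, and finally all classes.\<close>

instance l2 :: (euclidean_space) second_countable_topology
proof
  obtain B :: "'a set set" where B: "countable B" "topological_basis B"
    using ex_countable_basis by blast
  define R where "R = {U \<in> B. U \<in> lmeasurable}"
  have cR: "countable R" and Rl: "\<And>U. U \<in> R \<Longrightarrow> U \<in> lmeasurable"
    using B by (auto simp: R_def)
  \<comment> \<open>Intersecting with a unit ball shows that the basic sets of finite measure still
    form a base.\<close>
  have R: "\<exists>U\<in>R. x \<in> U \<and> U \<subseteq> T" if "open T" "x \<in> T" for x T
  proof -
    have "open (T \<inter> ball x 1)" "x \<in> T \<inter> ball x 1" using that by auto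
    then obtain U where U: "U \<in> B" "x \<in> U" "U \<subseteq> T \<inter> ball x 1"
      using B(2) topological_basisE by blast
    then have "open U" "bounded U"
      using B(2) topological_basis_open by (blast, meson bounded_ball bounded_subset le_infE)
    then have "U \<in> lmeasurable" by (rule lmeasurable_open[rotated])
    then show ?thesis using U by (auto simp: R_def)
  qed
  \<comment> \<open>Finite unions, so that an open set is an increasing limit of members.\<close>
  define \<B> where "\<B> = Union ` {F. finite F \<and> F \<subseteq> R}"
  have cB: "countable \<B>"
    unfolding \<B>_def using countable_Collect_finite_subset[OF cR] by auto
  have Bl: "U \<in> lmeasurable" if "U \<in> \<B>" for U
    using that Rl unfolding \<B>_def by (auto intro!: fmeasurable.finite_Union)
  define E where "E = (\<lambda>U. abs_l2 (indicator U) :: 'a l2) ` \<B>"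
  define Cl where "Cl = closure (rat_combinations E)"
  have sB: "c *\<^sub>R abs_l2 (indicator U) \<in> Cl" if "U \<in> \<B>" for U c
    unfolding Cl_def by (rule closure_rat_combinations_scaleR) (use that in \<open>auto simp: E_def\<close>)
  have cl: "l \<in> Cl" if "g \<longlonglongrightarrow> l" "\<And>n. g n \<in> Cl" for g l
    using that closed_sequentially[of Cl g l] by (simp add: Cl_def)
  have sO: "c *\<^sub>R abs_l2 (indicator T) \<in> Cl" if T: "open T" "T \<in> lmeasurable" for T :: "'a set" and c
  proof (cases "T = {}")
    case True
    have "{} \<in> \<B>" unfolding \<B>_def by (auto intro!: image_eqI[of _ _ "{}"])
    with True sB show ?thesis by auto
  next
    case False
    define \<D> where "\<D> = {b \<in> R. b \<subseteq> T}"
    have \<D>: "countable \<D>" "\<D> \<subseteq> R" "\<Union>\<D> = T"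
    proof -
      show "\<D> \<subseteq> R" by (auto simp: \<D>_def)
      then show "countable \<D>" using cR countable_subset by blast
      show "\<Union>\<D> = T" using R[OF T(1)] unfolding \<D>_def by blast
    qed
    have "\<D> \<noteq> {}" using \<D> False by auto
    define d where "d = from_nat_into \<D>"
    have d: "range d = \<D>" using \<D> \<open>\<D> \<noteq> {}\<close> by (simp add: d_def)
    define V where "V n = \<Union>(d ` {..<n})" for n :: nat
    have V: "V n \<in> \<B>" "V n \<subseteq> T" for n
    proof -
      have "d ` {..<n} \<subseteq> \<D>" using d by auto
      then show "V n \<in> \<B>" "V n \<subseteq> T"
        unfolding V_def \<B>_def using \<D>(2,3) by auto
    qed
    have "(\<lambda>n. abs_l2 (\<lambda>x. c * indicator (V n) x)) \<longlonglongrightarrow> abs_l2 (\<lambda>x. c * indicator T x)"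
    proof (rule dist_abs_l2_tendsto[where w = "\<lambda>x. c\<^sup>2 * indicator T x"])
      show "(\<lambda>n. c * indicator (V n) x) \<longlonglongrightarrow> c * (indicator T x :: real)" for x
      proof (cases "x \<in> T")
        case True
        then obtain m where "x \<in> d m" using d \<D> by auto
        then have "x \<in> V n" if "n > m" for n using that by (auto simp: V_def)
        then have "\<forall>\<^sub>F n in sequentially. c * indicator (V n) x = c * (indicator T x :: real)"
          using True by (auto simp: eventually_at_top_dense intro!: exI[of _ m])
        then show ?thesis by (rule tendsto_eventually)
      next
        case False
        then have "x \<notin> V n" for n using V by auto
        with False show ?thesis by simp
      qed
      show "integrable lebesgue (\<lambda>x. c\<^sup>2 * indicator T x)"
        using T by (auto simp: fmeasurable_def)
      show "(c * indicator (V n) x - c * indicator T x)\<^sup>2 \<le> c\<^sup>2 * indicator T x" for n x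
        using V(2)[of n] by (auto simp: indicator_def)
    qed (use V Bl T in \<open>auto intro!: square_integrable_scale square_integrable_indicator\<close>)
    moreover have "abs_l2 (\<lambda>x. c * indicator (V n) x) \<in> Cl" for n
      using sB[OF V(1), of c n] V Bl by (simp add: abs_l2_scaleR square_integrable_indicator)
    ultimately have "abs_l2 (\<lambda>x. c * indicator T x) \<in> Cl"
      by (rule cl)
    then show ?thesis using T by (simp add: abs_l2_scaleR square_integrable_indicator)
  qed
  have sM: "c *\<^sub>R abs_l2 (indicator S) \<in> Cl" if S: "S \<in> lmeasurable" for S :: "'a set" and c
  proof -
    have "\<exists>T. open T \<and> S \<subseteq> T \<and> T \<in> lmeasurable \<and> measure lebesgue (T - S) < 1 / Suc n" for n
    proof -
      obtain T where T: "open T" "S \<subseteq> T" "(T - S) \<in> lmeasurable" "emeasure lebesgue (T - S) < ennreal (1 / Suc n)"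
        using sets_lebesgue_outer_open[of S "1 / Suc n"] S by auto
      have "T = S \<union> (T - S)" using T by auto
      then have "T \<in> lmeasurable" using S T by (metis fmeasurable.Un)
      moreover have "measure lebesgue (T - S) < 1 / Suc n"
        using T(3,4) by (simp add: emeasure_eq_measure2 ennreal_less_iff)
      ultimately show ?thesis using T by blast
    qed
    then obtain T where T: "\<And>n. open (T n)" "\<And>n. S \<subseteq> T n" "\<And>n. T n \<in> lmeasurable"
      "\<And>n. measure lebesgue (T n - S) < 1 / Suc n" by metis
    have "(\<lambda>n. abs_l2 (\<lambda>x. c * indicator (T n) x)) \<longlonglongrightarrow> abs_l2 (\<lambda>x. c * indicator S x)"
    proof (rule LIM_zero_cancel, rule tendsto_norm_zero_cancel)
      have "(norm (abs_l2 (\<lambda>x. c * indicator (T n) x) - abs_l2 (\<lambda>x. c * indicator S x)))\<^sup>2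
        = c\<^sup>2 * measure lebesgue (T n - S)" for n
      proof -
        have "(norm (abs_l2 (\<lambda>x. c * indicator (T n) x) - abs_l2 (\<lambda>x. c * indicator S x)))\<^sup>2
          = (\<integral>x. (c * indicator (T n) x - c * indicator S x)\<^sup>2 \<partial>lebesgue)"
          using S T by (simp add: abs_l2_diff norm_abs_l2_sq square_integrable_diff 
            square_integrable_scale square_integrable_indicator)
        also have "\<dots> = (\<integral>x. c\<^sup>2 * indicator (T n - S) x \<partial>lebesgue)"
          using T(2)[of n] by (intro Bochner_Integration.integral_cong) (auto simp: indicator_def)
        also have "\<dots> = c\<^sup>2 * measure lebesgue (T n - S)" 
          using S T(3)[of n] by auto
        finally show ?thesis .
      qed
      moreover have "(\<lambda>n. c\<^sup>2 * measure lebesgue (T n - S)) \<longlonglongrightarrow> 0"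
      proof (rule tendsto_mult_right_zero, rule tendsto_sandwich[OF _ _ tendsto_const LIMSEQ_inverse_real_of_nat])
        show "\<forall>\<^sub>F n in sequentially. measure lebesgue (T n - S) \<le> inverse (real (Suc n))"
          using T(4) by (auto simp: divide_inverse intro!: always_eventually less_imp_le)
      qed auto
      ultimately have "(\<lambda>n. (norm (abs_l2 (\<lambda>x. c * indicator (T n) x) - abs_l2 (\<lambda>x. c * indicator S x)))\<^sup>2) \<longlonglongrightarrow> 0"
        by simp
      then show "(\<lambda>n. norm (abs_l2 (\<lambda>x. c * indicator (T n) x) - abs_l2 (\<lambda>x. c * indicator S x))) \<longlonglongrightarrow> 0"
        using tendsto_real_sqrt by fastforce
    qed
    moreover have "abs_l2 (\<lambda>x. c * indicator (T n) x) \<in> Cl" for n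
      using sO[OF T(1,3), of c n] T by (simp add: abs_l2_scaleR square_integrable_indicator)
    ultimately have "abs_l2 (\<lambda>x. c * indicator S x) \<in> Cl"
      by (rule cl)
    then show ?thesis using S by (simp add: abs_l2_scaleR square_integrable_indicator)
  qed
  have add: "x \<in> Cl \<Longrightarrow> y \<in> Cl \<Longrightarrow> x + y \<in> Cl" for x y
    unfolding Cl_def by (rule closure_rat_combinations_add)
  have zero: "0 \<in> Cl" using sM[of "{}" 0] by simp
  have sumC: "(\<And>i. i \<in> I \<Longrightarrow> h i \<in> Cl) \<Longrightarrow> (\<Sum>i\<in>I. h i) \<in> Cl" for h and I :: "real set"
    by (induction I rule: infinite_finite_induct) (auto intro: add zero)
  have all: "u \<in> Cl" for u :: "'a l2"
  proof (rule rep_l2_cases)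
    fix f assume f: "square_integrable f" "u = abs_l2 f"
    obtain s where s: "\<And>i. simple_function lebesgue (s i)" "\<And>x. (\<lambda>i. s i x) \<longlonglongrightarrow> f x"
      "\<And>i x. dist (s i x) 0 \<le> 2 * dist (f x) 0"
      using borel_measurable_implies_sequence_metric[of f lebesgue 0] f by (auto simp: square_integrable_def)
    have si: "(s i x)\<^sup>2 \<le> 4 * (f x)\<^sup>2" for i x
      using s(3)[of i x] power_mono[of "\<bar>s i x\<bar>" "2 * \<bar>f x\<bar>" 2] by (simp add: power_mult_distrib)
    have sq: "square_integrable (s i)" for i
      unfolding square_integrable_def
    proof
      show m: "s i \<in> borel_measurable lebesgue" using s(1) borel_measurable_simple_function by blast
      show "integrable lebesgue (\<lambda>x. (s i x)\<^sup>2)"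
        by (rule Bochner_Integration.integrable_bound[of _ "\<lambda>x. 4 * (f x)\<^sup>2"])
          (use f m si in \<open>auto simp: square_integrable_def\<close>)
    qed
    have "(\<lambda>n. abs_l2 (s n)) \<longlonglongrightarrow> abs_l2 f"
    proof (rule dist_abs_l2_tendsto[where w = "\<lambda>x. 10 * (f x)\<^sup>2"])
      show "(s n x - f x)\<^sup>2 \<le> 10 * (f x)\<^sup>2" for n x
      proof -
        have "(s n x - f x)\<^sup>2 \<le> 2 * (s n x)\<^sup>2 + 2 * (f x)\<^sup>2"
          using zero_le_power2[of "s n x + f x"] by (simp add: power2_eq_square algebra_simps)
        with si[of n x] show ?thesis by simp
      qed
    qed (use f sq s in \<open>auto simp: square_integrable_def\<close>)
    moreover have "abs_l2 (s n) \<in> Cl" for n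
    proof -
      let ?A = "\<lambda>y. s n -` {y}"
      have fin: "finite (range (s n))" and meas: "\<And>y. ?A y \<in> sets lebesgue"
        using simple_functionD[OF s(1)[of n]] by auto
      \<comment> \<open>Chebyshev: a nonzero value of a square-integrable simple function is taken
        on a set of finite measure.\<close>
      have lm: "?A y \<in> lmeasurable" if "y \<noteq> 0" for y
      proof -
        have "integrable lebesgue (\<lambda>x. indicator (?A y) x :: real)"
          proof (rule Bochner_Integration.integrable_bound[of _ "\<lambda>x. (1 / y\<^sup>2) * (s n x)\<^sup>2"])
            show "integrable lebesgue (\<lambda>x. (1 / y\<^sup>2) * (s n x)\<^sup>2)"
              using sq[of n] by (simp add: square_integrable_def)
            show "AE x in lebesgue. norm (indicator (?A y) x :: real) \<le> norm ((1 / y\<^sup>2) * (s n x)\<^sup>2)"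
              using that by (simp add: indicator_def)
          qed (use meas in simp)
        then show ?thesis using meas by (simp add: lmeasurable_iff_integrable)
      qed
      have "s n = (\<lambda>x. \<Sum>y\<in>range (s n) - {0}. y * indicator (?A y) x)"
      proof
        fix x
        have "(\<Sum>y\<in>range (s n) - {0}. y * indicator (?A y) x) = (\<Sum>y\<in>range (s n) - {0}. if y = s n x then s n x else 0)"
          by (intro sum.cong) (auto simp: indicator_def)
        also have "\<dots> = s n x" using fin by (simp add: sum.delta)
        finally show "s n x = (\<Sum>y\<in>range (s n) - {0}. y * indicator (?A y) x)" ..
      qed
      then have "abs_l2 (s n) = abs_l2 (\<lambda>x. \<Sum>y\<in>range (s n) - {0}. y * indicator (?A y) x)"
        by (rule arg_cong)
      also have "\<dots> = (\<Sum>y\<in>range (s n) - {0}. abs_l2 (\<lambda>x. y * indicator (?A y) x))"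
        by (rule abs_l2_sum) (auto intro!: square_integrable_scale square_integrable_indicator lm)
      also have "\<dots> = (\<Sum>y\<in>range (s n) - {0}. y *\<^sub>R abs_l2 (indicator (?A y)))"
        by (intro sum.cong) (auto simp: abs_l2_scaleR square_integrable_indicator lm)
      also have "\<dots> \<in> Cl"
        by (rule sumC) (auto intro!: sM lm)
      finally show ?thesis .
    qed
    ultimately show "u \<in> Cl" unfolding f by (rule cl)
  qed
  show "\<exists>B::'a l2 set set. countable B \<and> open = generate_topology B"
  proof (rule second_countable_if_dense)
    show "countable (rat_combinations E)"
      by (rule countable_rat_combinations) (simp add: E_def cB)
    show "closure (rat_combinations E) = UNIV" using all by (auto simp: Cl_def)
  qed
qed

section \<open>Measures determined by one-dimensional projections\<close>

text \<open>Levy's uniqueness theorem after normalization: the total masses agree because they are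
  the values of the characteristic functions at 0. Mass 0 is treated apart, as it cannot be
  normalized. General finite measures are needed because weights and restrictions to half-spaces
  destroy the total mass 1.\<close>

lemma finite_measure_eqI_char:
  fixes M N :: "real measure"
  assumes M: "finite_measure M" "sets M = sets borel" and N: "finite_measure N" "sets N = sets borel"
    and char: "\<And>t. (CLINT x|M. iexp (t * x)) = (CLINT x|N. iexp (t * x))"
  shows "M = N"
proof -
  interpret M: finite_measure M by fact
  interpret N: finite_measure N by fact
  have sp: "space M = UNIV" "space N = UNIV"
    using sets_eq_imp_space_eq[OF M(2)] sets_eq_imp_space_eq[OF N(2)] by simp_all
  have mass: "measure M UNIV = measure N UNIV"
    using char[of 0] sp by simp
  show ?thesis
  proof (cases "measure M UNIV = 0")
    case True
    then have "emeasure M UNIV = 0" "emeasure N UNIV = 0"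
      using mass sp by (simp_all add: M.emeasure_eq_measure N.emeasure_eq_measure)
    then have "emeasure M A = 0" "emeasure N A = 0" for A
      using emeasure_eq_0[of UNIV M A] emeasure_eq_0[of UNIV N A] M N by auto
    then show ?thesis using M N by (intro measure_eqI) auto
  next
    case False
    define m where "m = measure M UNIV"
    have m: "m > 0" using False by (simp add: m_def zero_less_measure_iff)
    have rd: "real_distribution (density K (\<lambda>_. ennreal (1 / m)))"
      if K: "finite_measure K" "sets K = sets borel" "measure K UNIV = m" for K :: "real measure"
    proof -
      interpret K: finite_measure K by fact
      have "space K = UNIV" using sets_eq_imp_space_eq[OF K(2)] by simp
      then have "emeasure (density K (\<lambda>_. ennreal (1 / m))) (space (density K (\<lambda>_. ennreal (1 / m)))) = 1"
        using m K by (simp add: emeasure_density_const K.emeasure_eq_measure ennreal_mult[symmetric])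
      then show ?thesis
        using K(2) by (simp add: real_distribution_def real_distribution_axioms_def prob_spaceI)
    qed
    have "density M (\<lambda>_. ennreal (1 / m)) = density N (\<lambda>_. ennreal (1 / m))"
    proof (rule Levy_uniqueness)
      show "char (density M (\<lambda>_. ennreal (1 / m))) = char (density N (\<lambda>_. ennreal (1 / m)))"
        using char m M(2) N(2) by (auto simp: char_def integral_density fun_eq_iff)
    qed (use rd M N mass m_def in auto)
    then have "emeasure (density M (\<lambda>_. ennreal (1 / m))) A = emeasure (density N (\<lambda>_. ennreal (1 / m))) A" for A
      by simp
    from this[of A for A] have "ennreal (1 / m) * emeasure M A = ennreal (1 / m) * emeasure N A"
      if "A \<in> sets borel" for A
      using that M(2) N(2) emeasure_density_const[of A M "ennreal (1 / m)"]
        emeasure_density_const[of A N "ennreal (1 / m)"] by metis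
    then have "emeasure M A = emeasure N A" if "A \<in> sets borel" for A
      using m that by (auto simp: ennreal_mult_cancel_left)
    then show ?thesis using M N by (intro measure_eqI) auto
  qed
qed

text \<open>The weight \<open>1 + cos\<close> is nonnegative, and multiplying a character by it only
  produces shifted characters. Weighting by it therefore preserves equality of characteristic
  functions.\<close>

lemma iexp_mult_cos:
  "complex_of_real (1 + cos (b + c)) * iexp a =
     iexp a + iexp c / 2 * iexp (a + b) + iexp (- c) / 2 * iexp (a - b)"
proof -
  have e: "complex_of_real (cos (b + c)) = (iexp (b + c) + iexp (- (b + c))) / 2"
    by (simp add: cos_of_real[symmetric] cos_exp_eq) (simp add: algebra_simps)
  show ?thesis
    unfolding of_real_add e by (simp add: field_simps exp_add exp_minus exp_diff)
qed

text \<open>Replaces a uniqueness theorem in several dimensions by the one on the line. The finite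
  measures with density \<open>1 + cos (inner x g + c)\<close> have projections to direction
  \<open>h\<close> with equal characteristic functions, so they give the same mass to
  \<open>S\<close>. The weight with \<open>g = 0\<close> and \<open>c = 0\<close> is the constant 2;
  subtracting the constant part leaves the integrals of the cosine over \<open>S\<close>, for every
  phase \<open>c\<close>.\<close>

lemma char_density_halfspace:
  fixes M N :: "'b::{real_inner, second_countable_topology} measure" and h g :: 'b
  assumes M: "finite_measure M" "sets M = sets borel" and N: "finite_measure N" "sets N = sets borel"
    and char: "\<And>g. (CLINT x|M. iexp (inner x g)) = (CLINT x|N. iexp (inner x g))"
    and B: "B \<in> sets borel"
  defines "S \<equiv> {x. inner x h \<in> B}"
  shows "(CLINT x|density M (indicator S). iexp (inner x g)) = (CLINT x|density N (indicator S). iexp (inner x g))"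
proof -
  have [measurable_cong]: "sets M = sets borel" "sets N = sets borel" by fact+
  have [measurable]: "B \<in> sets borel" by fact
  have Sm [measurable]: "S \<in> sets borel" unfolding S_def by measurable
  have int_iexp: "integrable K (\<lambda>x. c * iexp (inner x g))" if "K = M \<or> K = N" for K g c
  proof -
    interpret K: finite_measure K using that M N by auto
    have [measurable_cong]: "sets K = sets borel" using that M N by auto
    show ?thesis by (rule K.integrable_const_bound[of _ "norm c"]) (auto simp: norm_mult)
  qed
  have w: "(\<integral>x. indicator S x * (1 + cos (inner x g + c)) \<partial>M) = (\<integral>x. indicator S x * (1 + cos (inner x g + c)) \<partial>N)" for g c
  proof -
    let ?w = "\<lambda>x. 1 + cos (inner x g + c)"
    let ?D = "\<lambda>K. distr (density K (\<lambda>x. ennreal (?w x))) borel (\<lambda>x. inner x h)"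
    have w0: "0 \<le> ?w x" for x using cos_ge_minus_one[of "inner x g + c"] by linarith
    have w2: "?w x \<le> 2" for x using cos_le_one[of "inner x g + c"] by linarith
    have fin: "finite_measure (density K (\<lambda>x. ennreal (?w x)))" if "K = M \<or> K = N" for K
    proof
      interpret K: finite_measure K using that M N by auto
      have [measurable_cong]: "sets K = sets borel" using that M N by auto
      have "emeasure (density K (\<lambda>x. ennreal (?w x))) (space K) = (\<integral>\<^sup>+x. ennreal (?w x) \<partial>K)"
        by (subst emeasure_density) (auto intro!: nn_integral_cong)
      also have "\<dots> \<le> (\<integral>\<^sup>+x. ennreal 2 \<partial>K)"
        by (intro nn_integral_mono ennreal_leI w2)
      also have "\<dots> < \<infinity>"
        by (simp add: ennreal_mult_less_top less_top[symmetric] ennreal_mult_eq_top_iff)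
      finally show "emeasure (density K (\<lambda>x. ennreal (?w x))) (space (density K (\<lambda>x. ennreal (?w x)))) \<noteq> \<infinity>"
        by auto
    qed
    have ch: "(CLINT y|?D K. iexp (t * y)) = (CLINT x|K. iexp (inner x (t *\<^sub>R h)))
        + (CLINT x|K. iexp c / 2 * iexp (inner x (t *\<^sub>R h + g)))
        + (CLINT x|K. iexp (- c) / 2 * iexp (inner x (t *\<^sub>R h - g)))" if K: "K = M \<or> K = N" for K t
    proof -
      have [measurable_cong]: "sets K = sets borel" using that M N by auto
      have "(CLINT y|?D K. iexp (t * y)) = (CLINT x|K. ?w x *\<^sub>R iexp (t * inner x h))"
        using w0 by (subst integral_distr, simp, simp, subst integral_density) auto
      also have "\<dots> = (CLINT x|K. iexp (inner x (t *\<^sub>R h))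
        + iexp c / 2 * iexp (inner x (t *\<^sub>R h + g)) + iexp (- c) / 2 * iexp (inner x (t *\<^sub>R h - g)))"
        unfolding scaleR_conv_of_real iexp_mult_cos by (simp add: inner_add_right inner_diff_right)
      also have "\<dots> = (CLINT x|K. iexp (inner x (t *\<^sub>R h)))
        + (CLINT x|K. iexp c / 2 * iexp (inner x (t *\<^sub>R h + g)))
        + (CLINT x|K. iexp (- c) / 2 * iexp (inner x (t *\<^sub>R h - g)))"
        using int_iexp[OF K, of 1 "t *\<^sub>R h"] int_iexp[OF K, of "iexp c / 2" "t *\<^sub>R h + g"]
          int_iexp[OF K, of "iexp (-c) / 2" "t *\<^sub>R h - g"]
        by (simp only: Bochner_Integration.integral_add Bochner_Integration.integrable_add mult_1_left)
      finally show ?thesis .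
    qed
    have "?D M = ?D N"
    proof (rule finite_measure_eqI_char)
      fix t
      show "(CLINT x|?D M. iexp (t * x)) = (CLINT x|?D N. iexp (t * x))"
        using ch[of M t] ch[of N t] char[of "t *\<^sub>R h"] char[of "t *\<^sub>R h + g"] char[of "t *\<^sub>R h - g"]
        by simp
    qed (auto intro!: finite_measure.finite_measure_distr fin)
    then have "integral\<^sup>L (?D M) (indicat_real B) = (integral\<^sup>L (?D N) (indicat_real B))" by simp
    moreover have "integral\<^sup>L (?D K) (indicat_real B) = (\<integral>x. indicator S x * ?w x \<partial>K)"
      if "K = M \<or> K = N" for K
    proof -
      have [measurable_cong]: "sets K = sets borel" using that M N by auto
      have "integral\<^sup>L (?D K) (indicat_real B) = (\<integral>x. indicat_real B (inner x h) \<partial>density K (\<lambda>x. ennreal (?w x)))"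
        by (subst integral_distr) auto
      also have "\<dots> = (\<integral>x. ?w x *\<^sub>R indicator B (inner x h) \<partial>K)"
        using w0 by (subst integral_density) auto
      also have "\<dots> = (\<integral>x. indicator S x * ?w x \<partial>K)"
        by (intro Bochner_Integration.integral_cong) (auto simp: S_def indicator_def)
      finally show ?thesis .
    qed
    ultimately show ?thesis by auto
  qed
  have int_r: "integrable K (\<lambda>x. indicator S x * cos (inner x g + c))" "integrable K (\<lambda>x. indicator S x * (1::real))"
    if "K = M \<or> K = N" for K c
  proof -
    interpret K: finite_measure K using that M N by auto
    have [measurable_cong]: "sets K = sets borel" using that M N by auto
    show "integrable K (\<lambda>x. indicator S x * cos (inner x g + c))"
      by (rule K.integrable_const_bound[of _ 1]) (auto simp: indicator_def)
    show "integrable K (\<lambda>x. indicator S x * (1::real))"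
      by (rule K.integrable_const_bound[of _ 1]) (auto simp: indicator_def)
  qed
  have one: "(\<integral>x. indicator S x * (1::real) \<partial>M) = (\<integral>x. indicator S x * (1::real) \<partial>N)"
    using w[of 0 0] by (simp only: inner_zero_right add_0_left cos_zero mult_2_right[symmetric] one_add_one) (simp add: mult.commute)
  have cosc: "(\<integral>x. indicator S x * cos (inner x g + c) \<partial>M) = (\<integral>x. indicator S x * cos (inner x g + c) \<partial>N)" for c
  proof -
    have "(\<integral>x. indicator S x * (1 + cos (inner x g + c)) \<partial>K) = (\<integral>x. indicator S x * (1::real) \<partial>K)
       + (\<integral>x. indicator S x * cos (inner x g + c) \<partial>K)" if "K = M \<or> K = N" for K
      unfolding distrib_left using int_r[OF that] by (rule Bochner_Integration.integral_add[rotated])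
    from this[of M] this[of N] w[of g c] one show ?thesis by simp
  qed
  \<comment> \<open>Real and imaginary part; the sine is the cosine with phase
    \<open>- pi / 2\<close>.\<close>
  have red: "(CLINT x|density K (indicator S). iexp (inner x g)) =
     complex_of_real (\<integral>x. indicator S x * cos (inner x g + 0) \<partial>K)
     + \<i> * complex_of_real (\<integral>x. indicator S x * cos (inner x g + (- pi / 2)) \<partial>K)" if K: "K = M \<or> K = N" for K
  proof -
    have [measurable_cong]: "sets K = sets borel" using that M N by auto
    have ind: "(indicator S :: 'b \<Rightarrow> ennreal) = (\<lambda>x. ennreal (indicator S x))"
      by (auto simp: indicator_def)
    have sn: "cos (y + (- pi / 2)) = sin y" for y :: real
      by (simp add: cos_diff)
    have "(CLINT x|density K (indicator S). iexp (inner x g)) = (CLINT x|K. indicator S x *\<^sub>R iexp (inner x g))"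
      unfolding ind by (subst integral_density) auto
    also have "\<dots> = (CLINT x|K. complex_of_real (indicator S x * cos (inner x g + 0))
        + \<i> * complex_of_real (indicator S x * cos (inner x g + (- pi / 2))))"
      unfolding sn by (intro Bochner_Integration.integral_cong)
       (auto simp: indicator_def exp_Euler cos_of_real sin_of_real)
    also have "\<dots> = (CLINT x|K. complex_of_real (indicator S x * cos (inner x g + 0)))
        + (CLINT x|K. \<i> * complex_of_real (indicator S x * cos (inner x g + (- pi / 2))))"
      using int_r(1)[OF K] by (intro Bochner_Integration.integral_add integrable_mult_right integrable_of_real)
    finally show ?thesis by (simp only: integral_mult_right_zero integral_complex_of_real)
  qed
  show ?thesis by (simp only: red simp_thms cosc)
qed

lemma finite_measure_density_indicator:
  assumes "finite_measure M" "S \<in> sets M"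
  shows "finite_measure (density M (indicator S))"
proof
  have "emeasure (density M (indicator S)) (space M) = emeasure M S"
    using assms(2) sets.sets_into_space[OF assms(2)]
    by (subst emeasure_density) (auto simp: indicator_inter_arith[symmetric] Int_absorb2)
  then show "emeasure (density M (indicator S)) (space (density M (indicator S))) \<noteq> \<infinity>"
    using assms(1) by (simp add: finite_measure.emeasure_finite)
qed

text \<open>Lists of constraints, so that induction adds one constraint at a time and intersection
  is concatenation.\<close>

definition half_space_cylinder :: "('b::real_inner \<times> real set) list \<Rightarrow> 'b set" where
  "half_space_cylinder l = {x. \<forall>(h, B)\<in>set l. inner x h \<in> B}"

text \<open>The first constraint is absorbed into both measures as a density. By
  \<open>char_density_halfspace\<close> the new measures satisfy the hypotheses again, which is why
  the induction is over all pairs of measures.\<close>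

lemma emeasure_half_space_cylinder:
  fixes M N :: "'b::{real_inner, second_countable_topology} measure"
  assumes "finite_measure M" "sets M = sets borel" "finite_measure N" "sets N = sets borel"
    and "\<And>g. (CLINT x|M. iexp (inner x g)) = (CLINT x|N. iexp (inner x g))"
    and "snd ` set l \<subseteq> sets borel"
  shows "emeasure M (half_space_cylinder l) = emeasure N (half_space_cylinder l)"
  using assms
proof (induction l arbitrary: M N)
  case Nil
  interpret M: finite_measure M by fact
  interpret N: finite_measure N by fact
  have "space M = UNIV" "space N = UNIV"
    using sets_eq_imp_space_eq[OF Nil(2)] sets_eq_imp_space_eq[OF Nil(4)] by simp_all
  then show ?case using Nil(5)[of 0] 
    by (simp add: half_space_cylinder_def M.emeasure_eq_measure N.emeasure_eq_measure)
next
  case (Cons a l)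
  obtain h B where a: "a = (h, B)" by fastforce
  let ?S = "{x. inner x h \<in> B}"
  have B: "B \<in> sets borel" using Cons a by auto
  then have S: "?S \<in> sets borel" by measurable
  have L: "half_space_cylinder l \<in> sets borel"
  proof -
    have "half_space_cylinder l = (\<Inter>p\<in>set l. (\<lambda>x. inner x (fst p)) -` snd p) \<inter> UNIV"
      by (auto simp: half_space_cylinder_def)
    also have "\<dots> \<in> sets borel"
    proof -
      have "(\<lambda>x. inner x (fst p)) -` snd p \<in> sets borel" if "p \<in> set l" for p
        using measurable_sets_borel[of "\<lambda>x. inner x (fst p)" borel "snd p"] Cons(7) that by auto
      then have "(\<Inter>p\<in>set l. (\<lambda>x. inner x (fst p)) -` snd p) \<in> sets borel"
        by (cases "set l = {}") (auto intro!: sets.finite_INT)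
      then show ?thesis by simp
    qed
    finally show ?thesis .
  qed
  have "emeasure (density M (indicator ?S)) (half_space_cylinder l) = emeasure (density N (indicator ?S)) (half_space_cylinder l)"
  proof (rule Cons.IH)
    show "(CLINT x|density M (indicator ?S). iexp (inner x g)) = (CLINT x|density N (indicator ?S). iexp (inner x g))" for g
      by (rule char_density_halfspace) (use Cons B in auto)
  qed (use Cons S in \<open>auto intro!: finite_measure_density_indicator\<close>)
  moreover have "emeasure (density K (indicator ?S)) (half_space_cylinder l) = emeasure K (half_space_cylinder (a # l))"
    if "sets K = sets borel" for K
  proof -
    have "half_space_cylinder (a # l) = ?S \<inter> half_space_cylinder l"
      by (auto simp: half_space_cylinder_def a)
    then show ?thesis
      using that L S by (simp add: emeasure_density indicator_inter_arith[symmetric] sets.Int)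
  qed
  ultimately show ?case using Cons by auto
qed

lemma countable_dense_metric:
  obtains E :: "'b::{metric_space, second_countable_topology} set"
  where "countable E" "\<And>x e. 0 < e \<Longrightarrow> \<exists>y\<in>E. dist x y < e"
proof -
  obtain E :: "'b set" where E: "countable E" "\<And>X. open X \<Longrightarrow> X \<noteq> {} \<Longrightarrow> \<exists>d\<in>E. d \<in> X"
    using countable_dense_setE by blast
  have "\<exists>y\<in>E. dist x y < e" if "0 < e" for x e
    using E(2)[of "ball x e"] that by auto
  with E(1) show thesis by (rule that)
qed

text \<open>A closed ball is the intersection of the half-spaces
  \<open>inner (x - d) h \<le> r * norm h\<close> over a countable dense set of \<open>h\<close>:
  letting \<open>h\<close> approach \<open>x - d\<close> recovers the norm. Open sets are countable
  unions of such balls.\<close>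

lemma sets_borel_half_space_cylinders:
  "sets (borel :: 'b::{real_inner, second_countable_topology} measure) =
     sigma_sets UNIV (half_space_cylinder ` {l. snd ` set l \<subseteq> sets borel})" (is "_ = sigma_sets UNIV ?E")
proof
  interpret S: sigma_algebra UNIV "sigma_sets UNIV ?E"
    by (rule sigma_algebra_sigma_sets) simp
  have "U \<in> sigma_sets UNIV ?E" if "open U" for U :: "'b set"
  proof -
    obtain D :: "'b set" where D: "countable D" "\<And>x e. 0 < e \<Longrightarrow> \<exists>y\<in>D. dist x y < e"
      using countable_dense_metric by blast
    have hs: "{x. inner x h \<le> c} \<in> sigma_sets UNIV ?E" for h c
      by (rule sigma_sets.Basic, rule image_eqI[of _ _ "[(h, {..c})]"]) (auto simp: half_space_cylinder_def)
    have cb: "cball d r \<in> sigma_sets UNIV ?E" if "0 \<le> r" for d r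
    proof -
      have "cball d r = (\<Inter>h\<in>D. {x. inner x h \<le> r * norm h + inner d h})"
      proof (intro equalityI subsetI INT_I)
        fix x h assume "x \<in> cball d r" "h \<in> D"
        then have "inner (x - d) h \<le> r * norm h"
          using norm_cauchy_schwarz[of "x - d" h] mult_right_mono[of "norm (x - d)" r "norm h"]
          by (auto simp: dist_norm norm_minus_commute)
        then show "x \<in> {x. inner x h \<le> r * norm h + inner d h}" by (simp add: inner_diff_left)
      next
        fix x assume x: "x \<in> (\<Inter>h\<in>D. {x. inner x h \<le> r * norm h + inner d h})"
        have "\<exists>y. \<forall>n::nat. y n \<in> D \<and> dist (x - d) (y n) < inverse (Suc n)"
          using D(2)[of "inverse (Suc _)" "x - d"] by (intro choice) (meson inverse_positive_iff_positive of_nat_0_less_iff zero_less_Suc)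
        then obtain y :: "nat \<Rightarrow> 'b" where y: "\<And>n. y n \<in> D" "\<And>n. dist (x - d) (y n) < inverse (Suc n)" by blast
        have "(\<lambda>n. dist (y n) (x - d)) \<longlonglongrightarrow> 0"
          by (rule tendsto_sandwich[OF _ _ tendsto_const LIMSEQ_inverse_real_of_nat])
            (use y in \<open>auto simp: dist_commute intro!: always_eventually less_imp_le\<close>)
        then have lim: "y \<longlonglongrightarrow> x - d" using tendsto_dist_iff by blast
        have "inner (x - d) (y n) \<le> r * norm (y n)" for n
          using x y(1)[of n] by (auto simp: inner_diff_left)
        then have "inner (x - d) (x - d) \<le> r * norm (x - d)"
          by (intro LIMSEQ_le[of "\<lambda>n. inner (x - d) (y n)" _ "\<lambda>n. r * norm (y n)"]) (auto intro!: tendsto_intros lim)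
        then have "norm (x - d) * norm (x - d) \<le> r * norm (x - d)"
          by (simp add: power2_norm_eq_inner[symmetric] power2_eq_square)
        then show "x \<in> cball d r"
          using that by (cases "x = d") (auto simp: dist_norm norm_minus_commute)
      qed
      also have "\<dots> \<in> sigma_sets UNIV ?E"
        using D(1) hs D(2)[of 1] by (intro S.countable_INT') auto
      finally show ?thesis .
    qed
    have "U = \<Union>{b \<in> (\<lambda>(d, q). cball d (real_of_rat q)) ` (D \<times> {0<..}). b \<subseteq> U}" (is "_ = \<Union>?C")
    proof (rule eq_Union_subsets)
      fix x assume "x \<in> U"
      then obtain r where r: "r > 0" "ball x r \<subseteq> U" using \<open>open U\<close> by (meson open_contains_ball)
      obtain q where q: "0 < real_of_rat q" "real_of_rat q < r / 2"
        using of_rat_dense[of 0 "r/2"] r by auto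
      obtain d where d: "d \<in> D" "dist x d < real_of_rat q" using D(2) q by blast
      have "cball d (real_of_rat q) \<subseteq> ball x r"
      proof
        fix y assume "y \<in> cball d (real_of_rat q)"
        then show "y \<in> ball x r" using dist_triangle[of x y d] d q by (auto simp: dist_commute)
      qed
      with d q r show "\<exists>b\<in>(\<lambda>(d, q). cball d (real_of_rat q)) ` (D \<times> {0<..}). x \<in> b \<and> b \<subseteq> U"
        by (intro bexI[of _ "cball d (real_of_rat q)"]) (auto simp: dist_commute)
    qed
    also have "\<dots> \<in> sigma_sets UNIV ?E"
    proof (rule S.countable_Union)
      show "countable ?C" using D(1) by (intro countable_Collect) auto
    qed (use cb in auto)
    finally show ?thesis .
  qed
  moreover have "sets (borel :: 'b measure) = sigma_sets UNIV {S. open S}"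
    by (simp add: borel_def)
  ultimately show "sets (borel :: 'b measure) \<subseteq> sigma_sets UNIV ?E"
    by (simp only:) (intro S.sigma_sets_subset, auto)
next
  have "half_space_cylinder l \<in> sets borel" if "snd ` set l \<subseteq> sets borel" for l :: "('b \<times> real set) list"
  proof -
    have "half_space_cylinder l = (\<Inter>p\<in>set l. (\<lambda>x. inner x (fst p)) -` snd p)"
      by (auto simp: half_space_cylinder_def)
    moreover have "(\<lambda>x. inner x (fst p)) -` snd p \<in> sets borel" if "p \<in> set l" for p
      using measurable_sets_borel[of "\<lambda>x. inner x (fst p)" borel "snd p"] \<open>snd ` set l \<subseteq> sets borel\<close> that by auto
    ultimately show ?thesis
      by (cases "set l = {}") (auto intro!: sets.finite_INT)
  qed
  then show "sigma_sets UNIV ?E \<subseteq> sets borel"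
    using sets.sigma_sets_subset[of ?E borel] by auto
qed

text \<open>The form in which equality of laws is needed: the Wiener process is specified only by
  the laws of the one-dimensional projections of its increments.\<close>

theorem measure_eqI_projections:
  fixes M N :: "'b::{real_inner, second_countable_topology} measure"
  assumes "prob_space M" "sets M = sets borel" "prob_space N" "sets N = sets borel"
    and eq: "\<And>h. distr M borel (\<lambda>x. inner x h) = distr N borel (\<lambda>x. inner x h)"
  shows "M = N"
proof (rule measure_eqI_generator_eq)
  interpret M: prob_space M by fact
  interpret N: prob_space N by fact
  have [measurable_cong]: "sets M = sets borel" "sets N = sets borel" by fact+
  let ?E = "half_space_cylinder ` {l. snd ` set l \<subseteq> sets borel} :: 'b set set"
  have char: "(CLINT x|M. iexp (inner x g)) = (CLINT x|N. iexp (inner x g))" for g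
  proof -
    have "(CLINT x|K. iexp (inner x g)) = (CLINT y|distr K borel (\<lambda>x. inner x g). iexp y)" 
      if "sets K = sets borel" for K :: "'b measure"
    proof -
      have [measurable_cong]: "sets K = sets borel" by fact
      show ?thesis by (subst integral_distr) auto
    qed
    then show ?thesis using eq[of g] assms by simp
  qed
  show "emeasure M X = emeasure N X" if "X \<in> ?E" for X
    using that emeasure_half_space_cylinder[OF _ assms(2) _ assms(4) char] M.finite_measure_axioms N.finite_measure_axioms
    by auto
  show "Int_stable ?E"
  proof (rule Int_stableI_image)
    fix l m :: "('b \<times> real set) list"
    assume "l \<in> {l. snd ` set l \<subseteq> sets borel}" "m \<in> {l. snd ` set l \<subseteq> sets borel}"
    then show "\<exists>k\<in>{l. snd ` set l \<subseteq> sets borel}. half_space_cylinder l \<inter> half_space_cylinder m = half_space_cylinder k"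
      by (intro bexI[of _ "l @ m"]) (auto simp: half_space_cylinder_def)
  qed
  show "range (\<lambda>_::nat. half_space_cylinder []) \<subseteq> ?E" by auto
  show "(\<Union>_::nat. half_space_cylinder []) = (UNIV :: 'b set)" by (auto simp: half_space_cylinder_def)
qed (use assms in \<open>auto simp: sets_borel_half_space_cylinders[symmetric] finite_measure.emeasure_finite prob_space.finite_measure\<close>)

section \<open>Stationarity of the noise\<close>

text \<open>Measurability is contained in independence: a single increment, the case
  \<open>n = 1\<close>, is a random variable, and \<open>X t\<close> is up to sign the increment
  between 0 and \<open>t\<close>.\<close>

lemma independent_increments_measurable:
  fixes X :: "real \<Rightarrow> 'w \<Rightarrow> 'b::{real_normed_vector, second_countable_topology}"
  assumes P: "prob_space P" and ind: "independent_increments P X" and X0: "\<And>\<omega>. \<omega> \<in> space P \<Longrightarrow> X 0 \<omega> = 0"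
  shows "X t \<in> borel_measurable P"
proof -
  interpret prob_space P by fact
  have inc: "(\<lambda>\<omega>. X b \<omega> - X a \<omega>) \<in> borel_measurable P" if "a < b" for a b
  proof -
    have "indep_vars (\<lambda>_. borel) (\<lambda>i \<omega>. X ((\<lambda>i::nat. if i = 0 then a else b) (Suc i)) \<omega>
       - X ((\<lambda>i::nat. if i = 0 then a else b) i) \<omega>) {..<1::nat}"
      using ind[unfolded independent_increments_def, rule_format, of 1 "\<lambda>i. if i = 0 then a else b"] that by simp
    then show ?thesis
      by (simp add: indep_vars_def)
  qed
  consider "t = 0" | "t > 0" | "t < 0" by linarith
  then show ?thesis
  proof cases
    case 1
    have "(\<lambda>\<omega>. 0) \<in> borel_measurable P" by simp
    then show ?thesis using X0 1 by (subst measurable_cong[of P _ "\<lambda>_. 0"]) auto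
  next
    case 2
    have "X t \<omega> = X t \<omega> - X 0 \<omega>" if "\<omega> \<in> space P" for \<omega> using X0 that by simp
    with inc[OF 2] show ?thesis by (subst measurable_cong) auto
  next
    case 3
    have "X t \<omega> = - (X 0 \<omega> - X t \<omega>)" if "\<omega> \<in> space P" for \<omega> using X0 that by simp
    moreover have "(\<lambda>\<omega>. - (X 0 \<omega> - X t \<omega>)) \<in> borel_measurable P"
      using inc[OF 3] by measurable
    ultimately show ?thesis by (subst measurable_cong) auto
  qed
qed

lemma sorted_enumeration:
  assumes "finite (G :: real set)"
  obtains \<tau> :: "nat \<Rightarrow> real" where "\<tau> ` {..<card G} = G" "\<And>i. Suc i < card G \<Longrightarrow> \<tau> i < \<tau> (Suc i)"
proof
  let ?l = "sorted_list_of_set G"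
  show "(\<lambda>i. ?l ! i) ` {..<card G} = G"
    using assms by (metis atLeast0LessThan length_sorted_list_of_set list.set_map map_nth set_sorted_list_of_set set_upt)
  show "?l ! i < ?l ! Suc i" if "Suc i < card G" for i
    using strict_sorted_list_of_set[of G] that assms
    by (simp add: sorted_wrt_iff_nth_less)
qed

text \<open>The increments between consecutive times have as joint law the product of the laws \<nu>
  of the gaps. The gaps do not see the shift \<open>r\<close>, so for every \<open>r\<close> the
  probability is that of one set under one product measure.\<close>

theorem stationary_increments_cylinder:
  fixes X :: "real \<Rightarrow> 'w \<Rightarrow> 'b::{real_normed_vector, second_countable_topology}"
  assumes P: "prob_space P" and ind: "independent_increments P X" and X0: "\<And>\<omega>. \<omega> \<in> space P \<Longrightarrow> X 0 \<omega> = 0"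
    and stat: "\<And>s t. s < t \<Longrightarrow> distr P borel (\<lambda>\<omega>. X t \<omega> - X s \<omega>) = \<nu> (t - s)"
    and F: "finite F" and B: "\<And>s. s \<in> F \<Longrightarrow> B s \<in> sets borel"
  shows "measure P {\<omega>\<in>space P. \<forall>s\<in>F. X (r + s) \<omega> - X r \<omega> \<in> B s} =
    measure P {\<omega>\<in>space P. \<forall>s\<in>F. X s \<omega> \<in> B s}"
proof -
  interpret prob_space P by fact
  have [measurable]: "X t \<in> borel_measurable P" for t
    by (rule independent_increments_measurable[OF P ind X0])
  \<comment> \<open>Time 0 is added as reference point: \<open>X s\<close> is a signed sum of
    increments between 0 and \<open>s\<close>, and 0 may lie anywhere in the grid.\<close>
  let ?G = "insert 0 F"
  obtain \<tau> where \<tau>: "\<tau> ` {..<card ?G} = ?G" "\<And>i. Suc i < card ?G \<Longrightarrow> \<tau> i < \<tau> (Suc i)"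
    using sorted_enumeration[of ?G] F by auto
  define n where "n = card ?G - 1"
  have cG: "card ?G = Suc n" using F by (simp add: n_def card_gt_0_iff)
  have "0 \<in> \<tau> ` {..<card ?G}" using \<tau> by auto
  then obtain j0 where "j0 < card ?G" "0 = \<tau> j0" by blast
  then have j0: "j0 \<le> n" "\<tau> j0 = 0" using cG by auto
  define B' where "B' s = (if s \<in> F then B s else UNIV)" for s
  have [measurable]: "B' s \<in> sets borel" for s using B by (auto simp: B'_def)
  \<comment> \<open>If 0 is the only time there are no increments, and the criterion for
    independence by product laws excludes the empty index set.\<close>
  show ?thesis
  proof (cases "n = 0")
    case True
    then have "F \<subseteq> {0}" using cG \<tau> j0 by auto
    then show ?thesis using X0 
      by (intro arg_cong[of _ _ "measure P"]) (auto 0 3)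
  next
    case False
    define I where "I = {..<n}"
    have I: "I \<noteq> {}" using False by (auto simp: I_def)
    \<comment> \<open>\<open>j0\<close> is the index of time 0, so the difference of the two partial
      sums is the displacement from time 0 to the \<open>j\<close>-th time.\<close>
    define S where "S = {y \<in> space (PiM I (\<lambda>_. borel :: 'b measure)).
       \<forall>j\<in>{..n}. (\<Sum>i<j. y i) - (\<Sum>i<j0. y i) \<in> B' (\<tau> j)}"
    have comp: "(\<lambda>y. y i) \<in> borel_measurable (PiM I (\<lambda>_. borel :: 'b measure))" if "i < n" for i
      using that by (intro measurable_component_singleton) (auto simp: I_def)
    have Sm: "S \<in> sets (PiM I (\<lambda>_. borel :: 'b measure))"
    proof -
      have m: "(\<lambda>y. (\<Sum>i<j. y i) - (\<Sum>i<j0. y i)) \<in> borel_measurable (PiM I (\<lambda>_. borel :: 'b measure))"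
        if "j \<le> n" for j
        using that j0 by (intro borel_measurable_diff borel_measurable_sum comp) auto
      show ?thesis unfolding S_def
      proof (rule sets.sets_Collect_finite_All)
        fix j assume "j \<in> {..n}"
        then have "(\<lambda>y. (\<Sum>i<j. y i) - (\<Sum>i<j0. y i)) -` B' (\<tau> j) \<inter> space (PiM I (\<lambda>_. borel :: 'b measure))
          \<in> sets (PiM I (\<lambda>_. borel :: 'b measure))"
          using m[of j] by (intro measurable_sets) auto
        then show "{y \<in> space (PiM I (\<lambda>_. borel :: 'b measure)). (\<Sum>i<j. y i) - (\<Sum>i<j0. y i) \<in> B' (\<tau> j)}
          \<in> sets (PiM I (\<lambda>_. borel :: 'b measure))"
          by (simp add: vimage_def Int_def conj_commute)
      qed simp
    qed
    have key: "measure P {\<omega>\<in>space P. \<forall>s\<in>F. X (r + s) \<omega> - X r \<omega> \<in> B s} =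
       measure (PiM I (\<lambda>i. \<nu> (\<tau> (Suc i) - \<tau> i))) S" for r
    proof -
      define Y where "Y i \<omega> = X (r + \<tau> (Suc i)) \<omega> - X (r + \<tau> i) \<omega>" for i \<omega>
      have Yr: "Y i \<in> borel_measurable P" for i
        unfolding Y_def by measurable
      have "indep_vars (\<lambda>_. borel) Y I"
        unfolding Y_def I_def
        using ind[unfolded independent_increments_def, rule_format, of n "\<lambda>i. r + \<tau> i"] \<tau>(2) cG by simp
      then have "distr P (\<Pi>\<^sub>M i\<in>I. borel) (\<lambda>x. \<lambda>i\<in>I. Y i x) = (\<Pi>\<^sub>M i\<in>I. distr P borel (Y i))"
        by (rule iffD1[OF indep_vars_iff_distr_eq_PiM[OF I Yr]])
      also have "\<dots> = (\<Pi>\<^sub>M i\<in>I. \<nu> (\<tau> (Suc i) - \<tau> i))"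
      proof (rule PiM_cong[OF refl])
        fix i assume "i \<in> I"
        then have "distr P borel (Y i) = \<nu> ((r + \<tau> (Suc i)) - (r + \<tau> i))"
          unfolding Y_def using \<tau>(2)[of i] cG by (intro stat) (auto simp: I_def)
        then show "distr P borel (Y i) = \<nu> (\<tau> (Suc i) - \<tau> i)" by simp
      qed
      finally have D: "distr P (\<Pi>\<^sub>M i\<in>I. borel) (\<lambda>x. \<lambda>i\<in>I. Y i x) = (\<Pi>\<^sub>M i\<in>I. \<nu> (\<tau> (Suc i) - \<tau> i))" .
      have Ym: "(\<lambda>x. \<lambda>i\<in>I. Y i x) \<in> measurable P (\<Pi>\<^sub>M i\<in>I. borel)"
        by (intro measurable_restrict Yr)
      have tele: "(\<Sum>i<j. (\<lambda>i\<in>I. Y i \<omega>) i) = X (r + \<tau> j) \<omega> - X (r + \<tau> 0) \<omega>" if "j \<le> n" for j \<omega>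
      proof -
        have "(\<Sum>i<j. (\<lambda>i\<in>I. Y i \<omega>) i) = (\<Sum>i<j. X (r + \<tau> (Suc i)) \<omega> - X (r + \<tau> i) \<omega>)"
          using that by (intro sum.cong) (auto simp: I_def Y_def)
        also have "\<dots> = X (r + \<tau> j) \<omega> - X (r + \<tau> 0) \<omega>"
          by (rule sum_lessThan_telescope[of "\<lambda>i. X (r + \<tau> i) \<omega>"])
        finally show ?thesis .
      qed
      have "(\<lambda>x. \<lambda>i\<in>I. Y i x) -` S \<inter> space P = {\<omega>\<in>space P. \<forall>s\<in>F. X (r + s) \<omega> - X r \<omega> \<in> B s}"
      proof -
        have sp: "(\<lambda>i\<in>I. Y i \<omega>) \<in> space (PiM I (\<lambda>_. borel :: 'b measure))" for \<omega>
          by (auto simp: space_PiM)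
        have "(\<lambda>i\<in>I. Y i \<omega>) \<in> S \<longleftrightarrow> (\<forall>j\<in>{..n}. X (r + \<tau> j) \<omega> - X r \<omega> \<in> B' (\<tau> j))" for \<omega>
        proof -
          have "(\<Sum>i<j. (\<lambda>i\<in>I. Y i \<omega>) i) - (\<Sum>i<j0. (\<lambda>i\<in>I. Y i \<omega>) i) = X (r + \<tau> j) \<omega> - X r \<omega>"
            if "j \<le> n" for j
            unfolding tele[OF that] tele[OF j0(1)] using j0(2) by simp
          then show ?thesis using sp[of \<omega>] unfolding S_def by (auto simp del: restrict_apply)
        qed
        also have "\<dots> \<omega> \<longleftrightarrow> (\<forall>s\<in>\<tau> ` {..<card ?G}. X (r + s) \<omega> - X r \<omega> \<in> B' s)" for \<omega>
          unfolding cG by (auto simp: less_Suc_eq_le)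
        also have "\<dots> \<omega> \<longleftrightarrow> (\<forall>s\<in>F. X (r + s) \<omega> - X r \<omega> \<in> B s)" for \<omega>
          unfolding \<tau>(1) by (auto simp: B'_def)
        finally show ?thesis by auto
      qed
      then show ?thesis
        using measure_distr[OF Ym Sm] D by simp
    qed
    have "measure P {\<omega>\<in>space P. \<forall>s\<in>F. X (0 + s) \<omega> - X 0 \<omega> \<in> B s} = measure P {\<omega>\<in>space P. \<forall>s\<in>F. X s \<omega> \<in> B s}"
      using X0 by (intro arg_cong[of _ _ "measure P"]) auto
    then show ?thesis using key[of r] key[of 0] by simp
  qed
qed

text \<open>The law of the Wiener process is prescribed only in directions of \<open>L2 D\<close>,
  while \<open>measure_eqI_projections\<close> ranges over the whole ambient space. Cutting
  \<open>h\<close> off outside \<open>D\<close> leaves its pairings with \<open>L2 D\<close>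
  unchanged.\<close>

lemma L2_projection:
  assumes [measurable]: "D \<in> sets lebesgue"
  shows "\<exists>h'\<in>L2 D. \<forall>u\<in>L2 D. inner u h = inner u h'"
proof (intro bexI ballI)
  let ?f = "\<lambda>x. indicator D x * rep_l2 h x"
  have f: "square_integrable ?f"
    unfolding square_integrable_def
  proof
    show "integrable lebesgue (\<lambda>x. (?f x)\<^sup>2)"
      by (rule Bochner_Integration.integrable_bound[OF rep_l2_integrable_sq[of h]]) (auto simp: indicator_def)
  qed measurable
  show "abs_l2 ?f \<in> L2 D"
    by (rule abs_l2_in_L2[OF f]) simp
  fix u assume "u \<in> L2 D"
  then have z: "AE x in lebesgue. x \<notin> D \<longrightarrow> rep_l2 u x = 0" by (simp add: L2_iff)
  have "inner u h = (\<integral>x. ?f x * rep_l2 u x \<partial>lebesgue)"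
    unfolding inner_l2_rep
  proof (rule integral_cong_AE)
    show "AE x in lebesgue. rep_l2 u x * rep_l2 h x = ?f x * rep_l2 u x"
      using z by eventually_elim (auto simp: indicator_def)
  qed measurable
  then show "inner u h = inner u (abs_l2 ?f)"
    using inner_abs_l2_rep[OF f] by (simp add: inner_commute)
qed

section \<open>The path space, its cylinder sets and the invariance of the noise under
  shifts\<close>

lemma path_0: "\<omega> \<in> paths D \<Longrightarrow> \<omega> 0 = 0" and path_fst: "\<omega> \<in> paths D \<Longrightarrow> fst (\<omega> t) \<in> L2 D"
  and path_continuous: "\<omega> \<in> paths D \<Longrightarrow> continuous_on UNIV \<omega>"
  by (auto simp: paths_def)

text \<open>Separate conditions on the two components, so that independence of the two noises
  factorizes the probability of a cylinder.\<close>

definition path_cylinder ::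
    "'a::euclidean_space set \<Rightarrow> real set \<times> (real \<Rightarrow> 'a l2 set) \<times> (real \<Rightarrow> real set) \<Rightarrow> 'a path set" where
  "path_cylinder D = (\<lambda>(F, B, C). {\<omega>\<in>paths D. \<forall>s\<in>F. fst (\<omega> s) \<in> B s \<and> snd (\<omega> s) \<in> C s})"

definition cylinder_data :: "(real set \<times> (real \<Rightarrow> 'a::euclidean_space l2 set) \<times> (real \<Rightarrow> real set)) set" where
  "cylinder_data = {(F, B, C). finite F \<and> (\<forall>s. B s \<in> sets borel \<and> C s \<in> sets borel)}"

lemma Int_stable_path_cylinder: "Int_stable (path_cylinder D ` cylinder_data)"
proof (rule Int_stableI_image)
  fix i j :: "real set \<times> (real \<Rightarrow> 'a l2 set) \<times> (real \<Rightarrow> real set)"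
  obtain F B C F' B' C' where ij: "i = (F, B, C)" "j = (F', B', C')" by (metis prod_cases3)
  assume "i \<in> cylinder_data" "j \<in> cylinder_data"
  then show "\<exists>k\<in>cylinder_data. path_cylinder D i \<inter> path_cylinder D j = path_cylinder D k"
    by (intro bexI[of _ "(F \<union> F', \<lambda>s. (if s \<in> F then B s else UNIV) \<inter> (if s \<in> F' then B' s else UNIV),
       \<lambda>s. (if s \<in> F then C s else UNIV) \<inter> (if s \<in> F' then C' s else UNIV))"])
      (auto simp: path_cylinder_def cylinder_data_def ij)
qed

text \<open>Uniform continuity on a compact interval. A step function is coded by a mesh and a list,
  so for a countable dense \<open>E\<close> only countably many of them occur.\<close>

lemma step_approximation:
  fixes f :: "real \<Rightarrow> 'b::metric_space"
  assumes f: "continuous_on UNIV f" and E: "\<And>x e. 0 < e \<Longrightarrow> \<exists>y\<in>E. dist x y < e" and e: "0 < e"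
  shows "\<exists>N::nat. \<exists>l. set l \<subseteq> E \<and> N > 0 \<and>
    (\<forall>t\<in>{-T..T}. nat \<lfloor>(t + T) * N\<rfloor> < length l \<and> dist (f t) (l ! nat \<lfloor>(t + T) * N\<rfloor>) < e)"
proof -
  have "uniformly_continuous_on {-T..T} f"
    using f by (intro compact_uniformly_continuous) (auto intro: continuous_on_subset)
  then obtain d where d: "d > 0" "\<And>x y. x \<in> {-T..T} \<Longrightarrow> y \<in> {-T..T} \<Longrightarrow> dist x y < d \<Longrightarrow> dist (f x) (f y) < e / 2"
    unfolding uniformly_continuous_on_def using e by (metis half_gt_zero)
  obtain N :: nat where N: "N > 0" "1 / N < d"
    using d(1) by (metis nat_approx_posE of_nat_0_less_iff zero_less_Suc inverse_eq_divide)
  obtain g where g: "\<And>x. g x \<in> E" "\<And>x. dist x (g x) < e / 2"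
    using E[of "e/2"] e by (metis half_gt_zero)
  define l where "l = map (\<lambda>i. g (f (real i / N - T))) [0..<nat \<lfloor>2 * T * N\<rfloor> + 1]"
  have A: "nat \<lfloor>(t + T) * N\<rfloor> < length l \<and> dist (f t) (l ! nat \<lfloor>(t + T) * N\<rfloor>) < e" if t: "t \<in> {-T..T}" for t
  proof -
    define i where "i = nat \<lfloor>(t + T) * N\<rfloor>"
    have i0: "0 \<le> (t + T) * N" using t by auto
    have ri: "real i = of_int \<lfloor>(t + T) * N\<rfloor>" using i0 by (simp add: i_def)
    have i1: "real i \<le> (t + T) * N" "(t + T) * N < real i + 1" unfolding ri by linarith+
    have "(t + T) * N \<le> 2 * T * N" using t by (intro mult_right_mono) auto
    then have len: "i < nat \<lfloor>2 * T * N\<rfloor> + 1" unfolding i_def by (simp add: floor_mono less_Suc_eq_le nat_mono)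
    then have li: "l ! i = g (f (real i / N - T))" by (simp add: l_def del: upt_Suc)
    have a: "real i / N - T \<le> t" "t < real i / N - T + 1 / N" "- T \<le> real i / N - T"
      using i1 N by (auto simp: field_simps)
    then have "dist (f t) (f (real i / N - T)) < e / 2"
      using t N by (intro d) (auto simp: dist_real_def)
    then have "dist (f t) (l ! i) < e"
      using g(2)[of "f (real i / N - T)"] dist_triangle[of "f t" "l ! i" "f (real i / N - T)"]
      unfolding li by simp
    then show ?thesis using len by (simp add: i_def l_def)
  qed
  have "set l \<subseteq> E" using g by (auto simp: l_def)
  with N(1) A show ?thesis by (intro exI[of _ N] exI[of _ l] conjI ballI) simp_all
qed

lemma Collect_ball_eq_INT:
  "I \<noteq> {} \<Longrightarrow> {\<omega>\<in>\<Omega>. \<forall>t\<in>I. R t \<omega>} = (\<Inter>t\<in>I. {\<omega>\<in>\<Omega>. R t \<omega>})"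
  by blast

text \<open>The substantial half of the fact that Borel sets of paths are generated by cylinders,
  whence a law is determined by its cylinder probabilities. An open set is a countable union of
  tubes around step functions, and a tube is a countable intersection of cylinders because only
  rational times are tested.\<close>

lemma sigma_sets_open_paths_subset:
  "sigma_sets (paths D) {U. open_paths D U} \<subseteq> sigma_sets (paths D) (path_cylinder D ` cylinder_data)"
proof -
  let ?S = "sigma_sets (paths D) (path_cylinder D ` cylinder_data)"
  interpret S: sigma_algebra "paths D" ?S
    by (rule sigma_algebra_sigma_sets) (auto simp: path_cylinder_def)
  have "U \<in> ?S" if U: "open_paths D U" for U
  proof -
    obtain E :: "('a l2 \<times> real) set" where E: "countable E" "\<And>x e. 0 < e \<Longrightarrow> \<exists>y\<in>E. dist x y < e"
      using countable_dense_metric by blast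
    define b :: "nat \<Rightarrow> nat \<Rightarrow> ('a l2 \<times> real) list \<Rightarrow> nat \<Rightarrow> 'a path set" where
      "b M N l k = {\<omega>\<in>paths D. \<forall>t\<in>{-real M..real M} \<inter> \<rat>.
        dist (fst (\<omega> t)) (fst (l ! nat \<lfloor>(t + M) * N\<rfloor>)) \<le> 1 / Suc k \<and> 
        dist (snd (\<omega> t)) (snd (l ! nat \<lfloor>(t + M) * N\<rfloor>)) \<le> 1 / Suc k}" for M N l k
    have b_in: "b M N l k \<in> ?S" for M N l k
    proof -
      have eq: "b M N l k = (\<Inter>t\<in>{-real M..real M} \<inter> \<rat>. path_cylinder D ({t}, 
        (\<lambda>_. cball (fst (l ! nat \<lfloor>(t + M) * N\<rfloor>)) (1 / Suc k)), (\<lambda>_. cball (snd (l ! nat \<lfloor>(t + M) * N\<rfloor>)) (1 / Suc k))))"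
        (is "_ = (\<Inter>t\<in>?I. ?c t)")
      proof -
        have "0 \<in> ?I" by auto
        then have "?I \<noteq> {}" by blast
        then show ?thesis
          unfolding b_def path_cylinder_def
          by (simp add: dist_commute Collect_ball_eq_INT del: Int_iff)
      qed
      have c: "countable ?I" using countable_rat by (rule countable_subset[rotated]) auto
      have "0 \<in> ?I" by auto
      then have ne: "?I \<noteq> {}" by blast
      show ?thesis
        unfolding eq by (rule S.countable_INT'[OF c ne])
          (auto simp: cylinder_data_def intro!: sigma_sets.Basic imageI)
    qed
    define J where "J = {(M, N, l, k). b M N l k \<subseteq> U \<and> l \<in> lists E}"
    have "countable J"
    proof -
      have "J \<subseteq> UNIV \<times> UNIV \<times> lists E \<times> UNIV" by (auto simp: J_def)
      moreover have "countable (UNIV \<times> UNIV \<times> lists E \<times> UNIV :: (nat \<times> nat \<times> ('a l2 \<times> real) list \<times> nat) set)"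
        using E by auto
      ultimately show ?thesis by (rule countable_subset)
    qed
    moreover have "U = (\<Union>(M, N, l, k)\<in>J. b M N l k)"
    proof (intro equalityI subsetI)
      fix \<omega> assume w: "\<omega> \<in> U"
      then have wp: "\<omega> \<in> paths D" using U by (auto simp: open_paths_def)
      obtain T e where Te: "T > 0" "e > 0"
        "\<And>\<omega>'. \<omega>' \<in> paths D \<Longrightarrow> (\<forall>t\<in>{-T..T}. dist (\<omega>' t) (\<omega> t) < e) \<Longrightarrow> \<omega>' \<in> U"
        using U w unfolding open_paths_def by blast
      obtain M :: nat where M: "T \<le> real M" using real_arch_simple by blast
      \<comment> \<open>Membership in the tube costs 1 / (k + 1) in each component, and the step
        function another 1 / (k + 1); the bound 4 / (k + 1) used below is still smaller than
        \<open>e\<close>.\<close>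
      obtain k :: nat where k: "1 / Suc k < e / 5" using nat_approx_posE[of "e/5"] Te(2) by (auto simp: inverse_eq_divide)
      obtain N :: nat and l where l: "set l \<subseteq> E"
        and l': "\<forall>t\<in>{-real M..real M}. nat \<lfloor>(t + M) * N\<rfloor> < length l \<and> dist (\<omega> t) (l ! nat \<lfloor>(t + M) * N\<rfloor>) < 1 / Suc k"
        using step_approximation[OF path_continuous[OF wp] E(2), of "1 / Suc k" "real M"] by auto
      note l = l l'[rule_format, THEN conjunct2]
      have "b M N l k \<subseteq> U"
      proof
        fix \<omega>' assume "\<omega>' \<in> b M N l k"
        then have w': "\<omega>' \<in> paths D" and d: "\<And>t::real. t \<in> {-real M..real M} \<inter> \<rat> \<Longrightarrow> 
           dist (fst (\<omega>' t)) (fst (l ! nat \<lfloor>(t + M) * N\<rfloor>)) \<le> 1 / Suc k \<and> 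
           dist (snd (\<omega>' t)) (snd (l ! nat \<lfloor>(t + M) * N\<rfloor>)) \<le> 1 / Suc k"
          by (auto simp: b_def)
        have d2: "dist (\<omega>' t) (\<omega> t) \<le> 4 / Suc k" if "t \<in> {-real M..real M} \<inter> \<rat>" for t :: real
        proof -
          have "dist (\<omega>' t) (\<omega> t) \<le> dist (\<omega>' t) (l ! nat \<lfloor>(t + M) * N\<rfloor>) + dist (\<omega> t) (l ! nat \<lfloor>(t + M) * N\<rfloor>)"
            by (metis dist_commute dist_triangle)
          moreover have "dist (\<omega>' t) (l ! nat \<lfloor>(t + M) * N\<rfloor>) \<le> 
            dist (fst (\<omega>' t)) (fst (l ! nat \<lfloor>(t + M) * N\<rfloor>)) + dist (snd (\<omega>' t)) (snd (l ! nat \<lfloor>(t + M) * N\<rfloor>))"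
            unfolding dist_prod_def by (rule sqrt_sum_squares_le_sum) auto
          moreover have "4 / real (Suc k) = 4 * (1 / real (Suc k))" "0 \<le> 1 / real (Suc k)" by simp_all
          moreover have "dist (\<omega> t) (l ! nat \<lfloor>(t + M) * N\<rfloor>) < 1 / Suc k" using l(2)[of t] that by auto
          ultimately show ?thesis using d[OF that] by linarith
        qed
        have d3: "dist (\<omega>' t) (\<omega> t) \<le> 4 / Suc k" if "t \<in> {-T..T}" for t
        proof -
          have c: "continuous_on UNIV (\<lambda>t. dist (\<omega>' t) (\<omega> t))"
            using w' wp by (auto simp: paths_def intro!: continuous_on_dist)
          \<comment> \<open>Rational times are dense in the open interval; its endpoints are
            integers and hence tested themselves.\<close>
          have "t \<in> closure ({-real M<..<real M} \<inter> \<rat>) \<or> t = M \<or> t = -M"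
          proof (cases "t \<in> {-real M<..<real M}")
            case True
            then have "t \<in> {-real M<..<real M} \<inter> closure \<rat>" using Rats_closure_real by auto
            then show ?thesis using open_Int_closure_subset[of "{-real M<..<real M}" \<rat>] by auto
          qed (use that M in auto)
          moreover have "closure ({-real M<..<real M} \<inter> \<rat>) \<subseteq> {t. dist (\<omega>' t) (\<omega> t) \<le> 4 / Suc k}"
          proof (rule closure_minimal)
            show "closed {t. dist (\<omega>' t) (\<omega> t) \<le> 4 / Suc k}"
              by (rule closed_Collect_le[OF c continuous_on_const])
          qed (use d2 in auto)
          ultimately show ?thesis using d2[of t] by auto
        qed
        show "\<omega>' \<in> U"
        proof (rule Te(3)[OF w'], intro ballI)
          fix t assume "t \<in> {-T..T}"
          moreover have "4 / real (Suc k) = 4 * (1 / real (Suc k))" by simp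
          ultimately show "dist (\<omega>' t) (\<omega> t) < e" using d3[of t] k Te(2) by linarith
        qed
      qed
      moreover have "\<omega> \<in> b M N l k"
      proof -
        have "dist (fst (\<omega> t)) (fst (l ! nat \<lfloor>(t + M) * N\<rfloor>)) \<le> 1 / Suc k"
          "dist (snd (\<omega> t)) (snd (l ! nat \<lfloor>(t + M) * N\<rfloor>)) \<le> 1 / Suc k"
          if "t \<in> {-real M..real M} \<inter> \<rat>" for t :: real
          using l(2)[of t] that dist_fst_le[of "\<omega> t" "l ! nat \<lfloor>(t + M) * N\<rfloor>"]
            dist_snd_le[of "\<omega> t" "l ! nat \<lfloor>(t + M) * N\<rfloor>"] by auto
        then show ?thesis unfolding b_def using wp by blast
      qed
      ultimately show "\<omega> \<in> (\<Union>(M, N, l, k)\<in>J. b M N l k)"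
        using l(1) by (intro UN_I[of "(M, N, l, k)"]) (auto simp: J_def)
    qed (auto simp: J_def)
    ultimately show ?thesis using b_in by (auto intro!: S.countable_UN'')
  qed
  then show ?thesis by (intro S.sigma_sets_subset) auto
qed

lemma shift_in_paths: "\<omega> \<in> paths D \<Longrightarrow> shift r \<omega> \<in> paths D"
  unfolding paths_def shift_def
  by (auto intro!: continuous_intros L2_diff intro: continuous_on_compose2[where t=UNIV])

locale noise =
  fixes D :: "'a::euclidean_space set" and Q P
  assumes noise: "canonical_noise_space D Q P" and D_lebesgue: "D \<in> sets lebesgue"
begin

sublocale prob_space P using noise by (simp add: canonical_noise_space_def)

lemma space_P: "space P = paths D" using noise by (simp add: canonical_noise_space_def)

lemma W_measurable [measurable]: "(\<lambda>\<omega>. fst (\<omega> t)) \<in> borel_measurable P"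
proof (rule independent_increments_measurable[OF prob_space_axioms])
  show "independent_increments P (\<lambda>t \<omega>. fst (\<omega> t))"
    using noise by (simp add: canonical_noise_space_def wiener_process_def)
qed (simp add: path_0[of _ D] space_P)

lemma beta_measurable [measurable]: "(\<lambda>\<omega>. snd (\<omega> t)) \<in> borel_measurable P"
proof (rule independent_increments_measurable[OF prob_space_axioms])
  show "independent_increments P (\<lambda>t \<omega>. snd (\<omega> t))"
    using noise by (simp add: canonical_noise_space_def brownian_motion_def)
qed (simp add: path_0[of _ D] space_P)

lemma sets_P: "sets P = sigma_sets (paths D) (path_cylinder D ` cylinder_data)"
proof
  show "sets P \<subseteq> sigma_sets (paths D) (path_cylinder D ` cylinder_data)"
    using noise sigma_sets_open_paths_subset by (simp add: canonical_noise_space_def)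
  have "path_cylinder D (F, B, C) \<in> sets P" if "(F, B, C) \<in> cylinder_data" for F B C
  proof -
    have F: "finite F" and [measurable]: "\<And>s. B s \<in> sets borel" "\<And>s. C s \<in> sets borel"
      using that by (auto simp: cylinder_data_def)
    have "{\<omega>\<in>space P. \<forall>s\<in>F. fst (\<omega> s) \<in> B s \<and> snd (\<omega> s) \<in> C s} \<in> sets P"
      by (intro sets.sets_Collect_finite_All F) measurable
    then show ?thesis by (simp add: path_cylinder_def space_P)
  qed
  then have "path_cylinder D ` cylinder_data \<subseteq> sets P" by auto
  from sets.sigma_sets_subset[OF this]
  show "sigma_sets (paths D) (path_cylinder D ` cylinder_data) \<subseteq> sets P"
    by (simp only: space_P)
qed

lemma shift_measurable [measurable]: "shift r \<in> measurable P P"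
proof (rule measurable_sigma_sets[OF sets_P])
  show "path_cylinder D ` cylinder_data \<subseteq> Pow (paths D)" by (auto simp: path_cylinder_def)
  show "shift r \<in> space P \<rightarrow> paths D" using shift_in_paths space_P by auto
  fix y assume "y \<in> path_cylinder D ` cylinder_data"
  then obtain F B C where y: "y = path_cylinder D (F, B, C)" and F: "finite F"
    and [measurable]: "\<And>s. B s \<in> sets borel" "\<And>s. C s \<in> sets borel"
    by (auto simp: cylinder_data_def)
  have "shift r -` y \<inter> space P = {\<omega>\<in>space P. \<forall>s\<in>F. fst (\<omega> (r + s)) - fst (\<omega> r) \<in> B s \<and> snd (\<omega> (r + s)) - snd (\<omega> r) \<in> C s}"
    unfolding y using shift_in_paths by (auto simp: path_cylinder_def space_P shift_def)
  also have "\<dots> \<in> sets P"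
    by (intro sets.sets_Collect_finite_All F) measurable
  finally show "shift r -` y \<inter> space P \<in> sets P" .
qed

text \<open>In every direction both laws have the same Gaussian projection; directions outside
  \<open>L2 D\<close> are reduced to those inside by \<open>L2_projection\<close>.\<close>

lemma W_increment_law:
  assumes "s < t"
  shows "distr P borel (\<lambda>\<omega>. fst (\<omega> t) - fst (\<omega> s)) = distr P borel (\<lambda>\<omega>. fst (\<omega> (t - s)) - fst (\<omega> 0))"
proof (rule measure_eqI_projections)
  fix h :: "'a l2"
  obtain h' where h': "h' \<in> L2 D" "\<And>u. u \<in> L2 D \<Longrightarrow> inner u h = inner u h'"
    using L2_projection[OF D_lebesgue] by metis
  have "distr P borel (\<lambda>\<omega>. inner (fst (\<omega> b) - fst (\<omega> a)) h) = centered_gaussian ((b - a) * inner (Q h') h')" if "a < b" for a b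
  proof -
    have "distr P borel (\<lambda>\<omega>. inner (fst (\<omega> b) - fst (\<omega> a)) h) = distr P borel (\<lambda>\<omega>. inner (fst (\<omega> b) - fst (\<omega> a)) h')"
      using h' by (intro distr_cong) (auto simp: space_P intro!: L2_diff path_fst)
    then show ?thesis
      using noise h'(1) that by (simp add: canonical_noise_space_def wiener_process_def)
  qed
  from this[of s t] this[of 0 "t - s"] assms
  show "distr (distr P borel (\<lambda>\<omega>. fst (\<omega> t) - fst (\<omega> s))) borel (\<lambda>x. inner x h) =
    distr (distr P borel (\<lambda>\<omega>. fst (\<omega> (t - s)) - fst (\<omega> 0))) borel (\<lambda>x. inner x h)"
    by (simp add: distr_distr comp_def)
qed (auto intro!: prob_space_distr)

text \<open>Independence splits the shifted cylinder into its two components, each of which is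
  stationary. The unshifted cylinder is the case \<open>r = 0\<close>, since paths vanish at time
  0.\<close>

lemma emeasure_cylinder_shift:
  assumes "(F, B, C) \<in> cylinder_data"
  shows "emeasure (distr P P (shift r)) (path_cylinder D (F, B, C)) = emeasure P (path_cylinder D (F, B, C))"
proof -
  have F: "finite F" and B [measurable]: "\<And>s. B s \<in> sets borel" and C [measurable]: "\<And>s. C s \<in> sets borel"
    using assms by (auto simp: cylinder_data_def)
  let ?\<Pi> = "PiM UNIV (\<lambda>_. borel)"
  have split: "prob {\<omega>\<in>space P. (\<forall>s\<in>F. fst (\<omega> (r + s)) - fst (\<omega> r) \<in> B s) \<and> (\<forall>s\<in>F. snd (\<omega> (r + s)) - snd (\<omega> r) \<in> C s)}
    = prob {\<omega>\<in>space P. \<forall>s\<in>F. fst (\<omega> (r + s)) - fst (\<omega> r) \<in> B s} * prob {\<omega>\<in>space P. \<forall>s\<in>F. snd (\<omega> (r + s)) - snd (\<omega> r) \<in> C s}" for r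
  proof -
    have A1: "{y\<in>space (PiM UNIV (\<lambda>_. borel)). \<forall>s\<in>F. y (r + s) - y r \<in> B s} \<in> sets (PiM UNIV (\<lambda>_. borel))"
      by (intro sets.sets_Collect_finite_All F) measurable
    have A2: "{y\<in>space (PiM UNIV (\<lambda>_. borel)). \<forall>s\<in>F. y (r + s) - y r \<in> C s} \<in> sets (PiM UNIV (\<lambda>_. borel))"
      by (intro sets.sets_Collect_finite_All F) measurable
    have ind: "indep_set {(\<lambda>\<omega> t. fst (\<omega> t)) -` A \<inter> space P | A. A \<in> sets (PiM UNIV (\<lambda>_. borel))}
       {(\<lambda>\<omega> t. snd (\<omega> t)) -` A \<inter> space P | A. A \<in> sets (PiM UNIV (\<lambda>_. borel))}"
      using noise unfolding canonical_noise_space_def by blast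
    have "prob ({\<omega>\<in>space P. \<forall>s\<in>F. fst (\<omega> (r + s)) - fst (\<omega> r) \<in> B s} \<inter> {\<omega>\<in>space P. \<forall>s\<in>F. snd (\<omega> (r + s)) - snd (\<omega> r) \<in> C s})
      = prob {\<omega>\<in>space P. \<forall>s\<in>F. fst (\<omega> (r + s)) - fst (\<omega> r) \<in> B s} * prob {\<omega>\<in>space P. \<forall>s\<in>F. snd (\<omega> (r + s)) - snd (\<omega> r) \<in> C s}"
    proof (rule indep_setD[OF ind])
      show "{\<omega>\<in>space P. \<forall>s\<in>F. fst (\<omega> (r + s)) - fst (\<omega> r) \<in> B s} \<in> {(\<lambda>\<omega> t. fst (\<omega> t)) -` A \<inter> space P | A. A \<in> sets (PiM UNIV (\<lambda>_. borel))}"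
        using A1 by (intro CollectI exI[of _ "{y\<in>space (PiM UNIV (\<lambda>_. borel)). \<forall>s\<in>F. y (r + s) - y r \<in> B s}"]) (auto simp: space_PiM)
      show "{\<omega>\<in>space P. \<forall>s\<in>F. snd (\<omega> (r + s)) - snd (\<omega> r) \<in> C s} \<in> {(\<lambda>\<omega> t. snd (\<omega> t)) -` A \<inter> space P | A. A \<in> sets (PiM UNIV (\<lambda>_. borel))}"
        using A2 by (intro CollectI exI[of _ "{y\<in>space (PiM UNIV (\<lambda>_. borel)). \<forall>s\<in>F. y (r + s) - y r \<in> C s}"]) (auto simp: space_PiM)
    qed
    then show ?thesis by (simp add: Int_def conj_ac Collect_conj_eq[symmetric])
  qed
  have W: "prob {\<omega>\<in>space P. \<forall>s\<in>F. fst (\<omega> (r + s)) - fst (\<omega> r) \<in> B s} = prob {\<omega>\<in>space P. \<forall>s\<in>F. fst (\<omega> s) \<in> B s}" for r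
    using noise by (intro stationary_increments_cylinder[OF prob_space_axioms, where
        \<nu> = "\<lambda>u. distr P borel (\<lambda>\<omega>. fst (\<omega> u) - fst (\<omega> 0))"] W_increment_law F B)
      (auto simp: canonical_noise_space_def wiener_process_def path_0)
  have b: "prob {\<omega>\<in>space P. \<forall>s\<in>F. snd (\<omega> (r + s)) - snd (\<omega> r) \<in> C s} = prob {\<omega>\<in>space P. \<forall>s\<in>F. snd (\<omega> s) \<in> C s}" for r
    using noise by (intro stationary_increments_cylinder[OF prob_space_axioms, where \<nu> = centered_gaussian] F C)
      (auto simp: canonical_noise_space_def brownian_motion_def path_0)
  have eq: "{\<omega>\<in>space P. (\<forall>s\<in>F. fst (\<omega> (0 + s)) - fst (\<omega> 0) \<in> B s) \<and> (\<forall>s\<in>F. snd (\<omega> (0 + s)) - snd (\<omega> 0) \<in> C s)}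
    = path_cylinder D (F, B, C)"
    by (auto simp: path_cylinder_def space_P path_0[of _ D])
  have "shift r -` path_cylinder D (F, B, C) \<inter> space P
    = {\<omega>\<in>space P. (\<forall>s\<in>F. fst (\<omega> (r + s)) - fst (\<omega> r) \<in> B s) \<and> (\<forall>s\<in>F. snd (\<omega> (r + s)) - snd (\<omega> r) \<in> C s)}"
    using shift_in_paths by (auto simp: path_cylinder_def space_P shift_def)
  then have "prob (shift r -` path_cylinder D (F, B, C) \<inter> space P) = prob (path_cylinder D (F, B, C))"
    using split[of r] split[of 0] W[of r] W[of 0] b[of r] b[of 0] eq by simp
  moreover have "path_cylinder D (F, B, C) \<in> sets P"
    unfolding sets_P using assms by (intro sigma_sets.Basic imageI)
  ultimately show ?thesis
    by (simp add: emeasure_distr emeasure_eq_measure)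
qed

text \<open>Cylinders are stable under intersection and generate all events. This invariance
  transports an event about the path seen from time n back to time 0.\<close>

theorem distr_shift: "distr P P (shift r) = P"
proof (rule measure_eqI_generator_eq[of "path_cylinder D ` cylinder_data" "paths D" _ _ "\<lambda>_::nat. path_cylinder D ({}, \<lambda>_. UNIV, \<lambda>_. UNIV)"])
  interpret S: prob_space "distr P P (shift r)" by (rule prob_space_distr) simp
  show "emeasure (distr P P (shift r)) (path_cylinder D ({}, \<lambda>_. UNIV, \<lambda>_. UNIV)) \<noteq> \<infinity>" by simp
qed (auto simp: Int_stable_path_cylinder sets_P[symmetric] emeasure_cylinder_shift, auto simp: path_cylinder_def cylinder_data_def)

corollary prob_shift:
  assumes "A \<in> sets P"
  shows "prob {\<omega>\<in>space P. shift r \<omega> \<in> A} = prob A"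
proof -
  have "prob A = measure (distr P P (shift r)) A" by (simp add: distr_shift)
  also have "\<dots> = prob (shift r -` A \<inter> space P)" by (rule measure_distr) (use assms in auto)
  also have "shift r -` A \<inter> space P = {\<omega>\<in>space P. shift r \<omega> \<in> A}" by auto
  finally show ?thesis ..
qed

end

section \<open>Estimates for Brownian paths\<close>

lemma nn_integral_exp_neg:
  assumes "0 < (k::real)"
  shows "(\<integral>\<^sup>+s. ennreal (exp (k * s)) * indicator {..0} s \<partial>lborel) = ennreal (1 / k)"
proof -
  have "(\<integral>\<^sup>+s. ennreal (exp (k * s)) * indicator {..0} s \<partial>lborel)
     = (\<integral>\<^sup>+s. ennreal (exp (k * (0 + (-1) * s))) * indicator {..0} (0 + (-1) * s :: real) \<partial>lborel)"
    by (subst nn_integral_real_affine[where c = "-1" and t = 0]) auto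
  also have "\<dots> = (\<integral>\<^sup>+s. ennreal (exp (- k * s)) * indicator {0..} s \<partial>lborel)"
    by (intro nn_integral_cong) (auto simp: indicator_def)
  also have "\<dots> = ennreal (0 - (- exp (- k * 0) / k))"
  proof (rule nn_integral_FTC_atLeast)
    show "((\<lambda>s. - exp (- k * s) / k) \<longlongrightarrow> 0) at_top"
      using assms by real_asymp
    show "((\<lambda>s. - exp (- k * s) / k) has_real_derivative exp (- k * x)) (at x)" for x
      using assms by (auto intro!: derivative_eq_intros)
  qed auto
  finally show ?thesis by simp
qed

lemma set_integrable_exp_neg:
  assumes "0 < (k::real)"
  shows "set_integrable lborel {..0} (\<lambda>s. exp (k * s))"
  unfolding set_integrable_def
proof (rule integrableI_bounded)
  have "(\<integral>\<^sup>+s. ennreal (norm (indicator {..0} s *\<^sub>R exp (k * s))) \<partial>lborel)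
    = (\<integral>\<^sup>+s. ennreal (exp (k * s)) * indicator {..0} s \<partial>lborel)"
    by (intro nn_integral_cong) (auto simp: indicator_def)
  then show "(\<integral>\<^sup>+s. ennreal (norm (indicator {..0} s *\<^sub>R exp (k * s))) \<partial>lborel) < \<infinity>"
    using nn_integral_exp_neg[OF assms] by simp
qed simp

lemma set_integral_exp_neg: "(LINT s:{..0}|lborel. exp s) = (1 :: real)"
  unfolding set_lebesgue_integral_def
proof (subst integral_eq_nn_integral)
  have "(\<integral>\<^sup>+s. ennreal (indicator {..0} s *\<^sub>R exp s) \<partial>lborel)
    = (\<integral>\<^sup>+s. ennreal (exp (1 * s)) * indicator {..0} s \<partial>lborel)"
    by (intro nn_integral_cong) (auto simp: indicator_def)
  also have "\<dots> = 1" using nn_integral_exp_neg[of 1] by simp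
  finally show "enn2real (\<integral>\<^sup>+s. ennreal (indicator {..0} s *\<^sub>R exp s) \<partial>lborel) = (1 :: real)" by simp
qed auto

text \<open>Completing the square moves the mean of the density to
  \<open>a * \<sigma>\<^sup>2\<close>.\<close>

lemma nn_integral_normal_mgf:
  assumes "0 < \<sigma>"
  shows "(\<integral>\<^sup>+x. ennreal (normal_density 0 \<sigma> x) * ennreal (exp (a * x)) \<partial>lborel) = ennreal (exp (a\<^sup>2 * \<sigma>\<^sup>2 / 2))"
proof -
  have "normal_density 0 \<sigma> x * exp (a * x) = exp (a\<^sup>2 * \<sigma>\<^sup>2 / 2) * normal_density (a * \<sigma>\<^sup>2) \<sigma> x" for x
  proof -
    have "- (x - 0)\<^sup>2 / (2 * \<sigma>\<^sup>2) + a * x = a\<^sup>2 * \<sigma>\<^sup>2 / 2 + (- (x - a * \<sigma>\<^sup>2)\<^sup>2 / (2 * \<sigma>\<^sup>2))"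
      using assms by (simp add: field_simps power2_eq_square)
    then show ?thesis
      unfolding normal_density_def by (simp add: exp_add[symmetric] mult_exp_exp)
  qed
  then have "(\<integral>\<^sup>+x. ennreal (normal_density 0 \<sigma> x) * ennreal (exp (a * x)) \<partial>lborel)
    = (\<integral>\<^sup>+x. ennreal (exp (a\<^sup>2 * \<sigma>\<^sup>2 / 2)) * ennreal (normal_density (a * \<sigma>\<^sup>2) \<sigma> x) \<partial>lborel)"
    by (simp add: ennreal_mult[symmetric])
  also have "\<dots> = ennreal (exp (a\<^sup>2 * \<sigma>\<^sup>2 / 2)) * (\<integral>\<^sup>+x. ennreal (normal_density (a * \<sigma>\<^sup>2) \<sigma> x) \<partial>lborel)"
    by (rule nn_integral_cmult) simp
  also have "(\<integral>\<^sup>+x. ennreal (normal_density (a * \<sigma>\<^sup>2) \<sigma> x) \<partial>lborel) = 1"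
    using assms by (subst nn_integral_eq_integral) auto
  finally show ?thesis by simp
qed

text \<open>Continuity in time gives joint measurability: time is rounded down to multiples of 1 /
  (n + 1), where only countably many values occur. Used for the noise, and again for the distance to
  the attractor along a trajectory of bumps.\<close>

lemma borel_measurable_continuous_process:
  fixes X :: "'w \<Rightarrow> real \<Rightarrow> real"
  assumes cont: "\<And>\<omega>. \<omega> \<in> space M \<Longrightarrow> continuous_on UNIV (X \<omega>)" and meas: "\<And>s. (\<lambda>\<omega>. X \<omega> s) \<in> borel_measurable M"
  shows "(\<lambda>(\<omega>, s). X \<omega> s) \<in> borel_measurable (M \<Otimes>\<^sub>M lborel)"
proof -
  let ?u = "\<lambda>n p. X (fst p) (of_int \<lfloor>real (Suc n) * snd p\<rfloor> / real (Suc n))"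
  have "(\<lambda>n. ?u n p) \<longlonglongrightarrow> X (fst p) (snd p)" if "p \<in> space (M \<Otimes>\<^sub>M (lborel :: real measure))" for p
  proof -
  from that obtain \<omega> s where p: "p = (\<omega>, s)" "\<omega> \<in> space M" by (auto simp: space_pair_measure)
  have l: "(\<lambda>n. of_int \<lfloor>real (Suc n) * s\<rfloor> / real (Suc n)) \<longlonglongrightarrow> s"
  proof (rule tendsto_sandwich)
    show "\<forall>\<^sub>F n in sequentially. s - 1 / real (Suc n) \<le> of_int \<lfloor>real (Suc n) * s\<rfloor> / real (Suc n)"
    proof (rule always_eventually, rule allI)
      fix n
      have "real (Suc n) * s - 1 \<le> of_int \<lfloor>real (Suc n) * s\<rfloor>" by linarith
      then have "(real (Suc n) * s - 1) / real (Suc n) \<le> of_int \<lfloor>real (Suc n) * s\<rfloor> / real (Suc n)"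
        by (rule divide_right_mono) simp
      then show "s - 1 / real (Suc n) \<le> of_int \<lfloor>real (Suc n) * s\<rfloor> / real (Suc n)"
        by (simp add: diff_divide_distrib del: of_nat_Suc)
    qed
    show "\<forall>\<^sub>F n in sequentially. of_int \<lfloor>real (Suc n) * s\<rfloor> / real (Suc n) \<le> s"
    proof (rule always_eventually, rule allI)
      fix n
      have "of_int \<lfloor>real (Suc n) * s\<rfloor> \<le> real (Suc n) * s" by linarith
      then have "of_int \<lfloor>real (Suc n) * s\<rfloor> / real (Suc n) \<le> real (Suc n) * s / real (Suc n)"
        by (rule divide_right_mono) simp
      then show "of_int \<lfloor>real (Suc n) * s\<rfloor> / real (Suc n) \<le> s"
        by (simp del: of_nat_Suc)
    qed
    show "(\<lambda>n. s - 1 / real (Suc n)) \<longlonglongrightarrow> s"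
      using tendsto_diff[OF tendsto_const LIMSEQ_inverse_real_of_nat, of s] by (simp add: inverse_eq_divide)
  qed simp
  have c: "isCont (X \<omega>) s"
    using cont[OF p(2)] continuous_on_eq_continuous_at by blast
  have "(\<lambda>n. X \<omega> (of_int \<lfloor>real (Suc n) * s\<rfloor> / real (Suc n))) \<longlonglongrightarrow> X \<omega> s"
    by (rule isCont_tendsto_compose[OF c l])
  then show ?thesis by (simp only: p fst_conv snd_conv)
  qed
  moreover have "?u n \<in> borel_measurable (M \<Otimes>\<^sub>M (lborel :: real measure))" for n
  proof -
  have "(\<lambda>p. (\<lambda>i p. X (fst p) (of_int i / real (Suc n))) \<lfloor>real (Suc n) * snd p\<rfloor> p) \<in> borel_measurable (M \<Otimes>\<^sub>M (lborel :: real measure))"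
  proof (rule measurable_compose_countable[where f = "\<lambda>i p. X (fst p) (of_int i / real (Suc n))"
        and g = "\<lambda>p. \<lfloor>real (Suc n) * snd p\<rfloor>"])
    fix i :: int
    show "(\<lambda>p. X (fst p) (of_int i / real (Suc n))) \<in> borel_measurable (M \<Otimes>\<^sub>M (lborel :: real measure))"
      using meas by measurable
    show "(\<lambda>p. \<lfloor>real (Suc n) * snd p\<rfloor>) \<in> measurable (M \<Otimes>\<^sub>M (lborel :: real measure)) (count_space UNIV)"
      by measurable
  qed
  then show ?thesis by simp
  qed
  ultimately have "(\<lambda>p. X (fst p) (snd p)) \<in> borel_measurable (M \<Otimes>\<^sub>M (lborel :: real measure))"
    by (rule borel_measurable_LIMSEQ_real)
  then show ?thesis by (simp add: case_prod_beta')
qed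

context noise
begin

lemma beta_continuous: "\<omega> \<in> space P \<Longrightarrow> continuous_on UNIV (\<lambda>s. snd (\<omega> s))"
  using path_continuous[of \<omega> D] space_P by (auto intro!: continuous_intros)

lemma beta_joint_measurable [measurable]: "(\<lambda>p. snd (fst p (snd p))) \<in> borel_measurable (P \<Otimes>\<^sub>M lborel)"
  using borel_measurable_continuous_process[of P "\<lambda>\<omega> s. snd (\<omega> s)"] beta_continuous beta_measurable
  by (simp add: case_prod_beta')

lemma beta_path_measurable: "\<omega> \<in> space P \<Longrightarrow> (\<lambda>s. snd (\<omega> s)) \<in> borel_measurable borel"
  by (rule borel_measurable_continuous_onI[OF beta_continuous])

text \<open>A backward increment is a forward one with \<open>a\<close> replaced by
  \<open>- a\<close>; this allows both signs of \<open>t - s\<close>.\<close>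

lemma nn_integral_exp_beta:
  "(\<integral>\<^sup>+\<omega>. ennreal (exp (a * (snd (\<omega> t) - snd (\<omega> s)))) \<partial>P) = ennreal (exp (a\<^sup>2 * \<bar>t - s\<bar> / 2))"
proof -
  have 1: "(\<integral>\<^sup>+\<omega>. ennreal (exp (a * (snd (\<omega> t) - snd (\<omega> s)))) \<partial>P) = ennreal (exp (a\<^sup>2 * (t - s) / 2))"
    if "s < t" for a s t
  proof -
    have "distr P borel (\<lambda>\<omega>. snd (\<omega> t) - snd (\<omega> s)) = centered_gaussian (t - s)"
      using noise that by (simp add: canonical_noise_space_def brownian_motion_def)
    also have "\<dots> = density lborel (\<lambda>x. ennreal (normal_density 0 (sqrt (t - s)) x))"
      using that by (simp add: centered_gaussian_def)
    finally have law: "distr P borel (\<lambda>\<omega>. snd (\<omega> t) - snd (\<omega> s)) = \<dots>" .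
    have "(\<integral>\<^sup>+\<omega>. ennreal (exp (a * (snd (\<omega> t) - snd (\<omega> s)))) \<partial>P)
      = (\<integral>\<^sup>+x. ennreal (exp (a * x)) \<partial>distr P borel (\<lambda>\<omega>. snd (\<omega> t) - snd (\<omega> s)))"
      by (subst nn_integral_distr) auto
    also have "\<dots> = (\<integral>\<^sup>+x. ennreal (normal_density 0 (sqrt (t - s)) x) * ennreal (exp (a * x)) \<partial>lborel)"
      unfolding law by (subst nn_integral_density) auto
    also have "\<dots> = ennreal (exp (a\<^sup>2 * (t - s) / 2))"
      using that by (subst nn_integral_normal_mgf) auto
    finally show ?thesis .
  qed
  consider "s < t" | "s = t" | "t < s" by linarith
  then show ?thesis
  proof cases
    case 3
    have "a * (snd (\<omega> t) - snd (\<omega> s)) = (- a) * (snd (\<omega> s) - snd (\<omega> t))" for \<omega> :: "'a path"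
      by (simp add: algebra_simps)
    then show ?thesis using 1[OF 3, of "- a"] 3 by simp
  qed (use 1 in \<open>auto simp: emeasure_space_1\<close>)
qed

text \<open>Markov's inequality for the exponential. The free parameter of the Chernoff bound is
  absorbed in \<open>a\<close> and \<open>u\<close>, to be chosen at each use.\<close>

lemma beta_tail:
  "prob {\<omega>\<in>space P. u \<le> a * (snd (\<omega> t) - snd (\<omega> s))} \<le> exp (a\<^sup>2 * \<bar>t - s\<bar> / 2 - u)"
proof -
  have "emeasure P {\<omega>\<in>space P. u \<le> a * (snd (\<omega> t) - snd (\<omega> s))}
    = emeasure P ({\<omega>\<in>space P. 1 \<le> ennreal (exp (- u)) * ennreal (exp (a * (snd (\<omega> t) - snd (\<omega> s))))})"
    by (intro arg_cong[of _ _ "emeasure P"])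
      (auto simp: ennreal_mult[symmetric] exp_add[symmetric] one_ennreal.rep_eq ennreal_1[symmetric] simp del: ennreal_1)
  also have "\<dots> \<le> ennreal (exp (- u)) * (\<integral>\<^sup>+\<omega>. ennreal (exp (a * (snd (\<omega> t) - snd (\<omega> s)))) * indicator (space P) \<omega> \<partial>P)"
    by (rule nn_integral_Markov_inequality) auto
  also have "(\<integral>\<^sup>+\<omega>. ennreal (exp (a * (snd (\<omega> t) - snd (\<omega> s)))) * indicator (space P) \<omega> \<partial>P) =
     ennreal (exp (a\<^sup>2 * \<bar>t - s\<bar> / 2))"
    unfolding nn_integral_exp_beta[symmetric] by (intro nn_integral_cong) auto
  also have "ennreal (exp (- u)) * \<dots> = ennreal (exp (a\<^sup>2 * \<bar>t - s\<bar> / 2 - u))"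
    by (simp add: ennreal_mult[symmetric] exp_add[symmetric])
  finally show ?thesis by (simp add: emeasure_eq_measure)
qed

text \<open>A solution without diffusion grows by \<open>exp (\<eta> * n + \<mu> * \<beta>)\<close>,
  with \<beta> the noise at time n. If this is below 1, the multiple to start from exceeds the
  configuration to be reached and may leave the order interval; the event must become
  improbable.\<close>

lemma prob_growth_factor_small:
  assumes "0 < \<eta>"
  shows "(\<lambda>n. prob {\<omega>\<in>space P. \<eta> * real n + \<mu> * snd (\<omega> (real n)) < 0}) \<longlonglongrightarrow> 0"
proof -
  \<comment> \<open>With \<open>l * \<mu>\<^sup>2 \<le> \<eta>\<close> the Gaussian term in
    \<open>beta_tail\<close> uses up at most half of \<open>l * \<eta> * n\<close>; the summand 1
    covers \<mu> = 0.\<close>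
  define l where "l = \<eta> / (\<mu>\<^sup>2 + 1)"
  have m1: "\<mu>\<^sup>2 + 1 > 0" by (simp add: add_nonneg_pos)
  have l: "l > 0" "l * \<mu>\<^sup>2 \<le> \<eta>"
    using assms m1 by (auto simp: l_def field_simps)
  have bd: "prob {\<omega>\<in>space P. \<eta> * real n + \<mu> * snd (\<omega> (real n)) < 0} \<le> exp (- (l * \<eta> / 2) * real n)" for n
  proof -
    have "prob {\<omega>\<in>space P. \<eta> * real n + \<mu> * snd (\<omega> (real n)) < 0}
      \<le> prob {\<omega>\<in>space P. l * \<eta> * real n \<le> (- l * \<mu>) * (snd (\<omega> (real n)) - snd (\<omega> 0))}"
    proof (rule finite_measure_mono)
      show "{\<omega>\<in>space P. \<eta> * real n + \<mu> * snd (\<omega> (real n)) < 0}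
        \<subseteq> {\<omega>\<in>space P. l * \<eta> * real n \<le> (- l * \<mu>) * (snd (\<omega> (real n)) - snd (\<omega> 0))}"
      proof
        fix \<omega> assume w: "\<omega> \<in> {\<omega>\<in>space P. \<eta> * real n + \<mu> * snd (\<omega> (real n)) < 0}"
        then have "l * (\<eta> * real n + \<mu> * snd (\<omega> (real n))) \<le> 0"
          using l by (auto simp: mult_le_0_iff)
        with w show "\<omega> \<in> {\<omega>\<in>space P. l * \<eta> * real n \<le> (- l * \<mu>) * (snd (\<omega> (real n)) - snd (\<omega> 0))}"
          by (auto simp: space_P path_0[of _ D] algebra_simps)
      qed
    qed measurable
    also have "\<dots> \<le> exp ((- l * \<mu>)\<^sup>2 * \<bar>real n - 0\<bar> / 2 - l * \<eta> * real n)"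
      by (rule beta_tail)
    also have "\<dots> \<le> exp (- (l * \<eta> / 2) * real n)"
    proof -
      have "l * (l * \<mu>\<^sup>2) * real n \<le> l * \<eta> * real n"
        using l by (intro mult_right_mono mult_left_mono) auto
      then show ?thesis by (simp add: power_mult_distrib power2_eq_square algebra_simps)
    qed
    finally show ?thesis .
  qed
  show ?thesis
  proof (rule tendsto_sandwich[OF _ _ tendsto_const])
    show "\<forall>\<^sub>F n in sequentially. prob {\<omega>\<in>space P. \<eta> * real n + \<mu> * snd (\<omega> (real n)) < 0} \<le> exp (- (l * \<eta> / 2) * real n)"
      using bd by simp
    have m: "(\<lambda>n. exp (- m * real n)) \<longlonglongrightarrow> 0" if "0 < m" for m :: real
      using that by real_asymp
    show "(\<lambda>n. exp (- (l * \<eta> / 2) * real n)) \<longlonglongrightarrow> 0"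
      by (rule m) (use l assms in simp)
  qed simp
qed

lemma nn_integral_pair_swap:
  assumes [measurable]: "f \<in> borel_measurable (P \<Otimes>\<^sub>M (lborel :: real measure))"
  shows "(\<integral>\<^sup>+\<omega>. (\<integral>\<^sup>+s. f (\<omega>, s) \<partial>lborel) \<partial>P) = (\<integral>\<^sup>+s. (\<integral>\<^sup>+\<omega>. f (\<omega>, s) \<partial>P) \<partial>lborel)"
proof -
  interpret pair_sigma_finite P "lborel :: real measure" ..
  show ?thesis using Fubini'[of "\<lambda>\<omega> s. f (\<omega>, s)"] by simp
qed

text \<open>Tonelli, with the absolute value bounded by \<open>exp x + exp (- x)\<close>: the mean
  of the integrand is at most \<open>2 * exp (s / 2)\<close>. So for almost every path the integral
  in \<open>ou_process\<close> is a genuine one and not the default value 0.\<close>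

lemma AE_exp_beta_integrable:
  "AE \<omega> in P. set_integrable lborel {..0} (\<lambda>s. exp s * snd (\<omega> s))"
proof -
  have "(\<integral>\<^sup>+\<omega>. (\<integral>\<^sup>+s. ennreal (exp s * \<bar>snd (\<omega> s)\<bar>) * indicator {..0} s \<partial>lborel) \<partial>P)
      = (\<integral>\<^sup>+s. (\<integral>\<^sup>+\<omega>. ennreal (exp s * \<bar>snd (\<omega> s)\<bar>) * indicator {..0} s \<partial>P) \<partial>lborel)"
    using nn_integral_pair_swap[of "\<lambda>p. ennreal (exp (snd p) * \<bar>snd (fst p (snd p))\<bar>) * indicator {..0} (snd p)"] by simp
  also have "\<dots> \<le> (\<integral>\<^sup>+s. ennreal 2 * (ennreal (exp ((1/2) * s)) * indicator {..0} s) \<partial>lborel)"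
  proof (rule nn_integral_mono)
    fix s :: real
    have "(\<integral>\<^sup>+\<omega>. ennreal (exp s * \<bar>snd (\<omega> s)\<bar>) \<partial>P) \<le> ennreal (2 * exp ((1/2) * s))" if "s \<le> 0"
    proof -
      have "(\<integral>\<^sup>+\<omega>. ennreal (exp s * \<bar>snd (\<omega> s)\<bar>) \<partial>P) \<le>
        (\<integral>\<^sup>+\<omega>. ennreal (exp s) * (ennreal (exp (1 * (snd (\<omega> s) - snd (\<omega> 0)))) + ennreal (exp ((-1) * (snd (\<omega> s) - snd (\<omega> 0))))) \<partial>P)"
      proof (rule nn_integral_mono)
        fix \<omega> assume "\<omega> \<in> space P"
        then have z: "snd (\<omega> 0) = 0" by (simp add: space_P path_0[of _ D])
        have "\<bar>x\<bar> \<le> exp x + exp (- x)" for x :: real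
          using exp_ge_add_one_self[of x] exp_ge_add_one_self[of "-x"] exp_gt_zero[of x] exp_gt_zero[of "-x"] by linarith
        then have "exp s * \<bar>snd (\<omega> s)\<bar> \<le> exp s * (exp (snd (\<omega> s)) + exp (- snd (\<omega> s)))"
          by (intro mult_left_mono) auto
        then show "ennreal (exp s * \<bar>snd (\<omega> s)\<bar>) \<le> ennreal (exp s) * (ennreal (exp (1 * (snd (\<omega> s) - snd (\<omega> 0)))) + ennreal (exp ((-1) * (snd (\<omega> s) - snd (\<omega> 0)))))"
          by (simp add: z ennreal_plus[symmetric] ennreal_mult[symmetric] del: ennreal_plus)
      qed
      also have "\<dots> = ennreal (exp s) * (ennreal (exp (1\<^sup>2 * \<bar>s - 0\<bar> / 2)) + ennreal (exp ((-1)\<^sup>2 * \<bar>s - 0\<bar> / 2)))"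
        unfolding nn_integral_exp_beta[symmetric] by (subst nn_integral_cmult, simp, subst nn_integral_add) auto
      also have "\<dots> = ennreal (2 * exp ((1/2) * s))"
        using that by (simp add: ennreal_plus[symmetric] ennreal_mult[symmetric] exp_add[symmetric] mult_exp_exp del: ennreal_plus)
      finally show ?thesis .
    qed
    then show "(\<integral>\<^sup>+\<omega>. ennreal (exp s * \<bar>snd (\<omega> s)\<bar>) * indicator {..0} s \<partial>P) \<le> ennreal 2 * (ennreal (exp ((1/2) * s)) * indicator {..0} s)"
      by (cases "s \<le> 0") (auto simp: ennreal_mult)
  qed
  also have "\<dots> = ennreal 2 * (\<integral>\<^sup>+s. (ennreal (exp ((1/2) * s)) * indicator {..0} s) \<partial>lborel)"
    by (rule nn_integral_cmult) auto
  also have "\<dots> < \<infinity>"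
    using nn_integral_exp_neg[of "1/2"] by (simp add: ennreal_mult_less_top)
  finally have "(\<integral>\<^sup>+\<omega>. (\<integral>\<^sup>+s. ennreal (exp s * \<bar>snd (\<omega> s)\<bar>) * indicator {..0} s \<partial>lborel) \<partial>P) \<noteq> \<infinity>" by simp
  moreover have "(\<lambda>\<omega>. \<integral>\<^sup>+s. ennreal (exp s * \<bar>snd (\<omega> s)\<bar>) * indicator {..0} s \<partial>lborel) \<in> borel_measurable P"
    by (rule lborel.borel_measurable_nn_integral) (simp add: case_prod_beta')
  ultimately have "AE \<omega> in P. (\<integral>\<^sup>+s. ennreal (exp s * \<bar>snd (\<omega> s)\<bar>) * indicator {..0} s \<partial>lborel) \<noteq> \<infinity>"
    by (intro nn_integral_PInf_AE) auto
  then show ?thesis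
  proof (rule AE_mp, intro AE_I2 impI)
    fix \<omega> assume w: "\<omega> \<in> space P" and fin: "(\<integral>\<^sup>+s. ennreal (exp s * \<bar>snd (\<omega> s)\<bar>) * indicator {..0} s \<partial>lborel) \<noteq> \<infinity>"
    have [measurable]: "(\<lambda>s. snd (\<omega> s)) \<in> borel_measurable borel" by (rule beta_path_measurable[OF w])
    have "(\<integral>\<^sup>+s. ennreal (norm (indicator {..0} s *\<^sub>R (exp s * snd (\<omega> s)))) \<partial>lborel)
      = (\<integral>\<^sup>+s. ennreal (exp s * \<bar>snd (\<omega> s)\<bar>) * indicator {..0} s \<partial>lborel)"
      by (intro nn_integral_cong) (auto simp: indicator_def abs_mult)
    with fin show "set_integrable lborel {..0} (\<lambda>s. exp s * snd (\<omega> s))"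
      unfolding set_integrable_def by (intro integrableI_bounded) (auto simp: less_top)
  qed
qed

text \<open>The expectation of the integral is infinite when \<open>a\<^sup>2 / 2 \<ge> k\<close>,
  so Tonelli does not suffice. Instead the half-line is cut into unit blocks, and Borel-Cantelli
  controls, for all but finitely many blocks, the path at the right end of the block and the
  exponential of its oscillation inside.\<close>

lemma AE_clock_integrable:
  assumes k: "0 < k"
  shows "AE \<omega> in P. set_integrable lborel {..0} (\<lambda>s. exp (k * s + a * snd (\<omega> s)))"
proof -
  define blk where "blk n = {- real (Suc n)<..- real n}" for n
  define I where "I n \<omega> = (\<integral>\<^sup>+s. ennreal (exp (a * (snd (\<omega> s) - snd (\<omega> (- real n))))) * indicator (blk n) s \<partial>lborel)" for n and \<omega> :: "'a path"
  have blk [measurable]: "blk n \<in> sets borel" for n by (simp add: blk_def)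
  have I_meas [measurable]: "I n \<in> borel_measurable P" for n
    unfolding I_def by (rule lborel.borel_measurable_nn_integral) (simp add: case_prod_beta')
  have EI: "(\<integral>\<^sup>+\<omega>. I n \<omega> \<partial>P) \<le> ennreal (exp (a\<^sup>2 / 2))" for n
  proof -
    have "(\<integral>\<^sup>+\<omega>. I n \<omega> \<partial>P) = (\<integral>\<^sup>+s. (\<integral>\<^sup>+\<omega>. ennreal (exp (a * (snd (\<omega> s) - snd (\<omega> (- real n))))) * indicator (blk n) s \<partial>P) \<partial>lborel)"
      unfolding I_def
      using nn_integral_pair_swap[of "\<lambda>p. ennreal (exp (a * (snd (fst p (snd p)) - snd (fst p (- real n))))) * indicator (blk n) (snd p)"] by simp
    also have "\<dots> \<le> (\<integral>\<^sup>+s. ennreal (exp (a\<^sup>2 / 2)) * indicator (blk n) s \<partial>lborel)"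
    proof (rule nn_integral_mono)
      fix s
      have "(\<integral>\<^sup>+\<omega>. ennreal (exp (a * (snd (\<omega> s) - snd (\<omega> (- real n))))) \<partial>P) \<le> ennreal (exp (a\<^sup>2 / 2))" if "s \<in> blk n"
      proof -
        have "a\<^sup>2 * \<bar>s - - real n\<bar> \<le> a\<^sup>2 * 1"
          using that by (intro mult_left_mono) (auto simp: blk_def)
        then show ?thesis unfolding nn_integral_exp_beta by (intro ennreal_leI) simp
      qed
      then show "(\<integral>\<^sup>+\<omega>. ennreal (exp (a * (snd (\<omega> s) - snd (\<omega> (- real n))))) * indicator (blk n) s \<partial>P) \<le> ennreal (exp (a\<^sup>2 / 2)) * indicator (blk n) s"
        by (cases "s \<in> blk n") auto
    qed
    also have "\<dots> = ennreal (exp (a\<^sup>2 / 2))"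
      by (simp add: nn_integral_cmult_indicator) (simp add: blk_def)
    finally show ?thesis .
  qed
  define A where "A n = {\<omega>\<in>space P. ennreal (exp (k / 3 * real n)) \<le> I n \<omega>}" for n
  have A_meas [measurable]: "A n \<in> sets P" for n unfolding A_def by measurable
  have A_prob: "prob (A n) \<le> exp (a\<^sup>2 / 2) * exp (- (k / 3)) ^ n" for n
  proof -
    have "emeasure P (A n) = emeasure P {\<omega>\<in>space P. 1 \<le> ennreal (exp (- (k / 3 * real n))) * I n \<omega>}"
    proof (intro arg_cong[of _ _ "emeasure P"])
      have "ennreal (exp (k / 3 * real n)) \<le> x \<longleftrightarrow> 1 \<le> ennreal (exp (- (k / 3 * real n))) * x" for x
        by (cases x) (auto simp: ennreal_mult[symmetric] exp_minus field_simps ennreal_top_mult ennreal_mult_top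
           ennreal_1[symmetric] simp del: ennreal_1)
      then show "A n = {\<omega>\<in>space P. 1 \<le> ennreal (exp (- (k / 3 * real n))) * I n \<omega>}"
        by (auto simp: A_def)
    qed
    also have "\<dots> \<le> ennreal (exp (- (k / 3 * real n))) * (\<integral>\<^sup>+\<omega>. I n \<omega> * indicator (space P) \<omega> \<partial>P)"
      by (rule nn_integral_Markov_inequality) auto
    also have "(\<integral>\<^sup>+\<omega>. I n \<omega> * indicator (space P) \<omega> \<partial>P) = (\<integral>\<^sup>+\<omega>. I n \<omega> \<partial>P)"
      by (intro nn_integral_cong) auto
    also have "ennreal (exp (- (k / 3 * real n))) * \<dots> \<le> ennreal (exp (- (k / 3 * real n))) * ennreal (exp (a\<^sup>2 / 2))"
      by (intro mult_left_mono EI) simp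
    also have "\<dots> = ennreal (exp (a\<^sup>2 / 2) * exp (- (k / 3)) ^ n)"
      by (simp add: ennreal_mult[symmetric] exp_of_nat_mult[symmetric] mult.commute)
    finally show ?thesis by (simp add: emeasure_eq_measure)
  qed
  \<comment> \<open>As for the growth factor, now with rate \<open>k / 3\<close>: the Gaussian term
    uses up at most half of the exponent.\<close>
  define l where "l = k / (3 * (a\<^sup>2 + 1))"
  have m1: "a\<^sup>2 + 1 > 0" by (simp add: add_nonneg_pos)
  have l: "l > 0" "l * a\<^sup>2 \<le> k / 3"
    using k m1 by (auto simp: l_def field_simps)
  define B where "B n = {\<omega>\<in>space P. k / 3 * real n \<le> a * snd (\<omega> (- real n))}" for n
  have B_meas [measurable]: "B n \<in> sets P" for n unfolding B_def by measurable
  have B_prob: "prob (B n) \<le> exp (- (l * k / 6)) ^ n" for n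
  proof -
    have "prob (B n) \<le> prob {\<omega>\<in>space P. l * (k / 3) * real n \<le> (l * a) * (snd (\<omega> (- real n)) - snd (\<omega> 0))}"
    proof (rule finite_measure_mono)
      show "B n \<subseteq> {\<omega>\<in>space P. l * (k / 3) * real n \<le> (l * a) * (snd (\<omega> (- real n)) - snd (\<omega> 0))}"
      proof
        fix \<omega> assume w: "\<omega> \<in> B n"
        then have "l * (k / 3 * real n) \<le> l * (a * snd (\<omega> (- real n)))"
          using l by (intro mult_left_mono) (auto simp: B_def)
        with w show "\<omega> \<in> {\<omega>\<in>space P. l * (k / 3) * real n \<le> (l * a) * (snd (\<omega> (- real n)) - snd (\<omega> 0))}"
          by (auto simp: B_def space_P path_0[of _ D] algebra_simps)
      qed
    qed measurable
    also have "\<dots> \<le> exp ((l * a)\<^sup>2 * \<bar>- real n - 0\<bar> / 2 - l * (k / 3) * real n)"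
      by (rule beta_tail)
    also have "\<dots> \<le> exp (- (l * k / 6) * real n)"
    proof -
      have "l * (l * a\<^sup>2) * real n \<le> l * (k / 3) * real n"
        using l by (intro mult_right_mono mult_left_mono) auto
      then show ?thesis by (simp add: power_mult_distrib power2_eq_square algebra_simps)
    qed
    also have "\<dots> = exp (- (l * k / 6)) ^ n"
      by (simp add: exp_of_nat_mult[symmetric] mult.commute)
    finally show ?thesis .
  qed
  have sA: "summable (\<lambda>n. prob (A n))"
  proof (rule summable_comparison_test'[where N = 0])
    show "summable (\<lambda>n. exp (a\<^sup>2 / 2) * exp (- (k / 3)) ^ n)"
      using k by (intro summable_mult summable_geometric) simp
  qed (use A_prob in simp)
  have sB: "summable (\<lambda>n. prob (B n))"
  proof (rule summable_comparison_test'[where N = 0])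
    have "0 < l * k / 6" using l k by simp
    then show "summable (\<lambda>n. exp (- (l * k / 6)) ^ n)"
      by (intro summable_geometric) simp
  qed (use B_prob in simp)
  have "AE \<omega> in P. \<forall>\<^sub>F n in sequentially. \<omega> \<in> space P - A n"
    by (rule borel_cantelli_AE1[OF A_meas _ sA]) (simp add: less_top[symmetric])
  moreover have "AE \<omega> in P. \<forall>\<^sub>F n in sequentially. \<omega> \<in> space P - B n"
    by (rule borel_cantelli_AE1[OF B_meas _ sB]) (simp add: less_top[symmetric])
  ultimately show ?thesis
  proof (eventually_elim)
    fix \<omega> assume evA: "\<forall>\<^sub>F n in sequentially. \<omega> \<in> space P - A n" and evB: "\<forall>\<^sub>F n in sequentially. \<omega> \<in> space P - B n"
    then have w: "\<omega> \<in> space P" by (auto dest: eventually_happens)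
    have [measurable]: "(\<lambda>s. snd (\<omega> s)) \<in> borel_measurable borel" by (rule beta_path_measurable[OF w])
    define J where "J n = (\<integral>\<^sup>+s. ennreal (exp (k * s + a * snd (\<omega> s))) * indicator (blk n) s \<partial>lborel)" for n
    have Jfin: "J n < \<infinity>" for n
    proof -
      have "continuous_on {- real (Suc n)..- real n} (\<lambda>s. exp (k * s + a * snd (\<omega> s)))"
        by (intro continuous_intros continuous_on_subset[OF beta_continuous[OF w]]) auto
      then have "set_integrable lborel {- real (Suc n)..- real n} (\<lambda>s. exp (k * s + a * snd (\<omega> s)))"
        by (intro borel_integrable_atLeastAtMost' )
      then have "(\<integral>\<^sup>+s. ennreal (norm (indicator {- real (Suc n)..- real n} s *\<^sub>R exp (k * s + a * snd (\<omega> s)))) \<partial>lborel) < \<infinity>"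
        unfolding set_integrable_def by (simp only: integrable_iff_bounded)
      moreover have "J n \<le> (\<integral>\<^sup>+s. ennreal (norm (indicator {- real (Suc n)..- real n} s *\<^sub>R exp (k * s + a * snd (\<omega> s)))) \<partial>lborel)"
        unfolding J_def by (intro nn_integral_mono) (auto simp: indicator_def blk_def)
      ultimately show ?thesis by (rule order.strict_trans1[rotated])
    qed
    \<comment> \<open>The exponential gives at most \<open>exp (- k * n)\<close> on the block; the
      path value at its end and the oscillation give back at most \<open>exp (k / 3 * n)\<close>
      each.\<close>
    have Jev: "\<forall>\<^sub>F n in sequentially. J n \<le> ennreal (exp (- (k / 3)) ^ n)"
      using evA evB
    proof eventually_elim
      fix n assume nA: "\<omega> \<in> space P - A n" and nB: "\<omega> \<in> space P - B n"
      have "J n \<le> (\<integral>\<^sup>+s. ennreal (exp (- (2 * k / 3) * real n)) * (ennreal (exp (a * (snd (\<omega> s) - snd (\<omega> (- real n))))) * indicator (blk n) s) \<partial>lborel)"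
        unfolding J_def
      proof (rule nn_integral_mono)
        fix s
        have "exp (k * s + a * snd (\<omega> s)) \<le> exp (- (2 * k / 3) * real n) * exp (a * (snd (\<omega> s) - snd (\<omega> (- real n))))"
          if s: "s \<in> blk n"
        proof -
          have "k * s \<le> k * (- real n)" using s k by (intro mult_left_mono) (auto simp: blk_def)
          moreover have "a * snd (\<omega> (- real n)) \<le> k / 3 * real n" using nB by (auto simp: B_def)
          ultimately show ?thesis by (simp add: exp_add[symmetric] mult_exp_exp algebra_simps)
        qed
        then show "ennreal (exp (k * s + a * snd (\<omega> s))) * indicator (blk n) s \<le> ennreal (exp (- (2 * k / 3) * real n)) * (ennreal (exp (a * (snd (\<omega> s) - snd (\<omega> (- real n))))) * indicator (blk n) s)"
          by (cases "s \<in> blk n") (auto simp: ennreal_mult[symmetric] intro!: ennreal_leI)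
      qed
      also have "\<dots> = ennreal (exp (- (2 * k / 3) * real n)) * I n \<omega>"
        unfolding I_def by (rule nn_integral_cmult) simp
      also have "\<dots> \<le> ennreal (exp (- (2 * k / 3) * real n)) * ennreal (exp (k / 3 * real n))"
        using nA by (intro mult_left_mono) (auto simp: A_def)
      also have "\<dots> = ennreal (exp (- (k / 3)) ^ n)"
        by (simp add: ennreal_mult[symmetric] exp_of_nat_mult[symmetric] exp_add[symmetric] mult_exp_exp algebra_simps)
      finally show "J n \<le> ennreal (exp (- (k / 3)) ^ n)" .
    qed
    have "summable (\<lambda>n. enn2real (J n))"
    proof (rule summable_comparison_test_ev)
      show "\<forall>\<^sub>F n in sequentially. norm (enn2real (J n)) \<le> exp (- (k / 3)) ^ n"
        using Jev by eventually_elim (auto intro!: enn2real_leI)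
      show "summable (\<lambda>n. exp (- (k / 3)) ^ n)" using k by (intro summable_geometric) simp
    qed
    then have "(\<Sum>n. ennreal (enn2real (J n))) = ennreal (\<Sum>n. enn2real (J n))"
      by (intro suminf_ennreal2) auto
    then have sumfin: "(\<Sum>n. J n) < \<infinity>" using Jfin by (simp add: less_top)
    have "(\<integral>\<^sup>+s. ennreal (norm (indicator {..0} s *\<^sub>R exp (k * s + a * snd (\<omega> s)))) \<partial>lborel)
      \<le> (\<integral>\<^sup>+s. (\<Sum>n. ennreal (exp (k * s + a * snd (\<omega> s))) * indicator (blk n) s) \<partial>lborel)"
    proof (rule nn_integral_mono)
      fix s :: real
      show "ennreal (norm (indicator {..0} s *\<^sub>R exp (k * s + a * snd (\<omega> s)))) \<le> (\<Sum>n. ennreal (exp (k * s + a * snd (\<omega> s))) * indicator (blk n) s)"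
      proof (cases "s \<le> 0")
        case True
        define n where "n = nat \<lfloor>- s\<rfloor>"
        have "real n = of_int \<lfloor>- s\<rfloor>" using True by (simp add: n_def)
        then have "s \<in> blk n" by (auto simp: blk_def) linarith+
        then have "ennreal (norm (indicator {..0} s *\<^sub>R exp (k * s + a * snd (\<omega> s)))) = (\<Sum>i\<in>{n}. ennreal (exp (k * s + a * snd (\<omega> s))) * indicator (blk i) s)"
          using True by simp
        also have "\<dots> \<le> (\<Sum>i. ennreal (exp (k * s + a * snd (\<omega> s))) * indicator (blk i) s)"
          by (rule sum_le_suminf) auto
        finally show ?thesis .
      qed simp
    qed
    also have "\<dots> = (\<Sum>n. J n)"
      unfolding J_def by (rule nn_integral_suminf) simp
    finally show "set_integrable lborel {..0} (\<lambda>s. exp (k * s + a * snd (\<omega> s)))"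
      unfolding set_integrable_def using sumfin by (intro integrableI_bounded) auto
  qed
qed

end

section \<open>The Ornstein--Uhlenbeck process\<close>

definition good_path :: "'a::euclidean_space set \<Rightarrow> 'a path \<Rightarrow> bool" where
  "good_path D \<omega> \<longleftrightarrow> \<omega> \<in> paths D \<and> set_integrable lborel {..0} (\<lambda>s. exp s * snd (\<omega> s))"

text \<open>With \<open>H t\<close> the integral of \<open>exp r * snd (\<omega> r)\<close> over
  \<open>{..t}\<close>, the process equals \<open>snd (\<omega> t) - exp (- t) * H t\<close>. Its
  difference from the noise is thus differentiable although no differentiability of the noise is
  available, which gives the Langevin equation pathwise, without stochastic integrals.\<close>

lemma good_path_ou:
  assumes "good_path D \<omega>"
  shows "((\<lambda>t. snd (\<omega> t) - ou_process \<omega> t) has_real_derivative ou_process \<omega> t) (at t)"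
    and "continuous_on UNIV (ou_process \<omega>)"
proof -
  define f where "f r = exp r * snd (\<omega> r)" for r
  have cb: "continuous_on UNIV (\<lambda>r. snd (\<omega> r))"
    using assms path_continuous[of \<omega> D] by (auto simp: good_path_def intro!: continuous_intros)
  have cf: "continuous_on A f" for A
    unfolding f_def by (intro continuous_intros continuous_on_subset[OF cb]) auto
  have i0: "set_integrable lborel {..0} f" using assms by (simp add: good_path_def f_def[abs_def])
  have int_c: "set_integrable lborel {a..b} f" for a b
    by (rule borel_integrable_atLeastAtMost'[OF cf])
  have i: "set_integrable lborel {..t} f" for t
  proof (cases "t \<le> 0")
    case True
    then show ?thesis by (intro set_integrable_subset[OF i0]) auto
  next
    case False
    have "set_integrable lborel ({..0} \<union> {0..t}) f" by (rule set_integrable_Un[OF i0 int_c]) auto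
    also have "{..0} \<union> {0..t} = {..t}" using False by auto
    finally show ?thesis .
  qed
  define H where "H t = (LINT r:{..t}|lborel. f r)" for t
  have Hd: "(H has_real_derivative f t) (at t)" for t
  proof -
    \<comment> \<open>Splitting at \<open>t - 1\<close> leaves an integral over a compact interval,
      where the fundamental theorem of calculus applies.\<close>
    have H_eq: "H u = H (t - 1) + integral {t - 1..u} f" if "u \<in> {t - 1..t + 1}" for u
    proof -
      have "{..u} = {..t - 1} \<union> {t - 1<..u}" using that by auto
      then have "H u = H (t - 1) + (LINT r:{t - 1<..u}|lborel. f r)"
        unfolding H_def using i[of "t - 1"] set_integrable_subset[OF i[of u], of "{t - 1<..u}"]
          set_integral_Un[of "{..t - 1}" "{t - 1<..u}" lborel f] ivl_disj_int_one(3)[of "t - 1" u] by simp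
      also have "(LINT r:{t - 1<..u}|lborel. f r) = (LINT r:{t - 1..u}|lborel. f r)"
        by (intro set_integral_discrete_difference[of "{t-1}"]) (use that in auto)
      also have "\<dots> = integral {t - 1..u} f"
        by (rule set_borel_integral_eq_integral(2)[OF int_c])
      finally show ?thesis .
    qed
    have "((\<lambda>u. integral {t - 1..u} f) has_real_derivative f t) (at t within {t - 1..t + 1})"
      by (rule integral_has_real_derivative[OF cf]) auto
    then have "((\<lambda>u. integral {t - 1..u} f) has_real_derivative f t) (at t)"
      by (simp add: at_within_interior[of t "{t - 1..t + 1}"])
    from DERIV_add[OF DERIV_const this]
    have "((\<lambda>u. H (t - 1) + integral {t - 1..u} f) has_real_derivative f t) (at t)" by simp
    then show ?thesis
    proof (rule has_field_derivative_transform_within_open[where S = "{t - 1<..<t + 1}"])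
      fix u assume "u \<in> {t - 1<..<t + 1}"
      then show "H (t - 1) + integral {t - 1..u} f = H u" by (intro H_eq[symmetric]) auto
    qed auto
  qed
  have z: "ou_process \<omega> t = snd (\<omega> t) - exp (- t) * H t" for t
  proof -
    have e: "set_integrable lborel {..0} (\<lambda>s. exp s :: real)"
      using set_integrable_exp_neg[of 1] by simp
    have tr: "indicator {..0} s *\<^sub>R (exp s * snd (\<omega> (t + s))) = exp (- t) * (indicator {..t} (t + 1 * s) *\<^sub>R f (t + 1 * s))" for s
      by (auto simp: indicator_def f_def exp_add exp_minus)
    have "integrable lborel (\<lambda>r. indicator {..t} r *\<^sub>R f r)" using i[of t] by (simp add: set_integrable_def)
    then have "integrable lborel (\<lambda>s. indicator {..t} (t + 1 * s) *\<^sub>R f (t + 1 * s))"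
      by (rule lborel_integrable_real_affine) simp
    then have i2: "set_integrable lborel {..0} (\<lambda>s. exp s * snd (\<omega> (t + s)))"
      unfolding set_integrable_def tr by (rule integrable_mult_right)
    have "(LINT s:{..0}|lborel. exp s * snd (\<omega> (t + s))) = exp (- t) * (\<integral>s. indicator {..t} (t + 1 * s) *\<^sub>R f (t + 1 * s) \<partial>lborel)"
      unfolding set_lebesgue_integral_def tr by (rule integral_mult_right_zero)
    also have "(\<integral>s. indicator {..t} (t + 1 * s) *\<^sub>R f (t + 1 * s) \<partial>lborel) = H t"
      unfolding H_def set_lebesgue_integral_def
      using lborel_integral_real_affine[of 1 "\<lambda>r. indicator {..t} r *\<^sub>R f r" t] by simp
    finally have i3: "(LINT s:{..0}|lborel. exp s * snd (\<omega> (t + s))) = exp (- t) * H t" .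
    have "ou_process \<omega> t = - (LINT s:{..0}|lborel. exp s * snd (\<omega> (t + s)) - snd (\<omega> t) * exp s)"
      unfolding ou_process_def shift_def by (simp add: algebra_simps)
    also have "\<dots> = - (exp (- t) * H t - snd (\<omega> t) * 1)"
      using i2 e by (subst set_integral_diff) (auto simp: i3 set_integral_exp_neg)
    finally show ?thesis by simp
  qed
  have d: "((\<lambda>t. exp (- t) * H t) has_real_derivative ou_process \<omega> t) (at t)" for t
    unfolding z by (auto intro!: derivative_eq_intros Hd simp: f_def exp_minus field_simps)
  then show "((\<lambda>t. snd (\<omega> t) - ou_process \<omega> t) has_real_derivative ou_process \<omega> t) (at t)"
    by (simp add: z)
  have "continuous_on UNIV (\<lambda>t. exp (- t) * H t)"
    using d by (intro continuous_at_imp_continuous_on) (auto intro: DERIV_isCont)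
  then have "continuous_on UNIV (\<lambda>t. snd (\<omega> t) - exp (- t) * H t)" by (intro continuous_on_diff cb)
  then show "continuous_on UNIV (ou_process \<omega>)" by (simp add: z[abs_def])
qed

lemma ou_process_shift: "ou_process (shift T \<omega>) t = ou_process \<omega> (T + t)"
  by (simp add: ou_process_def shift_def add.assoc)

section \<open>Smooth functions\<close>

lemma Ck_on_SucI:
  assumes "\<And>x. (f has_derivative f' x) (at x)" "\<And>v. Ck_on k UNIV (\<lambda>x. f' x v)"
  shows "Ck_on (Suc k) UNIV f"
proof -
  have "frechet_derivative f (at x) = f' x" for x
    using frechet_derivative_at[OF assms(1)[of x]] by simp
  then show ?thesis using assms by (auto simp: differentiable_def)
qed

lemma Ck_on_SucD:
  assumes "Ck_on (Suc k) UNIV f"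
  shows "(f has_derivative frechet_derivative f (at x)) (at x)" "Ck_on k UNIV (\<lambda>x. frechet_derivative f (at x) v)"
  using assms by (auto simp: frechet_derivative_works)

lemma Ck_on_Suc_imp: "Ck_on (Suc k) UNIV f \<Longrightarrow> Ck_on k UNIV f"
proof (induction k arbitrary: f)
  case 0
  then show ?case
    by (auto intro!: continuous_at_imp_continuous_on differentiable_imp_continuous_within)
next
  case (Suc k)
  show ?case
    by (rule Ck_on_SucI[OF Ck_on_SucD(1)[OF Suc.prems]]) (rule Suc.IH[OF Ck_on_SucD(2)[OF Suc.prems]])
qed

lemma Ck_on_const: "Ck_on k UNIV (\<lambda>_. c)"
proof (induction k arbitrary: c)
  case (Suc k)
  show ?case by (rule Ck_on_SucI[where f' = "\<lambda>_ _. 0"]) (auto intro: Suc)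
qed auto

lemma Ck_on_inner: "Ck_on k UNIV (\<lambda>x. x \<bullet> w)"
proof (cases k)
  case (Suc n)
  show ?thesis unfolding Suc
    by (rule Ck_on_SucI[where f' = "\<lambda>_ v. v \<bullet> w"]) (auto intro!: derivative_eq_intros Ck_on_const)
qed (auto intro!: continuous_intros)

lemma Ck_on_add: "Ck_on k UNIV f \<Longrightarrow> Ck_on k UNIV g \<Longrightarrow> Ck_on k UNIV (\<lambda>x. f x + g x)"
proof (induction k arbitrary: f g)
  case (Suc k)
  show ?case
    by (rule Ck_on_SucI[OF has_derivative_add[OF Ck_on_SucD(1)[OF Suc.prems(1)] Ck_on_SucD(1)[OF Suc.prems(2)]]])
      (intro Suc.IH Ck_on_SucD(2) Suc.prems)
qed (auto intro!: continuous_intros)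

lemma Ck_on_mult: "Ck_on k UNIV f \<Longrightarrow> Ck_on k UNIV g \<Longrightarrow> Ck_on k UNIV (\<lambda>x. f x * g x)"
proof (induction k arbitrary: f g)
  case (Suc k)
  show ?case
    by (rule Ck_on_SucI[OF has_derivative_mult[OF Ck_on_SucD(1)[OF Suc.prems(1)] Ck_on_SucD(1)[OF Suc.prems(2)]]])
      (intro Ck_on_add Suc.IH Ck_on_SucD(2) Suc.prems Ck_on_Suc_imp)
qed (auto intro!: continuous_intros)

lemma Ck_on_prod: "(\<And>i. i \<in> I \<Longrightarrow> Ck_on k UNIV (f i)) \<Longrightarrow> Ck_on k UNIV (\<lambda>x. \<Prod>i\<in>I. f i x)"
  by (induction I rule: infinite_finite_induct) (auto intro: Ck_on_const Ck_on_mult)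

lemma Ck_on_sum: "(\<And>i. i \<in> I \<Longrightarrow> Ck_on k UNIV (f i)) \<Longrightarrow> Ck_on k UNIV (\<lambda>x. \<Sum>i\<in>I. f i x)"
  by (induction I rule: infinite_finite_induct) (auto intro: Ck_on_const Ck_on_add)

lemma Ck_on_affine: "Ck_on k UNIV (\<lambda>x. (x - c) \<bullet> w)"
  using Ck_on_add[OF Ck_on_inner[of k w] Ck_on_const[of k "- (c \<bullet> w)"]] by (simp add: inner_diff_left)

lemma Ck_on_norm_sq: "Ck_on k UNIV (\<lambda>x. (x - c) \<bullet> (x - c))"
proof -
  have "Ck_on k UNIV (\<lambda>x. \<Sum>b\<in>Basis. ((x - c) \<bullet> b) * ((x - c) \<bullet> b))"
    by (intro Ck_on_sum Ck_on_mult Ck_on_affine)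
  then show ?thesis by (simp add: euclidean_inner[symmetric])
qed

text \<open>Induction on \<open>k\<close> for all exponents at once, as differentiation lowers the
  exponent.\<close>

lemma Ck_on_powr:
  assumes m: "\<And>k. Ck_on k UNIV m" and pos: "\<And>x. 0 < m x"
  shows "Ck_on k UNIV (\<lambda>x. m x powr r)"
proof (induction k arbitrary: r)
  case 0
  then show ?case using m[of 0] pos by (auto intro!: continuous_intros simp: less_imp_neq[symmetric])
next
  case (Suc k)
  show ?case
  proof (rule Ck_on_SucI)
    fix x
    have "((\<lambda>y. y powr r) has_real_derivative r * m x powr (r - 1)) (at (m x))"
      using has_real_derivative_powr[OF pos] by simp
    then show "((\<lambda>x. m x powr r) has_derivative (\<lambda>v. r * m x powr (r - 1) * frechet_derivative m (at x) v)) (at x)"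
      using Ck_on_SucD(1)[OF m[of "Suc 0"]] by (intro has_derivative_compose[of m, unfolded o_def, where g = "\<lambda>y. y powr r", simplified] ) 
        (auto simp: has_field_derivative_def)
  next
    fix v
    show "Ck_on k UNIV (\<lambda>x. r * m x powr (r - 1) * frechet_derivative m (at x) v)"
      by (intro Ck_on_mult Ck_on_const Suc.IH Ck_on_SucD(2) m)
  qed
qed

text \<open>Smooth in \<open>y\<close>, with limit \<open>max 0 y powr r\<close> as \<open>a\<close> tends to 0.\<close>

definition flat :: "real \<Rightarrow> real \<Rightarrow> real \<Rightarrow> real" where
  "flat a r y = (if 0 < y then y powr r * exp (- a / y) else 0)"

lemma flat_tendsto_0:
  assumes "0 < a"
  shows "(flat a r \<longlongrightarrow> 0) (at 0)"
proof -
  have "((\<lambda>y. y powr r * exp (- a / y)) \<longlongrightarrow> 0) (at_right 0)"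
    using assms by real_asymp
  then have "(flat a r \<longlongrightarrow> 0) (at_right 0)"
    by (rule Lim_transform_eventually) (auto simp: flat_def eventually_at_right_less eventually_at intro!: exI[of _ 1])
  moreover have "(flat a r \<longlongrightarrow> 0) (at_left 0)"
    by (rule tendsto_eventually) (auto simp: flat_def eventually_at intro!: exI[of _ 1])
  ultimately show ?thesis by (simp add: filterlim_split_at_real filterlim_split_at)
qed

text \<open>Over all real \<open>r\<close>, of either sign, the functions \<open>flat a r\<close>
  are closed under differentiation up to linear combinations; this drives the induction for
  smoothness. At 0 the difference quotient is \<open>flat a (r - 1)\<close>, which tends to
  0.\<close>

lemma flat_has_derivative:
  assumes a: "0 < a"
  shows "(flat a r has_real_derivative r * flat a (r - 1) y + a * flat a (r - 2) y) (at y)"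
proof -
  consider "0 < y" | "y < 0" | "y = 0" by linarith
  then show ?thesis
  proof cases
    case 1
    have "((\<lambda>y. y powr r * exp (- a / y)) has_real_derivative r * flat a (r - 1) y + a * flat a (r - 2) y) (at y)"
      using 1 by (auto intro!: derivative_eq_intros simp: flat_def powr_diff power2_eq_square field_simps)
    then show ?thesis
      by (rule has_field_derivative_transform_within_open[where S = "{0<..}"]) (use 1 in \<open>auto simp: flat_def\<close>)
  next
    case 2
    have "((\<lambda>_. 0) has_real_derivative 0) (at y)" by simp
    then have "(flat a r has_real_derivative 0) (at y)"
      by (rule has_field_derivative_transform_within_open[where S = "{..<0}"]) (use 2 in \<open>auto simp: flat_def\<close>)
    then show ?thesis using 2 by (simp add: flat_def)
  next
    case 3
    have "((\<lambda>h. (flat a r (0 + h) - flat a r 0) / h) \<longlongrightarrow> 0) (at 0)"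
    proof (rule Lim_transform_eventually[OF flat_tendsto_0[OF a, of "r - 1"]])
      show "\<forall>\<^sub>F h in at 0. flat a (r - 1) h = (flat a r (0 + h) - flat a r 0) / h"
        by (auto simp: flat_def eventually_at powr_diff intro!: exI[of _ 1])
    qed
    then show ?thesis unfolding 3 DERIV_def by (simp add: flat_def)
  qed
qed

lemma Ck_on_flat:
  assumes m: "\<And>k. Ck_on k UNIV m" and a: "0 < a"
  shows "Ck_on k UNIV (\<lambda>x. flat a r (m x))"
proof (induction k arbitrary: r)
  case 0
  have "continuous_on UNIV (flat a r)"
    using flat_has_derivative[OF a] by (intro continuous_at_imp_continuous_on) (auto intro: DERIV_isCont)
  then show ?case using m[of 0] continuous_on_compose2[of UNIV "flat a r" UNIV m] by auto
next
  case (Suc k)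
  show ?case
  proof (rule Ck_on_SucI)
    fix x
    show "((\<lambda>x. flat a r (m x)) has_derivative (\<lambda>v. (r * flat a (r - 1) (m x) + a * flat a (r - 2) (m x)) * frechet_derivative m (at x) v)) (at x)"
      using has_derivative_compose[OF Ck_on_SucD(1)[OF m[of "Suc 0"]], of "flat a r"] flat_has_derivative[OF a]
      by (simp add: has_field_derivative_def)
  next
    fix v
    show "Ck_on k UNIV (\<lambda>x. (r * flat a (r - 1) (m x) + a * flat a (r - 2) (m x)) * frechet_derivative m (at x) v)"
      by (intro Ck_on_mult Ck_on_add Ck_on_const Suc.IH Ck_on_SucD(2) m)
  qed
qed

lemma gradient_inner:
  assumes "(f has_derivative f') (at x)"
  shows "gradient f x \<bullet> v = f' v"
proof -
  have f': "frechet_derivative f (at x) = f'" using frechet_derivative_at[OF assms] by simp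
  interpret linear f' using assms by (rule has_derivative_linear)
  have "gradient f x \<bullet> v = (\<Sum>b\<in>Basis. (v \<bullet> b) * f' b)"
    unfolding gradient_def f' inner_sum_left by (intro sum.cong) (auto simp: inner_commute)
  also have "\<dots> = f' (\<Sum>b\<in>Basis. (v \<bullet> b) *\<^sub>R b)" by (simp add: sum scale)
  finally show ?thesis by (simp add: euclidean_representation)
qed

lemma smooth_on_has_derivative:
  assumes "smooth_on UNIV f"
  shows "(f has_derivative (\<lambda>v. gradient f x \<bullet> v)) (at x)"
proof -
  have d: "(f has_derivative frechet_derivative f (at x)) (at x)"
    using assms Ck_on_SucD(1)[of 0 f x] by (auto simp: smooth_on_def simp del: Ck_on.simps)
  show ?thesis using d gradient_inner[OF d] by simp
qed

lemma smooth_on_continuous_gradient: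
  assumes "smooth_on UNIV f"
  shows "continuous_on UNIV (gradient f)"
proof -
  have "Ck_on (Suc 0) UNIV f" using assms by (simp add: smooth_on_def del: Ck_on.simps)
  from Ck_on_SucD(2)[OF this] show ?thesis
    unfolding gradient_def by (intro continuous_intros) simp
qed


section \<open>Integration by parts\<close>

text \<open>The class of the explicit solutions, which need not be smooth and so are no test
  functions. The gradient is an explicit argument because \<open>weak_gradient\<close> is only a
  choice.\<close>

definition C1_supported :: "'a::euclidean_space set \<Rightarrow> ('a \<Rightarrow> real) \<Rightarrow> ('a \<Rightarrow> 'a) \<Rightarrow> bool" where
  "C1_supported D u G \<longleftrightarrow> (\<forall>x. (u has_derivative (\<lambda>v. G x \<bullet> v)) (at x)) \<and> continuous_on UNIV G \<and>
     (\<exists>K. compact K \<and> K \<subseteq> D \<and> (\<forall>x. x \<notin> K \<longrightarrow> u x = 0 \<and> G x = 0))"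

lemma C1_supported_continuous: "C1_supported D u G \<Longrightarrow> continuous_on UNIV u"
  unfolding C1_supported_def
  by (auto intro!: continuous_at_imp_continuous_on intro: has_derivative_continuous)

lemma C1_supported_outside: "C1_supported D u G \<Longrightarrow> x \<notin> D \<Longrightarrow> u x = 0 \<and> G x = 0"
  by (auto simp: C1_supported_def)

lemma derivative_zero_outside:
  fixes u :: "'a::euclidean_space \<Rightarrow> real"
  assumes "(u has_derivative (\<lambda>v. g \<bullet> v)) (at x)" "closed K" "x \<notin> K" "\<And>x. x \<notin> K \<Longrightarrow> u x = 0"
  shows "g = 0"
proof -
  have "((\<lambda>_. 0) has_derivative (\<lambda>v. g \<bullet> v)) (at x)"
    by (rule has_derivative_transform_within_open[OF assms(1), where s = "- K"]) (use assms in auto)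
  then have "(\<lambda>v. g \<bullet> v) = (\<lambda>_. 0)"
    using has_derivative_unique has_derivative_const by blast
  then have "g \<bullet> g = 0" by metis
  then show ?thesis by simp
qed

lemma test_function_C1_supported:
  assumes "test_function D \<psi>"
  shows "C1_supported D \<psi> (gradient \<psi>)"
proof -
  have s: "smooth_on UNIV \<psi>" using assms by (simp add: test_function_def)
  obtain K where K: "compact K" "K \<subseteq> D" "\<And>x. x \<notin> K \<Longrightarrow> \<psi> x = 0"
    using assms by (auto simp: test_function_def)
  have "gradient \<psi> x = 0" if "x \<notin> K" for x
    using derivative_zero_outside[OF smooth_on_has_derivative[OF s] compact_imp_closed[OF K(1)] that] K by auto
  then show ?thesis
    using s K unfolding C1_supported_def
    by (auto intro!: smooth_on_has_derivative smooth_on_continuous_gradient exI[of _ K])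
qed

lemma C1_supported_mult:
  assumes "C1_supported D u G" "C1_supported D v H"
  shows "C1_supported D (\<lambda>x. u x * v x) (\<lambda>x. u x *\<^sub>R H x + v x *\<^sub>R G x)"
proof -
  obtain K where K: "compact K" "K \<subseteq> D" "\<And>x. x \<notin> K \<Longrightarrow> u x = 0 \<and> G x = 0"
    using assms by (auto simp: C1_supported_def)
  have "((\<lambda>x. u x * v x) has_derivative (\<lambda>w. (u x *\<^sub>R H x + v x *\<^sub>R G x) \<bullet> w)) (at x)" for x
  proof -
    have "(u has_derivative (\<lambda>w. G x \<bullet> w)) (at x)" "(v has_derivative (\<lambda>w. H x \<bullet> w)) (at x)"
      using assms by (auto simp: C1_supported_def)
    from has_derivative_mult[OF this] show ?thesis by (simp add: inner_add_left mult.commute)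
  qed
  moreover have "continuous_on UNIV (\<lambda>x. u x *\<^sub>R H x + v x *\<^sub>R G x)"
    using C1_supported_continuous[OF assms(1)] C1_supported_continuous[OF assms(2)] assms
    by (intro continuous_intros) (auto simp: C1_supported_def)
  ultimately show ?thesis
    unfolding C1_supported_def using K by (auto intro!: exI[of _ K])
qed

lemma integrable_compact_support:
  fixes f :: "'a::euclidean_space \<Rightarrow> 'b::euclidean_space"
  assumes "continuous_on UNIV f" "compact K" "\<And>x. x \<notin> K \<Longrightarrow> f x = 0"
  shows "integrable lborel f"
proof -
  have "integrable lborel (\<lambda>x. indicator K x *\<^sub>R f x)"
    by (rule borel_integrable_compact) (use assms in \<open>auto intro: continuous_on_subset\<close>)
  also have "(\<lambda>x. indicator K x *\<^sub>R f x) = f"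
    using assms(3) by (auto simp: indicator_def)
  finally show ?thesis .
qed

lemma lborel_integral_translate:
  fixes f :: "'a::euclidean_space \<Rightarrow> real"
  assumes "f \<in> borel_measurable borel"
  shows "(\<integral>x. f (x + c) \<partial>lborel) = (\<integral>x. f x \<partial>lborel)"
proof -
  have "(\<integral>x. f x \<partial>lborel) = (\<integral>x. f x \<partial>distr lborel borel ((+) c))" by (simp add: lborel_distr_plus)
  also have "\<dots> = (\<integral>x. f (c + x) \<partial>lborel)" using assms by (subst integral_distr) auto
  finally show ?thesis by (simp add: add.commute)
qed

lemma lborel_integrable_translate:
  fixes f :: "'a::euclidean_space \<Rightarrow> real"
  assumes "integrable lborel f"
  shows "integrable lborel (\<lambda>x. f (x + c))"
proof -
  have "integrable (distr lborel borel ((+) c)) f" using assms by (simp add: lborel_distr_plus)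
  then show ?thesis by (subst (asm) integrable_distr_eq) (use assms in \<open>auto simp: add.commute\<close>)
qed

text \<open>Translation invariance makes the difference quotients integrate to zero.\<close>

lemma integral_derivative_zero:
  fixes f :: "'a::euclidean_space \<Rightarrow> real"
  assumes f: "C1_supported UNIV f G"
  shows "(\<integral>x. G x \<bullet> b \<partial>lborel) = 0"
proof -
  obtain K where K: "compact K" "\<And>x. x \<notin> K \<Longrightarrow> f x = 0 \<and> G x = 0"
    and d: "\<And>x. (f has_derivative (\<lambda>v. G x \<bullet> v)) (at x)" and Gc: "continuous_on UNIV G"
    using f by (auto simp: C1_supported_def)
  have fc: "continuous_on UNIV f" by (rule C1_supported_continuous[OF f])
  have fi: "integrable lborel f" by (rule integrable_compact_support[OF fc K(1)]) (use K in auto)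
  obtain R where R: "\<And>x. x \<in> K \<Longrightarrow> norm x \<le> R"
    using compact_imp_bounded[OF K(1)] by (auto simp: bounded_iff)
  have "bounded (G ` K)" using Gc K(1) by (intro compact_imp_bounded compact_continuous_image) (auto intro: continuous_on_subset)
  then obtain M0 where M0: "\<And>x. x \<in> K \<Longrightarrow> norm (G x) \<le> M0" by (auto simp: bounded_iff)
  define M where "M = max 0 M0"
  have M: "norm (G x) \<le> M" "0 \<le> M" for x using M0[of x] K(2)[of x] by (cases "x \<in> K"; auto simp: M_def)+
  define h where "h n = inverse (real (Suc n))" for n
  have h: "0 < h n" "h n \<le> 1" for n by (auto simp: h_def field_simps)
  define q where "q n x = (f (x + h n *\<^sub>R b) - f x) / h n" for n x
  have bd: "\<bar>q n x\<bar> \<le> M * norm b" for n x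
  proof -
    have "\<exists>t\<in>{0<..<h n}. (\<lambda>t. f (x + t *\<^sub>R b)) (h n) - (\<lambda>t. f (x + t *\<^sub>R b)) 0 = (*) (G (x + t *\<^sub>R b) \<bullet> b) (h n - 0)"
    proof (rule mvt_simple[OF h(1)])
      fix t assume "0 \<le> t" "t \<le> h n"
      have "((\<lambda>t. x + t *\<^sub>R b) has_derivative (\<lambda>s. s *\<^sub>R b)) (at t within {0..h n})"
        by (auto intro!: derivative_eq_intros)
      from has_derivative_compose[OF this d]
      show "((\<lambda>t. f (x + t *\<^sub>R b)) has_derivative (*) (G (x + t *\<^sub>R b) \<bullet> b)) (at t within {0..h n})"
        by (rule has_derivative_eq_rhs) (simp add: fun_eq_iff mult.commute)
    qed
    then obtain t where "f (x + h n *\<^sub>R b) - f x = (G (x + t *\<^sub>R b) \<bullet> b) * h n" by auto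
    then have "q n x = G (x + t *\<^sub>R b) \<bullet> b" using h(1)[of n] by (simp add: q_def)
    then show ?thesis
      using Cauchy_Schwarz_ineq2[of "G (x + t *\<^sub>R b)" b] mult_right_mono[OF M(1)[of "x + t *\<^sub>R b"], of "norm b"] by simp
  qed
  \<comment> \<open>The translations have length at most \<open>norm b\<close>, so all difference
    quotients vanish outside one ball; the mean value theorem bounds them there.\<close>
  have "(\<lambda>n. \<integral>x. q n x \<partial>lborel) \<longlonglongrightarrow> (\<integral>x. G x \<bullet> b \<partial>lborel)"
  proof (rule integral_dominated_convergence[where w = "\<lambda>x. M * norm b * indicator (cball 0 (R + norm b)) x"])
    show "integrable lborel (\<lambda>x. M * norm b * indicator (cball 0 (R + norm b)) x :: real)"
      by (intro integrable_mult_right integrable_real_indicator emeasure_bounded_finite) auto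
    show "AE x in lborel. norm (q n x) \<le> M * norm b * indicator (cball 0 (R + norm b)) x" for n
    proof (rule AE_I2)
      fix x
      show "norm (q n x) \<le> M * norm b * indicator (cball 0 (R + norm b)) x"
      proof (cases "x \<in> cball 0 (R + norm b)")
        case False
        then have nx: "norm x > R + norm b" by simp
        have "h n * norm b \<le> norm b" using h(1,2)[of n] by (simp add: mult_left_le_one_le)
        then have "norm (x + h n *\<^sub>R b) > R"
          using nx norm_triangle_ineq4[of "x + h n *\<^sub>R b" "h n *\<^sub>R b"] h(1)[of n] by simp
        then have "x + h n *\<^sub>R b \<notin> K" "x \<notin> K" using R nx norm_ge_zero[of b] by (force, fastforce)
        then show ?thesis using K(2) M(2) by (simp add: q_def)
      qed (use bd in simp)
    qed
    show "AE x in lborel. (\<lambda>n. q n x) \<longlonglongrightarrow> G x \<bullet> b"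
    proof (rule AE_I2)
      fix x
      have "((\<lambda>t. x + t *\<^sub>R b) has_derivative (\<lambda>s. s *\<^sub>R b)) (at 0)"
        by (auto intro!: derivative_eq_intros)
      then have "((\<lambda>t. f (x + t *\<^sub>R b)) has_derivative (\<lambda>s. G x \<bullet> (s *\<^sub>R b))) (at 0)"
        by (rule has_derivative_compose) (use d[of x] in simp)
      then have "((\<lambda>t. f (x + t *\<^sub>R b)) has_real_derivative G x \<bullet> b) (at 0)"
        unfolding has_field_derivative_def
        by (rule has_derivative_eq_rhs) (simp add: fun_eq_iff mult.commute)
      then have "((\<lambda>t. (f (x + t *\<^sub>R b) - f x) / t) \<longlongrightarrow> G x \<bullet> b) (at 0)"
        by (simp add: DERIV_def)
      moreover have "filterlim h (at 0) sequentially"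
        unfolding filterlim_at using LIMSEQ_inverse_real_of_nat h by (auto simp: h_def[abs_def])
      ultimately show "(\<lambda>n. q n x) \<longlonglongrightarrow> G x \<bullet> b"
        unfolding q_def by (rule filterlim_compose)
    qed
    show "(\<lambda>x. G x \<bullet> b) \<in> borel_measurable lborel"
      using borel_measurable_continuous_onI[OF Gc] by simp
    show "q n \<in> borel_measurable lborel" for n
      unfolding q_def using fc by (intro borel_measurable_divide borel_measurable_diff borel_measurable_const)
        (auto intro!: borel_measurable_continuous_onI continuous_intros intro: continuous_on_compose2[of UNIV f])
  qed
  moreover have "(\<integral>x. q n x \<partial>lborel) = 0" for n
  proof -
    have "(\<integral>x. q n x \<partial>lborel) = ((\<integral>x. f (x + h n *\<^sub>R b) \<partial>lborel) - (\<integral>x. f x \<partial>lborel)) / h n"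
      unfolding q_def using fi lborel_integrable_translate[OF fi] by simp
    then show ?thesis using lborel_integral_translate[of f] fc by (simp add: borel_measurable_continuous_onI)
  qed
  ultimately have "(\<lambda>n. 0) \<longlonglongrightarrow> (\<integral>x. G x \<bullet> b \<partial>lborel)" by simp
  from LIMSEQ_unique[OF tendsto_const this] show ?thesis by simp
qed

lemma integral_lebesgue_on:
  fixes f :: "'a::euclidean_space \<Rightarrow> 'b::euclidean_space"
  assumes "D \<in> sets lebesgue" "\<And>x. x \<notin> D \<Longrightarrow> f x = 0" "f \<in> borel_measurable borel"
  shows "(\<integral>x. f x \<partial>lebesgue_on D) = (\<integral>x. f x \<partial>lborel)"
proof -
  have "(\<integral>x. f x \<partial>lebesgue_on D) = (\<integral>x. indicator D x *\<^sub>R f x \<partial>lebesgue)"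
    using assms by (subst integral_restrict_space) auto
  also have "(\<lambda>x. indicator D x *\<^sub>R f x) = f" using assms(2) by (auto simp: indicator_def)
  also have "(\<integral>x. f x \<partial>lebesgue) = (\<integral>x. f x \<partial>lborel)"
    using assms by (intro integral_completion) auto
  finally show ?thesis .
qed

text \<open>The product with a test function is again of this class, and the integral of its
  derivative vanishes.\<close>

lemma C1_supported_weak_gradient:
  assumes D: "D \<in> sets lebesgue" and u: "C1_supported D u G"
  shows "is_weak_gradient D u G"
  unfolding is_weak_gradient_def
proof (intro allI impI ballI)
  fix \<psi> b assume "test_function D \<psi>" "b \<in> (Basis :: 'a set)"
  then have p: "C1_supported D \<psi> (gradient \<psi>)" by (simp add: test_function_C1_supported)
  note m = C1_supported_mult[OF u p]
  have cu: "continuous_on UNIV u" "continuous_on UNIV \<psi>" "continuous_on UNIV G" "continuous_on UNIV (gradient \<psi>)"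
    using C1_supported_continuous[OF u] C1_supported_continuous[OF p] u p by (auto simp: C1_supported_def)
  have [measurable]: "u \<in> borel_measurable borel" "\<psi> \<in> borel_measurable borel" "G \<in> borel_measurable borel" "gradient \<psi> \<in> borel_measurable borel"
    using cu by (auto intro: borel_measurable_continuous_onI)
  obtain K where K: "compact K" "\<And>x. x \<notin> K \<Longrightarrow> u x = 0 \<and> G x = 0" using u by (auto simp: C1_supported_def)
  have i: "integrable lborel (\<lambda>x. u x * (gradient \<psi> x \<bullet> b))" "integrable lborel (\<lambda>x. (G x \<bullet> b) * \<psi> x)"
    by (rule integrable_compact_support[OF _ K(1)], (intro continuous_intros cu), use K in auto)+
  have "C1_supported UNIV (\<lambda>x. u x * \<psi> x) (\<lambda>x. u x *\<^sub>R gradient \<psi> x + \<psi> x *\<^sub>R G x)"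
    using m unfolding C1_supported_def by blast
  from integral_derivative_zero[OF this, of b]
  have "(\<integral>x. u x * (gradient \<psi> x \<bullet> b) + (G x \<bullet> b) * \<psi> x \<partial>lborel) = 0"
    by (simp add: inner_add_left mult.commute)
  then have "(\<integral>x. u x * (gradient \<psi> x \<bullet> b) \<partial>lborel) = - (\<integral>x. (G x \<bullet> b) * \<psi> x \<partial>lborel)"
    using i by simp
  moreover have "(\<integral>x. u x * (gradient \<psi> x \<bullet> b) \<partial>lebesgue_on D) = (\<integral>x. u x * (gradient \<psi> x \<bullet> b) \<partial>lborel)"
    "(\<integral>x. (G x \<bullet> b) * \<psi> x \<partial>lebesgue_on D) = (\<integral>x. (G x \<bullet> b) * \<psi> x \<partial>lborel)"
    using C1_supported_outside[OF u] by (auto intro!: integral_lebesgue_on D)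
  ultimately show "(\<integral>x. u x * (gradient \<psi> x \<bullet> b) \<partial>lebesgue_on D) = - (\<integral>x. (G x \<bullet> b) * \<psi> x \<partial>lebesgue_on D)"
    by simp
qed


section \<open>The fundamental lemma of the calculus of variations\<close>

text \<open>The positive and the negative part of \<open>F\<close> define finite measures that agree
  on boxes, an intersection-stable generator, hence on all Borel sets. On the set where
  \<open>F\<close> is positive one of them vanishes, so the other does.\<close>

lemma AE_zero_if_box_integrals_zero:
  fixes F :: "'a::euclidean_space \<Rightarrow> real"
  assumes F: "integrable lebesgue F" and z: "\<And>a b. (\<integral>x. F x * indicator (box a b) x \<partial>lebesgue) = 0"
  shows "AE x in lebesgue. F x = 0"
proof -
  have [measurable]: "F \<in> borel_measurable lebesgue" using F by auto
  \<comment> \<open>Pushed forward to the Borel sets, since boxes generate these and not the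
    Lebesgue sets. For the same reason the set of positivity is later replaced by a Borel set up to
    a null set.\<close>
  define \<mu> where "\<mu> G = distr (density lebesgue (\<lambda>x. ennreal (G x))) borel (\<lambda>x. x)" for G :: "'a \<Rightarrow> real"
  have em: "emeasure (\<mu> G) A = (\<integral>\<^sup>+x. ennreal (G x) * indicator A x \<partial>lebesgue)"
    if "G \<in> borel_measurable lebesgue" "A \<in> sets borel" for G A
  proof -
    have "(\<lambda>x::'a. x) \<in> borel_measurable lebesgue" by (intro measurable_completion) simp
    then show ?thesis
      unfolding \<mu>_def using that by (subst emeasure_distr) (auto simp: emeasure_density)
  qed
  have fin: "(\<integral>\<^sup>+x. ennreal (G x) * indicator A x \<partial>lebesgue) < \<infinity>" if "integrable lebesgue G" for G :: "'a \<Rightarrow> real" and A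
  proof -
    have "(\<integral>\<^sup>+x. ennreal (G x) * indicator A x \<partial>lebesgue) \<le> (\<integral>\<^sup>+x. ennreal (norm (G x)) \<partial>lebesgue)"
      by (intro nn_integral_mono) (auto simp: indicator_def intro!: ennreal_leI)
    also have "\<dots> < \<infinity>" using that by (simp add: integrable_iff_bounded)
    finally show ?thesis .
  qed
  have eq: "\<mu> F = \<mu> (\<lambda>x. - F x)"
  proof (rule measure_eqI_generator_eq)
    let ?E = "range (\<lambda>(a::'a, b). box a b)"
    show "Int_stable ?E"
      by (auto simp: Int_stable_def box_Int_box intro!: rev_image_eqI)
    show "sets (\<mu> F) = sigma_sets UNIV ?E" "sets (\<mu> (\<lambda>x. - F x)) = sigma_sets UNIV ?E"
      unfolding \<mu>_def by (simp_all add: borel_eq_box)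
    show "emeasure (\<mu> F) X = emeasure (\<mu> (\<lambda>x. - F x)) X" if "X \<in> ?E" for X
    proof -
      from that obtain a b where X: "X = box a b" by auto
      have i: "integrable lebesgue (\<lambda>x. F x * indicator X x)"
        unfolding X using integrable_mult_indicator[of "box a b" lebesgue F] F by (simp add: mult.commute)
      have "enn2real (\<integral>\<^sup>+x. ennreal (F x * indicator X x) \<partial>lebesgue) - enn2real (\<integral>\<^sup>+x. ennreal (- (F x * indicator X x)) \<partial>lebesgue) = 0"
        using real_lebesgue_integral_def[OF i] z[of a b] X by simp
      moreover have "ennreal (F x * indicator X x) = ennreal (F x) * indicator X x" 
        "ennreal (- (F x * indicator X x)) = ennreal (- F x) * indicator X x" for x
        by (auto simp: indicator_def)
      ultimately have e: "enn2real (\<integral>\<^sup>+x. ennreal (F x) * indicator X x \<partial>lebesgue) = enn2real (\<integral>\<^sup>+x. ennreal (- F x) * indicator X x \<partial>lebesgue)"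
        by simp
      have Xb: "X \<in> sets borel" unfolding X by simp
      have "emeasure (\<mu> F) X = ennreal (enn2real (\<integral>\<^sup>+x. ennreal (F x) * indicator X x \<partial>lebesgue))"
        using em[OF _ Xb, of F] fin[OF F, of X] by simp
      also have "\<dots> = ennreal (enn2real (\<integral>\<^sup>+x. ennreal (- F x) * indicator X x \<partial>lebesgue))"
        by (simp only: e)
      also have "\<dots> = emeasure (\<mu> (\<lambda>x. - F x)) X"
        using em[OF _ Xb, of "\<lambda>x. - F x"] fin[of "\<lambda>x. - F x" X] F by simp
      finally show ?thesis .
    qed
    show "range (\<lambda>n::nat. box (- real n *\<^sub>R One) (real n *\<^sub>R One)) \<subseteq> ?E" by auto
    show "(\<Union>n::nat. box (- real n *\<^sub>R One) (real n *\<^sub>R One)) = (UNIV :: 'a set)"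
      using UN_box_eq_UNIV by simp
    show "emeasure (\<mu> F) (box (- real n *\<^sub>R One) (real n *\<^sub>R One)) \<noteq> \<infinity>" for n
      using em[of F] fin[of F] F by (simp add: less_top)
  qed simp
  have null: "AE x in lebesgue. \<not> 0 < G x" if G: "integrable lebesgue G" and eqG: "\<mu> G = \<mu> (\<lambda>x. - G x)" for G :: "'a \<Rightarrow> real"
  proof -
    have [measurable]: "G \<in> borel_measurable lebesgue" using G by auto
    have "{x\<in>space lebesgue. 0 < G x} \<in> sets lebesgue" by measurable
    then obtain S N N' where S: "{x. 0 < G x} = S \<union> N" "N \<subseteq> N'" "N' \<in> null_sets lborel" "S \<in> sets borel"
      by (auto elim: sets_completionE)
    have "(\<integral>\<^sup>+x. ennreal (G x) * indicator S x \<partial>lebesgue) = (\<integral>\<^sup>+x. ennreal (- G x) * indicator S x \<partial>lebesgue)"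
      using em[of G S] em[of "\<lambda>x. - G x" S] eqG S(4) by simp
    also have "\<dots> = (\<integral>\<^sup>+x. 0 \<partial>(lebesgue :: 'a measure))"
    proof (intro nn_integral_cong)
      fix x
      have "0 < G x" if "x \<in> S" using S(1) that by auto
      then show "ennreal (- G x) * indicator S x = 0" by (auto simp: indicator_def ennreal_neg)
    qed
    finally have "(\<integral>\<^sup>+x. ennreal (G x) * indicator S x \<partial>lebesgue) = 0" by simp
    moreover have "(\<lambda>x. ennreal (G x) * indicator S x) \<in> borel_measurable lebesgue"
    proof -
      have [measurable]: "S \<in> sets lebesgue" using S(4) by simp
      show ?thesis by measurable
    qed
    ultimately have "AE x in lebesgue. ennreal (G x) * indicator S x = 0"
      by (simp add: nn_integral_0_iff_AE)
    moreover have "AE x in lebesgue. x \<notin> N'"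
      using S(3) by (intro AE_not_in) (auto simp: null_sets_completion_iff null_sets_completionI)
    ultimately show ?thesis
    proof eventually_elim
      fix x assume "ennreal (G x) * indicator S x = 0" "x \<notin> N'"
      then show "\<not> 0 < G x" using S(1,2) by (auto simp: indicator_def split: if_splits)
    qed
  qed
  have "AE x in lebesgue. \<not> 0 < F x" "AE x in lebesgue. \<not> 0 < - F x"
    using null[OF F eq] null[of "\<lambda>x. - F x"] F eq by auto
  then show ?thesis by eventually_elim auto
qed

lemma box_test_function:
  fixes a b :: "'a::euclidean_space"
  assumes "cbox a b \<subseteq> D" and e: "0 < e"
  shows "test_function D (\<lambda>x. \<Prod>i\<in>Basis. flat e 0 ((x - a) \<bullet> i) * flat e 0 (b \<bullet> i + (x - 0) \<bullet> (- i)))"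
  unfolding test_function_def smooth_on_def
proof (intro conjI exI[of _ "cbox a b"] allI impI)
  show "Ck_on k UNIV (\<lambda>x. \<Prod>i\<in>Basis. flat e 0 ((x - a) \<bullet> i) * flat e 0 (b \<bullet> i + (x - 0) \<bullet> (- i)))" for k
    by (intro Ck_on_prod Ck_on_mult Ck_on_flat[OF _ e] Ck_on_affine Ck_on_add Ck_on_const)
  fix x assume "x \<notin> cbox a b"
  then obtain i where "i \<in> Basis" "(x - a) \<bullet> i < 0 \<or> b \<bullet> i + (x - 0) \<bullet> (- i) < 0"
    by (force simp: mem_box inner_diff_left)
  then show "(\<Prod>i\<in>Basis. flat e 0 ((x - a) \<bullet> i) * flat e 0 (b \<bullet> i + (x - 0) \<bullet> (- i))) = 0"
    by (intro prod_zero) (auto simp: flat_def intro!: bexI[of _ i])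
qed (use assms in auto)

text \<open>Products of \<open>flat\<close> in the distances to the faces of a box converge
  boundedly to its indicator as the parameter tends to 0. They are test functions when the closed
  box lies in \<open>D\<close>, and countably many closed boxes cover \<open>D\<close>.\<close>

lemma fundamental_lemma:
  fixes h :: "'a::euclidean_space \<Rightarrow> real"
  assumes D: "open D" and h: "integrable (lebesgue_on D) h"
    and z: "\<And>\<psi>. test_function D \<psi> \<Longrightarrow> (\<integral>x. h x * \<psi> x \<partial>lebesgue_on D) = 0"
  shows "AE x in lebesgue_on D. h x = 0"
proof -
  have Dl [measurable]: "D \<in> sets lebesgue" using D by auto
  have hm [measurable]: "h \<in> borel_measurable (lebesgue_on D)" using h by auto
  have bz: "(\<integral>x. h x * indicator (box a b) x \<partial>lebesgue_on D) = 0" if "cbox a b \<subseteq> D" for a b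
  proof -
    define \<psi> where "\<psi> n x = (\<Prod>i\<in>Basis. flat (inverse (real (Suc n))) 0 ((x - a) \<bullet> i) * flat (inverse (real (Suc n))) 0 (b \<bullet> i + (x - 0) \<bullet> (- i)))"
      for n and x :: 'a
    have t: "test_function D (\<psi> n)" for n
      unfolding \<psi>_def by (rule box_test_function[OF that]) simp
    have f1: "0 \<le> flat (inverse (real (Suc n))) 0 y" "flat (inverse (real (Suc n))) 0 y \<le> 1" for n y
      by (auto simp: flat_def)
    have f2: "(\<lambda>n. flat (inverse (real (Suc n))) 0 y) \<longlonglongrightarrow> indicator {0<..} y" for y :: real
    proof (cases "0 < y")
      case True
      have "(\<lambda>n. exp (- inverse (real (Suc n)) / y)) \<longlonglongrightarrow> exp (- 0 / y)"
        using True by (intro tendsto_intros LIMSEQ_inverse_real_of_nat) auto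
      then show ?thesis using True by (simp add: flat_def)
    qed (simp add: flat_def)
    have lim: "(\<lambda>n. \<psi> n x) \<longlonglongrightarrow> indicator (box a b) x" for x
    proof -
      have "(\<lambda>n. \<psi> n x) \<longlonglongrightarrow> (\<Prod>i\<in>Basis. indicator {0<..} ((x - a) \<bullet> i) * indicator {0<..} (b \<bullet> i + (x - 0) \<bullet> (- i)))"
        unfolding \<psi>_def by (intro tendsto_prod tendsto_mult f2)
      also have "(\<Prod>i\<in>Basis. indicator {0<..} ((x - a) \<bullet> i) * indicator {0<..} (b \<bullet> i + (x - 0) \<bullet> (- i))) = (indicator (box a b) x :: real)"
        by (auto simp: indicator_def mem_box inner_diff_left prod_zero_iff intro!: prod.neutral)
      finally show ?thesis .
    qed
    have p1: "\<bar>\<psi> n x\<bar> \<le> 1" for n x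
      unfolding \<psi>_def abs_prod by (intro prod_le_1) (auto simp: abs_mult f1 simp del: of_nat_Suc intro!: mult_le_one)
    have pm: "\<psi> n \<in> borel_measurable borel" for n
      using C1_supported_continuous[OF test_function_C1_supported[OF t]] by (rule borel_measurable_continuous_onI)
    have "(\<lambda>n. \<integral>x. h x * \<psi> n x \<partial>lebesgue_on D) \<longlonglongrightarrow> (\<integral>x. h x * indicator (box a b) x \<partial>lebesgue_on D)"
    proof (rule integral_dominated_convergence[where w = "\<lambda>x. \<bar>h x\<bar>"])
      show "integrable (lebesgue_on D) (\<lambda>x. \<bar>h x\<bar>)" using h by simp
      show "AE x in lebesgue_on D. (\<lambda>n. h x * \<psi> n x) \<longlonglongrightarrow> h x * indicator (box a b) x"
        by (intro AE_I2 tendsto_intros lim)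
      show "AE x in lebesgue_on D. norm (h x * \<psi> n x) \<le> \<bar>h x\<bar>" for n
        using p1[of n] by (intro AE_I2) (simp add: abs_mult mult_left_le)
      show "(\<lambda>x. h x * \<psi> n x) \<in> borel_measurable (lebesgue_on D)" for n
        by (intro borel_measurable_times hm measurable_restrict_space1 measurable_completion) (use pm in simp)
      show "(\<lambda>x. h x * indicator (box a b) x) \<in> borel_measurable (lebesgue_on D)"
        by (intro borel_measurable_times hm measurable_restrict_space1 measurable_completion) simp
    qed
    then have "(\<lambda>n. 0) \<longlonglongrightarrow> (\<integral>x. h x * indicator (box a b) x \<partial>lebesgue_on D)" by (simp only: z[OF t])
    from LIMSEQ_unique[OF tendsto_const this] show ?thesis by simp
  qed
  have boxAE: "AE x in lebesgue. x \<in> box a b \<longrightarrow> h x = 0" if ab: "cbox a b \<subseteq> D" for a b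
  proof -
    let ?F = "\<lambda>x. indicator D x * h x * indicator (box a b) x"
    have i0: "integrable lebesgue (\<lambda>x. indicator D x * h x)"
      using h by (subst (asm) integrable_restrict_space) auto
    have iF: "integrable lebesgue ?F"
      using integrable_mult_indicator[OF _ i0, of "box a b"] by (simp add: mult.commute)
    have "AE x in lebesgue. ?F x = 0"
    proof (rule AE_zero_if_box_integrals_zero[OF iF])
      fix c d
      \<comment> \<open>Vanishing integrals are known only for boxes inside \<open>D\<close>, but
        required for all: the function is cut off to one such box, and the intersection with any
        other box is a smaller box.\<close>
      define a' where "a' = (\<Sum>i\<in>Basis. max (a \<bullet> i) (c \<bullet> i) *\<^sub>R i)"
      define b' where "b' = (\<Sum>i\<in>Basis. min (b \<bullet> i) (d \<bullet> i) *\<^sub>R i)"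
      have bi: "box a b \<inter> box c d = box a' b'" by (simp add: box_Int_box a'_def b'_def)
      have "(\<integral>x. ?F x * indicator (box c d) x \<partial>lebesgue) = (\<integral>x. indicator D x *\<^sub>R (h x * indicator (box a' b') x) \<partial>lebesgue)"
        unfolding bi[symmetric] by (intro Bochner_Integration.integral_cong) (auto simp: indicator_def)
      also have "\<dots> = (\<integral>x. h x * indicator (box a' b') x \<partial>lebesgue_on D)"
        by (subst integral_restrict_space) auto
      also have "\<dots> = 0"
      proof (cases "box a' b' = {}")
        case False
        have "cbox a' b' \<subseteq> cbox a b" by (auto simp: mem_box a'_def b'_def)
        then show ?thesis using bz ab by blast
      qed simp
      finally show "(\<integral>x. ?F x * indicator (box c d) x \<partial>lebesgue) = 0" .
    qed
    then show ?thesis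
    proof (rule AE_mp, intro AE_I2 impI)
      fix x assume "?F x = 0" "x \<in> box a b"
      moreover have "x \<in> D" using ab box_subset_cbox \<open>x \<in> box a b\<close> by blast
      ultimately show "h x = 0" by simp
    qed
  qed
  obtain \<D> where \<D>: "countable \<D>" "\<And>X. X \<in> \<D> \<Longrightarrow> X \<subseteq> D \<and> (\<exists>a b. X = cbox a b)" "\<Union>\<D> = D"
    using open_countable_Union_open_cbox[OF D] by (metis Pow_iff subsetD)
  have "AE x in lebesgue. x \<in> X \<longrightarrow> h x = 0" if "X \<in> \<D>" for X
  proof -
    from \<D>(2)[OF that] obtain a b where X: "X = cbox a b" "cbox a b \<subseteq> D" by auto
    have "AE x in lebesgue. x \<notin> cbox a b - box a b"
      by (rule AE_not_in) (metis negligible_frontier_interval negligible_iff_null_sets)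
    then show ?thesis using boxAE[OF X(2)] unfolding X by eventually_elim auto
  qed
  then have "AE x in lebesgue. \<forall>X\<in>\<D>. x \<in> X \<longrightarrow> h x = 0"
    by (subst AE_ball_countable[OF \<D>(1)]) blast
  then have "AE x in lebesgue. x \<in> D \<longrightarrow> h x = 0"
    by eventually_elim (use \<D>(3) in auto)
  then show ?thesis by (simp add: AE_restrict_space_iff)
qed

section \<open>Weak gradients\<close>

lemma powr_add_le:
  fixes a b :: "'a::real_normed_vector"
  assumes "0 \<le> p"
  shows "norm (a + b) powr p \<le> 2 powr p * (norm a powr p + norm b powr p)"
proof -
  have "norm (a + b) \<le> 2 * max (norm a) (norm b)"
    using norm_triangle_ineq[of a b] by linarith
  then have "norm (a + b) powr p \<le> (2 * max (norm a) (norm b)) powr p"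
    using assms by (intro powr_mono2) auto
  also have "\<dots> = 2 powr p * max (norm a) (norm b) powr p" by (simp add: powr_mult)
  also have "\<dots> \<le> 2 powr p * (norm a powr p + norm b powr p)"
    by (intro mult_left_mono) (auto simp: max_def)
  finally show ?thesis .
qed

lemma le_one_plus_powr:
  assumes "1 \<le> p" "0 \<le> (y::real)"
  shows "y \<le> 1 + y powr p"
proof (cases "y \<le> 1")
  case True
  then show ?thesis using powr_ge_zero[of y p] by linarith
next
  case False
  then have "y powr 1 \<le> y powr p" using assms by (intro powr_mono) auto
  then show ?thesis using False by simp
qed

locale sobolev =
  fixes D :: "'a::euclidean_space set" and p :: real
  assumes open_D: "open D" and bounded_D: "bounded D" and p1: "1 < p"
begin

abbreviation "L \<equiv> lebesgue_on D"
abbreviation "wg u \<equiv> weak_gradient D p (rep_l2 u)"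

lemma D_sets [measurable, simp]: "D \<in> sets lebesgue" using open_D by auto

lemma D_lmeasurable: "D \<in> lmeasurable" using open_D bounded_D by (simp add: lmeasurable_open)

sublocale finite_measure L
  using D_lmeasurable by (intro finite_measure_lebesgue_on)

lemma borel_L: "f \<in> borel_measurable borel \<Longrightarrow> f \<in> borel_measurable L"
  by (intro measurable_restrict_space1 measurable_completion) simp

lemma lebesgue_L: "f \<in> borel_measurable lebesgue \<Longrightarrow> f \<in> borel_measurable L"
  by (intro measurable_restrict_space1)

lemma rep_L [measurable]: "rep_l2 u \<in> borel_measurable L"
  by (intro lebesgue_L) simp

lemma AE_L:
  assumes "AE x in lebesgue. P x"
  shows "AE x in L. P x"
proof -
  have "AE x in lebesgue. x \<in> D \<longrightarrow> P x" using assms by eventually_elim simp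
  then show ?thesis by (simp add: AE_restrict_space_iff)
qed

lemma in_Lp_measurable [measurable_dest]: "in_Lp D p f \<Longrightarrow> f \<in> borel_measurable L"
  by (simp add: in_Lp_def)

lemma in_Lp_powr_integrable: "in_Lp D p f \<Longrightarrow> integrable L (\<lambda>x. norm (f x) powr p)"
  by (simp add: in_Lp_def)

lemma in_Lp_integrable:
  assumes "in_Lp D p f" shows "integrable L f"
proof (rule Bochner_Integration.integrable_bound[of _ "\<lambda>x. 1 + norm (f x) powr p"])
  show "integrable L (\<lambda>x. 1 + norm (f x) powr p)" using assms by (simp add: in_Lp_def)
  show "AE x in L. norm (f x) \<le> norm (1 + norm (f x) powr p)"
    using le_one_plus_powr[of p] p1 by (intro AE_I2) auto
qed (use assms in \<open>simp add: in_Lp_def\<close>)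

lemma in_Lp_diff:
  assumes "in_Lp D p f" "in_Lp D p g"
  shows "in_Lp D p (\<lambda>x. f x - g x)"
  unfolding in_Lp_def
proof
  show m: "(\<lambda>x. f x - g x) \<in> borel_measurable L"
    using assms by (intro borel_measurable_diff) (auto simp: in_Lp_def)
  show "integrable L (\<lambda>x. norm (f x - g x) powr p)"
  proof (rule Bochner_Integration.integrable_bound[of _ "\<lambda>x. 2 powr p * (norm (f x) powr p + norm (g x) powr p)"])
    show "AE x in L. norm (norm (f x - g x) powr p) \<le> norm (2 powr p * (norm (f x) powr p + norm (g x) powr p))"
      using powr_add_le[of p "f _" "- g _"] p1 by (intro AE_I2) (simp add: abs_mult)
    show "(\<lambda>x. norm (f x - g x) powr p) \<in> borel_measurable L" using m by measurable
  qed (use assms in \<open>simp add: in_Lp_def\<close>)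
qed

lemma in_Lp_bounded:
  assumes "f \<in> borel_measurable L" "\<And>x. norm (f x) \<le> M"
  shows "in_Lp D p f"
  unfolding in_Lp_def
proof
  show "integrable L (\<lambda>x. norm (f x) powr p)"
    by (rule integrable_const_bound[of _ "M powr p"]) (use assms p1 in \<open>auto intro!: powr_mono2\<close>)
qed fact

lemma C1_supported_bounded:
  assumes "C1_supported D u G"
  obtains M where "\<And>x. \<bar>u x\<bar> \<le> M" "\<And>x. norm (G x) \<le> M"
proof -
  obtain K where K: "compact K" "\<And>x. x \<notin> K \<Longrightarrow> u x = 0 \<and> G x = 0" and G: "continuous_on UNIV G"
    using assms by (auto simp: C1_supported_def)
  have "bounded (u ` K)" "bounded (G ` K)"
    using C1_supported_continuous[OF assms] G K(1)
    by (auto intro!: compact_imp_bounded compact_continuous_image intro: continuous_on_subset)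
  then obtain M1 M2 where M: "\<And>x. x \<in> K \<Longrightarrow> \<bar>u x\<bar> \<le> M1" "\<And>x. x \<in> K \<Longrightarrow> norm (G x) \<le> M2"
    by (auto simp: bounded_iff)
  have "\<bar>u x\<bar> \<le> max 0 (max M1 M2)" "norm (G x) \<le> max 0 (max M1 M2)" for x
    using M[of x] K(2)[of x] by (cases "x \<in> K"; force)+
  then show thesis by (rule that)
qed

lemma C1_supported_measurable:
  assumes "C1_supported D u G"
  shows "u \<in> borel_measurable borel" "G \<in> borel_measurable borel"
  using C1_supported_continuous[OF assms] assms
  by (auto simp: C1_supported_def intro: borel_measurable_continuous_onI)

lemma C1_supported_in_Lp:
  assumes "C1_supported D u G"
  shows "in_Lp D p u" "in_Lp D p G"
proof -
  obtain M where "\<And>x. \<bar>u x\<bar> \<le> M" "\<And>x. norm (G x) \<le> M" using C1_supported_bounded[OF assms] by blast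
  then show "in_Lp D p u" "in_Lp D p G"
    using C1_supported_measurable[OF assms] by (auto intro!: in_Lp_bounded borel_L)
qed

lemma integrable_mult_bounded:
  fixes f g :: "'a \<Rightarrow> real"
  assumes "integrable L f" "g \<in> borel_measurable L" "\<And>x. \<bar>g x\<bar> \<le> M"
  shows "integrable L (\<lambda>x. f x * g x)"
proof (rule Bochner_Integration.integrable_bound[of _ "\<lambda>x. M * norm (f x)"])
  show "integrable L (\<lambda>x. M * norm (f x))" using assms by simp
  have "0 \<le> M" using assms(3)[of undefined] by linarith
  then have "\<bar>f x\<bar> * \<bar>g x\<bar> \<le> M * \<bar>f x\<bar>" for x
    using mult_left_mono[OF assms(3)[of x], of "\<bar>f x\<bar>"] by (simp add: mult.commute)
  then show "AE x in L. norm (f x * g x) \<le> norm (M * norm (f x))"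
    using \<open>0 \<le> M\<close> by (intro AE_I2) (simp add: abs_mult)
  show "(\<lambda>x. f x * g x) \<in> borel_measurable L" using assms by (auto intro: borel_measurable_times)
qed

lemma test_integrable:
  assumes "integrable L (u :: 'a \<Rightarrow> real)" "integrable L (g :: 'a \<Rightarrow> 'a)" "test_function D \<psi>" "b \<in> Basis"
  shows "integrable L (\<lambda>x. u x * (gradient \<psi> x \<bullet> b))" "integrable L (\<lambda>x. (g x \<bullet> b) * \<psi> x)"
proof -
  note C = test_function_C1_supported[OF assms(3)]
  obtain M where M: "\<And>x. \<bar>\<psi> x\<bar> \<le> M" "\<And>x. norm (gradient \<psi> x) \<le> M" using C1_supported_bounded[OF C] by blast
  have "\<bar>gradient \<psi> x \<bullet> b\<bar> \<le> M" for x
    using Basis_le_norm[OF assms(4), of "gradient \<psi> x"] M(2)[of x] by linarith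
  then show "integrable L (\<lambda>x. u x * (gradient \<psi> x \<bullet> b))"
    using C1_supported_measurable[OF C] by (intro integrable_mult_bounded assms borel_L) auto
  show "integrable L (\<lambda>x. (g x \<bullet> b) * \<psi> x)"
    using C1_supported_measurable[OF C] M(1) assms(2) by (intro integrable_mult_bounded borel_L) auto
qed

lemma is_weak_gradient_diff:
  assumes "is_weak_gradient D u g" "is_weak_gradient D v h"
    and "integrable L u" "integrable L g" "integrable L v" "integrable L h"
  shows "is_weak_gradient D (\<lambda>x. u x - v x) (\<lambda>x. g x - h x)"
  unfolding is_weak_gradient_def
proof (intro allI impI ballI)
  fix \<psi> b assume t: "test_function D \<psi>" "b \<in> (Basis :: 'a set)"
  have "(\<integral>x. u x * (gradient \<psi> x \<bullet> b) \<partial>L) = - (\<integral>x. (g x \<bullet> b) * \<psi> x \<partial>L)"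
    "(\<integral>x. v x * (gradient \<psi> x \<bullet> b) \<partial>L) = - (\<integral>x. (h x \<bullet> b) * \<psi> x \<partial>L)"
    using assms(1,2) t unfolding is_weak_gradient_def by blast+
  then show "(\<integral>x. (u x - v x) * (gradient \<psi> x \<bullet> b) \<partial>L) = - (\<integral>x. ((g x - h x) \<bullet> b) * \<psi> x \<partial>L)"
    using test_integrable[OF assms(3,4) t] test_integrable[OF assms(5,6) t]
    by (simp add: left_diff_distrib inner_diff_left)
qed

text \<open>Needed because \<open>rep_l2\<close> picks an arbitrary member of its class.\<close>

lemma is_weak_gradient_cong:
  assumes "is_weak_gradient D u g" and eq: "AE x in L. u x = v x"
    and m: "u \<in> borel_measurable L" "v \<in> borel_measurable L"
  shows "is_weak_gradient D v g"
  unfolding is_weak_gradient_def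
proof (intro allI impI ballI)
  fix \<psi> b assume t: "test_function D \<psi>" "b \<in> (Basis :: 'a set)"
  have gm: "(\<lambda>x. gradient \<psi> x \<bullet> b) \<in> borel_measurable L"
    using C1_supported_measurable[OF test_function_C1_supported[OF t(1)]] by (intro borel_L) auto
  have "(\<integral>x. v x * (gradient \<psi> x \<bullet> b) \<partial>L) = (\<integral>x. u x * (gradient \<psi> x \<bullet> b) \<partial>L)"
    by (rule integral_cong_AE) (use eq m gm in \<open>auto intro: borel_measurable_times\<close>)
  then show "(\<integral>x. v x * (gradient \<psi> x \<bullet> b) \<partial>L) = - (\<integral>x. (g x \<bullet> b) * \<psi> x \<partial>L)"
    using assms(1) t unfolding is_weak_gradient_def by simp
qed

lemma weak_gradient_unique:
  assumes "is_weak_gradient D u g" "is_weak_gradient D u h" "integrable L g" "integrable L h"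
  shows "AE x in L. g x = h x"
proof -
  have "AE x in L. (g x - h x) \<bullet> b = 0" if b: "b \<in> Basis" for b
  proof (rule fundamental_lemma[OF open_D])
    show "integrable L (\<lambda>x. (g x - h x) \<bullet> b)" using assms by simp
    fix \<psi> assume t: "test_function D \<psi>"
    have "(\<integral>x. (g x \<bullet> b) * \<psi> x \<partial>L) = (\<integral>x. (h x \<bullet> b) * \<psi> x \<partial>L)"
      using assms(1,2) t b unfolding is_weak_gradient_def by fastforce
    then show "(\<integral>x. ((g x - h x) \<bullet> b) * \<psi> x \<partial>L) = 0"
      using test_integrable(2)[OF _ assms(3) t b, of "\<lambda>_. 0"] test_integrable(2)[OF _ assms(4) t b, of "\<lambda>_. 0"]
      by (simp add: left_diff_distrib inner_diff_left)
  qed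
  then have "AE x in L. \<forall>b\<in>Basis. (g x - h x) \<bullet> b = 0"
    by (subst AE_ball_countable) (auto intro: countable_finite)
  then show ?thesis
    by eventually_elim (auto simp: inner_diff_left intro!: euclidean_eqI[where 'a = 'a])
qed

text \<open>Uniqueness makes the choice behind \<open>weak_gradient\<close> harmless: under
  integrals it may be replaced by any explicit weak gradient in Lp.\<close>

lemma weak_gradient_eq:
  assumes "in_Lp D p g" "is_weak_gradient D u g"
  shows "AE x in L. weak_gradient D p u x = g x"
    and "in_Lp D p (weak_gradient D p u)" "is_weak_gradient D u (weak_gradient D p u)"
proof -
  have s: "in_Lp D p (weak_gradient D p u) \<and> is_weak_gradient D u (weak_gradient D p u)"
    unfolding weak_gradient_def by (rule someI[of _ g]) (use assms in simp)
  then show "in_Lp D p (weak_gradient D p u)" "is_weak_gradient D u (weak_gradient D p u)" by auto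
  show "AE x in L. weak_gradient D p u x = g x"
    using s assms by (intro weak_gradient_unique) (auto intro: in_Lp_integrable)
qed

lemma W1p_norm_eq:
  assumes "in_Lp D p g" "is_weak_gradient D u g"
  shows "W1p_norm D p u = ((\<integral>x. \<bar>u x\<bar> powr p \<partial>L) + (\<integral>x. norm (g x) powr p \<partial>L)) powr (1 / p)"
proof -
  have "(\<integral>x. norm (weak_gradient D p u x) powr p \<partial>L) = (\<integral>x. norm (g x) powr p \<partial>L)"
    by (rule integral_cong_AE)
      (use weak_gradient_eq[OF assms] assms(1) in \<open>auto simp: in_Lp_def\<close>)
  then show ?thesis by (simp add: W1p_norm_def)
qed

lemma W1p_norm_powr:
  assumes "in_Lp D p g" "is_weak_gradient D u g"
  shows "W1p_norm D p u powr p = (\<integral>x. \<bar>u x\<bar> powr p \<partial>L) + (\<integral>x. norm (g x) powr p \<partial>L)"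
proof -
  have "0 \<le> (\<integral>x. \<bar>u x\<bar> powr p \<partial>L) + (\<integral>x. norm (g x) powr p \<partial>L)"
    by (intro add_nonneg_nonneg Bochner_Integration.integral_nonneg) auto
  then show ?thesis unfolding W1p_norm_eq[OF assms] using p1 by (simp add: powr_powr)
qed

section \<open>The energy space V and integration by parts against its members\<close>

lemma V_spaceD:
  assumes "u \<in> V_space D p"
  shows "in_Lp D p (rep_l2 u)" "in_Lp D p (wg u)" "is_weak_gradient D (rep_l2 u) (wg u)"
proof -
  obtain g where g: "in_Lp D p (rep_l2 u)" "in_Lp D p g" "is_weak_gradient D (rep_l2 u) g"
    using assms by (auto simp: V_space_def W01p_def W1p_def)
  from g(1) weak_gradient_eq(2,3)[OF g(2,3)]
  show "in_Lp D p (rep_l2 u)" "in_Lp D p (wg u)" "is_weak_gradient D (rep_l2 u) (wg u)" by auto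
qed

text \<open>The gradient chosen for \<open>u - v\<close> need not be the difference of the chosen
  ones. This supplies the difference as a competitor, which uniqueness then identifies almost
  everywhere.\<close>

lemma rep_diff_weak_gradient:
  assumes "u \<in> V_space D p" "v \<in> V_space D p"
  shows "is_weak_gradient D (rep_l2 (u - v)) (\<lambda>x. wg u x - wg v x)" "in_Lp D p (\<lambda>x. wg u x - wg v x)"
proof -
  note u = V_spaceD[OF assms(1)] and v = V_spaceD[OF assms(2)]
  show "in_Lp D p (\<lambda>x. wg u x - wg v x)" by (rule in_Lp_diff[OF u(2) v(2)])
  show "is_weak_gradient D (rep_l2 (u - v)) (\<lambda>x. wg u x - wg v x)"
  proof (rule is_weak_gradient_cong)
    show "is_weak_gradient D (\<lambda>x. rep_l2 u x - rep_l2 v x) (\<lambda>x. wg u x - wg v x)"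
      by (rule is_weak_gradient_diff[OF u(3) v(3)]) (intro in_Lp_integrable u v)+
    show "AE x in L. rep_l2 u x - rep_l2 v x = rep_l2 (u - v) x"
      using AE_L[OF rep_l2_diff[of u v]] by eventually_elim simp
  qed auto
qed

lemma V_norm_diff_ge:
  assumes "u \<in> V_space D p" "v \<in> V_space D p"
  shows "(\<integral>x. norm (wg u x - wg v x) powr p \<partial>L) \<le> V_norm D p (u - v) powr p"
  unfolding V_norm_def W1p_norm_powr[OF rep_diff_weak_gradient(2,1)[OF assms]]
  by (simp add: Bochner_Integration.integral_nonneg)

lemma V_norm_ge:
  assumes "u \<in> V_space D p"
  shows "(\<integral>x. norm (wg u x) powr p \<partial>L) \<le> V_norm D p u powr p"
  unfolding V_norm_def W1p_norm_powr[OF V_spaceD(2,3)[OF assms]]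
  by (simp add: Bochner_Integration.integral_nonneg)

lemma square_integrable_C1:
  assumes "C1_supported D f G"
  shows "square_integrable f"
proof -
  obtain K where K: "compact K" "\<And>x. x \<notin> K \<Longrightarrow> f x = 0" using assms by (auto simp: C1_supported_def)
  have "integrable lborel (\<lambda>x. (f x)\<^sup>2)"
    by (rule integrable_compact_support[OF _ K(1)]) (use C1_supported_continuous[OF assms] K in \<open>auto intro!: continuous_intros\<close>)
  then show ?thesis
    unfolding square_integrable_def using C1_supported_measurable(1)[OF assms]
    by (auto simp: integrable_completion intro!: measurable_completion)
qed

lemma abs_C1_weak_gradient:
  assumes "C1_supported D f G"
  shows "is_weak_gradient D (rep_l2 (abs_l2 f)) G" "AE x in L. rep_l2 (abs_l2 f) x = f x"
    "AE x in L. wg (abs_l2 f) x = G x"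
proof -
  show eq: "AE x in L. rep_l2 (abs_l2 f) x = f x"
    by (rule AE_L[OF rep_abs_l2[OF square_integrable_C1[OF assms]]])
  show w: "is_weak_gradient D (rep_l2 (abs_l2 f)) G"
  proof (rule is_weak_gradient_cong)
    show "is_weak_gradient D f G" by (rule C1_supported_weak_gradient[OF D_sets assms])
    show "AE x in L. f x = rep_l2 (abs_l2 f) x" using eq by eventually_elim simp
  qed (use C1_supported_measurable(1)[OF assms] in \<open>auto intro: borel_L\<close>)
  show "AE x in L. wg (abs_l2 f) x = G x"
    by (rule weak_gradient_eq(1)[OF C1_supported_in_Lp(2)[OF assms] w])
qed

lemma V_norm_abs_C1:
  assumes "C1_supported D f G"
  shows "V_norm D p (abs_l2 f) powr p = (\<integral>x. \<bar>f x\<bar> powr p \<partial>L) + (\<integral>x. norm (G x) powr p \<partial>L)"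
proof -
  have "(\<integral>x. \<bar>rep_l2 (abs_l2 f) x\<bar> powr p \<partial>L) = (\<integral>x. \<bar>f x\<bar> powr p \<partial>L)"
    using abs_C1_weak_gradient(2)[OF assms] borel_L[OF C1_supported_measurable(1)[OF assms]]
    by (intro integral_cong_AE) auto
  then show ?thesis
    using W1p_norm_powr[OF C1_supported_in_Lp(2)[OF assms] abs_C1_weak_gradient(1)[OF assms]]
    by (simp add: V_norm_def)
qed

lemma abs_C1_in_L2: "C1_supported D f G \<Longrightarrow> abs_l2 f \<in> L2 D"
  by (intro abs_l2_in_L2 square_integrable_C1) (auto dest: C1_supported_outside)

lemma abs_C1_in_V:
  assumes f: "C1_supported D f G" and \<psi>: "\<And>k. test_function D (\<psi> k)"
    and lim: "\<And>x. (\<lambda>k. \<psi> k x) \<longlonglongrightarrow> f x" "\<And>x. (\<lambda>k. gradient (\<psi> k) x) \<longlonglongrightarrow> G x"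
    and bd: "\<And>k x. \<bar>\<psi> k x\<bar> \<le> M" "\<And>k x. norm (gradient (\<psi> k) x) \<le> M"
  shows "abs_l2 f \<in> V_space D p"
proof -
  let ?r = "rep_l2 (abs_l2 f)"
  note w = abs_C1_weak_gradient[OF f]
  have r_in: "in_Lp D p ?r"
  proof -
    have "integrable L (\<lambda>x. norm (?r x) powr p) \<longleftrightarrow> integrable L (\<lambda>x. norm (f x) powr p)"
      using w(2) C1_supported_in_Lp(1)[OF f] by (intro integrable_cong_AE) (auto simp: in_Lp_def)
    then show ?thesis using C1_supported_in_Lp(1)[OF f] by (simp add: in_Lp_def)
  qed
  have fm: "f \<in> borel_measurable L" "G \<in> borel_measurable L"
    using C1_supported_measurable[OF f] by (auto intro: borel_L)
  have pm: "\<psi> k \<in> borel_measurable L" "gradient (\<psi> k) \<in> borel_measurable L" for k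
    using C1_supported_measurable[OF test_function_C1_supported[OF \<psi>]] by (auto intro: borel_L)
  obtain M1 where M1: "\<And>x. \<bar>f x\<bar> \<le> M1" "\<And>x. norm (G x) \<le> M1" using C1_supported_bounded[OF f] by blast
  have eq: "W1p_norm D p (\<lambda>x. ?r x - \<psi> k x) = ((\<integral>x. \<bar>f x - \<psi> k x\<bar> powr p \<partial>L) + (\<integral>x. norm (G x - gradient (\<psi> k) x) powr p \<partial>L)) powr (1 / p)" for k
  proof -
    note C = test_function_C1_supported[OF \<psi>[of k]]
    have "is_weak_gradient D (\<lambda>x. ?r x - \<psi> k x) (\<lambda>x. G x - gradient (\<psi> k) x)"
      by (rule is_weak_gradient_diff[OF w(1) C1_supported_weak_gradient[OF D_sets C]])
        (intro in_Lp_integrable r_in C1_supported_in_Lp[OF f] C1_supported_in_Lp[OF C])+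
    from W1p_norm_eq[OF in_Lp_diff[OF C1_supported_in_Lp(2)[OF f] C1_supported_in_Lp(2)[OF C]] this]
    have "W1p_norm D p (\<lambda>x. ?r x - \<psi> k x) = ((\<integral>x. \<bar>?r x - \<psi> k x\<bar> powr p \<partial>L) + (\<integral>x. norm (G x - gradient (\<psi> k) x) powr p \<partial>L)) powr (1 / p)" .
    moreover have "(\<integral>x. \<bar>?r x - \<psi> k x\<bar> powr p \<partial>L) = (\<integral>x. \<bar>f x - \<psi> k x\<bar> powr p \<partial>L)"
      using w(2) fm pm by (intro integral_cong_AE) auto
    ultimately show ?thesis by simp
  qed
  have "(\<lambda>k. \<integral>x. \<bar>f x - \<psi> k x\<bar> powr p \<partial>L) \<longlonglongrightarrow> (\<integral>x. 0 \<partial>L)"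
  proof (rule integral_dominated_convergence[where w = "\<lambda>_. (M1 + M) powr p"])
    show "AE x in L. (\<lambda>k. \<bar>f x - \<psi> k x\<bar> powr p) \<longlonglongrightarrow> 0"
    proof (rule AE_I2)
      fix x
      have "(\<lambda>k. \<bar>f x - \<psi> k x\<bar> powr p) \<longlonglongrightarrow> \<bar>f x - f x\<bar> powr p"
        using p1 by (intro tendsto_powr2 tendsto_intros lim) auto
      then show "(\<lambda>k. \<bar>f x - \<psi> k x\<bar> powr p) \<longlonglongrightarrow> 0" by simp
    qed
    show "AE x in L. norm (\<bar>f x - \<psi> k x\<bar> powr p) \<le> (M1 + M) powr p" for k
    proof (rule AE_I2)
      fix x
      show "norm (\<bar>f x - \<psi> k x\<bar> powr p) \<le> (M1 + M) powr p"
        using M1(1)[of x] bd(1)[of k x] p1 by (simp, intro powr_mono2) auto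
    qed
  qed (use fm pm in auto)
  moreover have "(\<lambda>k. \<integral>x. norm (G x - gradient (\<psi> k) x) powr p \<partial>L) \<longlonglongrightarrow> (\<integral>x. 0 \<partial>L)"
  proof (rule integral_dominated_convergence[where w = "\<lambda>_. (M1 + M) powr p"])
    show "AE x in L. (\<lambda>k. norm (G x - gradient (\<psi> k) x) powr p) \<longlonglongrightarrow> 0"
    proof (rule AE_I2)
      fix x
      have "(\<lambda>k. norm (G x - gradient (\<psi> k) x) powr p) \<longlonglongrightarrow> norm (G x - G x) powr p"
        using p1 by (intro tendsto_powr2 tendsto_intros lim) auto
      then show "(\<lambda>k. norm (G x - gradient (\<psi> k) x) powr p) \<longlonglongrightarrow> 0" by simp
    qed
    show "AE x in L. norm (norm (G x - gradient (\<psi> k) x) powr p) \<le> (M1 + M) powr p" for k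
    proof (rule AE_I2)
      fix x
      show "norm (norm (G x - gradient (\<psi> k) x) powr p) \<le> (M1 + M) powr p"
        using M1(2)[of x] bd(2)[of k x] p1 norm_triangle_ineq4[of "G x" "gradient (\<psi> k) x"]
        by (simp, intro powr_mono2) auto
    qed
  qed (use fm pm in auto)
  ultimately have "(\<lambda>k. (\<integral>x. \<bar>f x - \<psi> k x\<bar> powr p \<partial>L) + (\<integral>x. norm (G x - gradient (\<psi> k) x) powr p \<partial>L)) \<longlonglongrightarrow> 0 + 0"
    by (intro tendsto_add) simp_all
  then have "(\<lambda>k. ((\<integral>x. \<bar>f x - \<psi> k x\<bar> powr p \<partial>L) + (\<integral>x. norm (G x - gradient (\<psi> k) x) powr p \<partial>L)) powr (1 / p)) \<longlonglongrightarrow> (0 + 0) powr (1 / p)"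
    using p1 by (intro tendsto_powr2 tendsto_const) (auto intro!: always_eventually add_nonneg_nonneg Bochner_Integration.integral_nonneg)
  then have "(\<lambda>k. W1p_norm D p (\<lambda>x. ?r x - \<psi> k x)) \<longlonglongrightarrow> 0"
    unfolding eq by simp
  then have "?r \<in> W01p D p"
    unfolding W01p_def W1p_def using r_in w(1) C1_supported_in_Lp(2)[OF f] \<psi> by blast
  then show ?thesis unfolding V_space_def using abs_C1_in_L2[OF f] by simp
qed

text \<open>In place of Hoelder's inequality the pointwise bound
  \<open>y \<le> \<theta> + \<theta> powr (1 - p) * y powr p\<close>: on a finite measure the first
  term is small with \<theta>, and the second one vanishes in the limit.\<close>

lemma Lp_tendsto_imp_L1:
  fixes e :: "nat \<Rightarrow> 'a \<Rightarrow> 'b::euclidean_space"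
  assumes e: "\<And>k. in_Lp D p (e k)" and lim: "(\<lambda>k. \<integral>x. norm (e k x) powr p \<partial>L) \<longlonglongrightarrow> 0"
  shows "(\<lambda>k. \<integral>x. norm (e k x) \<partial>L) \<longlonglongrightarrow> 0"
proof (rule LIMSEQ_I)
  fix r :: real assume r: "0 < r"
  define V where "V = measure L (space L)"
  define \<theta> where "\<theta> = r / (2 * (V + 1))"
  have V: "0 \<le> V" by (simp add: V_def)
  have th: "0 < \<theta>" "\<theta> * V < r / 2"
    using r V by (auto simp: \<theta>_def field_simps add_nonneg_pos)
  have pw: "y \<le> \<theta> + \<theta> powr (1 - p) * y powr p" if "0 \<le> y" for y
  proof (cases "y \<le> \<theta>")
    case False
    then have y: "0 < y" using th by linarith
    have "1 = (\<theta> / \<theta>) powr (p - 1)" using th by simp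
    also have "\<dots> \<le> (y / \<theta>) powr (p - 1)" using False th p1 by (intro powr_mono2 divide_right_mono) auto
    also have "\<dots> = \<theta> powr (1 - p) * y powr (p - 1)"
      using y th by (simp add: powr_divide powr_minus_divide[symmetric] field_simps) (simp add: powr_diff field_simps)
    finally have "y * 1 \<le> y * (\<theta> powr (1 - p) * y powr (p - 1))" using y by (intro mult_left_mono) auto
    also have "\<dots> = \<theta> powr (1 - p) * y powr p" using y by (simp add: powr_diff)
    finally show ?thesis using th by linarith
  qed (simp add: that add_increasing2)
  have "\<forall>\<^sub>F k in sequentially. (\<integral>x. norm (e k x) powr p \<partial>L) < r / 2 / \<theta> powr (1 - p)"
    using order_tendstoD(2)[OF lim] r th by simp
  then obtain N where N: "\<And>k. k \<ge> N \<Longrightarrow> (\<integral>x. norm (e k x) powr p \<partial>L) < r / 2 / \<theta> powr (1 - p)"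
    by (auto simp: eventually_sequentially)
  show "\<exists>no. \<forall>k\<ge>no. norm ((\<integral>x. norm (e k x) \<partial>L) - 0) < r"
  proof (intro exI[of _ N] allI impI)
    fix k assume "k \<ge> N"
    have "(\<integral>x. norm (e k x) \<partial>L) \<le> (\<integral>x. \<theta> + \<theta> powr (1 - p) * norm (e k x) powr p \<partial>L)"
      using in_Lp_integrable[OF e] in_Lp_powr_integrable[OF e] by (intro integral_mono) (auto intro: pw)
    also have "\<dots> = \<theta> * V + \<theta> powr (1 - p) * (\<integral>x. norm (e k x) powr p \<partial>L)"
      using in_Lp_powr_integrable[OF e] by (simp add: V_def mult.commute)
    also have "\<dots> < r / 2 + r / 2"
      using th N[OF \<open>k \<ge> N\<close>] by (intro add_strict_mono) (auto simp: field_simps)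
    finally show "norm ((\<integral>x. norm (e k x) \<partial>L) - 0) < r" by simp
  qed
qed

text \<open>For test functions this is the weak gradient of each component of \<open>J\<close>. The
  passage to \<open>v\<close> along the approximations from \<open>W01p\<close> needs only L1
  convergence, since \<open>J\<close> and its divergence are bounded.\<close>

lemma flux_pairing:
  assumes v: "v \<in> V_space D p" and J: "\<And>b. b \<in> Basis \<Longrightarrow> C1_supported D (\<lambda>x. J x \<bullet> b) (G b)"
    and Jm: "J \<in> borel_measurable borel" and Jb: "\<And>x. norm (J x) \<le> M"
  shows "(\<integral>x. J x \<bullet> wg v x \<partial>L) = - (\<integral>x. (\<Sum>b\<in>Basis. G b x \<bullet> b) * rep_l2 v x \<partial>L)"
proof -
  obtain \<psi> where \<psi>: "\<And>k. test_function D (\<psi> k)" and lim: "(\<lambda>k. W1p_norm D p (\<lambda>x. rep_l2 v x - \<psi> k x)) \<longlonglongrightarrow> 0"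
    using v by (auto simp: V_space_def W01p_def)
  note C = test_function_C1_supported[OF \<psi>]
  define dv where "dv x = (\<Sum>b\<in>Basis. G b x \<bullet> b)" for x
  note vD = V_spaceD[OF v]
  have JL: "J \<in> borel_measurable L" using Jm by (rule borel_L)
  have GmB: "G b \<in> borel_measurable borel" if "b \<in> Basis" for b
    using C1_supported_measurable[OF J[OF that]] by simp
  have dvm: "dv \<in> borel_measurable L"
    unfolding dv_def using GmB by (intro borel_measurable_sum borel_L borel_measurable_inner) auto
  obtain Md where Md: "\<And>x. \<bar>dv x\<bar> \<le> Md"
  proof -
    have "\<exists>M. \<forall>x. norm (G b x) \<le> M" if "b \<in> Basis" for b
      using C1_supported_bounded[OF J[OF that]] by blast
    then obtain N where N: "\<And>b x. b \<in> Basis \<Longrightarrow> norm (G b x) \<le> N b" by metis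
    have "\<bar>dv x\<bar> \<le> (\<Sum>b\<in>Basis. N b)" for x
      unfolding dv_def
    proof (rule order_trans[OF sum_abs], intro sum_mono)
      fix b :: 'a assume b: "b \<in> Basis"
      show "\<bar>G b x \<bullet> b\<bar> \<le> N b" using Basis_le_norm[OF b, of "G b x"] N[OF b, of x] by linarith
    qed
    then show thesis by (rule that)
  qed
  have test: "(\<integral>x. J x \<bullet> gradient (\<psi> k) x \<partial>L) = - (\<integral>x. dv x * \<psi> k x \<partial>L)" for k
  proof -
    have w: "(\<integral>x. (J x \<bullet> b) * (gradient (\<psi> k) x \<bullet> b) \<partial>L) = - (\<integral>x. (G b x \<bullet> b) * \<psi> k x \<partial>L)" if "b \<in> Basis" for b
      using C1_supported_weak_gradient[OF D_sets J[OF that]] \<psi>[of k] that unfolding is_weak_gradient_def by blast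
    have i: "integrable L (\<lambda>x. (J x \<bullet> b) * (gradient (\<psi> k) x \<bullet> b))" "integrable L (\<lambda>x. (G b x \<bullet> b) * \<psi> k x)"
      if "b \<in> Basis" for b
      using test_integrable[OF in_Lp_integrable[OF C1_supported_in_Lp(1)[OF J[OF that]]]
         in_Lp_integrable[OF C1_supported_in_Lp(2)[OF J[OF that]]] \<psi>[of k] that] by auto
    have "(\<integral>x. J x \<bullet> gradient (\<psi> k) x \<partial>L) = (\<integral>x. (\<Sum>b\<in>Basis. (J x \<bullet> b) * (gradient (\<psi> k) x \<bullet> b)) \<partial>L)"
      by (intro Bochner_Integration.integral_cong refl euclidean_inner)
    also have "\<dots> = (\<Sum>b\<in>Basis. (\<integral>x. (J x \<bullet> b) * (gradient (\<psi> k) x \<bullet> b) \<partial>L))"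
      by (rule Bochner_Integration.integral_sum) (rule i)
    also have "\<dots> = (\<Sum>b\<in>Basis. - (\<integral>x. (G b x \<bullet> b) * \<psi> k x \<partial>L))" by (intro sum.cong refl w)
    also have "\<dots> = - (\<integral>x. (\<Sum>b\<in>Basis. (G b x \<bullet> b) * \<psi> k x) \<partial>L)"
      by (subst Bochner_Integration.integral_sum) (auto intro: i simp: sum_negf)
    finally show ?thesis by (simp add: dv_def sum_distrib_right)
  qed
  define e where "e k x = wg v x - gradient (\<psi> k) x" for k x
  define e0 where "e0 k x = rep_l2 v x - \<psi> k x" for k x
  have ein: "in_Lp D p (e k)" "in_Lp D p (e0 k)" for k
    unfolding e_def[abs_def] e0_def[abs_def] by (intro in_Lp_diff vD C1_supported_in_Lp[OF C])+
  have wk: "is_weak_gradient D (e0 k) (e k)" for k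
    unfolding e_def[abs_def] e0_def[abs_def]
    by (rule is_weak_gradient_diff[OF vD(3) C1_supported_weak_gradient[OF D_sets C]])
      (intro in_Lp_integrable vD C1_supported_in_Lp[OF C])+
  have "(\<lambda>k. W1p_norm D p (e0 k) powr p) \<longlonglongrightarrow> 0 powr p"
    using lim p1 unfolding e0_def[abs_def]
    by (intro tendsto_powr2 tendsto_const) (auto simp: W1p_norm_def)
  then have limp: "(\<lambda>k. (\<integral>x. \<bar>e0 k x\<bar> powr p \<partial>L) + (\<integral>x. norm (e k x) powr p \<partial>L)) \<longlonglongrightarrow> 0"
    by (simp add: W1p_norm_powr[OF ein(1) wk])
  have l1: "(\<lambda>k. \<integral>x. norm (e k x) powr p \<partial>L) \<longlonglongrightarrow> 0"
    by (rule tendsto_sandwich[OF _ _ tendsto_const limp]) (auto intro!: always_eventually Bochner_Integration.integral_nonneg)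
  have l2: "(\<lambda>k. \<integral>x. norm (e0 k x) powr p \<partial>L) \<longlonglongrightarrow> 0"
    by (rule tendsto_sandwich[OF _ _ tendsto_const limp]) (auto intro!: always_eventually Bochner_Integration.integral_nonneg)
  have M0: "0 \<le> M" using Jb[of undefined] norm_ge_zero order_trans by blast
  have Md0: "0 \<le> Md" using Md[of undefined] abs_ge_zero order_trans by blast
  have iJe: "integrable L (\<lambda>x. J x \<bullet> e k x)" for k
  proof (rule Bochner_Integration.integrable_bound[of _ "\<lambda>x. M * norm (e k x)"])
    show "AE x in L. norm (J x \<bullet> e k x) \<le> norm (M * norm (e k x))"
    proof (rule AE_I2)
      fix x show "norm (J x \<bullet> e k x) \<le> norm (M * norm (e k x))"
        using Cauchy_Schwarz_ineq2[of "J x" "e k x"] mult_right_mono[OF Jb[of x], of "norm (e k x)"] M0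
        by (simp add: abs_mult)
    qed
    show "(\<lambda>x. J x \<bullet> e k x) \<in> borel_measurable L"
      using JL in_Lp_measurable[OF ein(1)] by (intro borel_measurable_inner) auto
  qed (use in_Lp_integrable[OF ein(1)] in auto)
  have ide: "integrable L (\<lambda>x. dv x * e0 k x)" for k
    using integrable_mult_bounded[OF in_Lp_integrable[OF ein(2)] dvm Md] by (simp add: mult.commute)
  have c1: "(\<lambda>k. \<integral>x. J x \<bullet> e k x \<partial>L) \<longlonglongrightarrow> 0"
  proof (rule tendsto_rabs_zero_cancel, rule tendsto_sandwich[OF _ _ tendsto_const])
    show "(\<lambda>k. M * (\<integral>x. norm (e k x) \<partial>L)) \<longlonglongrightarrow> 0"
      using tendsto_mult_left[OF Lp_tendsto_imp_L1[OF ein(1) l1], of M] by simp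
    show "\<forall>\<^sub>F k in sequentially. \<bar>\<integral>x. J x \<bullet> e k x \<partial>L\<bar> \<le> M * (\<integral>x. norm (e k x) \<partial>L)"
    proof (rule always_eventually, rule allI)
      fix k
      have "\<bar>\<integral>x. J x \<bullet> e k x \<partial>L\<bar> \<le> (\<integral>x. \<bar>J x \<bullet> e k x\<bar> \<partial>L)" by (rule integral_abs_bound)
      also have "\<dots> \<le> (\<integral>x. M * norm (e k x) \<partial>L)"
      proof (rule integral_mono)
        fix x show "\<bar>J x \<bullet> e k x\<bar> \<le> M * norm (e k x)"
          using Cauchy_Schwarz_ineq2[of "J x" "e k x"] mult_right_mono[OF Jb[of x], of "norm (e k x)"] by simp
      qed (use iJe in_Lp_integrable[OF ein(1)] in auto)
      finally show "\<bar>\<integral>x. J x \<bullet> e k x \<partial>L\<bar> \<le> M * (\<integral>x. norm (e k x) \<partial>L)" by simp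
    qed
  qed simp
  have c2: "(\<lambda>k. \<integral>x. dv x * e0 k x \<partial>L) \<longlonglongrightarrow> 0"
  proof (rule tendsto_rabs_zero_cancel, rule tendsto_sandwich[OF _ _ tendsto_const])
    show "(\<lambda>k. Md * (\<integral>x. norm (e0 k x) \<partial>L)) \<longlonglongrightarrow> 0"
      using tendsto_mult_left[OF Lp_tendsto_imp_L1[OF ein(2) l2], of Md] by simp
    show "\<forall>\<^sub>F k in sequentially. \<bar>\<integral>x. dv x * e0 k x \<partial>L\<bar> \<le> Md * (\<integral>x. norm (e0 k x) \<partial>L)"
    proof (rule always_eventually, rule allI)
      fix k
      have "\<bar>\<integral>x. dv x * e0 k x \<partial>L\<bar> \<le> (\<integral>x. \<bar>dv x * e0 k x\<bar> \<partial>L)" by (rule integral_abs_bound)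
      also have "\<dots> \<le> (\<integral>x. Md * norm (e0 k x) \<partial>L)"
      proof (rule integral_mono)
        fix x show "\<bar>dv x * e0 k x\<bar> \<le> Md * norm (e0 k x)"
          using mult_right_mono[OF Md[of x], of "\<bar>e0 k x\<bar>"] by (simp add: abs_mult)
      qed (use ide in_Lp_integrable[OF ein(2)] in auto)
      finally show "\<bar>\<integral>x. dv x * e0 k x \<partial>L\<bar> \<le> Md * (\<integral>x. norm (e0 k x) \<partial>L)" by simp
    qed
  qed simp
  have iJg: "integrable L (\<lambda>x. J x \<bullet> gradient (\<psi> k) x)" for k
  proof -
    obtain N where N: "\<And>x. norm (gradient (\<psi> k) x) \<le> N" using C1_supported_bounded[OF C[of k]] by blast
    show ?thesis
    proof (rule integrable_const_bound[of _ "M * N"])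
      show "AE x in L. norm (J x \<bullet> gradient (\<psi> k) x) \<le> M * N"
      proof (rule AE_I2)
        fix x
        show "norm (J x \<bullet> gradient (\<psi> k) x) \<le> M * N"
          using Cauchy_Schwarz_ineq2[of "J x" "gradient (\<psi> k) x"] mult_mono[OF Jb[of x] N[of x]] M0 by simp
      qed
      show "(\<lambda>x. J x \<bullet> gradient (\<psi> k) x) \<in> borel_measurable L"
        using JL borel_L[OF C1_supported_measurable(2)[OF C]] by (intro borel_measurable_inner) auto
    qed
  qed
  have idp: "integrable L (\<lambda>x. dv x * \<psi> k x)" for k
    using integrable_mult_bounded[OF in_Lp_integrable[OF C1_supported_in_Lp(1)[OF C]] dvm Md] by (simp add: mult.commute)
  have "(\<integral>x. J x \<bullet> wg v x \<partial>L) + (\<integral>x. dv x * rep_l2 v x \<partial>L) = (\<integral>x. J x \<bullet> e k x \<partial>L) + (\<integral>x. dv x * e0 k x \<partial>L)" for k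
  proof -
    have "(\<integral>x. J x \<bullet> wg v x \<partial>L) = (\<integral>x. J x \<bullet> e k x + J x \<bullet> gradient (\<psi> k) x \<partial>L)"
      by (simp add: e_def inner_diff_right)
    also have "\<dots> = (\<integral>x. J x \<bullet> e k x \<partial>L) + (\<integral>x. J x \<bullet> gradient (\<psi> k) x \<partial>L)"
      by (rule Bochner_Integration.integral_add[OF iJe iJg])
    finally have 1: "(\<integral>x. J x \<bullet> wg v x \<partial>L) = (\<integral>x. J x \<bullet> e k x \<partial>L) + (\<integral>x. J x \<bullet> gradient (\<psi> k) x \<partial>L)" .
    have "(\<integral>x. dv x * rep_l2 v x \<partial>L) = (\<integral>x. dv x * e0 k x + dv x * \<psi> k x \<partial>L)"
      by (simp add: e0_def right_diff_distrib)
    also have "\<dots> = (\<integral>x. dv x * e0 k x \<partial>L) + (\<integral>x. dv x * \<psi> k x \<partial>L)"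
      by (rule Bochner_Integration.integral_add[OF ide idp])
    finally show ?thesis using 1 test[of k] by simp
  qed
  then have "(\<lambda>k::nat. (\<integral>x. J x \<bullet> wg v x \<partial>L) + (\<integral>x. dv x * rep_l2 v x \<partial>L)) \<longlonglongrightarrow> 0 + 0"
    using tendsto_add[OF c1 c2] by simp
  from LIMSEQ_unique[OF tendsto_const this] show ?thesis by (simp add: dv_def)
qed

end


section \<open>Continuity of the \<open>p\<close>-Laplacian\<close>

lemma powr_diff_le:
  assumes "1 \<le> (r::real)" "0 \<le> B" "B \<le> A"
  shows "A powr r - B powr r \<le> r * A powr (r - 1) * (A - B)"
proof (cases "B = 0 \<or> A = B")
  case True
  have "A powr r = A powr (r - 1) * A" using assms by (cases "A = 0") (auto simp: powr_diff)
  moreover have "0 \<le> A powr (r - 1) * A" using assms by auto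
  ultimately show ?thesis using True assms mult_right_mono[of 1 r "A powr (r - 1) * A"] by auto
next
  case False
  then have AB: "0 < B" "B < A" using assms by auto
  have "\<exists>z. B < z \<and> z < A \<and> A powr r - B powr r = (A - B) * (r * z powr (r - 1))"
    by (rule MVT2[OF AB(2)]) (use AB in \<open>auto intro!: has_real_derivative_powr\<close>)
  then obtain z where z: "B < z" "z < A" "A powr r - B powr r = (A - B) * (r * z powr (r - 1))" by blast
  have "(A - B) * (r * z powr (r - 1)) \<le> (A - B) * (r * A powr (r - 1))"
    using z AB assms by (intro mult_left_mono powr_mono2) auto
  then show ?thesis using z(3) by (simp add: mult_ac)
qed

text \<open>The difference of the vectors is split off with the weight of the longer one. What
  remains, the difference of the weights times the shorter length, is at most the difference of the
  powers \<open>p - 1\<close>, to which the mean value theorem applies.\<close>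

lemma p_flux_lipschitz:
  fixes a b :: "'a::real_normed_vector"
  assumes p: "2 \<le> p"
  shows "norm (norm a powr (p - 2) *\<^sub>R a - norm b powr (p - 2) *\<^sub>R b) \<le> p * max (norm a) (norm b) powr (p - 2) * norm (a - b)"
proof -
  have main: "norm (norm a powr (p - 2) *\<^sub>R a - norm b powr (p - 2) *\<^sub>R b) \<le> p * norm a powr (p - 2) * norm (a - b)"
    if ab: "norm b \<le> norm a" for a b :: 'a
  proof -
    have e: "norm a powr (p - 2) *\<^sub>R a - norm b powr (p - 2) *\<^sub>R b = norm a powr (p - 2) *\<^sub>R (a - b) + (norm a powr (p - 2) - norm b powr (p - 2)) *\<^sub>R b"
      by (simp add: algebra_simps)
    have mono: "norm b powr (p - 2) \<le> norm a powr (p - 2)" using ab p by (intro powr_mono2) auto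
    have pm: "y powr (p - 2) * y = y powr (p - 1)" if "0 \<le> y" for y :: real
      using powr_mult_base[OF that, of "p - 2"] by (simp add: mult.commute)
    have "(norm a powr (p - 2) - norm b powr (p - 2)) * norm b \<le> norm a powr (p - 1) - norm b powr (p - 1)"
      using mult_left_mono[OF ab, of "norm a powr (p - 2)"] pm[of "norm a"] pm[of "norm b"] by (simp add: left_diff_distrib)
    also have "\<dots> \<le> (p - 1) * norm a powr (p - 1 - 1) * (norm a - norm b)"
      using p ab by (intro powr_diff_le) auto
    also have "\<dots> \<le> (p - 1) * norm a powr (p - 2) * norm (a - b)"
      using p ab norm_triangle_ineq2[of a b] by (intro mult_mono) auto
    finally have s: "(norm a powr (p - 2) - norm b powr (p - 2)) * norm b \<le> (p - 1) * norm a powr (p - 2) * norm (a - b)" .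
    have "norm (norm a powr (p - 2) *\<^sub>R a - norm b powr (p - 2) *\<^sub>R b) \<le> norm a powr (p - 2) * norm (a - b) + (norm a powr (p - 2) - norm b powr (p - 2)) * norm b"
      unfolding e using norm_triangle_ineq[of "norm a powr (p - 2) *\<^sub>R (a - b)" "(norm a powr (p - 2) - norm b powr (p - 2)) *\<^sub>R b"] mono by simp
    then show ?thesis using s by (simp add: algebra_simps)
  qed
  show ?thesis
  proof (cases "norm b \<le> norm a")
    case True
    then show ?thesis using main[OF True] by (simp add: max_def)
  next
    case False
    then show ?thesis using main[of a b] by (simp add: max_def norm_minus_commute)
  qed
qed

text \<open>Stands in for the inequalities of Hoelder and Young with a small parameter. Either
  \<open>e\<close> is small against \<open>m\<close> or \<open>h\<close> and the product goes into
  the first term, or \<open>e\<close> dominates both and its own power bounds everything.\<close>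

lemma p_young:
  fixes m e h \<theta> :: real
  assumes p: "2 \<le> p" and nn: "0 \<le> m" "0 \<le> e" "0 \<le> h" and th: "0 < \<theta>"
  shows "m powr (p - 2) * e * h \<le> \<theta> * (m powr p + h powr p) + \<theta> powr (1 - p) * e powr p"
proof -
  have pm1: "y powr (p - 2) * y = y powr (p - 1)" if "0 \<le> y" for y :: real
    using powr_mult_base[OF that, of "p - 2"] by (simp add: mult.commute)
  have pm2: "y powr (p - 1) * y = y powr p" if "0 \<le> y" for y :: real
    using powr_mult_base[OF that, of "p - 1"] by (simp add: mult.commute)
  show ?thesis
  proof (cases "e \<le> \<theta> * m")
    case True
    have "m powr (p - 2) * e * h \<le> m powr (p - 2) * (\<theta> * m) * h"
      using True nn by (intro mult_right_mono mult_left_mono) auto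
    also have "\<dots> = \<theta> * (m powr (p - 1) * h)" using pm1[OF nn(1)] by (simp add: mult_ac)
    also have "\<dots> \<le> \<theta> * (max m h powr (p - 1) * max m h)"
      using nn th p by (intro mult_left_mono mult_mono powr_mono2) auto
    also have "\<dots> = \<theta> * max m h powr p" using pm2[of "max m h"] nn by simp
    also have "\<dots> \<le> \<theta> * (m powr p + h powr p)" using th by (intro mult_left_mono) (auto simp: max_def)
    finally show ?thesis by (simp add: add_increasing2)
  next
    case False
    have "0 \<le> \<theta> * m" using nn th by simp
    then have e: "0 < e" using False by linarith
    have m: "m \<le> e / \<theta>" using False th by (simp add: field_simps)
    have "m powr (p - 2) * e * h \<le> (e / \<theta>) powr (p - 2) * e * h"
      using m e nn p by (intro mult_right_mono powr_mono2) auto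
    also have "\<dots> = \<theta> powr (2 - p) * (e powr (p - 1) * h)"
    proof -
      have "(e / \<theta>) powr (p - 2) = \<theta> powr (2 - p) * e powr (p - 2)"
        using e th powr_minus_divide[of \<theta> "p - 2"] by (simp add: powr_divide)
      then show ?thesis using pm1[of e] e by simp
    qed
    finally have 1: "m powr (p - 2) * e * h \<le> \<theta> powr (2 - p) * (e powr (p - 1) * h)" .
    show ?thesis
    proof (cases "e \<le> \<theta> * h")
      case True
      have "e powr (p - 1) * h \<le> (\<theta> * h) powr (p - 1) * h"
        using True e nn p by (intro mult_right_mono powr_mono2) auto
      also have "\<dots> = \<theta> powr (p - 1) * h powr p" using pm2[OF nn(3)] nn th by (simp add: powr_mult)
      finally have "\<theta> powr (2 - p) * (e powr (p - 1) * h) \<le> \<theta> powr (2 - p) * (\<theta> powr (p - 1) * h powr p)"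
        by (intro mult_left_mono) auto
      also have "\<dots> = \<theta> * h powr p" using th by (simp add: mult.assoc[symmetric] powr_add[symmetric])
      finally show ?thesis using 1 th by (simp add: distrib_left add_increasing add_increasing2)
    next
      case False
      then have "h \<le> e / \<theta>" using th by (simp add: field_simps)
      then have "e powr (p - 1) * h \<le> e powr (p - 1) * (e / \<theta>)" by (intro mult_left_mono) auto
      also have "\<dots> = e powr p / \<theta>" using pm2[of e] e by simp
      finally have "\<theta> powr (2 - p) * (e powr (p - 1) * h) \<le> \<theta> powr (2 - p) * (e powr p / \<theta>)"
        by (intro mult_left_mono) auto
      also have "\<dots> = \<theta> powr (1 - p) * e powr p" using th by (simp add: powr_diff field_simps power2_eq_square)
      finally show ?thesis using 1 th by (simp add: add_increasing)
    qed
  qed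
qed

locale sobolev2 = sobolev +
  assumes p2: "2 \<le> p"
begin

lemma flux_inner_bound: "\<bar>norm a powr (p - 2) * (a \<bullet> h)\<bar> \<le> norm a powr p + norm h powr p" for a h :: 'a
proof -
  have "\<bar>norm a powr (p - 2) * (a \<bullet> h)\<bar> \<le> norm a powr (p - 2) * norm a * norm h"
    using mult_left_mono[OF Cauchy_Schwarz_ineq2[of a h], of "norm a powr (p - 2)"] by (simp add: abs_mult mult.assoc)
  also have "\<dots> = norm a powr (p - 1) * norm h"
    using powr_mult_base[of "norm a" "p - 2"] by (simp add: mult.commute)
  also have "\<dots> \<le> max (norm a) (norm h) powr (p - 1) * max (norm a) (norm h)"
    using p2 by (intro mult_mono powr_mono2) auto
  also have "\<dots> = max (norm a) (norm h) powr p"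
    using powr_mult_base[of "max (norm a) (norm h)" "p - 1"] by (simp add: mult.commute le_max_iff_disj)
  also have "\<dots> \<le> norm a powr p + norm h powr p" by (auto simp: max_def)
  finally show ?thesis .
qed

lemma flux_integrable:
  fixes g h :: "'a \<Rightarrow> 'a"
  assumes "in_Lp D p g" "in_Lp D p h"
  shows "integrable L (\<lambda>x. norm (g x) powr (p - 2) * (g x \<bullet> h x))"
proof (rule Bochner_Integration.integrable_bound[of _ "\<lambda>x. norm (g x) powr p + norm (h x) powr p"])
  show "integrable L (\<lambda>x. norm (g x) powr p + norm (h x) powr p)" using assms by (simp add: in_Lp_def)
  show "AE x in L. norm (norm (g x) powr (p - 2) * (g x \<bullet> h x)) \<le> norm (norm (g x) powr p + norm (h x) powr p)"
    using flux_inner_bound by (intro AE_I2) simp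
  show "(\<lambda>x. norm (g x) powr (p - 2) * (g x \<bullet> h x)) \<in> borel_measurable L"
    using in_Lp_measurable[OF assms(1)] in_Lp_measurable[OF assms(2)] by measurable
qed

lemma p_laplace_bound:
  assumes u: "u \<in> V_space D p" and v: "v \<in> V_space D p"
  shows "\<bar>p_laplace D p u v\<bar> \<le> V_norm D p u powr p + V_norm D p v powr p"
proof -
  note uD = V_spaceD[OF u] and vD = V_spaceD[OF v]
  have "\<bar>p_laplace D p u v\<bar> \<le> (\<integral>x. \<bar>norm (wg u x) powr (p - 2) * (wg u x \<bullet> wg v x)\<bar> \<partial>L)"
    unfolding p_laplace_def abs_minus_cancel by (rule integral_abs_bound)
  also have "\<dots> \<le> (\<integral>x. norm (wg u x) powr p + norm (wg v x) powr p \<partial>L)"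
    using flux_integrable[OF uD(2) vD(2)] in_Lp_powr_integrable[OF uD(2)] in_Lp_powr_integrable[OF vD(2)]
    by (intro integral_mono flux_inner_bound) auto
  also have "\<dots> = (\<integral>x. norm (wg u x) powr p \<partial>L) + (\<integral>x. norm (wg v x) powr p \<partial>L)"
    using in_Lp_powr_integrable[OF uD(2)] in_Lp_powr_integrable[OF vD(2)] by simp
  also have "\<dots> \<le> V_norm D p u powr p + V_norm D p v powr p"
    using V_norm_ge[OF u] V_norm_ge[OF v] by simp
  finally show ?thesis .
qed

text \<open>Serves measurability in time: the approximation of a solution by V-valued simple
  functions carries over to the pairing. By \<open>p_young\<close> the error splits into a fixed
  quantity multiplied by \<theta> and terms that vanish with the gradient differences.\<close>

theorem p_laplace_continuous:
  assumes u: "u \<in> V_space D p" and v: "v \<in> V_space D p" and s: "\<And>k. s k \<in> V_space D p"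
    and lim: "(\<lambda>k. V_norm D p (u - s k)) \<longlonglongrightarrow> 0"
  shows "(\<lambda>k. p_laplace D p (s k) v) \<longlonglongrightarrow> p_laplace D p u v"
proof -
  note uD = V_spaceD[OF u] and vD = V_spaceD[OF v] and sD = V_spaceD[OF s]
  define I where "I k = (\<integral>x. norm (wg u x - wg (s k) x) powr p \<partial>L)" for k
  have I0: "0 \<le> I k" for k unfolding I_def by (intro Bochner_Integration.integral_nonneg) simp
  have "(\<lambda>k. V_norm D p (u - s k) powr p) \<longlonglongrightarrow> 0 powr p"
    using p1 by (intro tendsto_powr2 lim tendsto_const) (auto simp: V_norm_def W1p_norm_def)
  then have limp: "(\<lambda>k. V_norm D p (u - s k) powr p) \<longlonglongrightarrow> 0" by simp
  have I: "I \<longlonglongrightarrow> 0"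
    by (rule tendsto_sandwich[OF _ _ tendsto_const limp])
      (use I0 V_norm_diff_ge[OF u s] in \<open>auto simp: I_def\<close>)
  define A where "A = (\<integral>x. norm (wg u x) powr p \<partial>L)"
  define B where "B = (\<integral>x. norm (wg v x) powr p \<partial>L)"
  have AB: "0 \<le> A" "0 \<le> B" by (auto simp: A_def B_def intro!: Bochner_Integration.integral_nonneg)
  have est: "\<bar>p_laplace D p (s k) v - p_laplace D p u v\<bar> \<le> p * (\<theta> * ((1 + 2 powr p) * A + 2 powr p * I k + B + 2 powr p * A) + \<theta> powr (1 - p) * I k)"
    if th: "0 < \<theta>" for \<theta> k
  proof -
    let ?g = "wg (s k)" and ?f = "wg u" and ?h = "wg v"
    let ?m = "\<lambda>x. max (norm (?g x)) (norm (?f x))"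
    have i: "integrable L (\<lambda>x. norm (?f x) powr p)" "integrable L (\<lambda>x. norm (?h x) powr p)" "integrable L (\<lambda>x. norm (?f x - ?g x) powr p)"
      using in_Lp_powr_integrable uD(2) vD(2) in_Lp_diff[OF uD(2) sD(2)] by auto
    have "p_laplace D p (s k) v - p_laplace D p u v = - (\<integral>x. norm (?g x) powr (p - 2) * (?g x \<bullet> ?h x) - norm (?f x) powr (p - 2) * (?f x \<bullet> ?h x) \<partial>L)"
      unfolding p_laplace_def using flux_integrable[OF sD(2) vD(2)] flux_integrable[OF uD(2) vD(2)] by simp
    then have "\<bar>p_laplace D p (s k) v - p_laplace D p u v\<bar> \<le> (\<integral>x. \<bar>norm (?g x) powr (p - 2) * (?g x \<bullet> ?h x) - norm (?f x) powr (p - 2) * (?f x \<bullet> ?h x)\<bar> \<partial>L)"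
      by (simp add: integral_abs_bound)
    also have "\<dots> \<le> (\<integral>x. p * (\<theta> * ((1 + 2 powr p) * norm (?f x) powr p + 2 powr p * norm (?f x - ?g x) powr p + norm (?h x) powr p + 2 powr p * norm (?f x) powr p) + \<theta> powr (1 - p) * norm (?f x - ?g x) powr p) \<partial>L)"
    proof (rule integral_mono)
      show "integrable L (\<lambda>x. \<bar>norm (?g x) powr (p - 2) * (?g x \<bullet> ?h x) - norm (?f x) powr (p - 2) * (?f x \<bullet> ?h x)\<bar>)"
        using flux_integrable[OF sD(2) vD(2)] flux_integrable[OF uD(2) vD(2)] by simp
      show "integrable L (\<lambda>x. p * (\<theta> * ((1 + 2 powr p) * norm (?f x) powr p + 2 powr p * norm (?f x - ?g x) powr p + norm (?h x) powr p + 2 powr p * norm (?f x) powr p) + \<theta> powr (1 - p) * norm (?f x - ?g x) powr p))"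
        by (intro integrable_mult_right Bochner_Integration.integrable_add i)
      fix x
      have "\<bar>norm (?g x) powr (p - 2) * (?g x \<bullet> ?h x) - norm (?f x) powr (p - 2) * (?f x \<bullet> ?h x)\<bar>
        = \<bar>(norm (?g x) powr (p - 2) *\<^sub>R ?g x - norm (?f x) powr (p - 2) *\<^sub>R ?f x) \<bullet> ?h x\<bar>"
        by (simp add: inner_diff_left)
      also have "\<dots> \<le> norm (norm (?g x) powr (p - 2) *\<^sub>R ?g x - norm (?f x) powr (p - 2) *\<^sub>R ?f x) * norm (?h x)"
        by (rule Cauchy_Schwarz_ineq2)
      also have "\<dots> \<le> p * ?m x powr (p - 2) * norm (?g x - ?f x) * norm (?h x)"
        by (intro mult_right_mono p_flux_lipschitz p2) simp
      also have "\<dots> = p * (?m x powr (p - 2) * norm (?f x - ?g x) * norm (?h x))" by (simp add: norm_minus_commute)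
      also have "\<dots> \<le> p * (\<theta> * (?m x powr p + norm (?h x) powr p) + \<theta> powr (1 - p) * norm (?f x - ?g x) powr p)"
        using p2 th by (intro mult_left_mono p_young) (auto simp: le_max_iff_disj)
      also have "\<dots> \<le> p * (\<theta> * ((1 + 2 powr p) * norm (?f x) powr p + 2 powr p * norm (?f x - ?g x) powr p + norm (?h x) powr p + 2 powr p * norm (?f x) powr p) + \<theta> powr (1 - p) * norm (?f x - ?g x) powr p)"
      proof -
        have "norm (?g x) powr p \<le> 2 powr p * (norm (?g x - ?f x) powr p + norm (?f x) powr p)"
          using powr_add_le[of p "?g x - ?f x" "?f x"] p2 by simp
        moreover have "?m x powr p \<le> norm (?g x) powr p + norm (?f x) powr p" by (auto simp: max_def)
        ultimately have "?m x powr p \<le> (1 + 2 powr p) * norm (?f x) powr p + 2 powr p * norm (?f x - ?g x) powr p"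
          by (simp add: norm_minus_commute algebra_simps)
        moreover have "0 \<le> 2 powr p * norm (?f x) powr p" by simp
        ultimately have "?m x powr p + norm (?h x) powr p \<le> (1 + 2 powr p) * norm (?f x) powr p + 2 powr p * norm (?f x - ?g x) powr p + norm (?h x) powr p + 2 powr p * norm (?f x) powr p"
          by linarith
        then show ?thesis using th p2 by (intro mult_left_mono add_right_mono) simp_all
      qed
      finally show "\<bar>norm (?g x) powr (p - 2) * (?g x \<bullet> ?h x) - norm (?f x) powr (p - 2) * (?f x \<bullet> ?h x)\<bar> \<le> p * (\<theta> * ((1 + 2 powr p) * norm (?f x) powr p + 2 powr p * norm (?f x - ?g x) powr p + norm (?h x) powr p + 2 powr p * norm (?f x) powr p) + \<theta> powr (1 - p) * norm (?f x - ?g x) powr p)" .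
    qed
    also have "\<dots> = p * (\<theta> * ((1 + 2 powr p) * A + 2 powr p * I k + B + 2 powr p * A) + \<theta> powr (1 - p) * I k)"
      using i by (simp add: A_def B_def I_def)
    finally show ?thesis .
  qed
  define K where "K = (1 + 2 powr p) * A + B + 2 powr p * A"
  have K: "0 \<le> K" unfolding K_def using AB by (intro add_nonneg_nonneg mult_nonneg_nonneg) auto
  show ?thesis
  proof (rule LIMSEQ_I)
    fix r :: real assume r: "0 < r"
    \<comment> \<open>Makes \<open>p * \<theta> * K\<close>, the part that does not vanish in the
      limit, smaller than \<open>r / 2\<close>; \<open>K + 1\<close> because \<open>K\<close> may be
      0.\<close>
    define \<theta> where "\<theta> = r / (2 * p * (K + 1))"
    have th0: "0 < \<theta>" using r K p2 by (simp add: \<theta>_def)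
    have "p * \<theta> * (K + 1) = r / 2" using K p2 unfolding \<theta>_def by (simp add: divide_simps)
    moreover have "0 < p * \<theta>" using p2 th0 by simp
    ultimately have th: "0 < \<theta>" "p * \<theta> * K < r / 2" using th0 by (auto simp: distrib_left)
    have "(\<lambda>k. p * (\<theta> * (2 powr p * I k) + \<theta> powr (1 - p) * I k)) \<longlonglongrightarrow> p * (\<theta> * (2 powr p * 0) + \<theta> powr (1 - p) * 0)"
      by (intro tendsto_intros I)
    from order_tendstoD(2)[OF this, of "r / 2"] r
    have "\<forall>\<^sub>F k in sequentially. p * (\<theta> * (2 powr p * I k) + \<theta> powr (1 - p) * I k) < r / 2" by simp
    then obtain N where N: "\<And>k. N \<le> k \<Longrightarrow> p * (\<theta> * (2 powr p * I k) + \<theta> powr (1 - p) * I k) < r / 2"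
      by (auto simp: eventually_sequentially)
    have "norm (p_laplace D p (s k) v - p_laplace D p u v) < r" if "N \<le> k" for k
      using est[OF th(1), of k] N[OF that] th(2) by (simp add: K_def algebra_simps)
    then show "\<exists>no. \<forall>n\<ge>no. norm (p_laplace D p (s n) v - p_laplace D p u v) < r" by blast
  qed
qed

end

section \<open>Barenblatt profiles\<close>

lemma gradient_eqI: "(f has_derivative (\<lambda>v. g \<bullet> v)) (at x) \<Longrightarrow> gradient f x = g"
  using gradient_inner[of f "\<lambda>v. g \<bullet> v" x] by (metis euclidean_eqI)

definition pos_powr :: "real \<Rightarrow> real \<Rightarrow> real" where
  "pos_powr r y = max 0 y powr r"

lemma pos_powr_neg: "y \<le> 0 \<Longrightarrow> pos_powr r y = 0" by (simp add: pos_powr_def)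

lemma continuous_on_pos_powr: "0 < r \<Longrightarrow> continuous_on A (pos_powr r)"
  unfolding pos_powr_def by (intro continuous_on_powr' continuous_intros) auto

lemma pos_powr_has_derivative:
  assumes r: "1 < r"
  shows "(pos_powr r has_real_derivative r * pos_powr (r - 1) y) (at y)"
proof -
  consider "0 < y" | "y < 0" | "y = 0" by linarith
  then show ?thesis
  proof cases
    case 1
    have "((\<lambda>y. y powr r) has_real_derivative r * pos_powr (r - 1) y) (at y)"
      using has_real_derivative_powr[OF 1, of r] 1 by (simp add: pos_powr_def)
    then show ?thesis
      by (rule has_field_derivative_transform_within_open[where S = "{0<..}"]) (use 1 in \<open>auto simp: pos_powr_def\<close>)
  next
    case 2
    have "((\<lambda>_. 0) has_real_derivative 0) (at y)" by simp
    then have "(pos_powr r has_real_derivative 0) (at y)"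
      by (rule has_field_derivative_transform_within_open[where S = "{..<0}"]) (use 2 in \<open>auto simp: pos_powr_def\<close>)
    then show ?thesis using 2 by (simp add: pos_powr_neg)
  next
    case 3
    have "(\<lambda>h. pos_powr (r - 1) h) \<midarrow>0\<rightarrow> 0"
      using continuous_on_pos_powr[of "r - 1" UNIV] r
      by (auto simp: continuous_on_eq_continuous_at isCont_def pos_powr_neg dest!: spec[of _ 0])
    moreover have "\<forall>\<^sub>F h in at 0. pos_powr (r - 1) h = (pos_powr r (0 + h) - pos_powr r 0) / h"
    proof (intro eventually_at_topological[THEN iffD2] exI[of _ UNIV] conjI ballI impI)
      fix h :: real assume "h \<noteq> 0"
      then show "pos_powr (r - 1) h = (pos_powr r (0 + h) - pos_powr r 0) / h"
        by (cases "0 < h") (auto simp: pos_powr_def powr_diff max_def)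
    qed auto
    ultimately have "(\<lambda>h. (pos_powr r (0 + h) - pos_powr r 0) / h) \<midarrow>0\<rightarrow> 0"
      by (rule Lim_transform_eventually)
    then show ?thesis unfolding 3 DERIV_def by (simp add: pos_powr_neg)
  qed
qed

text \<open>Up to the factor \<open>q\<close> the gradient of \<open>norm x powr q\<close>, with
  value 0 at the origin.\<close>

definition radial :: "real \<Rightarrow> 'a::real_inner \<Rightarrow> 'a" where
  "radial q x = norm x powr (q - 2) *\<^sub>R x"

lemma norm_radial: "norm (radial q x) = norm x powr (q - 1)"
  using powr_mult_base[of "norm x" "q - 2"] by (simp add: radial_def mult.commute)

lemma inner_radial: "x \<bullet> radial q x = norm x powr q"
proof (cases "x = 0")
  case False
  then show ?thesis
    by (simp add: radial_def power2_norm_eq_inner[symmetric] powr_diff)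
qed (simp add: radial_def)

text \<open>For the Barenblatt exponent, which lies between 1 and 2, the scalar factor is singular
  at the origin; there continuity is read off from the norm
  \<open>norm x powr (q - 1)\<close>.\<close>

lemma continuous_on_radial:
  assumes "1 < q"
  shows "continuous_on A (radial q :: 'a::real_inner \<Rightarrow> 'a)"
proof (rule continuous_at_imp_continuous_on, rule ballI)
  fix x :: 'a
  show "isCont (radial q) x"
  proof (cases "x = 0")
    case False
    then show ?thesis unfolding radial_def[abs_def] by (intro continuous_intros) auto
  next
    case True
    have "((\<lambda>y::'a. norm y powr (q - 1)) \<longlongrightarrow> norm (0::'a) powr (q - 1)) (at 0)"
      using assms by (intro tendsto_powr2 tendsto_intros) auto
    then have "((\<lambda>y::'a. norm (radial q y)) \<longlongrightarrow> 0) (at 0)" by (simp add: norm_radial)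
    then have "((radial q :: 'a \<Rightarrow> 'a) \<longlongrightarrow> 0) (at 0)" by (rule tendsto_norm_zero_cancel)
    then show ?thesis unfolding True isCont_def by (simp add: radial_def[of q 0])
  qed
qed

lemma norm_powr_has_derivative:
  fixes x :: "'a::real_inner"
  assumes q: "1 < q"
  shows "((\<lambda>x. norm x powr q) has_derivative (\<lambda>v. (q *\<^sub>R radial q x) \<bullet> v)) (at x)"
proof (cases "x = 0")
  case False
  have "((\<lambda>y. y powr q) has_real_derivative q * norm x powr (q - 1)) (at (norm x))"
    using has_real_derivative_powr[of "norm x" q] False by simp
  then have "((\<lambda>x. norm x powr q) has_derivative (\<lambda>v. q * norm x powr (q - 1) * (sgn x \<bullet> v))) (at x)"
    using has_derivative_compose[OF has_derivative_norm[OF False], of "\<lambda>y. y powr q"]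
    by (auto simp: has_field_derivative_def inner_commute)
  moreover have "q * norm x powr (q - 1) * (sgn x \<bullet> v) = (q *\<^sub>R radial q x) \<bullet> v" for v
    using False by (simp add: radial_def sgn_div_norm powr_diff power2_eq_square divide_inverse)
  ultimately show ?thesis by simp
next
  case True
  have "((\<lambda>y::'a. norm y powr (q - 1)) \<longlongrightarrow> norm (0::'a) powr (q - 1)) (at 0)"
    using q by (intro tendsto_powr2 tendsto_intros) auto
  then have "((\<lambda>y::'a. norm y powr (q - 1)) \<longlongrightarrow> 0) (at 0)" by simp
  moreover have "\<forall>\<^sub>F y::'a in at 0. norm y powr (q - 1) = norm (norm (0 + y) powr q - norm (0::'a) powr q - (q *\<^sub>R radial q 0) \<bullet> y) / norm y"
    by (intro eventually_at_topological[THEN iffD2] exI[of _ UNIV]) (auto simp: powr_diff radial_def)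
  ultimately have "((\<lambda>y::'a. norm (norm (0 + y) powr q - norm (0::'a) powr q - (q *\<^sub>R radial q 0) \<bullet> y) / norm y) \<longlongrightarrow> 0) (at 0)"
    by (rule Lim_transform_eventually)
  then show ?thesis unfolding True has_derivative_at by (intro conjI bounded_linear_inner_right)
qed


section \<open>Classical functions in the energy space\<close>

text \<open>
  Bounded pointwise convergence on the bounded set \<open>D\<close> suffices for convergence in \<open>V\<close>; the test
  functions need not be constructed by mollification.
\<close>

definition V_approx :: "'a::euclidean_space set \<Rightarrow> ('a \<Rightarrow> real) \<Rightarrow> ('a \<Rightarrow> 'a) \<Rightarrow> bool" where
  "V_approx D f G \<longleftrightarrow> C1_supported D f G \<and> (\<exists>\<psi> M. (\<forall>k::nat. test_function D (\<psi> k)) \<and>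
     (\<forall>x. (\<lambda>k. \<psi> k x) \<longlonglongrightarrow> f x) \<and> (\<forall>x. (\<lambda>k. gradient (\<psi> k) x) \<longlonglongrightarrow> G x) \<and>
     (\<forall>k x. \<bar>\<psi> k x\<bar> \<le> M) \<and> (\<forall>k x. norm (gradient (\<psi> k) x) \<le> M))"

lemma test_function_derivative:
  "test_function D \<psi> \<Longrightarrow> (\<psi> has_derivative (\<lambda>v. gradient \<psi> x \<bullet> v)) (at x)"
  by (intro smooth_on_has_derivative) (simp add: test_function_def)

lemma C1_supported_sum:
  assumes "finite S" "\<And>c. c \<in> S \<Longrightarrow> C1_supported D (f c) (G c)"
  shows "C1_supported D (\<lambda>x. \<Sum>c\<in>S. f c x) (\<lambda>x. \<Sum>c\<in>S. G c x)"
proof -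
  have "\<forall>c\<in>S. \<exists>K. compact K \<and> K \<subseteq> D \<and> (\<forall>x. x \<notin> K \<longrightarrow> f c x = 0 \<and> G c x = 0)"
    using assms(2) by (auto simp: C1_supported_def)
  then obtain K where K: "\<And>c. c \<in> S \<Longrightarrow> compact (K c) \<and> K c \<subseteq> D \<and> (\<forall>x. x \<notin> K c \<longrightarrow> f c x = 0 \<and> G c x = 0)"
    by metis
  show ?thesis unfolding C1_supported_def
  proof (intro conjI allI exI[of _ "\<Union>c\<in>S. K c"] impI)
    show "((\<lambda>x. \<Sum>c\<in>S. f c x) has_derivative (\<lambda>v. (\<Sum>c\<in>S. G c x) \<bullet> v)) (at x)" for x
      unfolding inner_sum_left using assms(2) by (intro has_derivative_sum) (auto simp: C1_supported_def)
    show "continuous_on UNIV (\<lambda>x. \<Sum>c\<in>S. G c x)"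
      using assms(2) by (intro continuous_intros) (auto simp: C1_supported_def)
  qed (use K assms(1) in \<open>auto intro!: compact_UN sum.neutral\<close>)
qed

lemma C1_supported_scale:
  assumes "C1_supported D f G"
  shows "C1_supported D (\<lambda>x. a * f x) (\<lambda>x. a *\<^sub>R G x)"
proof -
  obtain K where K: "compact K" "K \<subseteq> D" "\<And>x. x \<notin> K \<Longrightarrow> f x = 0 \<and> G x = 0"
    and d: "\<And>x. (f has_derivative (\<lambda>v. G x \<bullet> v)) (at x)" and c: "continuous_on UNIV G"
    using assms by (auto simp: C1_supported_def)
  have d': "((\<lambda>x. a * f x) has_derivative (\<lambda>v. (a *\<^sub>R G x) \<bullet> v)) (at x)" for x
    using has_derivative_mult_right[OF d[of x], of a] by simp
  have c': "continuous_on UNIV (\<lambda>x. a *\<^sub>R G x)" using c by (intro continuous_intros)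
  show ?thesis unfolding C1_supported_def
    by (intro conjI allI impI exI[of _ K] d' c') (use K in auto)
qed

lemma test_function_scale: "test_function D \<psi> \<Longrightarrow> test_function D (\<lambda>x. a * \<psi> x)"
  unfolding test_function_def smooth_on_def by (auto intro!: Ck_on_mult Ck_on_const)

lemma test_function_sum:
  assumes "finite S" "\<And>c. c \<in> S \<Longrightarrow> test_function D (\<psi> c)"
  shows "test_function D (\<lambda>x. \<Sum>c\<in>S. \<psi> c x)"
proof -
  have "\<forall>c\<in>S. \<exists>K. compact K \<and> K \<subseteq> D \<and> (\<forall>x. x \<notin> K \<longrightarrow> \<psi> c x = 0)"
    using assms(2) by (auto simp: test_function_def)
  then obtain K where K: "\<And>c. c \<in> S \<Longrightarrow> compact (K c) \<and> K c \<subseteq> D \<and> (\<forall>x. x \<notin> K c \<longrightarrow> \<psi> c x = 0)"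
    by metis
  show ?thesis unfolding test_function_def smooth_on_def
  proof (intro conjI allI exI[of _ "\<Union>c\<in>S. K c"] impI)
    show "Ck_on k UNIV (\<lambda>x. \<Sum>c\<in>S. \<psi> c x)" for k
      using assms(2) by (intro Ck_on_sum) (auto simp: test_function_def smooth_on_def)
  qed (use K assms(1) in \<open>auto intro!: compact_UN sum.neutral\<close>)
qed

lemma V_approx_scale:
  assumes "V_approx D f G"
  shows "V_approx D (\<lambda>x. a * f x) (\<lambda>x. a *\<^sub>R G x)"
proof -
  obtain \<psi> M where C: "C1_supported D f G" and t: "\<And>k::nat. test_function D (\<psi> k)"
    and l: "\<And>x. (\<lambda>k. \<psi> k x) \<longlonglongrightarrow> f x" "\<And>x. (\<lambda>k. gradient (\<psi> k) x) \<longlonglongrightarrow> G x"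
    and b: "\<And>k x. \<bar>\<psi> k x\<bar> \<le> M" "\<And>k x. norm (gradient (\<psi> k) x) \<le> M"
    using assms by (auto simp: V_approx_def)
  have g: "gradient (\<lambda>x. a * \<psi> k x) x = a *\<^sub>R gradient (\<psi> k) x" for k x
    by (rule gradient_eqI) (use has_derivative_mult_right[OF test_function_derivative[OF t], of a] in simp)
  show ?thesis unfolding V_approx_def
  proof (intro conjI exI allI)
    show "C1_supported D (\<lambda>x. a * f x) (\<lambda>x. a *\<^sub>R G x)" by (rule C1_supported_scale[OF C])
    show "test_function D (\<lambda>x. a * \<psi> k x)" for k by (rule test_function_scale[OF t])
    show "(\<lambda>k. a * \<psi> k x) \<longlonglongrightarrow> a * f x" for x by (intro tendsto_intros l)
    show "(\<lambda>k. gradient (\<lambda>x. a * \<psi> k x) x) \<longlonglongrightarrow> a *\<^sub>R G x" for x unfolding g by (intro tendsto_intros l)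
    show "\<bar>a * \<psi> k x\<bar> \<le> \<bar>a\<bar> * M" "norm (gradient (\<lambda>x. a * \<psi> k x) x) \<le> \<bar>a\<bar> * M" for k x
      unfolding g using b[of k x] by (auto simp: abs_mult intro!: mult_left_mono)
  qed
qed

lemma V_approx_sum:
  assumes S: "finite S" and V: "\<And>c. c \<in> S \<Longrightarrow> V_approx D (f c) (G c)"
  shows "V_approx D (\<lambda>x. \<Sum>c\<in>S. f c x) (\<lambda>x. \<Sum>c\<in>S. G c x)"
proof -
  have "\<forall>c\<in>S. \<exists>\<psi> M. (\<forall>k::nat. test_function D (\<psi> k)) \<and>
     (\<forall>x. (\<lambda>k. \<psi> k x) \<longlonglongrightarrow> f c x) \<and> (\<forall>x. (\<lambda>k. gradient (\<psi> k) x) \<longlonglongrightarrow> G c x) \<and>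
     (\<forall>k x. \<bar>\<psi> k x\<bar> \<le> M) \<and> (\<forall>k x. norm (gradient (\<psi> k) x) \<le> M)"
    using V unfolding V_approx_def by blast
  from bchoice[OF this] obtain \<psi> where "\<forall>c\<in>S. \<exists>M. (\<forall>k::nat. test_function D (\<psi> c k)) \<and>
     (\<forall>x. (\<lambda>k. \<psi> c k x) \<longlonglongrightarrow> f c x) \<and> (\<forall>x. (\<lambda>k. gradient (\<psi> c k) x) \<longlonglongrightarrow> G c x) \<and>
     (\<forall>k x. \<bar>\<psi> c k x\<bar> \<le> M) \<and> (\<forall>k x. norm (gradient (\<psi> c k) x) \<le> M)" ..
  from bchoice[OF this] obtain M where H: "\<forall>c\<in>S. (\<forall>k::nat. test_function D (\<psi> c k)) \<and>
     (\<forall>x. (\<lambda>k. \<psi> c k x) \<longlonglongrightarrow> f c x) \<and> (\<forall>x. (\<lambda>k. gradient (\<psi> c k) x) \<longlonglongrightarrow> G c x) \<and>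
     (\<forall>k x. \<bar>\<psi> c k x\<bar> \<le> M c) \<and> (\<forall>k x. norm (gradient (\<psi> c k) x) \<le> M c)" ..
  have t: "\<And>c k. c \<in> S \<Longrightarrow> test_function D (\<psi> c k)"
    and l: "\<And>c x. c \<in> S \<Longrightarrow> (\<lambda>k::nat. \<psi> c k x) \<longlonglongrightarrow> f c x" "\<And>c x. c \<in> S \<Longrightarrow> (\<lambda>k. gradient (\<psi> c k) x) \<longlonglongrightarrow> G c x"
    and b: "\<And>c k x. c \<in> S \<Longrightarrow> \<bar>\<psi> c k x\<bar> \<le> M c" "\<And>c k x. c \<in> S \<Longrightarrow> norm (gradient (\<psi> c k) x) \<le> M c"
    using H by simp_all
  have g: "gradient (\<lambda>x. \<Sum>c\<in>S. \<psi> c k x) x = (\<Sum>c\<in>S. gradient (\<psi> c k) x)" for k x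
    by (rule gradient_eqI) (unfold inner_sum_left, intro has_derivative_sum test_function_derivative[OF t])
  show ?thesis unfolding V_approx_def
  proof (intro conjI exI allI)
    show "C1_supported D (\<lambda>x. \<Sum>c\<in>S. f c x) (\<lambda>x. \<Sum>c\<in>S. G c x)"
      using V by (intro C1_supported_sum S) (auto simp: V_approx_def)
    show "test_function D (\<lambda>x. \<Sum>c\<in>S. \<psi> c k x)" for k by (intro test_function_sum S t)
    show "(\<lambda>k. \<Sum>c\<in>S. \<psi> c k x) \<longlonglongrightarrow> (\<Sum>c\<in>S. f c x)" for x by (intro tendsto_sum l)
    show "(\<lambda>k. gradient (\<lambda>x. \<Sum>c\<in>S. \<psi> c k x) x) \<longlonglongrightarrow> (\<Sum>c\<in>S. G c x)" for x
      unfolding g by (intro tendsto_sum l)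
    show "\<bar>\<Sum>c\<in>S. \<psi> c k x\<bar> \<le> (\<Sum>c\<in>S. M c)" for k x
      by (rule order_trans[OF sum_abs]) (intro sum_mono b)
    show "norm (gradient (\<lambda>x. \<Sum>c\<in>S. \<psi> c k x) x) \<le> (\<Sum>c\<in>S. M c)" for k x
      unfolding g by (rule order_trans[OF norm_sum]) (intro sum_mono b)
  qed
qed

lemma (in sobolev) V_approx_in_V: "V_approx D f G \<Longrightarrow> abs_l2 f \<in> V_space D p"
  unfolding V_approx_def by (elim conjE exE) (rule abs_C1_in_V, auto)


section \<open>The Barenblatt solution\<close>

text \<open>
  The Barenblatt solution \<open>U\<close> of \<open>\<partial>\<^sub>t U = div (|\<nabla>U|\<^sup>p\<^sup>-\<^sup>2 \<nabla>U)\<close> in dimension \<open>d\<close>, with \<open>dU\<close> its gradient,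
  \<open>Ut\<close> its time derivative and \<open>rad\<close> the radius of its support. The constraint on \<open>lam\<close> makes the
  total mass constant in time, the one on \<open>k\<close> balances the two sides of the equation.
\<close>

locale barenblatt =
  fixes p d lam q gam k :: real
  assumes p: "2 < p" and d: "0 \<le> d" and lam: "lam * (d * (p - 2) + p) = 1"
    and q_def: "q = p / (p - 1)" and gam_def: "gam = (p - 1) / (p - 2)"
    and k_pos: "0 < k" and k: "(k * gam * q) powr (p - 1) = lam"
begin

lemma q: "1 < q" and gam: "1 < gam" and lam_pos: "0 < lam"
proof -
  show "1 < q" "1 < gam" using p by (auto simp: q_def gam_def field_simps)
  have "0 < d * (p - 2) + p" using p d by (intro add_nonneg_pos) auto
  then show "0 < lam" using lam zero_less_mult_pos2[of lam "d * (p - 2) + p"] by simp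
qed

definition Y where "Y C t x = C - k * t powr (- lam * q) * norm x powr q" for x :: "'a::euclidean_space"
definition U where "U C t x = t powr (- d * lam) * pos_powr gam (Y C t x)" for x :: "'a::euclidean_space"
definition dU where "dU C t x = - (t powr (- d * lam - lam * q) * (k * gam * q) * pos_powr (gam - 1) (Y C t x)) *\<^sub>R radial q x"
  for x :: "'a::euclidean_space"
text \<open>Written as the divergence of the field \<open>- (lam / t * U C t x) *\<^sub>R x\<close>,
  the form in which the flux delivers it.\<close>

definition Ut where "Ut C t x = - (lam / t) * (d * U C t x + x \<bullet> dU C t x)" for x :: "'a::euclidean_space"
definition rad where "rad C t = t powr lam * (C / k) powr (1 / q)"

lemma Y_nonpos:
  assumes "0 < C" "0 < t" "rad C t \<le> norm x"
  shows "Y C t x \<le> 0"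
proof -
  have r0: "0 \<le> rad C t" by (simp add: rad_def)
  have "rad C t powr q = t powr (lam * q) * (C / k)"
    using q assms k_pos unfolding rad_def by (simp add: powr_mult powr_powr)
  then have "t powr (lam * q) * (C / k) \<le> norm x powr q"
    using powr_mono2[of q "rad C t" "norm x"] q assms r0 by simp
  then have "k * t powr (- lam * q) * (t powr (lam * q) * (C / k)) \<le> k * t powr (- lam * q) * norm x powr q"
    using k_pos by (intro mult_left_mono) auto
  moreover have "k * t powr (- lam * q) * (t powr (lam * q) * (C / k)) = C"
    using k_pos assms by (simp add: powr_minus field_simps)
  ultimately show ?thesis by (simp add: Y_def)
qed

lemma outside_zero:
  assumes "0 < C" "0 < t" "rad C t \<le> norm x"
  shows "U C t x = 0" "dU C t x = 0" "Ut C t x = 0"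
  using Y_nonpos[OF assms] by (simp_all add: U_def dU_def Ut_def pos_powr_neg)

lemma continuous_on_U:
  assumes "continuous_on A f" "continuous_on A g" "\<And>a. a \<in> A \<Longrightarrow> 0 < f a"
  shows "continuous_on A (\<lambda>a. U C (f a) (g a))" "continuous_on A (\<lambda>a. dU C (f a) (g a))" "continuous_on A (\<lambda>a. Ut C (f a) (g a))"
proof -
  have f0: "\<forall>a\<in>A. f a \<noteq> 0" using assms(3) by force
  have Y: "continuous_on A (\<lambda>a. Y C (f a) (g a))"
    unfolding Y_def using f0 q assms by (intro continuous_intros continuous_on_powr') auto
  have P: "continuous_on A (\<lambda>a. pos_powr r (Y C (f a) (g a)))" if "0 < r" for r
    by (rule continuous_on_compose2[OF continuous_on_pos_powr[OF that] Y]) auto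
  have R: "continuous_on A (\<lambda>a. radial q (g a))"
    by (rule continuous_on_compose2[OF continuous_on_radial[OF q] assms(2)]) auto
  show U: "continuous_on A (\<lambda>a. U C (f a) (g a))"
    unfolding U_def using gam f0 by (intro continuous_intros P assms) auto
  show dU: "continuous_on A (\<lambda>a. dU C (f a) (g a))"
    unfolding dU_def using gam f0 by (intro continuous_intros P R assms) auto
  show "continuous_on A (\<lambda>a. Ut C (f a) (g a))"
    unfolding Ut_def using f0 by (intro continuous_intros U dU assms) auto
qed

text \<open>Up to time \<open>T\<close> all supports lie in one ball, so compactness gives the
  bounds.\<close>

lemma bounded_U:
  assumes C: "0 < C"
  obtains M where "\<And>t x. 1 \<le> t \<Longrightarrow> t \<le> T \<Longrightarrow> \<bar>U C t (x::'a::euclidean_space)\<bar> \<le> M \<and> norm (dU C t x) \<le> M \<and> \<bar>Ut C t x\<bar> \<le> M"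
proof -
  define R where "R = T powr lam * (C / k) powr (1 / q)"
  let ?A = "{1..T} \<times> cball (0::'a) R"
  have cA: "compact ?A" by (intro compact_Times) auto
  have "continuous_on ?A (\<lambda>a. U C (fst a) (snd a))" "continuous_on ?A (\<lambda>a. dU C (fst a) (snd a))" "continuous_on ?A (\<lambda>a. Ut C (fst a) (snd a))"
    by (intro continuous_on_U continuous_intros; auto)+
  from this[THEN compact_continuous_image[OF _ cA], THEN compact_imp_bounded]
  obtain M1 M2 M3 where M: "\<forall>a\<in>?A. \<bar>U C (fst a) (snd a)\<bar> \<le> M1" "\<forall>a\<in>?A. norm (dU C (fst a) (snd a)) \<le> M2" "\<forall>a\<in>?A. \<bar>Ut C (fst a) (snd a)\<bar> \<le> M3"
    by (auto simp: bounded_iff)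
  define M where "M = max 0 (max M1 (max M2 M3))"
  have "\<bar>U C t x\<bar> \<le> M \<and> norm (dU C t x) \<le> M \<and> \<bar>Ut C t x\<bar> \<le> M" if t: "1 \<le> t" "t \<le> T" for t and x :: 'a
  proof (cases "norm x \<le> R")
    case True
    then have "(t, x) \<in> ?A" using t by auto
    then have "\<bar>U C t x\<bar> \<le> M1" "norm (dU C t x) \<le> M2" "\<bar>Ut C t x\<bar> \<le> M3"
      using M by force+
    then show ?thesis by (auto simp: M_def)
  next
    case False
    have "rad C t \<le> R" unfolding rad_def R_def using t lam_pos by (intro mult_right_mono powr_mono2) auto
    then show ?thesis using outside_zero[of C t x] False C t by (simp add: M_def)
  qed
  then show thesis by (rule that)
qed

lemma U_has_derivative:
  "(U C t has_derivative (\<lambda>v. dU C t x \<bullet> v)) (at (x::'a::euclidean_space))"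
proof -
  have "(Y C t has_derivative (\<lambda>v. 0 - k * t powr (- lam * q) * ((q *\<^sub>R radial q x) \<bullet> v))) (at x)"
    unfolding Y_def[abs_def] by (intro has_derivative_diff has_derivative_const has_derivative_mult_right norm_powr_has_derivative q)
  then have "((\<lambda>x. pos_powr gam (Y C t x)) has_derivative (\<lambda>v. gam * pos_powr (gam - 1) (Y C t x) * (0 - k * t powr (- lam * q) * ((q *\<^sub>R radial q x) \<bullet> v)))) (at x)"
    by (rule has_derivative_compose) (use pos_powr_has_derivative[OF gam] in \<open>simp add: has_field_derivative_def\<close>)
  from has_derivative_mult_right[OF this, of "t powr (- d * lam)"]
  show ?thesis
    unfolding U_def[abs_def]
    by (rule has_derivative_eq_rhs) (simp add: fun_eq_iff dU_def powr_diff powr_minus divide_inverse)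
qed

text \<open>The power \<open>norm x powr q\<close> from differentiating \<open>Y\<close> reappears
  as \<open>x \<bullet> radial q x\<close>, which turns the time derivative into the divergence form
  of \<open>Ut\<close>.\<close>

lemma U_time_derivative:
  assumes "0 < t"
  shows "((\<lambda>t. U C t x) has_real_derivative Ut C t x) (at t)"
proof -
  have Y: "((\<lambda>t. Y C t x) has_real_derivative k * lam * q * t powr (- lam * q - 1) * norm x powr q) (at t)"
    unfolding Y_def using assms by (auto intro!: derivative_eq_intros)
  have A: "((\<lambda>t. pos_powr gam (Y C t x)) has_real_derivative gam * pos_powr (gam - 1) (Y C t x) * (k * lam * q * t powr (- lam * q - 1) * norm x powr q)) (at t)"
    by (rule DERIV_chain2[OF pos_powr_has_derivative[OF gam] Y])
  have B: "((\<lambda>t. t powr (- d * lam)) has_real_derivative (- d * lam) * t powr (- d * lam - 1)) (at t)"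
    using assms by (auto intro!: derivative_eq_intros)
  have A1: "((\<lambda>t. U C t x) has_real_derivative (- d * lam) * t powr (- d * lam - 1) * pos_powr gam (Y C t x)
     + gam * pos_powr (gam - 1) (Y C t x) * (k * lam * q * t powr (- lam * q - 1) * norm x powr q) * t powr (- d * lam)) (at t)"
    unfolding U_def by (rule DERIV_mult[OF B A])
  have e: "t powr (- d * lam - 1) = t powr (- d * lam) / t" "t powr (- lam * q - 1) = t powr (- (lam * q)) / t"
    "t powr (- d * lam - lam * q) = t powr (- d * lam) * t powr (- (lam * q))"
    using assms by (auto simp: powr_diff powr_minus divide_inverse)
  have "(- d * lam) * t powr (- d * lam - 1) * pos_powr gam (Y C t x)
     + gam * pos_powr (gam - 1) (Y C t x) * (k * lam * q * t powr (- lam * q - 1) * norm x powr q) * t powr (- d * lam) = Ut C t x"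
    using assms unfolding Ut_def dU_def U_def e by (simp add: inner_radial field_simps)
  then show ?thesis using A1 by simp
qed

text \<open>The purpose of the exponents: \<open>(gam - 1) * (p - 2) = 1\<close> and
  \<open>(q - 1) * (p - 2) + (q - 2) = 0\<close> make the nonlinear flux collapse to
  \<open>U\<close> times a linear field. So the flux is as regular as \<open>U\<close>, and its
  divergence is elementary.\<close>

lemma U_flux:
  assumes t: "0 < t"
  shows "norm (dU C t x) powr (p - 2) *\<^sub>R dU C t x = - (lam / t * U C t x) *\<^sub>R (x::'a::euclidean_space)"
proof (cases "x = 0 \<or> Y C t x \<le> 0")
  case True
  then show ?thesis by (auto simp: dU_def U_def pos_powr_neg radial_def)
next
  case False
  then have x: "0 < norm x" and y: "0 < Y C t x" by auto
  define a where "a = t powr (- d * lam - lam * q) * (k * gam * q)"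
  have a: "0 < a" using t k_pos gam q by (simp add: a_def)
  have nd: "norm (dU C t x) = a * (Y C t x) powr (gam - 1) * norm x powr (q - 1)"
    using k_pos gam q y by (simp add: dU_def norm_radial a_def pos_powr_def abs_mult)
  have e1: "(gam - 1) * (p - 2) = 1" using p by (simp add: gam_def field_simps)
  have e2: "(q - 1) * (p - 2) + (q - 2) = 0" using p by (simp add: q_def field_simps)
  have n1: "norm (dU C t x) powr (p - 2) = a powr (p - 2) * Y C t x * norm x powr ((q - 1) * (p - 2))"
    unfolding nd using a x y e1 by (simp add: powr_mult powr_powr)
  have e3: "norm x powr ((q - 1) * (p - 2)) * norm x powr (q - 2) = 1"
    using x e2 by (simp add: powr_add[symmetric])
  have "norm (dU C t x) powr (p - 2) *\<^sub>R dU C t x = - (a powr (p - 2) * a * (Y C t x * Y C t x powr (gam - 1)) * (norm x powr ((q - 1) * (p - 2)) * norm x powr (q - 2))) *\<^sub>R x"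
    unfolding n1 using y by (simp add: dU_def radial_def a_def pos_powr_def mult_ac)
  also have "\<dots> = - (a powr (p - 1) * Y C t x powr gam) *\<^sub>R x"
    using powr_mult_base[of a "p - 2"] powr_mult_base[of "Y C t x" "gam - 1"] a y unfolding e3 by (simp add: mult.commute)
  also have "a powr (p - 1) = lam / t * t powr (- d * lam)"
  proof -
    \<comment> \<open>Here the constraint on \<open>lam\<close> enters: it makes the power of
      \<open>t\<close> equal to the one in \<open>U\<close> divided by \<open>t\<close>.\<close>
    have "(- d * lam - lam * q) * (p - 1) = - 1 + - d * lam"
    proof -
      have "q * (p - 1) = p" using p by (simp add: q_def)
      then have "(- d * lam - lam * q) * (p - 1) = - d * lam * (p - 1) - lam * p"
        by (simp add: left_diff_distrib mult.assoc)
      also have "\<dots> = - (lam * (d * (p - 2) + p)) - d * lam" by (simp add: algebra_simps)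
      finally show ?thesis using lam by simp
    qed
    then have "a powr (p - 1) = t powr (- 1 + - d * lam) * lam"
      unfolding a_def using t k k_pos gam q by (simp add: powr_mult powr_powr)
    also have "t powr (- 1 + - d * lam) = t powr (- 1) * t powr (- d * lam)" by (rule powr_add)
    finally show ?thesis using t by (simp add: powr_minus divide_inverse mult_ac)
  qed
  finally show ?thesis using y by (simp add: U_def pos_powr_def mult_ac)
qed

text \<open>
  \<open>U\<close> is smooth neither at the origin nor at the boundary of its support: the shift of \<open>x \<bullet> x\<close> by \<open>a\<close>
  repairs the former, \<open>flat\<close> the latter.
\<close>

definition U_smooth :: "real \<Rightarrow> real \<Rightarrow> real \<Rightarrow> 'a::euclidean_space \<Rightarrow> real" where
  "U_smooth a C t x = t powr (- d * lam) * flat a gam (C + - (k * t powr (- lam * q)) * (x \<bullet> x + a) powr (q / 2))"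

definition dU_smooth :: "real \<Rightarrow> real \<Rightarrow> real \<Rightarrow> 'a::euclidean_space \<Rightarrow> 'a" where
  "dU_smooth a C t x = (let y = C + - (k * t powr (- lam * q)) * (x \<bullet> x + a) powr (q / 2) in
     - (t powr (- d * lam) * (gam * flat a (gam - 1) y + a * flat a (gam - 2) y) * (k * t powr (- lam * q)) * q * (x \<bullet> x + a) powr (q / 2 - 1)) *\<^sub>R x)"

lemma U_smooth_derivative:
  fixes x :: "'a::euclidean_space"
  assumes a: "0 < a"
  shows "(U_smooth a C t has_derivative (\<lambda>v. dU_smooth a C t x \<bullet> v)) (at x)"
proof -
  have pos: "0 < x \<bullet> x + a" using a by (simp add: add_nonneg_pos)
  let ?m = "\<lambda>x::'a. C + - (k * t powr (- lam * q)) * (x \<bullet> x + a) powr (q / 2)"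
  have "((\<lambda>x::'a. x \<bullet> x + a) has_derivative (\<lambda>v. 2 * (x \<bullet> v))) (at x)"
    by (auto intro!: derivative_eq_intros simp: inner_commute)
  moreover have "((\<lambda>y. y powr (q / 2)) has_derivative (*) (q / 2 * (x \<bullet> x + a) powr (q / 2 - 1))) (at (x \<bullet> x + a))"
    using has_real_derivative_powr[OF pos, of "q / 2"] by (simp add: has_field_derivative_def)
  ultimately have "((\<lambda>x::'a. (x \<bullet> x + a) powr (q / 2)) has_derivative (\<lambda>v. q / 2 * (x \<bullet> x + a) powr (q / 2 - 1) * (2 * (x \<bullet> v)))) (at x)"
    by (rule has_derivative_compose)
  then have m: "(?m has_derivative (\<lambda>v. 0 + - (k * t powr (- lam * q)) * (q / 2 * (x \<bullet> x + a) powr (q / 2 - 1) * (2 * (x \<bullet> v))))) (at x)"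
    by (intro has_derivative_add has_derivative_const has_derivative_mult_right)
  have "((\<lambda>x. flat a gam (?m x)) has_derivative (\<lambda>v. (gam * flat a (gam - 1) (?m x) + a * flat a (gam - 2) (?m x)) *
     (0 + - (k * t powr (- lam * q)) * (q / 2 * (x \<bullet> x + a) powr (q / 2 - 1) * (2 * (x \<bullet> v)))))) (at x)"
    by (rule has_derivative_compose[OF m]) (use flat_has_derivative[OF a] in \<open>simp add: has_field_derivative_def\<close>)
  from has_derivative_mult_right[OF this, of "t powr (- d * lam)"]
  show ?thesis
    unfolding U_smooth_def[abs_def]
    by (rule has_derivative_eq_rhs) (simp add: fun_eq_iff dU_smooth_def Let_def)
qed

text \<open>With \<open>s = a / y\<close> the additional term carries
  \<open>s * exp (- s) \<le> 1\<close>. The bounds do not depend on \<open>a\<close>, as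
  \<open>V_approx\<close> requires.\<close>

lemma flat_bounds:
  assumes a: "0 < a" "0 < r"
  shows "\<bar>flat a r y\<bar> \<le> pos_powr r y" "\<bar>r * flat a (r - 1) y + a * flat a (r - 2) y\<bar> \<le> (r + 1) * pos_powr (r - 1) y"
proof -
  show "\<bar>flat a r y\<bar> \<le> pos_powr r y"
    using a by (auto simp: flat_def pos_powr_def mult_left_le)
  show "\<bar>r * flat a (r - 1) y + a * flat a (r - 2) y\<bar> \<le> (r + 1) * pos_powr (r - 1) y"
  proof (cases "0 < y")
    case True
    define s where "s = a / y"
    have s: "0 < s" using a True by (simp add: s_def)
    have "s \<le> exp s" using exp_ge_add_one_self[of s] by linarith
    then have "s * exp (- s) \<le> 1" by (simp add: exp_minus field_simps)
    moreover have "exp (- s) \<le> 1" using s by simp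
    ultimately have "r * exp (- s) + s * exp (- s) \<le> r * 1 + 1" using a by (intro add_mono mult_left_mono) auto
    then have "y powr (r - 1) * (r * exp (- s) + s * exp (- s)) \<le> y powr (r - 1) * (r + 1)"
      by (intro mult_left_mono) auto
    moreover have "y powr (r - 2) = y powr (r - 1) / y"
      using True powr_diff[of y "r - 1" 1] by simp
    then have "r * flat a (r - 1) y + a * flat a (r - 2) y = y powr (r - 1) * (r * exp (- s) + s * exp (- s))"
      using True by (simp add: flat_def s_def field_simps)
    moreover have "0 \<le> r * flat a (r - 1) y + a * flat a (r - 2) y"
      using a True by (auto simp: flat_def intro!: add_nonneg_nonneg)
    ultimately show ?thesis using True by (simp add: pos_powr_def mult.commute)
  qed (simp add: flat_def pos_powr_neg)
qed

text \<open>With convergence from below all terms vanish when \<open>Y0 \<le> 0\<close>. This admits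
  negative exponents, such as \<open>gam - 2\<close> for \<open>p > 3\<close>.\<close>

lemma flat_tendsto:
  assumes y: "\<And>n. y n \<le> Y0" "y \<longlonglongrightarrow> Y0" and a: "a \<longlonglongrightarrow> 0" "\<And>n. 0 < a n"
  shows "(\<lambda>n. flat (a n) r (y n)) \<longlonglongrightarrow> pos_powr r Y0"
proof (cases "0 < Y0")
  case True
  have "(\<lambda>n. y n powr r * exp (- a n / y n)) \<longlonglongrightarrow> Y0 powr r * exp (- 0 / Y0)"
    using True by (intro tendsto_intros y a) auto
  moreover have "\<forall>\<^sub>F n in sequentially. y n powr r * exp (- a n / y n) = flat (a n) r (y n)"
    using order_tendstoD(1)[OF y(2) True] by eventually_elim (simp add: flat_def)
  ultimately show ?thesis
    using True by (simp add: pos_powr_def) (rule Lim_transform_eventually)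
next
  case False
  then have "flat (a n) r (y n) = 0" for n using y(1)[of n] by (simp add: flat_def)
  then show ?thesis using False by (simp add: pos_powr_neg)
qed

lemma norm_powr_q: "(x \<bullet> x) powr (q / 2) = norm x powr q" for x :: "'a::euclidean_space"
proof (cases "x = 0")
  case False
  then have "x \<bullet> x = norm x powr 2" by (simp add: power2_norm_eq_inner)
  then show ?thesis by (simp only: powr_powr) simp
qed simp

lemma U_V_approx:
  fixes c :: "'a::euclidean_space"
  assumes C: "0 < C" and t: "0 < t" and D: "cball c (rad C t) \<subseteq> D"
  shows "V_approx D (\<lambda>x. U C t (x - c)) (\<lambda>x. dU C t (x - c))"
proof -
  define a where "a n = inverse (real (Suc n))" for n
  have a: "0 < a n" "a n \<le> 1" for n by (auto simp: a_def field_simps)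
  have al: "a \<longlonglongrightarrow> 0" unfolding a_def[abs_def] by (rule LIMSEQ_inverse_real_of_nat)
  define m where "m n x = C + - (k * t powr (- lam * q)) * (x \<bullet> x + a n) powr (q / 2)" for n and x :: 'a
  \<comment> \<open>The shift by \<open>a n\<close> lowers the argument of \<open>flat\<close>, so
    the approximations vanish wherever the limit does.\<close>
  have m_le: "m n x \<le> Y C t x" for n x
  proof -
    have "norm x powr q \<le> (x \<bullet> x + a n) powr (q / 2)"
      unfolding norm_powr_q[symmetric] using q a(1)[of n] by (intro powr_mono2) auto
    then have "k * t powr (- lam * q) * norm x powr q \<le> k * t powr (- lam * q) * (x \<bullet> x + a n) powr (q / 2)"
      using k_pos by (intro mult_left_mono) auto
    then show ?thesis by (simp add: m_def Y_def)
  qed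
  have m_lim: "(\<lambda>n. m n x) \<longlonglongrightarrow> Y C t x" for x
  proof -
    have "(\<lambda>n. m n x) \<longlonglongrightarrow> C + - (k * t powr (- lam * q)) * (x \<bullet> x + 0) powr (q / 2)"
      unfolding m_def using q a by (intro tendsto_intros tendsto_powr2 al) (auto intro!: always_eventually add_nonneg_nonneg less_imp_le)
    then show ?thesis by (simp add: Y_def norm_powr_q)
  qed
  have zero: "U_smooth (a n) C t y = 0 \<and> dU_smooth (a n) C t y = 0" if "rad C t \<le> norm y" for n and y :: 'a
  proof -
    have "m n y \<le> 0" using m_le[of n y] Y_nonpos[OF C t that] by linarith
    then show ?thesis unfolding U_smooth_def dU_smooth_def Let_def m_def[symmetric] by (simp add: flat_def)
  qed
  define \<psi> where "\<psi> n x = U_smooth (a n) C t (x - c)" for n x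
  have der: "(\<psi> n has_derivative (\<lambda>v. dU_smooth (a n) C t (x - c) \<bullet> v)) (at x)" for n x
  proof -
    have "((\<lambda>x. x - c) has_derivative (\<lambda>v. v)) (at x)" by (auto intro!: derivative_eq_intros)
    from has_derivative_compose[OF this U_smooth_derivative[OF a(1)]] show ?thesis unfolding \<psi>_def[abs_def] .
  qed
  have grad: "gradient (\<psi> n) x = dU_smooth (a n) C t (x - c)" for n x by (rule gradient_eqI[OF der])
  have test: "test_function D (\<psi> n)" for n
    unfolding test_function_def smooth_on_def
  proof (intro conjI allI exI[of _ "cball c (rad C t)"] impI)
    show "Ck_on j UNIV (\<psi> n)" for j
      unfolding \<psi>_def[abs_def] U_smooth_def
      by (intro Ck_on_mult Ck_on_const Ck_on_flat[OF _ a(1)] Ck_on_add Ck_on_powr Ck_on_norm_sq)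
        (use a in \<open>auto intro!: add_nonneg_pos\<close>)
    show "\<psi> n x = 0" if "x \<notin> cball c (rad C t)" for x
      using that zero[of "x - c" n] by (simp add: \<psi>_def dist_norm norm_minus_commute)
  qed (use D in auto)
  have C1: "C1_supported D (\<lambda>x. U C t (x - c)) (\<lambda>x. dU C t (x - c))"
    unfolding C1_supported_def
  proof (intro conjI allI exI[of _ "cball c (rad C t)"] impI)
    show "((\<lambda>x. U C t (x - c)) has_derivative (\<lambda>v. dU C t (x - c) \<bullet> v)) (at x)" for x
    proof -
      have "((\<lambda>x. x - c) has_derivative (\<lambda>v. v)) (at x)" by (auto intro!: derivative_eq_intros)
      from has_derivative_compose[OF this U_has_derivative] show ?thesis .
    qed
    show "continuous_on UNIV (\<lambda>x. dU C t (x - c))" by (intro continuous_on_U continuous_intros) (use t in auto)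
    fix x assume "x \<notin> cball c (rad C t)"
    then have "rad C t \<le> norm (x - c)" by (simp add: dist_norm norm_minus_commute)
    then show "U C t (x - c) = 0" "dU C t (x - c) = 0" using outside_zero[OF C t] by auto
  qed (use D in auto)
  define R where "R = rad C t"
  have R0: "0 \<le> R" by (simp add: R_def rad_def)
  \<comment> \<open>Uniform gradient bound: \<open>norm y\<close> is at most the square root of
    \<open>y \<bullet> y + a n\<close>, which turns the negative power \<open>q / 2 - 1\<close> into
    the positive power \<open>q / 2 - 1 / 2\<close>.\<close>
  define B where "B = t powr (- d * lam) * (gam + 1) * C powr (gam - 1) * (k * t powr (- lam * q)) * q * (R\<^sup>2 + 1) powr (q / 2 - 1 / 2)"
  define M where "M = max (t powr (- d * lam) * C powr gam) B"
  have Y_le: "Y C t x \<le> C" for x :: 'a using k_pos by (simp add: Y_def)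
  have pp: "pos_powr r (m n x) \<le> C powr r" if "0 \<le> r" for r n x
    unfolding pos_powr_def using m_le[of n x] Y_le[of x] C that by (intro powr_mono2) auto
  have M0: "0 \<le> M" by (simp add: M_def le_max_iff_disj)
  have b1: "\<bar>U_smooth (a n) C t y\<bar> \<le> M" for n and y :: 'a
  proof -
    have "\<bar>U_smooth (a n) C t y\<bar> = t powr (- d * lam) * \<bar>flat (a n) gam (m n y)\<bar>"
      by (simp add: U_smooth_def m_def abs_mult)
    also have "\<dots> \<le> t powr (- d * lam) * C powr gam"
      using flat_bounds(1)[OF a(1), of gam n "m n y"] pp[of gam n y] gam by (intro mult_left_mono) auto
    finally show ?thesis by (simp add: M_def le_max_iff_disj)
  qed
  have b2: "norm (dU_smooth (a n) C t y) \<le> M" for n and y :: 'a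
  proof (cases "rad C t \<le> norm y")
    case True
    then show ?thesis using zero M0 by simp
  next
    case False
    let ?F = "gam * flat (a n) (gam - 1) (m n y) + a n * flat (a n) (gam - 2) (m n y)"
    let ?s = "y \<bullet> y + a n"
    have s0: "0 < ?s" using a(1)[of n] by (simp add: add_nonneg_pos)
    have s1: "?s \<le> R\<^sup>2 + 1" using False a(2)[of n] power_mono[of "norm y" R 2]
      by (simp add: R_def power2_norm_eq_inner)
    have ny: "norm y \<le> ?s powr (1 / 2)"
      using a(1)[of n] by (simp add: powr_half_sqrt norm_eq_sqrt_inner)
    have "norm (dU_smooth (a n) C t y) = t powr (- d * lam) * \<bar>?F\<bar> * (k * t powr (- lam * q)) * q * (?s powr (q / 2 - 1) * norm y)"
      using k_pos q by (simp add: dU_smooth_def Let_def m_def abs_mult)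
    also have "\<dots> \<le> t powr (- d * lam) * ((gam + 1) * C powr (gam - 1)) * (k * t powr (- lam * q)) * q * ((R\<^sup>2 + 1) powr (q / 2 - 1 / 2))"
    proof (intro mult_mono)
      have "\<bar>?F\<bar> \<le> (gam + 1) * pos_powr (gam - 1) (m n y)" using flat_bounds(2)[OF a(1)] gam by auto
      also have "\<dots> \<le> (gam + 1) * C powr (gam - 1)" using pp[of "gam - 1"] gam by (intro mult_left_mono) auto
      finally show "\<bar>?F\<bar> \<le> (gam + 1) * C powr (gam - 1)" .
      have "?s powr (q / 2 - 1) * norm y \<le> ?s powr (q / 2 - 1) * ?s powr (1 / 2)"
        using ny by (intro mult_left_mono) auto
      also have "\<dots> = ?s powr (q / 2 - 1 / 2)" using s0 by (simp add: powr_add[symmetric])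
      also have "\<dots> \<le> (R\<^sup>2 + 1) powr (q / 2 - 1 / 2)" using s0 s1 q by (intro powr_mono2) auto
      finally show "?s powr (q / 2 - 1) * norm y \<le> (R\<^sup>2 + 1) powr (q / 2 - 1 / 2)" .
    qed (use k_pos q gam in auto)
    also have "\<dots> = B" by (simp add: B_def mult_ac)
    finally show ?thesis by (simp add: M_def le_max_iff_disj)
  qed
  have l1: "(\<lambda>n. U_smooth (a n) C t y) \<longlonglongrightarrow> U C t y" for y :: 'a
    unfolding U_smooth_def U_def m_def[symmetric] by (intro tendsto_intros flat_tendsto m_le m_lim al a)
  have l2: "(\<lambda>n. dU_smooth (a n) C t y) \<longlonglongrightarrow> dU C t y" for y :: 'a
  proof (cases "y = 0")
    case False
    then have y: "0 < y \<bullet> y" by simp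
    have "(\<lambda>n. - (t powr (- d * lam) * (gam * flat (a n) (gam - 1) (m n y) + a n * flat (a n) (gam - 2) (m n y)) * (k * t powr (- lam * q)) * q * (y \<bullet> y + a n) powr (q / 2 - 1)) *\<^sub>R y)
      \<longlonglongrightarrow> - (t powr (- d * lam) * (gam * pos_powr (gam - 1) (Y C t y) + 0 * pos_powr (gam - 2) (Y C t y)) * (k * t powr (- lam * q)) * q * (y \<bullet> y + 0) powr (q / 2 - 1)) *\<^sub>R y"
      using y by (intro tendsto_intros flat_tendsto m_le m_lim al a) auto
    moreover have "(y \<bullet> y) powr (q / 2 - 1) = norm y powr (q - 2)"
      using y by (simp add: power2_norm_eq_inner[symmetric] powr_diff norm_powr_q) (simp add: power2_norm_eq_inner norm_powr_q)
    moreover have "t powr (- d * lam - lam * q) = t powr (- d * lam) * t powr (- lam * q)"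
      using powr_add[of t "- d * lam" "- lam * q"] by simp
    ultimately show ?thesis
      unfolding dU_smooth_def Let_def m_def[symmetric] by (simp add: dU_def radial_def mult_ac)
  qed (simp add: dU_smooth_def dU_def radial_def Let_def)
  show ?thesis
    unfolding V_approx_def
  proof (intro conjI exI allI)
    show "test_function D (\<psi> n)" for n by (rule test)
    show "(\<lambda>n. \<psi> n x) \<longlonglongrightarrow> U C t (x - c)" for x unfolding \<psi>_def by (rule l1)
    show "(\<lambda>n. gradient (\<psi> n) x) \<longlonglongrightarrow> dU C t (x - c)" for x unfolding grad by (rule l2)
    show "\<bar>\<psi> n x\<bar> \<le> M" for n x unfolding \<psi>_def by (rule b1)
    show "norm (gradient (\<psi> n) x) \<le> M" for n x unfolding grad by (rule b2)
  qed (rule C1)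
qed

end

lemma barenblatt_exists:
  assumes "2 < p" "0 \<le> (d::real)"
  obtains lam q gam k where "barenblatt p d lam q gam k"
proof -
  define lam where "lam = 1 / (d * (p - 2) + p)"
  define q where "q = p / (p - 1)"
  define gam where "gam = (p - 1) / (p - 2)"
  define k where "k = lam powr (1 / (p - 1)) / (gam * q)"
  have pos: "0 < d * (p - 2) + p" using assms by (intro add_nonneg_pos) auto
  then have l: "0 < lam" "lam * (d * (p - 2) + p) = 1" by (auto simp: lam_def)
  have gq: "0 < gam * q" using assms by (simp add: gam_def q_def)
  then have "gam \<noteq> 0" "q \<noteq> 0" by auto
  then have kg: "k * gam * q = lam powr (1 / (p - 1))" by (simp add: k_def)
  have "(k * gam * q) powr (p - 1) = lam" unfolding kg using l assms by (simp add: powr_powr)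
  moreover have "0 < k" using gq l by (simp add: k_def)
  ultimately have "barenblatt p d lam q gam k"
    using assms l by unfold_locales (auto simp: q_def gam_def)
  then show thesis by (rule that)
qed

section \<open>Compactly supported explicit solutions\<close>

lemma C1_supported_mult_coordinate:
  assumes f: "C1_supported D f G"
  shows "C1_supported D (\<lambda>x. f x * ((x - c) \<bullet> b)) (\<lambda>x. f x *\<^sub>R b + ((x - c) \<bullet> b) *\<^sub>R G x)"
proof -
  obtain K where K: "compact K" "K \<subseteq> D" "\<And>x. x \<notin> K \<Longrightarrow> f x = 0 \<and> G x = 0"
    and d: "\<And>x. (f has_derivative (\<lambda>v. G x \<bullet> v)) (at x)" and c: "continuous_on UNIV G"
    using f by (auto simp: C1_supported_def)
  have d': "((\<lambda>x. f x * ((x - c) \<bullet> b)) has_derivative (\<lambda>v. (f x *\<^sub>R b + ((x - c) \<bullet> b) *\<^sub>R G x) \<bullet> v)) (at x)" for x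
  proof -
    have "((\<lambda>x. (x - c) \<bullet> b) has_derivative (\<lambda>v. v \<bullet> b)) (at x)" by (auto intro!: derivative_eq_intros)
    from has_derivative_mult[OF d this] show ?thesis
      by (rule has_derivative_eq_rhs) (simp add: fun_eq_iff inner_add_left inner_add_right inner_commute)
  qed
  have c': "continuous_on UNIV (\<lambda>x. f x *\<^sub>R b + ((x - c) \<bullet> b) *\<^sub>R G x)"
    using c C1_supported_continuous[OF f] by (intro continuous_intros)
  show ?thesis unfolding C1_supported_def
    by (intro conjI allI impI exI[of _ K] d' c') (use K in auto)
qed

text \<open>Time starts at 1, away from the singularity of the Barenblatt formula at 0. Supports
  grow, so room in \<open>D\<close> and disjointness are required only at the final time
  \<open>T\<close>; the common constant \<open>C\<close> gives all bumps the same radius.\<close>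

locale bumps = sobolev2 D p + barenblatt p "real DIM('a)" lam q gam k
  for D :: "'a::euclidean_space set" and p lam q gam k :: real +
  fixes C T :: real and S :: "'a set"
  assumes C: "0 < C" and T: "1 \<le> T" and S: "finite S"
    and inside: "\<And>c. c \<in> S \<Longrightarrow> cball c (rad C T) \<subseteq> D"
    and separated: "\<And>c c'. c \<in> S \<Longrightarrow> c' \<in> S \<Longrightarrow> c \<noteq> c' \<Longrightarrow> 2 * rad C T \<le> dist c c'"
begin

definition u where "u t x = (\<Sum>c\<in>S. U C t (x - c))"
definition Du where "Du t x = (\<Sum>c\<in>S. dU C t (x - c))"
definition ut where "ut t x = (\<Sum>c\<in>S. Ut C t (x - c))"
definition v where "v t = abs_l2 (u t)"

lemma rad_mono: "1 \<le> t \<Longrightarrow> t \<le> T \<Longrightarrow> rad C t \<le> rad C T"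
  unfolding rad_def using lam_pos by (intro mult_right_mono powr_mono2) auto

lemma inside': "1 \<le> t \<Longrightarrow> t \<le> T \<Longrightarrow> c \<in> S \<Longrightarrow> cball c (rad C t) \<subseteq> D"
  using inside[of c] rad_mono[of t] by (meson order_trans subset_cball)

lemma bump_V_approx: "1 \<le> t \<Longrightarrow> t \<le> T \<Longrightarrow> c \<in> S \<Longrightarrow> V_approx D (\<lambda>x. U C t (x - c)) (\<lambda>x. dU C t (x - c))"
  using C by (intro U_V_approx inside') auto

lemma u_V_approx: "1 \<le> t \<Longrightarrow> t \<le> T \<Longrightarrow> V_approx D (u t) (Du t)"
  unfolding u_def[abs_def] Du_def[abs_def] by (intro V_approx_sum S bump_V_approx)

lemma u_C1: "1 \<le> t \<Longrightarrow> t \<le> T \<Longrightarrow> C1_supported D (u t) (Du t)"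
  using u_V_approx by (simp add: V_approx_def)

lemma only_one_bump:
  assumes "1 \<le> t" "t \<le> T" "c \<in> S" "norm (x - c) < rad C t" "c' \<in> S" "c' \<noteq> c"
  shows "rad C t \<le> norm (x - c')"
proof -
  have "2 * rad C T \<le> dist c c'" using assms by (intro separated) auto
  also have "\<dots> \<le> norm (x - c) + norm (x - c')"
    using dist_triangle[of c c' x] by (simp add: dist_norm norm_minus_commute)
  finally show ?thesis using assms rad_mono[of t] by linarith
qed

text \<open>At each point at most one bump is nonzero, and this is where the nonlinear flux becomes
  additive.\<close>

lemma u_flux:
  assumes t: "1 \<le> t" "t \<le> T"
  shows "norm (Du t x) powr (p - 2) *\<^sub>R Du t x = - (lam / t) *\<^sub>R (\<Sum>c\<in>S. U C t (x - c) *\<^sub>R (x - c))"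
proof (cases "\<exists>c\<in>S. norm (x - c) < rad C t")
  case True
  then obtain c where c: "c \<in> S" "norm (x - c) < rad C t" by blast
  have z: "U C t (x - c') = 0" "dU C t (x - c') = 0" if "c' \<in> S - {c}" for c'
    using outside_zero[OF C, of t "x - c'"] only_one_bump[OF t c, of c'] that t by auto
  have "Du t x = dU C t (x - c)"
    unfolding Du_def using z by (subst sum.remove[OF S c(1)]) simp
  moreover have "(\<Sum>c\<in>S. U C t (x - c) *\<^sub>R (x - c)) = U C t (x - c) *\<^sub>R (x - c)"
    using z by (subst sum.remove[OF S c(1)]) simp
  ultimately show ?thesis using U_flux[of t C "x - c"] t by simp
next
  case False
  then have "U C t (x - c) = 0" "dU C t (x - c) = 0" if "c \<in> S" for c
    using outside_zero[OF C, of t "x - c"] t that by force+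
  then show ?thesis by (simp add: Du_def)
qed

text \<open>By \<open>u_flux\<close> the flux is a C1 field with compact support, so
  \<open>flux_pairing\<close> applies. Up to the factor \<open>- (lam / t)\<close>, the divergence
  of each summand is \<open>DIM('a)\<close> times \<open>U\<close> plus the inner product of
  position and gradient, as in \<open>Ut\<close>.\<close>

lemma ut_pairing:
  assumes t: "1 \<le> t" "t \<le> T" and w: "w \<in> V_space D p"
  shows "(\<integral>x. (norm (Du t x) powr (p - 2) *\<^sub>R Du t x) \<bullet> wg w x \<partial>L) = - (\<integral>x. ut t x * rep_l2 w x \<partial>L)"
proof -
  define J where "J x = norm (Du t x) powr (p - 2) *\<^sub>R Du t x" for x
  define G where "G b x = - (lam / t) *\<^sub>R (\<Sum>c\<in>S. U C t (x - c) *\<^sub>R b + ((x - c) \<bullet> b) *\<^sub>R dU C t (x - c))" for b x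
  have J: "J x = - (lam / t) *\<^sub>R (\<Sum>c\<in>S. U C t (x - c) *\<^sub>R (x - c))" for x
    unfolding J_def by (rule u_flux[OF t])
  have "C1_supported D (\<lambda>x. - (lam / t) * (\<Sum>c\<in>S. U C t (x - c) * ((x - c) \<bullet> b))) (G b)" for b
    unfolding G_def using bump_V_approx[OF t] S
    by (intro C1_supported_scale C1_supported_sum C1_supported_mult_coordinate) (auto simp: V_approx_def)
  moreover have "(\<lambda>x. J x \<bullet> b) = (\<lambda>x. - (lam / t) * (\<Sum>c\<in>S. U C t (x - c) * ((x - c) \<bullet> b)))" for b
    by (simp add: J inner_sum_left fun_eq_iff)
  ultimately have JG: "C1_supported D (\<lambda>x. J x \<bullet> b) (G b)" for b
    by (simp only:)
  have c: "continuous_on UNIV J"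
    unfolding J[abs_def] using t by (intro continuous_intros continuous_on_U) auto
  obtain M where M: "\<And>x. norm (J x) \<le> M"
  proof -
    have "\<exists>M. \<forall>x. \<bar>J x \<bullet> b\<bar> \<le> M" for b using C1_supported_bounded[OF JG[of b]] by blast
    then obtain m where m: "\<And>b x. \<bar>J x \<bullet> b\<bar> \<le> m b" by metis
    have "norm (J x) \<le> (\<Sum>b\<in>Basis. m b)" for x
      by (rule order_trans[OF norm_le_l1]) (intro sum_mono m)
    then show thesis by (rule that)
  qed
  have "(\<integral>x. J x \<bullet> wg w x \<partial>L) = - (\<integral>x. (\<Sum>b\<in>Basis. G b x \<bullet> b) * rep_l2 w x \<partial>L)"
    by (rule flux_pairing[OF w JG borel_measurable_continuous_onI[OF c] M])
  moreover have "(\<Sum>b\<in>Basis. G b x \<bullet> b) = ut t x" for x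
  proof -
    have "(\<Sum>b\<in>Basis. G b x \<bullet> b) = - (lam / t) * (\<Sum>c\<in>S. \<Sum>b\<in>Basis. U C t (x - c) * (b \<bullet> b) + ((x - c) \<bullet> b) * (dU C t (x - c) \<bullet> b))"
    proof -
      have "G b x \<bullet> b = - (lam / t) * (\<Sum>c\<in>S. U C t (x - c) * (b \<bullet> b) + ((x - c) \<bullet> b) * (dU C t (x - c) \<bullet> b))" for b
        by (simp only: G_def inner_scaleR_left inner_sum_left inner_add_left)
      then show ?thesis
        by (simp only: sum_distrib_left[symmetric] sum.swap[of _ S])
    qed
    also have "\<dots> = - (lam / t) * (\<Sum>c\<in>S. real DIM('a) * U C t (x - c) + (x - c) \<bullet> dU C t (x - c))"
    proof -
      have "(\<Sum>b\<in>Basis. U C t y * (b \<bullet> b) + (y \<bullet> b) * (dU C t y \<bullet> b)) = real DIM('a) * U C t y + y \<bullet> dU C t y" for y :: 'a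
        unfolding sum.distrib euclidean_inner[of y "dU C t y"] by (simp add: inner_Basis)
      then show ?thesis by simp
    qed
    also have "\<dots> = ut t x" by (simp add: ut_def Ut_def sum_distrib_left)
    finally show ?thesis .
  qed
  ultimately show ?thesis by (simp add: J_def)
qed

lemma bounds:
  obtains M where "0 \<le> M" "\<And>t x. 1 \<le> t \<Longrightarrow> t \<le> T \<Longrightarrow> \<bar>u t x\<bar> \<le> M \<and> norm (Du t x) \<le> M \<and> \<bar>ut t x\<bar> \<le> M"
proof -
  obtain M where M: "\<And>t x. 1 \<le> t \<Longrightarrow> t \<le> T \<Longrightarrow> \<bar>U C t (x::'a)\<bar> \<le> M \<and> norm (dU C t x) \<le> M \<and> \<bar>Ut C t x\<bar> \<le> M"
    using bounded_U[OF C] by blast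
  have M0: "0 \<le> M" using M[of 1 0] T by linarith
  have "\<bar>u t x\<bar> \<le> real (card S) * M \<and> norm (Du t x) \<le> real (card S) * M \<and> \<bar>ut t x\<bar> \<le> real (card S) * M"
    if "1 \<le> t" "t \<le> T" for t x
    unfolding u_def Du_def ut_def using M[OF that]
    by (intro conjI order_trans[OF sum_abs] order_trans[OF norm_sum] sum_bounded_above) auto
  with M0 show thesis by (intro that[of "real (card S) * M"]) auto
qed

lemma u_time_derivative: "0 < t \<Longrightarrow> ((\<lambda>t. u t x) has_real_derivative ut t x) (at t)"
  unfolding u_def ut_def by (intro DERIV_sum U_time_derivative)

lemma u_continuous:
  "continuous_on {0<..} (\<lambda>t. u t x)" "continuous_on {0<..} (\<lambda>t. Du t x)" "continuous_on {0<..} (\<lambda>t. ut t x)"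
  unfolding u_def Du_def ut_def by (intro continuous_on_sum continuous_on_U continuous_intros; simp)+

lemma u_measurable: "0 < t \<Longrightarrow> u t \<in> borel_measurable borel" "0 < t \<Longrightarrow> Du t \<in> borel_measurable borel" "0 < t \<Longrightarrow> ut t \<in> borel_measurable borel"
  unfolding u_def[abs_def] Du_def[abs_def] ut_def[abs_def]
  by (intro borel_measurable_continuous_onI continuous_on_sum continuous_on_U continuous_intros; simp)+

lemma u_tendsto:
  assumes "t0 > 0" "s \<longlonglongrightarrow> t0" 
  shows "(\<lambda>n. u (s n) x) \<longlonglongrightarrow> u t0 x" "(\<lambda>n. Du (s n) x) \<longlonglongrightarrow> Du t0 x" "(\<lambda>n. ut (s n) x) \<longlonglongrightarrow> ut t0 x"
proof -
  have "isCont (\<lambda>t. u t x) t0" "isCont (\<lambda>t. Du t x) t0" "isCont (\<lambda>t. ut t x) t0"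
    using u_continuous[of x] assms by (auto simp: continuous_on_eq_continuous_at)
  then show "(\<lambda>n. u (s n) x) \<longlonglongrightarrow> u t0 x" "(\<lambda>n. Du (s n) x) \<longlonglongrightarrow> Du t0 x" "(\<lambda>n. ut (s n) x) \<longlonglongrightarrow> ut t0 x"
    by (auto intro: isCont_tendsto_compose assms)
qed

lemma v_in: assumes "1 \<le> t" "t \<le> T" shows "v t \<in> L2 D" "a *\<^sub>R v t \<in> V_space D p" "square_integrable (u t)"
proof -
  show sq: "square_integrable (u t)" by (rule square_integrable_C1[OF u_C1[OF assms]])
  show "v t \<in> L2 D" unfolding v_def by (rule abs_C1_in_L2[OF u_C1[OF assms]])
  have "a *\<^sub>R v t = abs_l2 (\<lambda>x. a * u t x)" unfolding v_def by (rule abs_l2_scaleR[OF sq])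
  then show "a *\<^sub>R v t \<in> V_space D p"
    using V_approx_in_V[OF V_approx_scale[OF u_V_approx[OF assms]]] by simp
qed

lemma inner_v:
  assumes t: "1 \<le> t" "t \<le> T"
  shows "inner (v t) w = (\<integral>x. u t x * rep_l2 w x \<partial>L)"
proof -
  have "inner (v t) w = (\<integral>x. u t x * rep_l2 w x \<partial>lebesgue)"
    unfolding v_def by (rule inner_abs_l2_rep[OF v_in(3)[OF t]])
  also have "\<dots> = (\<integral>x. indicator D x *\<^sub>R (u t x * rep_l2 w x) \<partial>lebesgue)"
    using C1_supported_outside[OF u_C1[OF t]] by (intro Bochner_Integration.integral_cong) (auto simp: indicator_def)
  also have "\<dots> = (\<integral>x. u t x * rep_l2 w x \<partial>L)"
    by (subst integral_restrict_space) auto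
  finally show ?thesis .
qed

text \<open>Homogeneity of degree \<open>p - 1\<close>; the factor \<open>a\<close> will be
  \<open>exp (\<rho> t)\<close>.\<close>

lemma p_laplace_v:
  assumes t: "1 \<le> t" "t \<le> T" and a: "0 < a" and w: "w \<in> V_space D p"
  shows "p_laplace D p (a *\<^sub>R v t) w = a powr (p - 1) * (\<integral>x. ut t x * rep_l2 w x \<partial>L)"
proof -
  have eq: "a *\<^sub>R v t = abs_l2 (\<lambda>x. a * u t x)" unfolding v_def by (rule abs_l2_scaleR[OF v_in(3)[OF t]])
  have g: "AE x in L. wg (a *\<^sub>R v t) x = a *\<^sub>R Du t x"
    unfolding eq by (rule abs_C1_weak_gradient(3)[OF C1_supported_scale[OF u_C1[OF t]]])
  have gm: "wg (a *\<^sub>R v t) \<in> borel_measurable L" "wg w \<in> borel_measurable L" "Du t \<in> borel_measurable L"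
    using V_spaceD(2)[OF v_in(2)[OF t]] V_spaceD(2)[OF w] u_measurable(2)[of t] t
    by (auto simp: in_Lp_def intro: borel_L)
  have "(\<integral>x. norm (wg (a *\<^sub>R v t) x) powr (p - 2) * (wg (a *\<^sub>R v t) x \<bullet> wg w x) \<partial>L)
     = (\<integral>x. a powr (p - 1) * ((norm (Du t x) powr (p - 2) *\<^sub>R Du t x) \<bullet> wg w x) \<partial>L)"
  proof (rule integral_cong_AE)
    show "AE x in L. norm (wg (a *\<^sub>R v t) x) powr (p - 2) * (wg (a *\<^sub>R v t) x \<bullet> wg w x) = a powr (p - 1) * ((norm (Du t x) powr (p - 2) *\<^sub>R Du t x) \<bullet> wg w x)"
      using g
    proof eventually_elim
      fix x assume "wg (a *\<^sub>R v t) x = a *\<^sub>R Du t x"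
      moreover have "a powr (p - 1) = a powr (p - 2) * a" using powr_mult_base[of a "p - 2"] a by (simp add: mult.commute)
      ultimately show "norm (wg (a *\<^sub>R v t) x) powr (p - 2) * (wg (a *\<^sub>R v t) x \<bullet> wg w x) = a powr (p - 1) * ((norm (Du t x) powr (p - 2) *\<^sub>R Du t x) \<bullet> wg w x)"
        using a by (simp add: powr_mult)
    qed
  qed (use gm in measurable)
  then show ?thesis
    unfolding p_laplace_def using ut_pairing[OF t w] by simp
qed

lemma u_difference_bound:
  assumes M: "\<And>t x. 1 \<le> t \<Longrightarrow> t \<le> T \<Longrightarrow> \<bar>ut t x\<bar> \<le> M" and st: "s \<in> {1..T}" "t \<in> {1..T}"
  shows "\<bar>u s x - u t x\<bar> \<le> M * \<bar>s - t\<bar>"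
proof -
  have "norm (u s x - u t x) \<le> M * norm (s - t)"
  proof (rule field_differentiable_bound[of "{1..T}" "\<lambda>t. u t x" "\<lambda>t. ut t x"])
    show "((\<lambda>t. u t x) has_field_derivative ut r x) (at r within {1..T})" if "r \<in> {1..T}" for r
      using u_time_derivative[of r x] that by (auto intro: has_field_derivative_at_within)
  qed (use M st in auto)
  then show ?thesis by simp
qed

text \<open>Lipschitz in time, since the time derivative is bounded and all supports stay in the
  bounded set \<open>D\<close>.\<close>

lemma v_continuous: "continuous_on {1..T} v"
proof -
  obtain M where M0: "0 \<le> M" and M: "\<And>t x. 1 \<le> t \<Longrightarrow> t \<le> T \<Longrightarrow> \<bar>u t x\<bar> \<le> M \<and> norm (Du t x) \<le> M \<and> \<bar>ut t x\<bar> \<le> M"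
    using bounds by blast
  have lip: "dist (v s) (v t) \<le> M * sqrt (measure lebesgue D) * dist s t" if st: "s \<in> {1..T}" "t \<in> {1..T}" for s t
  proof -
    have sq: "square_integrable (u s)" "square_integrable (u t)" using st by (auto intro: v_in)
    have "(norm (v s - v t))\<^sup>2 = (\<integral>x. (u s x - u t x)\<^sup>2 \<partial>lebesgue)"
      unfolding v_def by (simp add: abs_l2_diff[OF sq] norm_abs_l2_sq square_integrable_diff[OF sq])
    also have "\<dots> \<le> (\<integral>x. (M * \<bar>s - t\<bar>)\<^sup>2 * indicator D x \<partial>lebesgue)"
    proof (rule integral_mono)
      show "integrable lebesgue (\<lambda>x. (u s x - u t x)\<^sup>2)" using square_integrable_diff[OF sq] by (simp add: square_integrable_def)
      show "integrable lebesgue (\<lambda>x. (M * \<bar>s - t\<bar>)\<^sup>2 * indicator D x)" using D_lmeasurable by (auto simp: fmeasurable_def)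
      fix x
      show "(u s x - u t x)\<^sup>2 \<le> (M * \<bar>s - t\<bar>)\<^sup>2 * indicator D x"
      proof (cases "x \<in> D")
        case True
        then show ?thesis using power_mono[OF u_difference_bound[of M s t x], of 2] M st by simp
      next
        case False
        then show ?thesis using C1_supported_outside[OF u_C1] st by simp
      qed
    qed
    also have "\<dots> = (M * sqrt (measure lebesgue D) * dist s t)\<^sup>2"
      using D_lmeasurable by (simp add: power_mult_distrib dist_real_def)
    finally have "norm (v s - v t) \<le> M * sqrt (measure lebesgue D) * dist s t"
      by (rule power2_le_imp_le) (use M0 in simp)
    then show ?thesis by (simp only: dist_norm[of "v s" "v t"])
  qed
  have "(M * sqrt (measure lebesgue D))-lipschitz_on {1..T} v"
    by (rule lipschitz_onI[OF lip]) (use M0 in auto)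
  then show ?thesis by (rule lipschitz_on_continuous_on)
qed

lemma rep_integrable: "w \<in> V_space D p \<Longrightarrow> integrable L (rep_l2 w)"
  by (intro in_Lp_integrable V_spaceD)

text \<open>Differentiation under the integral; by the mean value theorem the bound on
  \<open>ut\<close> also dominates the difference quotients.\<close>

lemma inner_v_derivative:
  assumes w: "w \<in> V_space D p" and t: "t \<in> {1..T}"
  shows "((\<lambda>t. inner (v t) w) has_real_derivative (\<integral>x. ut t x * rep_l2 w x \<partial>L)) (at t within {1..T})"
proof -
  obtain M where M0: "0 \<le> M" and M: "\<And>t x. 1 \<le> t \<Longrightarrow> t \<le> T \<Longrightarrow> \<bar>u t x\<bar> \<le> M \<and> norm (Du t x) \<le> M \<and> \<bar>ut t x\<bar> \<le> M"
    using bounds by blast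
  note wi = rep_integrable[OF w]
  have ui: "integrable L (\<lambda>x. u s x * rep_l2 w x)" if "s \<in> {1..T}" for s
    using integrable_mult_bounded[OF wi borel_L[OF u_measurable(1)[of s]], of M] M that by (auto simp: mult.commute)
  show ?thesis
    unfolding has_field_derivative_iff tendsto_at_iff_sequentially comp_def
  proof (intro allI impI)
    fix s assume s: "\<forall>i. s i \<in> {1..T} - {t}" and lim: "s \<longlonglongrightarrow> t"
    have "(inner (v (s n)) w - inner (v t) w) / (s n - t) = (\<integral>x. (u (s n) x - u t x) / (s n - t) * rep_l2 w x \<partial>L)" for n
    proof -
      have sn: "s n \<in> {1..T}" using s by auto
      have "(\<integral>x. (u (s n) x - u t x) / (s n - t) * rep_l2 w x \<partial>L) = (\<integral>x. (u (s n) x * rep_l2 w x - u t x * rep_l2 w x) / (s n - t) \<partial>L)"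
        by (intro Bochner_Integration.integral_cong) (auto simp: left_diff_distrib)
      also have "\<dots> = ((\<integral>x. u (s n) x * rep_l2 w x \<partial>L) - (\<integral>x. u t x * rep_l2 w x \<partial>L)) / (s n - t)"
        using ui[OF sn] ui[OF t] by simp
      finally show ?thesis using inner_v[of "s n" w] inner_v[of t w] sn t by auto
    qed
    moreover have "(\<lambda>n. \<integral>x. (u (s n) x - u t x) / (s n - t) * rep_l2 w x \<partial>L) \<longlonglongrightarrow> (\<integral>x. ut t x * rep_l2 w x \<partial>L)"
    proof (rule integral_dominated_convergence[where w = "\<lambda>x. M * \<bar>rep_l2 w x\<bar>"])
      show "integrable L (\<lambda>x. M * \<bar>rep_l2 w x\<bar>)" using wi by simp
      show "AE x in L. (\<lambda>n. (u (s n) x - u t x) / (s n - t) * rep_l2 w x) \<longlonglongrightarrow> ut t x * rep_l2 w x"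
      proof (rule AE_I2)
        fix x
        have "((\<lambda>r. (u r x - u t x) / (r - t)) \<longlongrightarrow> ut t x) (at t)"
          using u_time_derivative[of t x] t by (simp add: has_field_derivative_iff)
        moreover have "filterlim s (at t) sequentially"
          unfolding filterlim_at using lim s by auto
        ultimately have "(\<lambda>n. (u (s n) x - u t x) / (s n - t)) \<longlonglongrightarrow> ut t x"
          by (rule filterlim_compose)
        then show "(\<lambda>n. (u (s n) x - u t x) / (s n - t) * rep_l2 w x) \<longlonglongrightarrow> ut t x * rep_l2 w x"
          by (intro tendsto_intros)
      qed
      show "AE x in L. norm ((u (s n) x - u t x) / (s n - t) * rep_l2 w x) \<le> M * \<bar>rep_l2 w x\<bar>" for n
      proof (rule AE_I2)
        fix x
        have sn: "s n \<in> {1..T}" "s n \<noteq> t" using s by auto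
        have "\<bar>u (s n) x - u t x\<bar> \<le> M * \<bar>s n - t\<bar>" using M sn t by (intro u_difference_bound) auto
        then have "\<bar>(u (s n) x - u t x) / (s n - t)\<bar> \<le> M" using sn(2) by (simp add: abs_divide divide_le_eq)
        then show "norm ((u (s n) x - u t x) / (s n - t) * rep_l2 w x) \<le> M * \<bar>rep_l2 w x\<bar>"
          by (simp only: real_norm_def abs_mult) (intro mult_right_mono, auto)
      qed
      show "(\<lambda>x. ut t x * rep_l2 w x) \<in> borel_measurable L"
        using t by (intro borel_measurable_times rep_L borel_L[OF u_measurable(3)]) auto
      show "(\<lambda>x. (u (s n) x - u t x) / (s n - t) * rep_l2 w x) \<in> borel_measurable L" for n
      proof -
        have "0 < s n" using s by (metis DiffD1 atLeastAtMost_iff less_le_trans zero_less_one)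
        then show ?thesis using t
          by (intro borel_measurable_times rep_L borel_measurable_divide borel_measurable_diff borel_measurable_const borel_L[OF u_measurable(1)]) auto
      qed
    qed
    ultimately show "(\<lambda>n. (inner (v (s n)) w - inner (v t) w) / (s n - t)) \<longlonglongrightarrow> (\<integral>x. ut t x * rep_l2 w x \<partial>L)"
      by (simp only:)
  qed
qed

lemma ut_pairing_continuous:
  assumes w: "w \<in> V_space D p"
  shows "continuous_on {1..T} (\<lambda>t. \<integral>x. ut t x * rep_l2 w x \<partial>L)"
  unfolding continuous_on_sequentially comp_def
proof (intro allI ballI impI)
  fix s t assume t: "t \<in> {1..T}" and "(\<forall>n. s n \<in> {1..T}) \<and> s \<longlonglongrightarrow> t"
  then have s: "\<And>n. s n \<in> {1..T}" "s \<longlonglongrightarrow> t" by auto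
  obtain M where M0: "0 \<le> M" and M: "\<And>t x. 1 \<le> t \<Longrightarrow> t \<le> T \<Longrightarrow> \<bar>u t x\<bar> \<le> M \<and> norm (Du t x) \<le> M \<and> \<bar>ut t x\<bar> \<le> M"
    using bounds by blast
  have sp: "0 < s n" "1 \<le> s n" "s n \<le> T" for n using s(1)[of n] by auto
  show "(\<lambda>n. \<integral>x. ut (s n) x * rep_l2 w x \<partial>L) \<longlonglongrightarrow> (\<integral>x. ut t x * rep_l2 w x \<partial>L)"
  proof (rule integral_dominated_convergence[where w = "\<lambda>x. M * \<bar>rep_l2 w x\<bar>"])
    show "integrable L (\<lambda>x. M * \<bar>rep_l2 w x\<bar>)" using rep_integrable[OF w] by simp
    show "AE x in L. (\<lambda>n. ut (s n) x * rep_l2 w x) \<longlonglongrightarrow> ut t x * rep_l2 w x"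
      using t s by (intro AE_I2 tendsto_intros u_tendsto) auto
    show "AE x in L. norm (ut (s n) x * rep_l2 w x) \<le> M * \<bar>rep_l2 w x\<bar>" for n
      using M[OF sp(2,3)] by (intro AE_I2) (simp add: abs_mult mult_right_mono)
    show "(\<lambda>x. ut t x * rep_l2 w x) \<in> borel_measurable L" "(\<lambda>x. ut (s n) x * rep_l2 w x) \<in> borel_measurable L" for n
      using t sp by (intro borel_measurable_times rep_L borel_L[OF u_measurable(3)]; auto)+
  qed
qed

text \<open>Sequential continuity in the norm of V, by which rounding the time yields the simple
  functions for strong measurability.\<close>

lemma V_norm_v_tendsto:
  assumes a: "a \<longlonglongrightarrow> a0" and s: "s \<longlonglongrightarrow> s0" "\<And>n. s n \<in> {1..T}" "s0 \<in> {1..T}"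
  shows "(\<lambda>n. V_norm D p (a0 *\<^sub>R v s0 - a n *\<^sub>R v (s n))) \<longlonglongrightarrow> 0"
proof -
  obtain M where M0: "0 \<le> M" and M: "\<And>t x. 1 \<le> t \<Longrightarrow> t \<le> T \<Longrightarrow> \<bar>u t x\<bar> \<le> M \<and> norm (Du t x) \<le> M \<and> \<bar>ut t x\<bar> \<le> M"
    using bounds by blast
  obtain A where A: "\<And>n. \<bar>a n\<bar> \<le> A"
    using convergent_imp_bounded[OF a] by (auto simp: bounded_iff)
  have A0: "\<bar>a0\<bar> \<le> A" using tendsto_le[OF _ tendsto_const tendsto_rabs[OF a], of A] A by simp
  have sn: "1 \<le> s n" "s n \<le> T" "1 \<le> s0" "s0 \<le> T" for n using s(2)[of n] s(3) by auto
  define f where "f n x = a0 * u s0 x - a n * u (s n) x" for n x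
  define g where "g n x = a0 *\<^sub>R Du s0 x - a n *\<^sub>R Du (s n) x" for n x
  have C1: "C1_supported D (f n) (g n)" for n
  proof -
    \<comment> \<open>The difference is written as a sum over two indices, so that closure under
      finite sums and multiples covers it.\<close>
    have "C1_supported D (\<lambda>x. \<Sum>i\<in>{0,1::nat}. if i = 0 then a0 * u s0 x else - a n * u (s n) x) (\<lambda>x. \<Sum>i\<in>{0,1::nat}. if i = 0 then a0 *\<^sub>R Du s0 x else - a n *\<^sub>R Du (s n) x)"
    proof (rule C1_supported_sum)
      fix i :: nat
      show "C1_supported D (\<lambda>x. if i = 0 then a0 * u s0 x else - a n * u (s n) x) (\<lambda>x. if i = 0 then a0 *\<^sub>R Du s0 x else - a n *\<^sub>R Du (s n) x)"
        using C1_supported_scale[OF u_C1[OF sn(3,4)], of a0] C1_supported_scale[OF u_C1[OF sn(1,2)], of "- a n"]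
        by (cases "i = 0") simp_all
    qed simp
    then show ?thesis unfolding f_def[abs_def] g_def[abs_def] by simp
  qed
  have eq: "a0 *\<^sub>R v s0 - a n *\<^sub>R v (s n) = abs_l2 (f n)" for n
    unfolding v_def f_def[abs_def]
    by (simp add: abs_l2_scaleR abs_l2_diff v_in(3) sn square_integrable_scale)
  have N: "V_norm D p (a0 *\<^sub>R v s0 - a n *\<^sub>R v (s n)) = ((\<integral>x. \<bar>f n x\<bar> powr p \<partial>L) + (\<integral>x. norm (g n x) powr p \<partial>L)) powr (1 / p)" for n
  proof -
    have "0 \<le> V_norm D p (abs_l2 (f n))" by (simp add: V_norm_def W1p_norm_def)
    then have "V_norm D p (abs_l2 (f n)) = (V_norm D p (abs_l2 (f n)) powr p) powr (1 / p)"
      using p1 by (simp add: powr_powr)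
    then show ?thesis unfolding eq V_norm_abs_C1[OF C1] .
  qed
  have fl: "(\<lambda>n. f n x) \<longlonglongrightarrow> a0 * u s0 x - a0 * u s0 x" "(\<lambda>n. g n x) \<longlonglongrightarrow> a0 *\<^sub>R Du s0 x - a0 *\<^sub>R Du s0 x" for x
    unfolding f_def g_def using sn(3) by (intro tendsto_intros a u_tendsto s; simp)+
  have prod: "\<bar>a0\<bar> * y \<le> A * M" "\<bar>a n\<bar> * y \<le> A * M" if "0 \<le> y" "y \<le> M" for y n
    using that A0 A[of n] by (auto intro!: mult_mono)
  have fb: "\<bar>f n x\<bar> \<le> 2 * (A * M)" for n x
  proof -
    have "\<bar>f n x\<bar> \<le> \<bar>a0\<bar> * \<bar>u s0 x\<bar> + \<bar>a n\<bar> * \<bar>u (s n) x\<bar>"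
      unfolding f_def using abs_triangle_ineq4[of "a0 * u s0 x" "a n * u (s n) x"] by (simp add: abs_mult)
    also have "\<dots> \<le> A * M + A * M" using M[OF sn(3,4)] M[OF sn(1,2)] by (intro add_mono prod) auto
    finally show ?thesis by simp
  qed
  have gb: "norm (g n x) \<le> 2 * (A * M)" for n x
  proof -
    have "norm (g n x) \<le> \<bar>a0\<bar> * norm (Du s0 x) + \<bar>a n\<bar> * norm (Du (s n) x)"
      unfolding g_def using norm_triangle_ineq4[of "a0 *\<^sub>R Du s0 x" "a n *\<^sub>R Du (s n) x"] by simp
    also have "\<dots> \<le> A * M + A * M" using M[OF sn(3,4)] M[OF sn(1,2)] by (intro add_mono prod) auto
    finally show ?thesis by simp
  qed
  note fm = borel_L[OF C1_supported_measurable(1)[OF C1]] and gm = borel_L[OF C1_supported_measurable(2)[OF C1]]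
  have "(\<lambda>n. \<integral>x. \<bar>f n x\<bar> powr p \<partial>L) \<longlonglongrightarrow> (\<integral>x. 0 \<partial>L)"
  proof (rule integral_dominated_convergence[where w = "\<lambda>_. (2 * (A * M)) powr p"])
    have "(\<lambda>n. \<bar>f n x\<bar> powr p) \<longlonglongrightarrow> \<bar>a0 * u s0 x - a0 * u s0 x\<bar> powr p" for x
      using p1 by (intro tendsto_powr2 tendsto_intros fl) auto
    then show "AE x in L. (\<lambda>n. \<bar>f n x\<bar> powr p) \<longlonglongrightarrow> 0" by simp
    show "AE x in L. norm (\<bar>f n x\<bar> powr p) \<le> (2 * (A * M)) powr p" for n
      using fb[of n] p1 by (intro AE_I2) (simp add: powr_mono2)
  qed (use fm in auto)
  moreover have "(\<lambda>n. \<integral>x. norm (g n x) powr p \<partial>L) \<longlonglongrightarrow> (\<integral>x. 0 \<partial>L)"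
  proof (rule integral_dominated_convergence[where w = "\<lambda>_. (2 * (A * M)) powr p"])
    have "(\<lambda>n. norm (g n x) powr p) \<longlonglongrightarrow> norm (a0 *\<^sub>R Du s0 x - a0 *\<^sub>R Du s0 x) powr p" for x
      using p1 by (intro tendsto_powr2 tendsto_intros fl) auto
    then show "AE x in L. (\<lambda>n. norm (g n x) powr p) \<longlonglongrightarrow> 0" by simp
    show "AE x in L. norm (norm (g n x) powr p) \<le> (2 * (A * M)) powr p" for n
      using gb[of n] p1 by (intro AE_I2) (simp add: powr_mono2)
  qed (use gm in auto)
  ultimately have "(\<lambda>n. (\<integral>x. \<bar>f n x\<bar> powr p \<partial>L) + (\<integral>x. norm (g n x) powr p \<partial>L)) \<longlonglongrightarrow> 0 + 0"
    by (intro tendsto_add) simp_all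
  then have "(\<lambda>n. ((\<integral>x. \<bar>f n x\<bar> powr p \<partial>L) + (\<integral>x. norm (g n x) powr p \<partial>L)) powr (1 / p)) \<longlonglongrightarrow> (0 + 0) powr (1 / p)"
    using p1 by (intro tendsto_powr2 tendsto_const) (auto intro!: always_eventually add_nonneg_nonneg Bochner_Integration.integral_nonneg)
  then show ?thesis unfolding N by simp
qed

end

section \<open>Concatenation of solutions\<close>

lemma set_integrable_lebesgue_shift:
  fixes f :: "real \<Rightarrow> real"
  assumes "set_integrable lebesgue {a..b} f"
  shows "set_integrable lebesgue {a + h..b + h} (\<lambda>s. f (s - h))"
    "(LINT s:{a + h..b + h}|lebesgue. f (s - h)) = (LINT s:{a..b}|lebesgue. f s)"
proof -
  have e: "indicator {a + h..b + h} s *\<^sub>R f (s - h) = indicator {a..b} (- h + 1 * s) *\<^sub>R f (- h + 1 * s)" for s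
    by (auto simp: indicator_def)
  show "set_integrable lebesgue {a + h..b + h} (\<lambda>s. f (s - h))"
    using assms lebesgue_integrable_real_affine_iff[of 1 "\<lambda>s. indicator {a..b} s *\<^sub>R f s" "- h"]
    unfolding set_integrable_def e by simp
  show "(LINT s:{a + h..b + h}|lebesgue. f (s - h)) = (LINT s:{a..b}|lebesgue. f s)"
    using lebesgue_integral_real_affine[of 1 "\<lambda>s. indicator {a..b} s *\<^sub>R f s" "- h"]
    unfolding set_lebesgue_integral_def e by simp
qed

lemma AE_lebesgue_on_nonneg:
  "(AE t in lebesgue_on {0::real..}. P t) \<longleftrightarrow> (AE t in lebesgue. t \<in> {0..} \<longrightarrow> P t)"
  by (rule AE_restrict_space_iff) simp

lemma AE_lebesgue_shift:
  fixes h :: real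
  assumes "AE t in lebesgue_on {0..}. P t"
  shows "AE t in lebesgue. h \<le> t \<longrightarrow> P (t - h)"
proof -
  have "AE t in lebesgue. t \<in> {0..} \<longrightarrow> P t" using assms by (simp add: AE_restrict_space_iff)
  then obtain N where N: "N \<in> null_sets lebesgue" "{t. \<not> (0 \<le> t \<longrightarrow> P t)} \<subseteq> N"
    by (auto simp: eventually_ae_filter)
  have "(+) h ` N \<in> null_sets lebesgue"
    using negligible_translation[of N h] N(1) by (simp add: negligible_iff_null_sets)
  moreover have "{t. \<not> (h \<le> t \<longrightarrow> P (t - h))} \<subseteq> (+) h ` N"
  proof
    fix t assume "t \<in> {t. \<not> (h \<le> t \<longrightarrow> P (t - h))}"
    then have "t - h \<in> N" using N(2) by auto
    then show "t \<in> (+) h ` N" by (intro image_eqI[of _ _ "t - h"]) auto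
  qed
  ultimately show ?thesis by (auto simp: eventually_ae_filter)
qed

text \<open>Clamped at 0, so that the half-line is mapped into itself and simple functions on it can
  be composed with the shift.\<close>

lemma lebesgue_shift_measurable:
  "(\<lambda>t. if t \<le> h then 0 else t - h) \<in> measurable (lebesgue_on {0::real..}) (lebesgue_on {0..})"
proof (rule measurable_restrict_space2)
  show "(\<lambda>t. if t \<le> h then 0 else t - h) \<in> space (lebesgue_on {0..}) \<rightarrow> {0..}" by auto
  have "(\<lambda>t. - h + 1 * t) \<in> measurable lebesgue (lebesgue :: real measure)"
    using lebesgue_affine_measurable[where c = "\<lambda>x::real. 1" and t = "- h"] by simp
  then have "(\<lambda>t. t - h) \<in> measurable lebesgue (lebesgue :: real measure)" by simp
  then have "(\<lambda>t. if t \<le> h then 0 else t - h) \<in> measurable lebesgue (lebesgue :: real measure)"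
    by (intro measurable_If) auto
  then show "(\<lambda>t. if t \<le> h then 0 else t - h) \<in> measurable (lebesgue_on {0..}) (lebesgue :: real measure)"
    by (rule measurable_restrict_space1)
qed

lemma set_integrable_mono_fun:
  fixes f g :: "real \<Rightarrow> real"
  assumes "set_integrable lebesgue A g" "f \<in> borel_measurable (lebesgue_on B)" "A \<subseteq> B" "A \<in> sets lebesgue" "B \<in> sets lebesgue"
    and le: "\<And>s. s \<in> A - N \<Longrightarrow> \<bar>f s\<bar> \<le> g s" and N: "negligible N"
  shows "set_integrable lebesgue A f"
  unfolding set_integrable_def
proof (rule Bochner_Integration.integrable_bound[OF assms(1)[unfolded set_integrable_def]])
  have "f \<in> borel_measurable (lebesgue_on A)"
    by (rule measurable_restrict_mono[OF assms(2,3)])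
  then show "(\<lambda>x. indicat_real A x *\<^sub>R f x) \<in> borel_measurable lebesgue"
    using assms(4) by (subst (asm) borel_measurable_restrict_space_iff) (auto simp: mult.commute)
  have "AE x in lebesgue. x \<notin> N" using N by (intro AE_not_in) (simp add: negligible_iff_null_sets)
  then show "AE x in lebesgue. norm (indicat_real A x *\<^sub>R f x) \<le> norm (indicat_real A x *\<^sub>R g x)"
  proof eventually_elim
    fix x assume "x \<notin> N"
    then show "norm (indicat_real A x *\<^sub>R f x) \<le> norm (indicat_real A x *\<^sub>R g x)"
      using le[of x] by (cases "x \<in> A") auto
  qed
qed

context sobolev2
begin

text \<open>\<open>is_solution\<close> does not assert that its integrand is integrable, and a
  divergent integral would count as 0; splitting the integral at a time needs the real thing.
  Measurability comes from \<open>p_laplace_continuous\<close>, the dominating function from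
  \<open>p_laplace_bound\<close>.\<close>

lemma p_laplace_time_integrable:
  assumes Z: "in_Lp_loc_V D p Z" and w: "w \<in> V_space D p" and r: "0 \<le> r"
    and c: "continuous_on {0..r} c"
  shows "set_integrable lebesgue {0..r} (\<lambda>s. c s * p_laplace D p (Z s) w)"
proof -
  obtain s where s: "\<And>k::nat. simple_function (lebesgue_on {0..}) (s k)" "\<And>k. s k ` {0..} \<subseteq> V_space D p"
    and ae: "AE t in lebesgue_on {0..}. Z t \<in> V_space D p \<and> (\<lambda>k. V_norm D p (Z t - s k t)) \<longlonglongrightarrow> 0"
    using Z unfolding in_Lp_loc_V_def strongly_measurable_V_def by blast
  have "AE t in lebesgue. t \<in> {0..} \<longrightarrow> Z t \<in> V_space D p \<and> (\<lambda>k. V_norm D p (Z t - s k t)) \<longlonglongrightarrow> 0"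
    using ae by (rule AE_lebesgue_on_nonneg[THEN iffD1])
  then obtain N where N: "negligible N"
    "\<And>t. 0 \<le> t \<Longrightarrow> t \<notin> N \<Longrightarrow> Z t \<in> V_space D p \<and> (\<lambda>k. V_norm D p (Z t - s k t)) \<longlonglongrightarrow> 0"
  proof (rule AE_E3)
    fix N :: "real set"
    assume "N \<in> null_sets lebesgue"
      and "\<And>t. t \<in> space lebesgue - N \<Longrightarrow> t \<in> {0..} \<longrightarrow> Z t \<in> V_space D p \<and> (\<lambda>k. V_norm D p (Z t - s k t)) \<longlonglongrightarrow> 0"
    then show thesis by (intro that[of N]) (auto simp: negligible_iff_null_sets)
  qed
  have "(\<lambda>t. p_laplace D p (s k t) w) measurable_on {0..}" for k
    using borel_measurable_simple_function[OF simple_function_compose1[OF s(1), of "\<lambda>u. p_laplace D p u w" k]]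
    by (simp add: measurable_on_iff_borel_measurable)
  then have "(\<lambda>t. p_laplace D p (Z t) w) measurable_on {0..}"
  proof (rule measurable_on_limit[OF _ N(1)])
    fix t :: real assume "t \<in> {0..} - N"
    then show "(\<lambda>k. p_laplace D p (s k t) w) \<longlonglongrightarrow> p_laplace D p (Z t) w"
      using N(2)[of t] s(2) w by (intro p_laplace_continuous) auto
  qed
  then have m: "(\<lambda>t. p_laplace D p (Z t) w) \<in> borel_measurable (lebesgue_on {0..})"
    by (simp add: measurable_on_iff_borel_measurable)
  have "set_integrable lebesgue {0..r} (\<lambda>t. V_norm D p (Z t) powr p + V_norm D p w powr p)"
  proof (rule set_integral_add(1))
    show "set_integrable lebesgue {0..r} (\<lambda>t. V_norm D p (Z t) powr p)" using Z r by (simp add: in_Lp_loc_V_def)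
    show "set_integrable lebesgue {0..r} (\<lambda>t. V_norm D p w powr p)"
      by (rule absolutely_integrable_continuous_real) simp
  qed
  then have "(\<lambda>t. p_laplace D p (Z t) w) absolutely_integrable_on {0..r}"
  proof (rule set_integrable_mono_fun[OF _ m _ _ _ _ N(1)])
    fix t assume "t \<in> {0..r} - N"
    then show "\<bar>p_laplace D p (Z t) w\<bar> \<le> V_norm D p (Z t) powr p + V_norm D p w powr p"
      using N(2)[of t] w by (intro p_laplace_bound) auto
  qed auto
  then show ?thesis
  proof (intro absolutely_integrable_bounded_measurable_product_real)
    show "c \<in> borel_measurable (lebesgue_on {0..r})"
      using c by (intro continuous_imp_measurable_on_sets_lebesgue) auto
    show "bounded (c ` {0..r})" using c by (intro compact_imp_bounded compact_continuous_image) auto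
  qed auto
qed

end

context bumps
begin

definition Z1 where "Z1 \<rho> \<sigma> t = exp (\<rho> t) *\<^sub>R v (\<sigma> t)"

text \<open>
  Solutions live on \<open>{0..}\<close>, but the bumps may meet or leave \<open>D\<close> after the time \<open>T\<close>; hence the
  continuation by an arbitrary solution \<open>Z2\<close>.
\<close>

theorem concatenated_solution:
  fixes z \<rho> \<sigma> :: "real \<Rightarrow> real"
  assumes z: "continuous_on {0..} z" and T0: "0 \<le> T0"
    and \<rho>: "\<And>t. t \<in> {0..T0} \<Longrightarrow> (\<rho> has_real_derivative \<eta> + \<mu> * z t) (at t within {0..T0})"
    and \<sigma>: "\<And>t. t \<in> {0..T0} \<Longrightarrow> (\<sigma> has_real_derivative exp ((p - 2) * (\<mu> * z t + \<rho> t))) (at t within {0..T0})"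
    and \<sigma>_in: "\<And>t. t \<in> {0..T0} \<Longrightarrow> \<sigma> t \<in> {1..T}"
    and Z2: "is_solution D p \<eta> \<mu> (\<lambda>s. z (T0 + s)) x2 Z2" "Z2 0 = Z1 \<rho> \<sigma> T0"
  shows "is_solution D p \<eta> \<mu> z (exp (\<mu> * z 0) *\<^sub>R Z1 \<rho> \<sigma> 0) (\<lambda>t. if t \<le> T0 then Z1 \<rho> \<sigma> t else Z2 (t - T0))"
    (is "is_solution _ _ _ _ _ _ ?Z")
proof -
  let ?Z1 = "Z1 \<rho> \<sigma>"
  have \<rho>c: "continuous_on {0..T0} \<rho>" and \<sigma>c: "continuous_on {0..T0} \<sigma>"
    by (rule DERIV_continuous_on[OF \<rho>], assumption) (rule DERIV_continuous_on[OF \<sigma>])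
  have zc: "continuous_on {0..T0} z" using z by (rule continuous_on_subset) auto
  have Z2c: "continuous_on {0..} Z2" and Z2L: "\<And>t. 0 \<le> t \<Longrightarrow> Z2 t \<in> L2 D" and Z2V: "in_Lp_loc_V D p Z2"
    using Z2(1) by (auto simp: is_solution_def)
  have Z1c: "continuous_on {0..T0} ?Z1"
    unfolding Z1_def using \<sigma>_in
    by (intro continuous_intros \<rho>c continuous_on_compose2[OF v_continuous \<sigma>c]) auto
  have Z1V: "?Z1 t \<in> V_space D p" and Z1L: "?Z1 t \<in> L2 D" if "t \<in> {0..T0}" for t
    using \<sigma>_in[OF that] v_in[of "\<sigma> t"] by (auto simp: Z1_def intro: L2_scaleR)
  have V_lim: "(\<lambda>n. V_norm D p (?Z1 t - ?Z1 (g n))) \<longlonglongrightarrow> 0" if g: "g \<longlonglongrightarrow> t" "\<And>n. g n \<in> {0..T0}" "t \<in> {0..T0}" for g t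
  proof -
    have "(\<lambda>n. \<rho> (g n)) \<longlonglongrightarrow> \<rho> t" "(\<lambda>n. \<sigma> (g n)) \<longlonglongrightarrow> \<sigma> t"
      using \<rho>c \<sigma>c g by (auto simp: continuous_on_sequentially comp_def)
    then show ?thesis unfolding Z1_def using \<sigma>_in g
      by (intro V_norm_v_tendsto tendsto_intros) auto
  qed
  have Zc: "continuous_on {0..} ?Z"
  proof -
    have "continuous_on ({0..T0} \<union> {T0..}) (\<lambda>t. if t \<le> T0 then ?Z1 t else Z2 (t - T0))"
    proof (rule continuous_on_cases)
      show "continuous_on {T0..} (\<lambda>t. Z2 (t - T0))"
        by (intro continuous_on_compose2[OF Z2c] continuous_intros) auto
    qed (use Z1c Z2(2) in auto)
    moreover have "{0..T0} \<union> {T0..} = {0..}" using T0 by auto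
    ultimately show ?thesis by simp
  qed
  have ZL: "?Z t \<in> L2 D" if "0 \<le> t" for t using Z1L[of t] Z2L[of "t - T0"] that by auto
  have "strongly_measurable_V D p ?Z"
  proof -
    obtain s where s: "\<And>k::nat. simple_function (lebesgue_on {0..}) (s k)" "\<And>k. s k ` {0..} \<subseteq> V_space D p"
      and ae: "AE t in lebesgue_on {0..}. Z2 t \<in> V_space D p \<and> (\<lambda>k. V_norm D p (Z2 t - s k t)) \<longlonglongrightarrow> 0"
      using Z2V unfolding in_Lp_loc_V_def strongly_measurable_V_def by blast
    \<comment> \<open>Time rounded down takes finitely many values on \<open>{0..T0}\<close>, so its
      composition with the trajectory is simple. The value 0 after \<open>T0\<close> keeps
      \<open>g\<close> inside the interval where the trajectory is in V.\<close>
    define g where "g k t = (if t \<le> T0 then of_int \<lfloor>real (Suc k) * t\<rfloor> / real (Suc k) else 0)" for k t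
    have gs: "simple_function (lebesgue_on {0..}) (g k)" for k
    proof (rule simple_function_borel_measurable)
      show "g k \<in> borel_measurable (lebesgue_on {0..})"
        unfolding g_def by (intro measurable_restrict_space1 measurable_completion) simp
      have "g k t \<in> (\<lambda>i. of_int i / real (Suc k)) ` {0..\<lfloor>real (Suc k) * T0\<rfloor>}" if "0 \<le> t" for t
      proof (cases "t \<le> T0")
        case True
        then have "\<lfloor>real (Suc k) * t\<rfloor> \<in> {0..\<lfloor>real (Suc k) * T0\<rfloor>}"
          using that by (auto intro!: floor_mono mult_left_mono simp del: of_nat_Suc)
        then show ?thesis using True by (auto simp: g_def simp del: of_nat_Suc)
      next
        case False
        then show ?thesis using T0 by (auto simp: g_def simp del: of_nat_Suc intro!: image_eqI[of _ _ 0])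
      qed
      then have "g k ` space (lebesgue_on {0..}) \<subseteq> (\<lambda>i. of_int i / real (Suc k)) ` {0..\<lfloor>real (Suc k) * T0\<rfloor>}"
        by auto
      then show "finite (g k ` space (lebesgue_on {0..}))" by (rule finite_subset) simp
    qed
    have gb: "g k t \<in> {0..T0}" if "0 \<le> t" for k t
    proof (cases "t \<le> T0")
      case True
      have "of_int \<lfloor>real (Suc k) * t\<rfloor> \<le> real (Suc k) * t" "0 \<le> \<lfloor>real (Suc k) * t\<rfloor>" using that by auto
      then have "of_int \<lfloor>real (Suc k) * t\<rfloor> / real (Suc k) \<le> t" "0 \<le> of_int \<lfloor>real (Suc k) * t\<rfloor> / real (Suc k)"
        by (auto simp: divide_le_eq mult.commute simp del: of_nat_Suc)
      then show ?thesis using True by (simp add: g_def del: of_nat_Suc)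
    qed (simp add: g_def T0)
    have gl: "(\<lambda>k. g k t) \<longlonglongrightarrow> t" if "0 \<le> t" "t \<le> T0" for t
    proof (rule tendsto_sandwich)
      show "\<forall>\<^sub>F k in sequentially. t - 1 / real (Suc k) \<le> g k t"
      proof (rule always_eventually, rule allI)
        fix k
        have "real (Suc k) * t - 1 \<le> of_int \<lfloor>real (Suc k) * t\<rfloor>" by linarith
        then have "(real (Suc k) * t - 1) / real (Suc k) \<le> of_int \<lfloor>real (Suc k) * t\<rfloor> / real (Suc k)"
          by (rule divide_right_mono) simp
        then show "t - 1 / real (Suc k) \<le> g k t" using that by (simp add: g_def diff_divide_distrib del: of_nat_Suc)
      qed
      show "\<forall>\<^sub>F k in sequentially. g k t \<le> t"
      proof (rule always_eventually, rule allI)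
        fix k
        have "of_int \<lfloor>real (Suc k) * t\<rfloor> \<le> real (Suc k) * t" by linarith
        then show "g k t \<le> t" using that by (simp add: g_def divide_le_eq mult.commute del: of_nat_Suc)
      qed
      show "(\<lambda>n. t - 1 / real (Suc n)) \<longlonglongrightarrow> t"
        using tendsto_diff[OF tendsto_const LIMSEQ_inverse_real_of_nat, of t] by (simp add: inverse_eq_divide)
    qed simp
    define h where "h t = (if t \<le> T0 then 0 else t - T0)" for t
    have hm: "h \<in> measurable (lebesgue_on {0..}) (lebesgue_on {0..})"
      unfolding h_def[abs_def] by (rule lebesgue_shift_measurable)
    define r where "r k t = (if t \<in> {..T0} then ?Z1 (g k t) else s k (h t))" for k t
    have "simple_function (lebesgue_on {0..}) (r k)" for k
      unfolding r_def
    proof (rule simple_function_If_set)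
      show "simple_function (lebesgue_on {0..}) (\<lambda>t. ?Z1 (g k t))" by (rule simple_function_compose1[OF gs])
      show "simple_function (lebesgue_on {0..}) (\<lambda>t. s k (h t))" by (rule simple_function_comp[OF hm s(1)])
      show "{..T0} \<inter> space (lebesgue_on {0..}) \<in> sets (lebesgue_on {0..})"
        by (auto simp: sets_restrict_space intro!: image_eqI[of _ _ "{..T0}"])
    qed
    moreover have "r k ` {0..} \<subseteq> V_space D p" for k
      using Z1V[OF gb] s(2)[of k] by (auto simp: r_def h_def)
    moreover have "AE t in lebesgue_on {0..}. ?Z t \<in> V_space D p \<and> (\<lambda>k. V_norm D p (?Z t - r k t)) \<longlonglongrightarrow> 0"
    proof -
      have "AE t in lebesgue. T0 \<le> t \<longrightarrow> Z2 (t - T0) \<in> V_space D p \<and> (\<lambda>k. V_norm D p (Z2 (t - T0) - s k (t - T0))) \<longlonglongrightarrow> 0"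
        by (rule AE_lebesgue_shift[OF ae])
      then have "AE t in lebesgue. t \<in> {0..} \<longrightarrow> ?Z t \<in> V_space D p \<and> (\<lambda>k. V_norm D p (?Z t - r k t)) \<longlonglongrightarrow> 0"
      proof eventually_elim
        fix t assume H: "T0 \<le> t \<longrightarrow> Z2 (t - T0) \<in> V_space D p \<and> (\<lambda>k. V_norm D p (Z2 (t - T0) - s k (t - T0))) \<longlonglongrightarrow> 0"
        show "t \<in> {0..} \<longrightarrow> ?Z t \<in> V_space D p \<and> (\<lambda>k. V_norm D p (?Z t - r k t)) \<longlonglongrightarrow> 0"
        proof
          assume "t \<in> {0..}"
          then show "?Z t \<in> V_space D p \<and> (\<lambda>k. V_norm D p (?Z t - r k t)) \<longlonglongrightarrow> 0"
            using H Z1V[of t] V_lim[OF gl gb, of t] by (cases "t \<le> T0") (auto simp: r_def h_def)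
        qed
      qed
      then show ?thesis by (simp only: AE_lebesgue_on_nonneg)
    qed
    ultimately show ?thesis unfolding strongly_measurable_V_def by (intro exI[of _ r]) auto
  qed
  moreover have "set_integrable lebesgue {0..r} (\<lambda>t. V_norm D p (?Z t) powr p)" if "0 \<le> r" for r
  proof -
    have V0: "V_norm D p y \<ge> 0" for y by (simp add: V_norm_def W1p_norm_def)
    obtain M where M: "0 \<le> M" "\<And>t x. 1 \<le> t \<Longrightarrow> t \<le> T \<Longrightarrow> \<bar>u t x\<bar> \<le> M \<and> norm (Du t x) \<le> M \<and> \<bar>ut t x\<bar> \<le> M"
      using bounds by blast
    have eqV: "V_norm D p (?Z1 t) powr p = exp (\<rho> t) powr p * ((\<integral>x. \<bar>u (\<sigma> t) x\<bar> powr p \<partial>L) + (\<integral>x. norm (Du (\<sigma> t) x) powr p \<partial>L))"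
      if "t \<in> {0..T0}" for t
    proof -
      have st: "1 \<le> \<sigma> t" "\<sigma> t \<le> T" using \<sigma>_in[OF that] by auto
      have "?Z1 t = abs_l2 (\<lambda>x. exp (\<rho> t) * u (\<sigma> t) x)"
        unfolding Z1_def v_def by (rule abs_l2_scaleR[OF v_in(3)[OF st]])
      then show ?thesis
        using V_norm_abs_C1[OF C1_supported_scale[OF u_C1[OF st], of "exp (\<rho> t)"]]
        by (simp add: abs_mult powr_mult distrib_left)
    qed
    have cu: "continuous_on {1..T} (\<lambda>t. (\<integral>x. \<bar>u t x\<bar> powr p \<partial>L) + (\<integral>x. norm (Du t x) powr p \<partial>L))"
      unfolding continuous_on_sequentially comp_def
    proof (intro allI ballI impI tendsto_add)
      fix s t assume t: "t \<in> {1..T}" and "(\<forall>n. s n \<in> {1..T}) \<and> s \<longlonglongrightarrow> t"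
      then have s: "\<And>n. s n \<in> {1..T}" "s \<longlonglongrightarrow> t" "0 < t" by auto
      have sn: "0 < s n" "1 \<le> s n" "s n \<le> T" for n using s(1)[of n] by auto
      show "(\<lambda>n. \<integral>x. \<bar>u (s n) x\<bar> powr p \<partial>L) \<longlonglongrightarrow> (\<integral>x. \<bar>u t x\<bar> powr p \<partial>L)"
      proof (rule integral_dominated_convergence[where w = "\<lambda>_. M powr p"])
        show "AE x in L. (\<lambda>n. \<bar>u (s n) x\<bar> powr p) \<longlonglongrightarrow> \<bar>u t x\<bar> powr p"
          using s p1 by (intro AE_I2 tendsto_powr2 tendsto_intros u_tendsto) auto
        show "AE x in L. norm (\<bar>u (s n) x\<bar> powr p) \<le> M powr p" for n
          using M(2)[OF sn(2,3)] p1 by (intro AE_I2) (simp add: powr_mono2)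
        show "(\<lambda>x. \<bar>u t x\<bar> powr p) \<in> borel_measurable L" "(\<lambda>x. \<bar>u (s n) x\<bar> powr p) \<in> borel_measurable L" for n
          using borel_L[OF u_measurable(1)[OF s(3)]] borel_L[OF u_measurable(1)[OF sn(1)]] by auto
      qed simp
      show "(\<lambda>n. \<integral>x. norm (Du (s n) x) powr p \<partial>L) \<longlonglongrightarrow> (\<integral>x. norm (Du t x) powr p \<partial>L)"
      proof (rule integral_dominated_convergence[where w = "\<lambda>_. M powr p"])
        show "AE x in L. (\<lambda>n. norm (Du (s n) x) powr p) \<longlonglongrightarrow> norm (Du t x) powr p"
          using s p1 by (intro AE_I2 tendsto_powr2 tendsto_intros u_tendsto) auto
        show "AE x in L. norm (norm (Du (s n) x) powr p) \<le> M powr p" for n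
          using M(2)[OF sn(2,3)] p1 by (intro AE_I2) (simp add: powr_mono2)
        show "(\<lambda>x. norm (Du t x) powr p) \<in> borel_measurable L" "(\<lambda>x. norm (Du (s n) x) powr p) \<in> borel_measurable L" for n
          using borel_L[OF u_measurable(2)[OF s(3)]] borel_L[OF u_measurable(2)[OF sn(1)]] by auto
      qed simp
    qed
    have "continuous_on {0..T0} (\<lambda>t. exp (\<rho> t) powr p * ((\<integral>x. \<bar>u (\<sigma> t) x\<bar> powr p \<partial>L) + (\<integral>x. norm (Du (\<sigma> t) x) powr p \<partial>L)))"
      using \<sigma>_in by (intro continuous_on_mult continuous_intros \<rho>c continuous_on_compose2[OF cu \<sigma>c]) auto
    then have "continuous_on {0..T0} (\<lambda>t. V_norm D p (?Z1 t) powr p)"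
      using eqV by (subst continuous_on_cong[OF refl]) auto
    then have "set_integrable lebesgue {0..T0} (\<lambda>t. V_norm D p (?Z1 t) powr p)"
      by (rule absolutely_integrable_continuous_real)
    then have "set_integrable lebesgue {0..T0} (\<lambda>t. V_norm D p (?Z t) powr p)"
      by (subst set_integrable_cong[OF refl refl]) auto
    moreover have "set_integrable lebesgue {T0..r + T0} (\<lambda>t. V_norm D p (?Z t) powr p)"
    proof -
      have "set_integrable lebesgue {0..r} (\<lambda>t. V_norm D p (Z2 t) powr p)" using Z2V that by (simp add: in_Lp_loc_V_def)
      from set_integrable_lebesgue_shift(1)[OF this, of T0]
      show ?thesis using Z2(2) by (subst set_integrable_cong[OF refl refl]) (auto simp: add.commute)
    qed
    ultimately have "set_integrable lebesgue ({0..T0} \<union> {T0..r + T0}) (\<lambda>t. V_norm D p (?Z t) powr p)"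
      by (intro set_integrable_Un) auto
    then show ?thesis by (rule set_integrable_subset) (use T0 in auto)
  qed
  ultimately have ZV: "in_Lp_loc_V D p ?Z" by (simp add: in_Lp_loc_V_def)
  have eq: "inner (?Z t) w = inner (?Z 0) w + (LINT s:{0..t}|lebesgue. exp ((p - 2) * \<mu> * z s) * p_laplace D p (?Z s) w + \<eta> * inner (?Z s) w + \<mu> * z s * inner (?Z s) w)"
    if t: "0 \<le> t" and w: "w \<in> V_space D p" for t w
  proof -
    define F where "F s = exp ((p - 2) * \<mu> * z s) * p_laplace D p (?Z s) w + \<eta> * inner (?Z s) w + \<mu> * z s * inner (?Z s) w" for s
    \<comment> \<open>The integrand on \<open>{0..T0}\<close> after homogeneity has pulled
      \<open>exp (\<rho> s)\<close> out of the operator; in this form continuity in time is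
      available.\<close>
    define F1 where "F1 s = exp ((p - 1) * \<rho> s) * exp ((p - 2) * \<mu> * z s) * (\<integral>x. ut (\<sigma> s) x * rep_l2 w x \<partial>L) + (\<eta> + \<mu> * z s) * inner (?Z1 s) w" for s
    have FF1: "F s = F1 s" if "s \<in> {0..T0}" for s
    proof -
      have "p_laplace D p (?Z1 s) w = exp (\<rho> s) powr (p - 1) * (\<integral>x. ut (\<sigma> s) x * rep_l2 w x \<partial>L)"
        unfolding Z1_def using \<sigma>_in[OF that] w by (intro p_laplace_v) auto
      then show ?thesis using that by (simp add: F_def F1_def exp_powr_real algebra_simps)
    qed
    have F1c: "continuous_on {0..T0} F1"
      unfolding F1_def using \<sigma>_in
      by (intro continuous_intros \<rho>c zc Z1c continuous_on_compose2[OF ut_pairing_continuous[OF w] \<sigma>c]) auto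
    have der: "((\<lambda>s. inner (?Z1 s) w) has_real_derivative F1 s) (at s within {0..T0})" if s: "s \<in> {0..T0}" for s
    proof -
      have "((\<lambda>s. inner (v (\<sigma> s)) w) has_real_derivative (\<integral>x. ut (\<sigma> s) x * rep_l2 w x \<partial>L) * exp ((p - 2) * (\<mu> * z s + \<rho> s))) (at s within {0..T0})"
      proof -
        have "((\<lambda>t. inner (v t) w) has_real_derivative (\<integral>x. ut (\<sigma> s) x * rep_l2 w x \<partial>L)) (at (\<sigma> s) within {1..T})"
          by (rule inner_v_derivative[OF w \<sigma>_in[OF s]])
        then have "((\<lambda>t. inner (v t) w) has_real_derivative (\<integral>x. ut (\<sigma> s) x * rep_l2 w x \<partial>L)) (at (\<sigma> s) within \<sigma> ` {0..T0})"
          by (rule DERIV_subset) (use \<sigma>_in in blast)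
        from DERIV_image_chain[OF this \<sigma>[OF s]] show ?thesis unfolding comp_def .
      qed
      moreover have "((\<lambda>s. exp (\<rho> s)) has_real_derivative exp (\<rho> s) * (\<eta> + \<mu> * z s)) (at s within {0..T0})"
        by (rule DERIV_chain2[OF DERIV_exp \<rho>[OF s]])
      ultimately
      have "((\<lambda>s. exp (\<rho> s) * inner (v (\<sigma> s)) w) has_real_derivative
        exp (\<rho> s) * (\<eta> + \<mu> * z s) * inner (v (\<sigma> s)) w + (\<integral>x. ut (\<sigma> s) x * rep_l2 w x \<partial>L) * exp ((p - 2) * (\<mu> * z s + \<rho> s)) * exp (\<rho> s)) (at s within {0..T0})"
        by (intro DERIV_mult)
      \<comment> \<open>The speed of \<sigma> is made for this identity: times
        \<open>exp (\<rho> s)\<close> it is the coefficient in the equation times the factor from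
        homogeneity.\<close>
      moreover have "exp ((p - 2) * (\<mu> * z s + \<rho> s)) * exp (\<rho> s) = exp ((p - 1) * \<rho> s) * exp ((p - 2) * \<mu> * z s)"
        unfolding mult_exp_exp by (simp add: algebra_simps)
      then have "exp (\<rho> s) * (\<eta> + \<mu> * z s) * inner (v (\<sigma> s)) w + (\<integral>x. ut (\<sigma> s) x * rep_l2 w x \<partial>L) * exp ((p - 2) * (\<mu> * z s + \<rho> s)) * exp (\<rho> s) = F1 s"
        by (simp add: F1_def Z1_def mult_ac)
      ultimately show ?thesis by (simp add: Z1_def)
    qed
    have part1: "set_integrable lebesgue {0..t} F \<and> inner (?Z1 t) w = inner (?Z1 0) w + (LINT s:{0..t}|lebesgue. F s)" if "0 \<le> t" "t \<le> T0" for t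
    proof -
      have c: "continuous_on {0..t} F1" by (rule continuous_on_subset[OF F1c]) (use that in auto)
      have "(F1 has_integral (inner (?Z1 t) w - inner (?Z1 0) w)) {0..t}"
      proof (rule fundamental_theorem_of_calculus[OF that(1)])
        fix s assume "s \<in> {0..t}"
        then have "((\<lambda>s. inner (?Z1 s) w) has_real_derivative F1 s) (at s within {0..t})"
          using that by (intro DERIV_subset[OF der]) auto
        then show "((\<lambda>s. inner (?Z1 s) w) has_vector_derivative F1 s) (at s within {0..t})"
          by (simp add: has_real_derivative_iff_has_vector_derivative)
      qed
      moreover have i: "set_integrable lebesgue {0..t} F1" by (rule absolutely_integrable_continuous_real[OF c])
      ultimately have "(LINT s:{0..t}|lebesgue. F1 s) = inner (?Z1 t) w - inner (?Z1 0) w"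
        using set_lebesgue_integral_eq_integral(2)[OF i] integral_unique by metis
      moreover have "(LINT s:{0..t}|lebesgue. F s) = (LINT s:{0..t}|lebesgue. F1 s)"
        by (rule set_lebesgue_integral_cong) (use FF1 that in auto)
      moreover have "set_integrable lebesgue {0..t} F"
        using i by (subst set_integrable_cong[OF refl refl, of _ F F1]) (use FF1 that in auto)
      ultimately show ?thesis by simp
    qed
    show ?thesis
    proof (cases "t \<le> T0")
      case True
      then show ?thesis using part1[of t] t T0 by (simp add: F_def)
    next
      case False
      define r where "r = t - T0"
      have r: "0 \<le> r" "t = r + T0" using False by (auto simp: r_def)
      define F2 where "F2 s = exp ((p - 2) * \<mu> * z (T0 + s)) * p_laplace D p (Z2 s) w + \<eta> * inner (Z2 s) w + \<mu> * z (T0 + s) * inner (Z2 s) w" for s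
      have zr: "continuous_on {0..r} (\<lambda>s. z (T0 + s))"
        by (intro continuous_on_compose2[OF z] continuous_intros) (use T0 in auto)
      have Z2r: "continuous_on {0..r} Z2" by (rule continuous_on_subset[OF Z2c]) auto
      have i1: "set_integrable lebesgue {0..r} (\<lambda>s. exp ((p - 2) * \<mu> * z (T0 + s)) * p_laplace D p (Z2 s) w)"
        by (intro p_laplace_time_integrable[OF Z2V w r(1)] continuous_intros zr)
      have i2: "set_integrable lebesgue {0..r} (\<lambda>s. \<eta> * inner (Z2 s) w + \<mu> * z (T0 + s) * inner (Z2 s) w)"
        by (intro absolutely_integrable_continuous_real continuous_intros zr Z2r)
      have iF2: "set_integrable lebesgue {0..r} F2"
        using set_integral_add(1)[OF i1 i2] by (simp add: F2_def[abs_def] add.assoc)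
      have e2: "inner (Z2 r) w = inner (Z2 0) w + (LINT s:{0..r}|lebesgue. F2 s)"
        using Z2(1) r(1) w unfolding is_solution_def F2_def by blast
      have FF2: "F s = F2 (s - T0)" if "s \<in> {T0..r + T0}" for s
        using that Z2(2) by (auto simp: F_def F2_def)
      have iS: "set_integrable lebesgue {T0..r + T0} F"
        using set_integrable_lebesgue_shift(1)[OF iF2, of T0]
        by (subst set_integrable_cong[OF refl refl, of _ F "\<lambda>s. F2 (s - T0)"]) (use FF2 in auto)
      have "(LINT s:{T0..r + T0}|lebesgue. F s) = (LINT s:{T0..r + T0}|lebesgue. F2 (s - T0))"
        by (rule set_lebesgue_integral_cong) (use FF2 in auto)
      also have "\<dots> = (LINT s:{0..r}|lebesgue. F2 s)"
        using set_integrable_lebesgue_shift(2)[OF iF2, of T0] by simp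
      finally have I2: "(LINT s:{T0..r + T0}|lebesgue. F s) = (LINT s:{0..r}|lebesgue. F2 s)" .
      have pT: "set_integrable lebesgue {0..T0} F" "inner (?Z1 T0) w = inner (?Z1 0) w + (LINT s:{0..T0}|lebesgue. F s)"
        using part1[of T0] T0 by auto
      have un: "{0..t} = {0..T0} \<union> {T0..r + T0}" using T0 r by auto
      have "(LINT s:{0..t}|lebesgue. F s) = (LINT s:{0..T0}|lebesgue. F s) + (LINT s:{T0..r + T0}|lebesgue. F s)"
        unfolding un
      proof (rule set_integral_Un_AE[OF _ _ _ pT(1) iS])
        have "AE x in lebesgue. x \<notin> {T0}" by (rule AE_not_in) (simp add: negligible_iff_null_sets[symmetric])
        then show "AE x in lebesgue. \<not> (x \<in> {0..T0} \<and> x \<in> {T0..r + T0})" by eventually_elim auto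
      qed auto
      then have "inner (Z2 r) w = inner (?Z1 0) w + (LINT s:{0..t}|lebesgue. F s)"
        using e2 I2 pT(2) Z2(2) by simp
      then show ?thesis using False T0 by (simp add: r_def F_def)
    qed
  qed
  show ?thesis
    unfolding is_solution_def using Zc ZL ZV eq T0
    by (intro conjI allI impI ballI) (auto simp: exp_minus)
qed

end

section \<open>Bumps in the attractor\<close>

definition clock :: "real \<Rightarrow> real \<Rightarrow> real set \<Rightarrow> 'a::euclidean_space path \<Rightarrow> real" where
  "clock k a A \<omega> = (LINT s:A|lborel. exp (k * s + a * snd (\<omega> s)))"

text \<open>Uniqueness identifies \<phi> with the explicit solution up to \<open>T0\<close>;
  existence of a solution along the shifted path supplies the continuation beyond
  \<open>T0\<close>.\<close>

lemma (in bumps) rds_grown_bumps: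
  assumes rds: "is_rds_of_equation D p \<eta> \<mu> \<phi>" and good: "good_path D \<omega>" and T0: "0 \<le> T0"
    and K: "1 + clock ((p - 2) * \<eta>) ((p - 2) * \<mu>) {- T0..0} (shift T0 \<omega>) \<le> T"
  shows "\<phi> T0 \<omega> (exp (- (\<eta> * T0 + \<mu> * snd (\<omega> T0))) *\<^sub>R v 1)
    = v (1 + clock ((p - 2) * \<eta>) ((p - 2) * \<mu>) {- T0..0} (shift T0 \<omega>))"
proof -
  let ?z = "ou_process \<omega>"
  have \<omega>: "\<omega> \<in> paths D" using good by (simp add: good_path_def)
  have \<omega>c: "continuous_on UNIV \<omega>" by (rule path_continuous[OF \<omega>])
  define f where "f s = exp ((p - 2) * \<eta> * s + (p - 2) * \<mu> * snd (shift T0 \<omega> s))" for s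
  have fc: "continuous_on A f" for A
    unfolding f_def shift_def
    by (intro continuous_intros continuous_on_compose2[OF \<omega>c]) auto
  have fpos: "0 \<le> f s" for s by (simp add: f_def)
  define \<rho> where "\<rho> t = \<eta> * t + \<mu> * (snd (\<omega> t) - ?z t) - (\<eta> * T0 + \<mu> * snd (\<omega> T0))" for t
  define \<sigma> where "\<sigma> t = 1 + integral {- T0..t - T0} f" for t
  have cl: "clock ((p - 2) * \<eta>) ((p - 2) * \<mu>) {- T0..0} (shift T0 \<omega>) = integral {- T0..0} f"
    unfolding clock_def f_def[symmetric]
    by (intro set_borel_integral_eq_integral(2) borel_integrable_atLeastAtMost' fc)
  have \<rho>': "(\<rho> has_real_derivative \<eta> + \<mu> * ?z t) (at t within {0..T0})" for t
  proof -
    have "((\<lambda>t. snd (\<omega> t) - ?z t) has_real_derivative ?z t) (at t within {0..T0})"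
      by (rule has_field_derivative_at_within[OF good_path_ou(1)[OF good]])
    from DERIV_diff[OF DERIV_add[OF DERIV_cmult_Id[of \<eta>] DERIV_cmult[OF this, of \<mu>]] DERIV_const]
    show ?thesis unfolding \<rho>_def by (simp add: add.commute)
  qed
  have \<sigma>': "(\<sigma> has_real_derivative exp ((p - 2) * (\<mu> * ?z t + \<rho> t))) (at t within {0..T0})" if t: "t \<in> {0..T0}" for t
  proof -
    have "((\<lambda>x. integral {- T0..x} f) has_real_derivative f (t - T0)) (at (t - T0) within {- T0..0})"
      by (rule integral_has_real_derivative[OF fc]) (use t in auto)
    then have 1: "((\<lambda>x. integral {- T0..x} f) has_real_derivative f (t - T0)) (at (t - T0) within (\<lambda>t. t - T0) ` {0..T0})"
      by (rule DERIV_subset) auto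
    have 2: "((\<lambda>t. t - T0) has_real_derivative 1) (at t within {0..T0})"
      by (auto intro!: derivative_eq_intros)
    have "((\<lambda>t. integral {- T0..t - T0} f) has_real_derivative f (t - T0)) (at t within {0..T0})"
      using DERIV_image_chain[OF 1 2] unfolding comp_def mult_1_right .
    then have "(\<sigma> has_real_derivative f (t - T0)) (at t within {0..T0})"
      unfolding \<sigma>_def by (auto intro!: derivative_eq_intros)
    moreover have "f (t - T0) = exp ((p - 2) * (\<mu> * ?z t + \<rho> t))"
      by (simp add: f_def \<rho>_def shift_def algebra_simps)
    ultimately show ?thesis by simp
  qed
  have \<sigma>_in: "\<sigma> t \<in> {1..T}" if "t \<in> {0..T0}" for t
  proof -
    have i: "f integrable_on {- T0..b}" for b by (rule integrable_continuous_real[OF fc])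
    have "0 \<le> integral {- T0..t - T0} f" by (rule Henstock_Kurzweil_Integration.integral_nonneg[OF i fpos])
    moreover have "integral {- T0..t - T0} f \<le> integral {- T0..0} f"
      by (rule integral_subset_le[OF _ i i]) (use that fpos in auto)
    ultimately show ?thesis using K unfolding cl \<sigma>_def by auto
  qed
  have \<sigma>0: "\<sigma> 0 = 1" and \<sigma>T: "\<sigma> T0 = 1 + clock ((p - 2) * \<eta>) ((p - 2) * \<mu>) {- T0..0} (shift T0 \<omega>)"
    by (simp_all add: \<sigma>_def cl)
  have vL: "v (\<sigma> t) \<in> L2 D" if "t \<in> {0..T0}" for t using v_in \<sigma>_in[OF that] by auto
  define x2 where "x2 = exp (\<mu> * ?z T0) *\<^sub>R Z1 \<rho> \<sigma> T0"
  have "x2 \<in> L2 D" unfolding x2_def Z1_def using vL T0 by (auto intro!: L2_scaleR)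
  then obtain Z2 where Z2: "is_solution D p \<eta> \<mu> (ou_process (shift T0 \<omega>)) x2 Z2"
    using rds shift_in_paths[OF \<omega>] unfolding is_rds_of_equation_def by blast
  have "Z2 0 = exp (- \<mu> * ou_process (shift T0 \<omega>) 0) *\<^sub>R x2" using Z2 by (simp add: is_solution_def)
  then have Z20: "Z2 0 = Z1 \<rho> \<sigma> T0" by (simp add: x2_def ou_process_shift exp_minus)
  have os: "ou_process (shift T0 \<omega>) = (\<lambda>s. ?z (T0 + s))" by (rule ext) (rule ou_process_shift)
  have sol: "is_solution D p \<eta> \<mu> ?z (exp (\<mu> * ?z 0) *\<^sub>R Z1 \<rho> \<sigma> 0) (\<lambda>t. if t \<le> T0 then Z1 \<rho> \<sigma> t else Z2 (t - T0))"
    by (rule concatenated_solution[OF continuous_on_subset[OF good_path_ou(2)[OF good]] T0 \<rho>' \<sigma>' \<sigma>_in Z2[unfolded os] Z20]) auto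
  \<comment> \<open>At the start the same normalization leaves the inverse of the growth factor up
    to \<open>T0\<close>.\<close>
  have x1: "exp (\<mu> * ?z 0) *\<^sub>R Z1 \<rho> \<sigma> 0 = exp (- (\<eta> * T0 + \<mu> * snd (\<omega> T0))) *\<^sub>R v 1"
    using path_0[OF \<omega>] by (simp add: Z1_def \<sigma>0 \<rho>_def mult_exp_exp algebra_simps)
  have "exp (- (\<eta> * T0 + \<mu> * snd (\<omega> T0))) *\<^sub>R v 1 \<in> L2 D"
    using vL[of 0] T0 by (auto simp: \<sigma>0 intro: L2_scaleR)
  then obtain Z where
    uq: "\<And>Z'. is_solution D p \<eta> \<mu> ?z (exp (- (\<eta> * T0 + \<mu> * snd (\<omega> T0))) *\<^sub>R v 1) Z' \<Longrightarrow> \<forall>t\<ge>0. Z' t = Z t"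
    and ph: "\<And>t. 0 \<le> t \<Longrightarrow> \<phi> t \<omega> (exp (- (\<eta> * T0 + \<mu> * snd (\<omega> T0))) *\<^sub>R v 1) = exp (\<mu> * ?z t) *\<^sub>R Z t"
    using rds \<omega> unfolding is_rds_of_equation_def by blast
  have "Z T0 = Z1 \<rho> \<sigma> T0" using uq[OF sol[unfolded x1]] T0 by force
  then have "\<phi> T0 \<omega> (exp (- (\<eta> * T0 + \<mu> * snd (\<omega> T0))) *\<^sub>R v 1) = exp (\<mu> * ?z T0) *\<^sub>R Z1 \<rho> \<sigma> T0"
    using ph[OF T0] by simp
  also have "\<dots> = v (\<sigma> T0)" by (simp add: Z1_def \<rho>_def mult_exp_exp algebra_simps)
  finally show ?thesis by (simp add: \<sigma>T)
qed


section \<open>Distance to the attractor and convergence in probability\<close>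

lemma semidist_singleton: "A \<noteq> {} \<Longrightarrow> semidist {x} A = ennreal (infdist x A)"
proof -
  assume A: "A \<noteq> {}"
  have "(INF b\<in>A. ennreal (dist x b)) = ennreal (infdist x A)"
  proof (rule antisym)
    show "ennreal (infdist x A) \<le> (INF b\<in>A. ennreal (dist x b))"
      by (intro INF_greatest ennreal_leI infdist_le)
    show "(INF b\<in>A. ennreal (dist x b)) \<le> ennreal (infdist x A)"
    proof (rule ennreal_le_epsilon)
      fix e :: real assume e: "0 < e"
      have "\<exists>b\<in>A. dist x b < infdist x A + e"
      proof (rule ccontr)
        assume "\<not> ?thesis"
        then have "infdist x A + e \<le> dist x b" if "b \<in> A" for b using that by force
        then have "infdist x A + e \<le> (INF b\<in>A. dist x b)" by (intro cINF_greatest[OF A])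
        then show False using e A by (simp add: infdist_notempty)
      qed
      then obtain b where b: "b \<in> A" "dist x b < infdist x A + e" by blast
      have "(INF b\<in>A. ennreal (dist x b)) \<le> ennreal (dist x b)" by (rule INF_lower[OF b(1)])
      also have "\<dots> \<le> ennreal (infdist x A + e)" using b by (intro ennreal_leI) simp
      finally show "(INF b\<in>A. ennreal (dist x b)) \<le> ennreal (infdist x A) + ennreal e"
        using e by (simp add: infdist_nonneg)
    qed
  qed
  then show ?thesis by (simp add: semidist_def)
qed

text \<open>For empty \<open>A\<close> the infimum is \<open>top\<close>, which
  \<open>enn2real\<close> sends to 0, and \<open>infdist\<close> is 0 by convention. So the
  measurability assumed for \<open>semidist\<close> passes to \<open>infdist\<close> on all
  paths.\<close>

lemma enn2real_semidist_singleton: "enn2real (semidist {x} A) = infdist x A"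
  by (cases "A = {}") (auto simp: semidist_singleton infdist_nonneg, simp add: semidist_def infdist_def)

lemma semidist_mono: "x \<in> X \<Longrightarrow> semidist {x} A \<le> semidist X A"
  unfolding semidist_def by (rule SUP_mono) auto

context noise
begin

lemma clock_measurable [measurable]:
  assumes [measurable]: "A \<in> sets borel"
  shows "clock k a A \<in> borel_measurable P"
proof -
  have "(\<lambda>(\<omega>, s). indicator A s *\<^sub>R exp (k * s + a * snd (\<omega> s))) \<in> borel_measurable (P \<Otimes>\<^sub>M lborel)"
    using beta_joint_measurable unfolding case_prod_beta' by measurable
  then show ?thesis
    unfolding clock_def set_lebesgue_integral_def
    by (rule lborel.borel_measurable_lebesgue_integral)
qed

lemma AE_clock_tendsto:
  assumes "0 < k"
  shows "AE \<omega> in P. (\<forall>n. clock k a {- real n..0} \<omega> \<le> clock k a {..0} \<omega>) \<and>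
    (\<lambda>n. clock k a {- real n..0} \<omega>) \<longlonglongrightarrow> clock k a {..0} \<omega>"
  using AE_clock_integrable[OF assms, of a]
proof eventually_elim
  fix \<omega> :: "'a path" assume i: "set_integrable lborel {..0} (\<lambda>s. exp (k * s + a * snd (\<omega> s)))"
  let ?f = "\<lambda>A s. indicator A s *\<^sub>R exp (k * s + a * snd (\<omega> s))"
  have i': "integrable lborel (?f {..0})" using i by (simp add: set_integrable_def)
  have in': "integrable lborel (?f {- real n..0})" for n
    using set_integrable_subset[OF i, of "{- real n..0}"] by (auto simp: set_integrable_def)
  have "(\<integral>s. ?f {- real n..0} s \<partial>lborel) \<le> (\<integral>s. ?f {..0} s \<partial>lborel)" for n
    by (rule integral_mono[OF in' i']) (auto simp: indicator_def)
  moreover have "(\<lambda>n. \<integral>s. ?f {- real n..0} s \<partial>lborel) \<longlonglongrightarrow> (\<integral>s. ?f {..0} s \<partial>lborel)"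
  proof (rule integral_dominated_convergence[OF _ _ i'])
    show "AE s in lborel. (\<lambda>n. ?f {- real n..0} s) \<longlonglongrightarrow> ?f {..0} s"
    proof (rule AE_I2)
      fix s :: real
      obtain N where N: "- s \<le> real N" using real_arch_simple by blast
      have "eventually (\<lambda>n. ?f {- real n..0} s = ?f {..0} s) sequentially"
        using eventually_ge_at_top[of N]
      proof eventually_elim
        fix n assume "N \<le> n"
        then have "- s \<le> real n" using N by linarith
        then show "?f {- real n..0} s = ?f {..0} s" by (auto simp: indicator_def)
      qed
      then show "(\<lambda>n. ?f {- real n..0} s) \<longlonglongrightarrow> ?f {..0} s" by (rule tendsto_eventually)
    qed
    show "AE s in lborel. norm (?f {- real n..0} s) \<le> ?f {..0} s" for n
      by (rule AE_I2) (auto simp: indicator_def)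
  qed (rule borel_measurable_integrable[OF i'], rule borel_measurable_integrable[OF in'])
  ultimately show "(\<forall>n. clock k a {- real n..0} \<omega> \<le> clock k a {..0} \<omega>) \<and>
    (\<lambda>n. clock k a {- real n..0} \<omega>) \<longlonglongrightarrow> clock k a {..0} \<omega>"
    by (simp add: clock_def set_lebesgue_integral_def)
qed

text \<open>Every tail intersection lies in each late \<open>B n\<close> and is therefore null. This
  is less than almost sure convergence of a subsequence, but enough for membership in a closed
  set.\<close>

lemma AE_frequently_not_in:
  fixes B :: "nat \<Rightarrow> 'a path set"
  assumes B: "\<And>n. B n \<in> events" and lim: "(\<lambda>n. prob (B n)) \<longlonglongrightarrow> 0"
  shows "AE \<omega> in P. \<forall>N. \<exists>n\<ge>N. \<omega> \<notin> B n"
proof -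
  have "AE \<omega> in P. \<exists>n\<ge>N. \<omega> \<notin> B n" for N
  proof -
    have m: "(\<Inter>n\<in>{N..}. B n) \<in> events" using B by (intro sets.countable_INT) auto
    have "prob (\<Inter>n\<in>{N..}. B n) \<le> prob (B n)" if "N \<le> n" for n
      by (rule finite_measure_mono[OF _ B]) (use that in auto)
    then have "prob (\<Inter>n\<in>{N..}. B n) \<le> 0"
      by (intro LIMSEQ_le_const[OF lim]) blast
    then have "prob (\<Inter>n\<in>{N..}. B n) = 0" using measure_nonneg[of P] by (intro antisym)
    then have "(\<Inter>n\<in>{N..}. B n) \<in> null_sets P" using m by (simp add: emeasure_eq_measure null_setsI)
    from AE_not_in[OF this] show ?thesis by eventually_elim auto
  qed
  then show ?thesis by (simp add: AE_all_countable)
qed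

end

context bumps
begin

text \<open>The condition \<open>1 + clock \<le> T\<close> is the price of fixing the configuration
  before the path; it is disposed of by letting \<open>T\<close> run through the integers.\<close>

theorem AE_bumps_in_attractor:
  assumes noise: "canonical_noise_space D Q P" and \<eta>: "0 < \<eta>" and p2: "2 < p"
    and rds: "is_rds_of_equation D p \<eta> \<mu> \<phi>" and attr: "weak_interval_random_attractor D P \<phi> A"
  shows "AE \<omega> in P. 1 + clock ((p - 2) * \<eta>) ((p - 2) * \<mu>) {..0} \<omega> \<le> T \<longrightarrow>
    v (1 + clock ((p - 2) * \<eta>) ((p - 2) * \<mu>) {..0} \<omega>) \<in> A \<omega>"
proof -
  interpret noise D Q P using noise by unfold_locales auto
  define \<tau> :: "nat \<Rightarrow> 'a path \<Rightarrow> real" where "\<tau> n = clock ((p - 2) * \<eta>) ((p - 2) * \<mu>) {- real n..0}" for n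
  define \<tau>' :: "'a path \<Rightarrow> real" where "\<tau>' = clock ((p - 2) * \<eta>) ((p - 2) * \<mu>) {..0}"
  have \<tau>m [measurable]: "\<tau> n \<in> borel_measurable P" for n unfolding \<tau>_def by measurable
  have rcs: "\<And>x. x \<in> L2 D \<Longrightarrow> (\<lambda>\<omega>. semidist {x} (A \<omega>)) \<in> borel_measurable P"
    and cl: "AE \<omega> in P. closed (A \<omega>)" and ne: "AE \<omega> in P. A \<omega> \<noteq> {} \<and> compact (A \<omega>)"
    using attr by (auto simp: weak_interval_random_attractor_def random_closed_set_def)
  \<comment> \<open>The distance to the attractor along the trajectory, with time clamped to
    \<open>{1..T}\<close>: continuous in \<open>s\<close> on the whole line and measurable in the
    path, hence jointly measurable. Only so may it be evaluated at the random time
    \<open>1 + \<tau> n\<close>.\<close>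
  define G where "G \<omega> s = infdist (v (max 1 (min T s))) (A \<omega>)" for \<omega> s
  have Gc: "continuous_on UNIV (G \<omega>)" for \<omega>
    unfolding G_def using T
    by (intro continuous_intros continuous_on_compose2[OF v_continuous]) auto
  have Gm: "(\<lambda>\<omega>. G \<omega> s) \<in> borel_measurable P" for s
  proof -
    have "v (max 1 (min T s)) \<in> L2 D" using v_in(1) T by auto
    from borel_measurable_enn2real[OF rcs[OF this]]
    show ?thesis unfolding G_def enn2real_semidist_singleton by simp
  qed
  have "(\<lambda>(\<omega>, s). G \<omega> s) \<in> borel_measurable (P \<Otimes>\<^sub>M lborel)"
    by (rule borel_measurable_continuous_process[OF Gc Gm])
  moreover have "(\<lambda>\<omega>. (\<omega>, 1 + \<tau> n \<omega>)) \<in> measurable P (P \<Otimes>\<^sub>M lborel)" for n by measurable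
  ultimately have Gnm [measurable]: "(\<lambda>\<omega>. G \<omega> (1 + \<tau> n \<omega>)) \<in> borel_measurable P" for n
    using measurable_compose[of "\<lambda>\<omega>. (\<omega>, 1 + \<tau> n \<omega>)" P "P \<Otimes>\<^sub>M lborel" "\<lambda>(\<omega>, s). G \<omega> s" borel] by simp
  define B where "B e n = {\<omega>\<in>space P. 1 + \<tau> n \<omega> \<le> T \<and> G \<omega> (1 + \<tau> n \<omega>) > e}" for e n
  have Bm [measurable]: "B e n \<in> events" for e n unfolding B_def by measurable
  obtain M where M: "0 \<le> M" "\<And>t x. 1 \<le> t \<Longrightarrow> t \<le> T \<Longrightarrow> \<bar>u t x\<bar> \<le> M \<and> norm (Du t x) \<le> M \<and> \<bar>ut t x\<bar> \<le> M"
    using bounds by blast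
  \<comment> \<open>The interval between the constants \<open>- M\<close> and \<open>M\<close> on
    \<open>D\<close> does not depend on the path and contains every multiple of \<open>v 1\<close>
    by a factor in [0, 1].\<close>
  define box where "box c = abs_l2 (\<lambda>x. c * indicator D x)" for c :: real
  have "D \<in> lmeasurable" using open_D bounded_D lmeasurable_open by blast
  then have sqb: "square_integrable (\<lambda>x. c * indicator D x)" for c :: real
    by (intro square_integrable_scale square_integrable_indicator)
  have boxL: "box c \<in> L2 D" for c unfolding box_def by (rule abs_l2_in_L2[OF sqb]) auto
  have box_le: "le_on D (box (- M)) (box M)"
    unfolding le_on_rep box_def using rep_abs_l2[OF sqb[of "- M"]] rep_abs_l2[OF sqb[of M]]
    by eventually_elim (use M(1) in auto)
  have in_box: "c *\<^sub>R v 1 \<in> order_interval D (box (- M)) (box M)" if "0 \<le> c" "c \<le> 1" for c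
  proof -
    have sq: "square_integrable (u 1)" by (rule v_in(3)) (use T in auto)
    have e: "c *\<^sub>R v 1 = abs_l2 (\<lambda>x. c * u 1 x)" unfolding v_def by (rule abs_l2_scaleR[OF sq])
    have b: "\<bar>c * u 1 x\<bar> \<le> M" for x
      using mult_mono[of c 1 "\<bar>u 1 x\<bar>" M] M(2)[of 1 x] T that by (simp add: abs_mult)
    note ae = rep_abs_l2[OF square_integrable_scale[OF sq, of c]]
    have "le_on D (box (- M)) (c *\<^sub>R v 1)"
      unfolding le_on_rep box_def e using rep_abs_l2[OF sqb[of "- M"]] ae
    proof eventually_elim
      fix x assume "rep_l2 (abs_l2 (\<lambda>x. - M * indicator D x)) x = - M * indicator D x"
        "rep_l2 (abs_l2 (\<lambda>x. c * u 1 x)) x = c * u 1 x"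
      then show "x \<in> D \<longrightarrow> rep_l2 (abs_l2 (\<lambda>x. - M * indicator D x)) x \<le> rep_l2 (abs_l2 (\<lambda>x. c * u 1 x)) x"
        using b[of x] by (simp add: abs_le_iff)
    qed
    moreover have "le_on D (c *\<^sub>R v 1) (box M)"
      unfolding le_on_rep box_def e using rep_abs_l2[OF sqb[of M]] ae
    proof eventually_elim
      fix x assume "rep_l2 (abs_l2 (\<lambda>x. M * indicator D x)) x = M * indicator D x"
        "rep_l2 (abs_l2 (\<lambda>x. c * u 1 x)) x = c * u 1 x"
      then show "x \<in> D \<longrightarrow> rep_l2 (abs_l2 (\<lambda>x. c * u 1 x)) x \<le> rep_l2 (abs_l2 (\<lambda>x. M * indicator D x)) x"
        using b[of x] by (simp add: abs_le_iff)
    qed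
    moreover have "c *\<^sub>R v 1 \<in> L2 D" by (rule L2_scaleR[OF v_in(1)]) (use T in auto)
    ultimately show ?thesis by (simp add: order_interval_def)
  qed
  define E where "E t \<omega> = semidist (\<phi> t \<omega> ` order_interval D (box (- M)) (box M)) (A (shift t \<omega>))" for t \<omega>
  have Etend: "tends_to_0_in_probability P E"
    using attr boxL box_le unfolding weak_interval_random_attractor_def E_def by blast
  then have Em [measurable]: "E (real n) \<in> borel_measurable P" for n
    by (simp add: tends_to_0_in_probability_def)
  have good: "AE \<omega> in P. good_path D \<omega>"
    using AE_exp_beta_integrable AE_space by eventually_elim (simp add: good_path_def space_P)
  have Blim: "(\<lambda>n. prob (B e n)) \<longlonglongrightarrow> 0" if e: "0 < e" for e
  proof (rule tendsto_sandwich[OF _ _ tendsto_const])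
    let ?g = "\<lambda>n. {\<omega>\<in>space P. \<eta> * real n + \<mu> * snd (\<omega> (real n)) < 0}"
    let ?E = "\<lambda>t. {\<omega>\<in>space P. E t \<omega> > ennreal e}"
    have "((\<lambda>t. prob (?E t)) \<longlongrightarrow> 0) at_top" using Etend e by (simp add: tends_to_0_in_probability_def)
    from filterlim_compose[OF this filterlim_real_sequentially] prob_growth_factor_small[OF \<eta>, of \<mu>]
    show "(\<lambda>n. prob (?g n) + prob (?E (real n))) \<longlonglongrightarrow> 0" using tendsto_add by fastforce
    have "prob (B e n) \<le> prob (?g n) + prob (?E (real n))" for n
    proof -
      have gm: "?g n \<in> events" "?E (real n) \<in> events" by measurable
      \<comment> \<open>\<open>B e n\<close> is tested at the path shifted by n, so that \<phi> runs
        from time 0 along the unshifted path. Unless the growth factor is below 1, the initial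
        multiple lies in the interval, and its image, the grown configuration, is no farther from
        the attractor than \<open>E\<close>.\<close>
      have sub: "\<omega> \<in> ?g n \<union> ?E (real n)"
        if g: "good_path D \<omega>" and sp: "\<omega> \<in> space P" and "shift (real n) \<omega> \<in> B e n" for \<omega>
      proof (cases "\<omega> \<in> ?g n")
        case False
        let ?w = "exp (- (\<eta> * real n + \<mu> * snd (\<omega> (real n)))) *\<^sub>R v 1"
        have "?w \<in> order_interval D (box (- M)) (box M)" by (rule in_box) (use False sp in auto)
        moreover have K: "1 + \<tau> n (shift (real n) \<omega>) \<le> T"
          and Ge: "e < G (shift (real n) \<omega>) (1 + \<tau> n (shift (real n) \<omega>))"
          using that(3) by (auto simp: B_def)
        moreover have "\<phi> (real n) \<omega> ?w = v (1 + \<tau> n (shift (real n) \<omega>))"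
          using rds_grown_bumps[OF rds g, of "real n"] K by (simp add: \<tau>_def)
        ultimately have "v (1 + \<tau> n (shift (real n) \<omega>)) \<in> \<phi> (real n) \<omega> ` order_interval D (box (- M)) (box M)"
          by (metis image_eqI)
        then have le: "semidist {v (1 + \<tau> n (shift (real n) \<omega>))} (A (shift (real n) \<omega>)) \<le> E (real n) \<omega>"
          unfolding E_def by (rule semidist_mono)
        have "0 \<le> \<tau> n (shift (real n) \<omega>)" unfolding \<tau>_def clock_def set_lebesgue_integral_def by simp
        then have "max 1 (min T (1 + \<tau> n (shift (real n) \<omega>))) = 1 + \<tau> n (shift (real n) \<omega>)" using K by auto
        then have "e < enn2real (semidist {v (1 + \<tau> n (shift (real n) \<omega>))} (A (shift (real n) \<omega>)))"
          using Ge by (simp add: G_def enn2real_semidist_singleton)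
        then have "ennreal e < semidist {v (1 + \<tau> n (shift (real n) \<omega>))} (A (shift (real n) \<omega>))"
          using e enn2real_mono[of _ "ennreal e"] by (force simp: not_less[symmetric])
        then have "ennreal e < E (real n) \<omega>" using le by (rule less_le_trans)
        then show ?thesis using sp by simp
      qed simp
      \<comment> \<open>Shift invariance replaces the event at time 0 by the one seen from time
        n.\<close>
      have "prob (B e n) = prob {\<omega>\<in>space P. shift (real n) \<omega> \<in> B e n}" by (rule prob_shift[OF Bm, symmetric])
      also have "\<dots> \<le> prob (?g n \<union> ?E (real n))"
      proof (rule finite_measure_mono_AE)
        show "AE \<omega> in P. \<omega> \<in> {\<omega>\<in>space P. shift (real n) \<omega> \<in> B e n} \<longrightarrow> \<omega> \<in> ?g n \<union> ?E (real n)"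
          using good by eventually_elim (use sub in blast)
        show "?g n \<union> ?E (real n) \<in> events" using gm by (rule sets.Un)
      qed
      also have "\<dots> \<le> prob (?g n) + prob (?E (real n))" by (rule measure_Un_le[OF gm])
      finally show ?thesis .
    qed
    then show "\<forall>\<^sub>F n in sequentially. prob (B e n) \<le> prob (?g n) + prob (?E (real n))" by simp
  qed simp
  have "AE \<omega> in P. \<forall>N. \<exists>n\<ge>N. \<omega> \<notin> B (1 / real (Suc j)) n" for j
    by (rule AE_frequently_not_in[OF Bm Blim]) simp
  then have "AE \<omega> in P. \<forall>j. \<forall>N. \<exists>n\<ge>N. \<omega> \<notin> B (1 / real (Suc j)) n" by (simp add: AE_all_countable)
  moreover have "AE \<omega> in P. (\<forall>n. \<tau> n \<omega> \<le> \<tau>' \<omega>) \<and> (\<lambda>n. \<tau> n \<omega>) \<longlonglongrightarrow> \<tau>' \<omega>"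
    unfolding \<tau>_def \<tau>'_def by (rule AE_clock_tendsto) (use \<eta> p2 in simp)
  ultimately have "AE \<omega> in P. 1 + \<tau>' \<omega> \<le> T \<longrightarrow> v (1 + \<tau>' \<omega>) \<in> A \<omega>"
    using ne cl AE_space
  proof eventually_elim
    fix \<omega> assume fr: "\<forall>j. \<forall>N. \<exists>n\<ge>N. \<omega> \<notin> B (1 / real (Suc j)) n"
      and lim: "(\<forall>n. \<tau> n \<omega> \<le> \<tau>' \<omega>) \<and> (\<lambda>n. \<tau> n \<omega>) \<longlonglongrightarrow> \<tau>' \<omega>"
      and A: "A \<omega> \<noteq> {} \<and> compact (A \<omega>)" "closed (A \<omega>)" and sp: "\<omega> \<in> space P"
    show "1 + \<tau>' \<omega> \<le> T \<longrightarrow> v (1 + \<tau>' \<omega>) \<in> A \<omega>"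
    proof
      assume K: "1 + \<tau>' \<omega> \<le> T"
      have "isCont (G \<omega>) (1 + \<tau>' \<omega>)" using Gc[of \<omega>] by (simp add: continuous_on_eq_continuous_at)
      moreover have "(\<lambda>n. 1 + \<tau> n \<omega>) \<longlonglongrightarrow> 1 + \<tau>' \<omega>" using lim by (intro tendsto_intros) auto
      ultimately have Glim: "(\<lambda>n. G \<omega> (1 + \<tau> n \<omega>)) \<longlonglongrightarrow> G \<omega> (1 + \<tau>' \<omega>)" by (rule isCont_tendsto_compose)
      \<comment> \<open>If the limit were larger, all late n would belong to \<open>B\<close>,
        whereas every tail contains an n outside.\<close>
      have le: "G \<omega> (1 + \<tau>' \<omega>) \<le> 1 / real (Suc j)" for j
      proof (rule ccontr)
        assume "\<not> ?thesis"
        then have "eventually (\<lambda>n. G \<omega> (1 + \<tau> n \<omega>) > 1 / real (Suc j)) sequentially"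
          using order_tendstoD(1)[OF Glim] by simp
        then obtain N where "\<And>n. N \<le> n \<Longrightarrow> G \<omega> (1 + \<tau> n \<omega>) > 1 / real (Suc j)"
          by (auto simp: eventually_sequentially)
        moreover have "1 + \<tau> n \<omega> \<le> T" for n using lim K by (meson add_left_mono order_trans)
        ultimately show False using fr[rule_format, of N j] sp by (auto simp: B_def)
      qed
      have "(\<lambda>j. 1 / real (Suc j)) \<longlonglongrightarrow> 0" by (rule LIMSEQ_Suc[OF lim_1_over_n])
      then have "G \<omega> (1 + \<tau>' \<omega>) \<le> 0" by (rule LIMSEQ_le_const) (use le in blast)
      moreover have "0 \<le> \<tau>' \<omega>" unfolding \<tau>'_def clock_def set_lebesgue_integral_def by simp
      then have "max 1 (min T (1 + \<tau>' \<omega>)) = 1 + \<tau>' \<omega>" using K by auto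
      ultimately have "infdist (v (1 + \<tau>' \<omega>)) (A \<omega>) = 0" using infdist_nonneg by (auto simp: G_def intro: antisym)
      then show "v (1 + \<tau>' \<omega>) \<in> A \<omega>" using A by (simp add: in_closed_iff_infdist_zero)
    qed
  qed
  then show ?thesis by (simp add: \<tau>'_def)
qed

end

section \<open>Packings by bumps and the entropy\<close>

text \<open>Two points in one open ball of radius \<delta> are closer than
  \<open>2 * \<delta>\<close>, so each ball of a cover contains at most one point of
  \<open>F\<close>.\<close>

lemma card_le_covering_number:
  assumes A: "compact A" "A \<subseteq> H" and F: "finite F" "F \<subseteq> A" and \<delta>: "0 < \<delta>"
    and sep: "\<And>x y. x \<in> F \<Longrightarrow> y \<in> F \<Longrightarrow> x \<noteq> y \<Longrightarrow> 2 * \<delta> \<le> dist x y"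
  shows "card F \<le> covering_number H \<delta> A"
proof -
  let ?P = "\<lambda>n. \<exists>C. finite C \<and> card C = n \<and> C \<subseteq> H \<and> A \<subseteq> (\<Union>c\<in>C. ball c \<delta>)"
  \<comment> \<open>Without a finite cover the \<open>LEAST\<close> in
    \<open>covering_number\<close> would say nothing; compactness provides one, with centres in
    \<open>A\<close> and hence in \<open>H\<close>.\<close>
  obtain C where "C \<subseteq> A" "finite C" "A \<subseteq> (\<Union>c\<in>C. ball c \<delta>)"
    using compactE_image[OF A(1), of A "\<lambda>c. ball c \<delta>"] \<delta> by (metis UN_I centre_in_ball open_ball subsetI)
  then have "?P (card C)" using A(2) by blast
  then have "?P (LEAST n. ?P n)" by (rule LeastI)
  then obtain C where C: "finite C" "card C = covering_number H \<delta> A" "A \<subseteq> (\<Union>c\<in>C. ball c \<delta>)"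
    unfolding covering_number_def by blast
  have "\<exists>c\<in>C. x \<in> ball c \<delta>" if "x \<in> F" for x using that F(2) C(3) by blast
  then obtain f where f: "\<And>x. x \<in> F \<Longrightarrow> f x \<in> C \<and> dist (f x) x < \<delta>" unfolding mem_ball by metis
  have "inj_on f F"
  proof (rule inj_onI, rule ccontr)
    fix x y assume xy: "x \<in> F" "y \<in> F" "f x = f y" "x \<noteq> y"
    have "dist x y \<le> dist (f x) x + dist (f y) y"
      using dist_triangle[of x y "f x"] xy(3) by (simp add: dist_commute)
    also have "\<dots> < 2 * \<delta>" using f[OF xy(1)] f[OF xy(2)] by simp
    finally show False using sep[OF xy(1,2,4)] by simp
  qed
  then have "card F \<le> card C" by (rule card_inj_on_le) (use f C in auto)
  then show ?thesis using C by simp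
qed

lemma separated_grid:
  fixes D :: "'a::euclidean_space set"
  assumes "open D" "D \<noteq> {}"
  obtains r where "0 < r" "\<And>n::nat. 0 < n \<Longrightarrow> \<exists>G\<subseteq>D. finite G \<and> card G = n ^ DIM('a) \<and>
    (\<forall>c\<in>G. cball c (r / n) \<subseteq> D) \<and> (\<forall>c\<in>G. \<forall>c'\<in>G. c \<noteq> c' \<longrightarrow> 2 * (r / n) \<le> dist c c')"
proof -
  obtain x0 R where R: "0 < R" "cball x0 R \<subseteq> D"
    using assms open_contains_cball[of D] by blast
  \<comment> \<open>The grid has mesh 2 r / n with fewer than n steps in each coordinate, so its
    points are within \<open>2 * DIM('a) * r\<close> of \<open>x0\<close>; one more \<open>r\<close>
    is left for the balls of radius r / n.\<close>
  define r where "r = R / (2 * DIM('a) + 1)"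
  have r0: "0 < r" using R by (simp add: r_def add_nonneg_pos)
  have rR: "2 * DIM('a) * r + r = R"
  proof -
    have "2 * DIM('a) * r + r = (2 * DIM('a) + 1) * r" by (simp add: distrib_right)
    also have "\<dots> = R" unfolding r_def by (simp add: add_nonneg_eq_0_iff)
    finally show ?thesis .
  qed
  have "\<exists>G\<subseteq>D. finite G \<and> card G = n ^ DIM('a) \<and>
    (\<forall>c\<in>G. cball c (r / n) \<subseteq> D) \<and> (\<forall>c\<in>G. \<forall>c'\<in>G. c \<noteq> c' \<longrightarrow> 2 * (r / n) \<le> dist c c')"
    if n: "0 < n" for n :: nat
  proof -
    define I where "I = Pi\<^sub>E (Basis :: 'a set) (\<lambda>_. {..<n})"
    define g where "g \<kappa> = x0 + (2 * (r / n)) *\<^sub>R (\<Sum>b\<in>Basis. real (\<kappa> b) *\<^sub>R b)" for \<kappa> :: "'a \<Rightarrow> nat"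
    have e0: "0 < r / n" using r0 n by simp
    have far: "2 * (r / n) \<le> dist (g \<kappa>) (g \<kappa>')" if k: "\<kappa> \<in> I" "\<kappa>' \<in> I" "\<kappa> \<noteq> \<kappa>'" for \<kappa> \<kappa>'
    proof -
      obtain b where b: "b \<in> Basis" "\<kappa> b \<noteq> \<kappa>' b"
        using k PiE_ext[of \<kappa> Basis "\<lambda>_. {..<n}" \<kappa>'] unfolding I_def by blast
      have "(g \<kappa> - g \<kappa>') \<bullet> b = 2 * (r / n) * (real (\<kappa> b) - real (\<kappa>' b))"
        using b(1) by (simp add: g_def inner_diff_left inner_add_left inner_sum_left_Basis right_diff_distrib)
      moreover have "1 \<le> \<bar>real (\<kappa> b) - real (\<kappa>' b)\<bar>" using b(2) by linarith
      then have "2 * (r / n) * 1 \<le> 2 * (r / n) * \<bar>real (\<kappa> b) - real (\<kappa>' b)\<bar>"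
        using e0 by (intro mult_left_mono) auto
      moreover have "\<bar>(g \<kappa> - g \<kappa>') \<bullet> b\<bar> \<le> norm (g \<kappa> - g \<kappa>')" by (rule Basis_le_norm[OF b(1)])
      ultimately show ?thesis using r0 by (simp add: abs_mult dist_norm)
    qed
    have inj: "inj_on g I"
    proof (rule inj_onI, rule ccontr)
      fix \<kappa> \<kappa>' assume "\<kappa> \<in> I" "\<kappa>' \<in> I" "g \<kappa> = g \<kappa>'" "\<kappa> \<noteq> \<kappa>'"
      then show False using far[of \<kappa> \<kappa>'] e0 by simp
    qed
    have cb: "cball (g \<kappa>) (r / n) \<subseteq> D" if "\<kappa> \<in> I" for \<kappa>
    proof -
      have "norm (\<Sum>b\<in>Basis. real (\<kappa> b) *\<^sub>R b) \<le> (\<Sum>b\<in>(Basis::'a set). real n)"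
        using that by (intro sum_norm_le) (fastforce simp: I_def PiE_iff intro: less_imp_le)
      then have "2 * (r / n) * norm (\<Sum>b\<in>Basis. real (\<kappa> b) *\<^sub>R b) \<le> 2 * (r / n) * (DIM('a) * n)"
        using e0 by (intro mult_left_mono) auto
      then have "dist x0 (g \<kappa>) \<le> 2 * DIM('a) * r" using n e0 r0 by (simp add: g_def dist_norm abs_mult mult_ac)
      moreover have "r / n \<le> r" using n r0 by (simp add: field_simps)
      ultimately have "cball (g \<kappa>) (r / n) \<subseteq> cball x0 R"
        using rR by (intro subsetI) (simp add: mem_cball, smt (verit) dist_triangle)
      then show ?thesis using R by blast
    qed
    have gD: "g ` I \<subseteq> D" using cb e0 by (force simp: subset_iff)
    moreover have "finite (g ` I)" unfolding I_def by (intro finite_imageI finite_PiE) auto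
    moreover have "card (g ` I) = n ^ DIM('a)" by (simp add: card_image[OF inj]) (simp add: I_def card_PiE)
    ultimately show ?thesis using cb far by (intro exI[of _ "g ` I"]) blast
  qed
  then show thesis using r0 that by blast
qed

section \<open>Many configurations of bumps in one domain\<close>

locale barenblatt_domain = sobolev2 D p + barenblatt p "real DIM('a)" lam q gam k
  for D :: "'a::euclidean_space set" and p lam q gam k :: real
begin

text \<open>\<open>bumps.v\<close> with the set of centres as an argument, so that configurations
  can be compared outside the locale that fixes one.\<close>

definition bump_sum :: "real \<Rightarrow> 'a set \<Rightarrow> real \<Rightarrow> 'a l2" where
  "bump_sum C S t = abs_l2 (\<lambda>x. \<Sum>c\<in>S. U C t (x - c))"

lemma bumps_subset:
  assumes "bumps D p lam q gam k C T G" "S \<subseteq> G"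
  shows "bumps D p lam q gam k C T S"
proof -
  interpret bumps D p lam q gam k C T G by fact
  show ?thesis
  proof unfold_locales
    show "finite S" using assms(2) S by (rule finite_subset)
    show "cball c (rad C T) \<subseteq> D" if "c \<in> S" for c using inside that assms(2) by blast
    show "2 * rad C T \<le> dist c c'" if "c \<in> S" "c' \<in> S" "c \<noteq> c'" for c c'
      using separated that assms(2) by blast
  qed (use C T in auto)
qed

text \<open>At this radius \<open>Y\<close> has dropped to \<open>C / 2\<close> at time 1 and is
  larger later, while the prefactor of \<open>U\<close> is smallest at \<open>T\<close>.\<close>

lemma U_lower_bound:
  assumes C: "0 < C" and t: "1 \<le> t" "t \<le> T" and x: "norm x \<le> (C / (2 * k)) powr (1 / q)"
  shows "T powr (- real DIM('a) * lam) * (C / 2) powr gam \<le> U C t (x :: 'a)"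
proof -
  have "norm x powr q \<le> ((C / (2 * k)) powr (1 / q)) powr q" using x q by (intro powr_mono2) auto
  also have "\<dots> = C / (2 * k)" using q C k_pos by (simp add: powr_powr)
  finally have n: "norm x powr q \<le> C / (2 * k)" .
  have "t powr (- lam * q) \<le> 1" using powr_mono[of "- lam * q" 0 t] t lam_pos q by simp
  then have "t powr (- lam * q) * norm x powr q \<le> 1 * (C / (2 * k))"
    using n by (intro mult_mono) auto
  then have "k * (t powr (- lam * q) * norm x powr q) \<le> k * (C / (2 * k))"
    using k_pos by (intro mult_left_mono) auto
  also have "\<dots> = C / 2" using k_pos by simp
  finally have Y: "C / 2 \<le> Y C t x" by (simp add: Y_def mult_ac)
  have "(C / 2) powr gam \<le> pos_powr gam (Y C t x)"
    using Y C gam by (simp add: pos_powr_def powr_mono2)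
  moreover have "T powr (- real DIM('a) * lam) \<le> t powr (- real DIM('a) * lam)"
    using t lam_pos by (intro powr_mono2') auto
  ultimately show ?thesis unfolding U_def by (intro mult_mono) auto
qed

text \<open>Two different sets of centres differ in some \<open>c\<close>. On the ball of radius
  \<open>R\<close> around \<open>c\<close> no other bump is present, and the bump at
  \<open>c\<close> occurs in exactly one of the two sums; its lower bound there gives the
  estimate.\<close>

lemma bump_sum_separated:
  assumes G: "bumps D p lam q gam k C T G" and sub: "S \<subseteq> G" "S' \<subseteq> G" "S \<noteq> S'" and t: "1 \<le> t" "t \<le> T"
  defines "R \<equiv> (C / (2 * k)) powr (1 / q)"
  shows "(T powr (- real DIM('a) * lam) * (C / 2) powr gam)\<^sup>2 * (unit_ball_vol (real DIM('a)) * R ^ DIM('a))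
    \<le> (norm (bump_sum C S t - bump_sum C S' t))\<^sup>2"
proof -
  interpret bumps D p lam q gam k C T G by fact
  define w where "w S x = (\<Sum>c\<in>S. U C t (x - c))" for S and x :: 'a
  have sq: "square_integrable (w S)" if "S \<subseteq> G" for S
  proof -
    have "w S = bumps.u lam q gam k C S t"
      using bumps.u_def[OF bumps_subset[OF G that]] by (simp add: w_def fun_eq_iff)
    then show ?thesis using bumps.v_in(3)[OF bumps_subset[OF G that] t] by simp
  qed
  obtain c where c: "c \<in> G" "(c \<in> S) \<noteq> (c \<in> S')" using sub by blast
  let ?m = "T powr (- real DIM('a) * lam) * (C / 2) powr gam"
  have R0: "0 \<le> R" by (simp add: R_def)
  have "R \<le> (C / k) powr (1 / q)"
    unfolding R_def using C k_pos q by (intro powr_mono2) (auto simp: field_simps)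
  also have "\<dots> \<le> rad C t"
    using t lam_pos mult_right_mono[OF ge_one_powr_ge_zero[of t lam], of "(C / k) powr (1 / q)"] by (simp add: rad_def)
  finally have Rr: "R \<le> rad C t" .
  have wx: "w A x = (if c \<in> A then U C t (x - c) else 0)" if x: "x \<in> ball c R" and A: "A \<subseteq> G" for A x
  proof -
    have "U C t (x - c') = (if c' = c then U C t (x - c) else 0)" if "c' \<in> A" for c'
      using only_one_bump[OF t c(1), of x c'] x Rr that A outside_zero(1)[OF C, of t "x - c'"] t
      by (auto simp: dist_norm norm_minus_commute)
    then have "w A x = (\<Sum>c'\<in>A. if c' = c then U C t (x - c) else 0)"
      unfolding w_def by (rule sum.cong[OF refl])
    then show ?thesis using finite_subset[OF A S] by simp
  qed
  have lower: "?m\<^sup>2 * indicator (ball c R) x \<le> (w S x - w S' x)\<^sup>2" for x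
  proof (cases "x \<in> ball c R")
    case True
    have "?m \<le> U C t (x - c)"
      using True by (intro U_lower_bound[OF C t]) (simp add: R_def dist_norm norm_minus_commute)
    moreover have "(w S x - w S' x)\<^sup>2 = (U C t (x - c))\<^sup>2"
      using wx[OF True sub(1)] wx[OF True sub(2)] c(2) by auto
    moreover have "0 \<le> ?m" by simp
    ultimately show ?thesis using True power_mono[of ?m "U C t (x - c)" 2] by simp
  qed simp
  have "?m\<^sup>2 * (unit_ball_vol (real DIM('a)) * R ^ DIM('a)) = (\<integral>x. ?m\<^sup>2 * indicator (ball c R) x \<partial>lebesgue)"
    using content_ball[OF R0, of c] by simp
  also have "\<dots> \<le> (\<integral>x. (w S x - w S' x)\<^sup>2 \<partial>lebesgue)"
  proof (rule integral_mono[OF _ _ lower])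
    show "integrable lebesgue (\<lambda>x. ?m\<^sup>2 * indicator (ball c R) x)"
      using emeasure_bounded_finite[OF bounded_ball, of c R]
      by (intro integrable_mult_right integrable_real_indicator) auto
    show "integrable lebesgue (\<lambda>x. (w S x - w S' x)\<^sup>2)"
      using square_integrable_diff[OF sq[OF sub(1)] sq[OF sub(2)]] by (simp add: square_integrable_def)
  qed
  also have "\<dots> = (norm (bump_sum C S t - bump_sum C S' t))\<^sup>2"
    unfolding bump_sum_def w_def[symmetric]
    by (simp add: abs_l2_diff[OF sq[OF sub(1)] sq[OF sub(2)]] norm_abs_l2_sq square_integrable_diff[OF sq[OF sub(1)] sq[OF sub(2)]])
  finally show ?thesis .
qed

lemma packing:
  assumes T: "1 \<le> T" and D: "D \<noteq> {}"
  obtains c where "0 < c" "\<And>n::nat. 0 < n \<Longrightarrow> \<exists>C G. bumps D p lam q gam k C T G \<and> card G = n ^ DIM('a) \<and>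
    (\<forall>S\<subseteq>G. \<forall>S'\<subseteq>G. S \<noteq> S' \<longrightarrow> (\<forall>t\<in>{1..T}.
      2 * c * real n powr (- (p / (p - 2) + real DIM('a) / 2)) \<le> norm (bump_sum C S t - bump_sum C S' t)))"
proof -
  let ?d = "real DIM('a)"
  obtain r where r: "0 < r" and grid: "\<And>n::nat. 0 < n \<Longrightarrow> \<exists>G\<subseteq>D. finite G \<and> card G = n ^ DIM('a) \<and>
    (\<forall>c\<in>G. cball c (r / n) \<subseteq> D) \<and> (\<forall>c\<in>G. \<forall>c'\<in>G. c \<noteq> c' \<longrightarrow> 2 * (r / n) \<le> dist c c')"
    using separated_grid[OF open_D D] by metis
  \<comment> \<open>Solves \<open>rad (C n) T = r / n\<close>, so that the bumps at the final time
    just fit the grid.\<close>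
  define C where "C n = k * (r / n / T powr lam) powr q" for n :: nat
  \<comment> \<open>The square root of the bound in \<open>bump_sum_separated\<close>, stripped of
    its powers of n. These come from the height, with exponent \<open>q * gam = p / (p - 2)\<close>,
    and from the volume, with half the dimension.\<close>
  define h where "h = T powr (- ?d * lam) * (k / 2) powr gam * (r / T powr lam) powr (q * gam)
    * sqrt (unit_ball_vol ?d) * (r / T powr lam * (1 / 2) powr (1 / q)) powr (?d / 2)"
  have T0: "0 < T powr lam" using T by simp
  have h0: "0 < h" unfolding h_def using T r k_pos q by (intro mult_pos_pos) auto
  have qg: "q * gam = p / (p - 2)" using p2 p by (simp add: q_def gam_def)
  have "\<exists>C G. bumps D p lam q gam k C T G \<and> card G = n ^ DIM('a) \<and>
    (\<forall>S\<subseteq>G. \<forall>S'\<subseteq>G. S \<noteq> S' \<longrightarrow> (\<forall>t\<in>{1..T}.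
      2 * (h / 2) * real n powr (- (p / (p - 2) + ?d / 2)) \<le> norm (bump_sum C S t - bump_sum C S' t)))"
    if n: "0 < n" for n :: nat
  proof -
    let ?N = "real n powr (- (p / (p - 2) + ?d / 2))"
    have C0: "0 < C n" using k_pos r T0 n by (simp add: C_def)
    have a: "r / n / T powr lam = (r / T powr lam) * (1 / n)" by simp
    have rad: "rad (C n) T = r / n"
      using k_pos r T0 n q by (simp add: rad_def C_def powr_powr)
    obtain G where G: "G \<subseteq> D" "finite G" "card G = n ^ DIM('a)" "\<forall>c\<in>G. cball c (r / n) \<subseteq> D"
      "\<forall>c\<in>G. \<forall>c'\<in>G. c \<noteq> c' \<longrightarrow> 2 * (r / n) \<le> dist c c'" using grid[OF n] by blast
    have b: "bumps D p lam q gam k (C n) T G"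
      using C0 T G by unfold_locales (auto simp: rad)
    let ?R = "(C n / (2 * k)) powr (1 / q)"
    have R: "?R = r / T powr lam * (1 / 2) powr (1 / q) * (1 / n)"
    proof -
      have "C n / (2 * k) = (r / n / T powr lam) powr q * (1 / 2)" using k_pos by (simp add: C_def)
      then have "?R = ((r / n / T powr lam) powr q) powr (1 / q) * (1 / 2) powr (1 / q)"
        using r T0 n by (simp only: powr_mult)
      also have "((r / n / T powr lam) powr q) powr (1 / q) = r / n / T powr lam" using q r T0 n by (simp add: powr_powr)
      finally show ?thesis by simp
    qed
    have "(C n / 2) powr gam = (k / 2 * ((r / T powr lam) powr q * (1 / n) powr q)) powr gam"
      unfolding C_def a using r T0 n by (subst powr_mult) auto
    also have "\<dots> = (k / 2) powr gam * ((r / T powr lam) powr (q * gam) * (1 / n) powr (q * gam))"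
      using k_pos r T0 n by (subst powr_mult | simp add: powr_powr)+
    finally have Cg: "(C n / 2) powr gam = (k / 2) powr gam * ((r / T powr lam) powr (q * gam) * (1 / n) powr (q * gam))" .
    have Rd: "?R ^ DIM('a) = ((r / T powr lam * (1 / 2) powr (1 / q)) powr (?d / 2) * (1 / n) powr (?d / 2))\<^sup>2"
    proof -
      have R0: "0 < ?R" unfolding R using r T0 n by simp
      have "?R ^ DIM('a) = (?R powr (?d / 2))\<^sup>2"
        using R0 by (simp add: powr_realpow[symmetric] powr_powr)
      also have "?R powr (?d / 2) = (r / T powr lam * (1 / 2) powr (1 / q)) powr (?d / 2) * (1 / n) powr (?d / 2)"
        unfolding R by (rule powr_mult)
      finally show ?thesis .
    qed
    have N: "(1 / n) powr (q * gam) * (1 / n) powr (?d / 2) = ?N"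
      unfolding qg using n by (simp add: powr_minus powr_divide powr_add[symmetric] field_simps)
    have sq: "(h * ?N)\<^sup>2 = (T powr (- ?d * lam) * (C n / 2) powr gam)\<^sup>2 * (unit_ball_vol ?d * ?R ^ DIM('a))"
    proof -
      have "sqrt (unit_ball_vol ?d) ^ 2 = unit_ball_vol ?d" by simp
      then show ?thesis unfolding Rd Cg N[symmetric] h_def by (simp add: power_mult_distrib mult_ac)
    qed
    have "2 * (h / 2) * ?N \<le> norm (bump_sum (C n) S t - bump_sum (C n) S' t)"
      if "S \<subseteq> G" "S' \<subseteq> G" "S \<noteq> S'" "t \<in> {1..T}" for S S' t
    proof -
      have "(h * ?N)\<^sup>2 \<le> (norm (bump_sum (C n) S t - bump_sum (C n) S' t))\<^sup>2"
        unfolding sq by (rule bump_sum_separated[OF b that(1-3)]) (use that in auto)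
      from power2_le_imp_le[OF this] show ?thesis by simp
    qed
    then show ?thesis using b G(3) by (intro exI[of _ "C n"] exI[of _ G]) blast
  qed
  then show thesis using h0 by (intro that[of "h / 2"]) auto
qed

end

section \<open>From packings at all scales to entropy and dimension\<close>

lemma powr_lower_bound_from_scales:
  fixes h :: "real \<Rightarrow> real" and m :: nat
  assumes c: "0 < c" and b: "0 < b" and \<kappa>: "\<kappa> \<le> real m / b"
    and h: "\<And>n \<delta>. 0 < n \<Longrightarrow> 0 < \<delta> \<Longrightarrow> \<delta> \<le> c * real n powr (- b) \<Longrightarrow> real (n ^ m) * ln 2 \<le> h \<delta>"
  shows "\<exists>C>0. \<forall>\<^sub>F \<delta> in at_right 0. C * \<delta> powr (- \<kappa>) \<le> h \<delta>"
proof (intro exI conjI)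
  let ?C = "(1 / 2) ^ m * c powr (real m / b) * ln 2"
  show "0 < ?C" using c by simp
  have "?C * \<delta> powr (- \<kappa>) \<le> h \<delta>" if \<delta>: "0 < \<delta>" "\<delta> < min c 1" for \<delta>
  proof -
    \<comment> \<open>The real scale at which \<open>c * y powr (- b)\<close> equals \<delta>. Since
      \<open>y \<ge> 1\<close>, rounding down to \<open>n\<close> loses at most a factor 2.\<close>
    define y where "y = (c / \<delta>) powr (1 / b)"
    have y1: "1 \<le> y" unfolding y_def using \<delta> b by (intro ge_one_powr_ge_zero) auto
    define n where "n = nat \<lfloor>y\<rfloor>"
    have "1 \<le> \<lfloor>y\<rfloor>" using y1 by simp
    then have "real n = of_int \<lfloor>y\<rfloor>" "1 \<le> real n" by (simp_all add: n_def)
    then have n: "0 < n" "real n \<le> y" "y / 2 \<le> real n" by linarith+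
    have "\<delta> / c = y powr (- b)"
      unfolding y_def using b c \<delta> by (simp add: powr_powr powr_minus)
    also have "\<dots> \<le> real n powr (- b)" using n b by (intro powr_mono2') auto
    finally have "\<delta> \<le> c * real n powr (- b)" using c by (simp add: field_simps)
    from h[OF n(1) \<delta>(1) this] have H: "real (n ^ m) * ln 2 \<le> h \<delta>" .
    have "y ^ m = y powr real m" using y1 by (simp add: powr_realpow)
    also have "\<dots> = (c / \<delta>) powr (real m / b)" by (simp add: y_def powr_powr)
    also have "\<dots> = c powr (real m / b) * \<delta> powr (- (real m / b))"
      using c \<delta> by (simp add: powr_divide powr_minus field_simps)
    finally have ym: "y ^ m = c powr (real m / b) * \<delta> powr (- (real m / b))" .
    \<comment> \<open>Because \<delta> < 1, the bound with exponent \<open>real m / b\<close>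
      implies the one with the smaller \<kappa>.\<close>
    have "\<delta> powr (- \<kappa>) \<le> \<delta> powr (- (real m / b))" using \<delta> \<kappa> by (intro powr_mono') auto
    then have "?C * \<delta> powr (- \<kappa>) \<le> ?C * \<delta> powr (- (real m / b))"
      using c by (intro mult_left_mono) auto
    also have "\<dots> = (y / 2) ^ m * ln 2" by (simp add: power_divide ym)
    also have "\<dots> \<le> real (n ^ m) * ln 2"
      using n y1 by (auto intro!: mult_right_mono power_mono)
    finally show ?thesis using H by (rule order_trans)
  qed
  then show "\<forall>\<^sub>F \<delta> in at_right 0. ?C * \<delta> powr (- \<kappa>) \<le> h \<delta>"
    using c by (intro eventually_at_rightI[of 0 "min c 1"]) auto
qed

text \<open>A negative power of \<delta> outgrows the logarithm, so the quotient even converges to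
  \<infinity>.\<close>

lemma fractal_dimension_infinite:
  assumes C: "0 < C" and \<kappa>: "0 < \<kappa>"
    and ev: "\<forall>\<^sub>F \<delta> in at_right 0. C * \<delta> powr (- \<kappa>) \<le> kolmogorov_entropy H \<delta> A"
  shows "fractal_dimension H A = \<infinity>"
proof -
  have "filterlim (\<lambda>\<delta>. C * \<delta> powr (- \<kappa>) / ln (1 / \<delta>)) at_top (at_right 0)"
    using C \<kappa> by real_asymp
  moreover have "\<forall>\<^sub>F \<delta>::real in at_right 0. 0 < \<delta> \<and> \<delta> < 1"
    by (rule eventually_at_rightI[of 0 1]) auto
  with ev have "\<forall>\<^sub>F \<delta> in at_right 0. C * \<delta> powr (- \<kappa>) / ln (1 / \<delta>) \<le> kolmogorov_entropy H \<delta> A / ln (1 / \<delta>)"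
    by eventually_elim (auto intro!: divide_right_mono)
  ultimately have "filterlim (\<lambda>\<delta>. kolmogorov_entropy H \<delta> A / ln (1 / \<delta>)) at_top (at_right 0)"
    by (rule filterlim_at_top_mono)
  then have "((\<lambda>\<delta>. ereal (kolmogorov_entropy H \<delta> A / ln (1 / \<delta>))) \<longlongrightarrow> \<infinity>) (at_right 0)"
    by (simp add: tendsto_PInfty_eq_at_top)
  then show ?thesis
    unfolding fractal_dimension_def by (intro lim_imp_Limsup) auto
qed

text \<open>The clock need not be bounded uniformly in the path, whereas configurations are built
  for a given final time. So they are chosen, independently of \<omega>, for every integer
  \<open>K\<close> and every n; this leaves countably many exceptional null sets, and each path uses
  some \<open>K\<close> above its own clock. The constant depends on the path only through this
  \<open>K\<close>.\<close>

lemma (in barenblatt_domain) AE_entropy_lower_bound: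
  assumes noise: "canonical_noise_space D Q P" and \<eta>: "0 < \<eta>" and D: "D \<noteq> {}"
    and rds: "is_rds_of_equation D p \<eta> \<mu> \<phi>" and attr: "weak_interval_random_attractor D P \<phi> A"
  shows "AE \<omega> in P. \<exists>c>0. \<forall>n \<delta>. 0 < n \<longrightarrow> 0 < \<delta> \<longrightarrow>
    \<delta> \<le> c * real n powr (- (p / (p - 2) + real DIM('a) / 2)) \<longrightarrow>
    real (n ^ DIM('a)) * ln 2 \<le> kolmogorov_entropy (L2 D) \<delta> (A \<omega>)"
proof -
  let ?\<tau> = "clock ((p - 2) * \<eta>) ((p - 2) * \<mu>) {..0}"
  let ?b = "p / (p - 2) + real DIM('a) / 2"
  define Q where "Q K c n C G \<longleftrightarrow> bumps D p lam q gam k C (1 + real K) G \<and> card G = n ^ DIM('a) \<and>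
    (\<forall>S\<subseteq>G. \<forall>S'\<subseteq>G. S \<noteq> S' \<longrightarrow> (\<forall>t\<in>{1..1 + real K}.
      2 * c * real n powr (- ?b) \<le> norm (bump_sum C S t - bump_sum C S' t)))" for K :: nat and c and n :: nat and C G
  have "\<exists>c>0. \<forall>n::nat>0. \<exists>C G. Q K c n C G" for K
    using packing[OF _ D, of "1 + real K"] unfolding Q_def by (metis le_add_same_cancel1 of_nat_0_le_iff)
  then obtain c where c: "\<And>K. 0 < c K" "\<And>K n. 0 < n \<Longrightarrow> \<exists>C G. Q K (c K) n C G" by metis
  \<comment> \<open>The radius constant is picked together with a grid and before the path; the
    almost sure statements below refer to these fixed choices.\<close>
  define C where "C K n = (SOME C. \<exists>G. Q K (c K) n C G)" for K n
  define G where "G K n = (SOME G. Q K (c K) n (C K n) G)" for K n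
  have CG: "Q K (c K) n (C K n) (G K n)" if "0 < n" for K n
  proof -
    have "\<exists>G. Q K (c K) n (C K n) G" unfolding C_def by (rule someI_ex[OF c(2)[OF that]])
    then show ?thesis unfolding G_def by (rule someI_ex)
  qed
  have bmp: "bumps D p lam q gam k (C K n) (1 + real K) (G K n)" if "0 < n" for K n
    by (rule CG[OF that, unfolded Q_def, THEN conjunct1])
  have fin: "finite (G K n)" if "0 < n" for K n by (rule bumps.S[OF bmp[OF that]])
  have in_A: "AE \<omega> in P. \<forall>S\<in>Pow (G K n). 1 + ?\<tau> \<omega> \<le> 1 + real K \<longrightarrow> bump_sum (C K n) S (1 + ?\<tau> \<omega>) \<in> A \<omega>"
    if n: "0 < n" for K n
  proof (rule AE_finite_allI)
    show "finite (Pow (G K n))" using fin[OF n] by simp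
    fix S assume "S \<in> Pow (G K n)"
    then interpret bumps D p lam q gam k "C K n" "1 + real K" S
      by (intro bumps_subset[OF bmp[OF n]]) simp
    show "AE \<omega> in P. 1 + ?\<tau> \<omega> \<le> 1 + real K \<longrightarrow> bump_sum (C K n) S (1 + ?\<tau> \<omega>) \<in> A \<omega>"
      using AE_bumps_in_attractor[OF noise \<eta> p rds attr] unfolding v_def u_def[abs_def] bump_sum_def .
  qed
  have "AE \<omega> in P. \<forall>K. \<forall>n\<in>{0<..}. \<forall>S\<in>Pow (G K n). 1 + ?\<tau> \<omega> \<le> 1 + real K \<longrightarrow> bump_sum (C K n) S (1 + ?\<tau> \<omega>) \<in> A \<omega>"
    unfolding AE_all_countable by (intro allI AE_ball_countable' in_A) auto
  moreover have "AE \<omega> in P. compact (A \<omega>)"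
    using attr by (auto simp: weak_interval_random_attractor_def)
  ultimately show ?thesis using AE_space
  proof eventually_elim
    case (elim \<omega>)
    obtain K where K: "?\<tau> \<omega> \<le> real K" using real_arch_simple by blast
    have "0 \<le> ?\<tau> \<omega>" unfolding clock_def set_lebesgue_integral_def by simp
    then have t: "1 + ?\<tau> \<omega> \<in> {1..1 + real K}" using K by simp
    have "real (n ^ DIM('a)) * ln 2 \<le> kolmogorov_entropy (L2 D) \<delta> (A \<omega>)"
      if n: "0 < n" and \<delta>: "0 < \<delta>" "\<delta> \<le> c K * real n powr (- ?b)" for n \<delta>
    proof -
      let ?f = "\<lambda>S. bump_sum (C K n) S (1 + ?\<tau> \<omega>)"
      have card: "card (G K n) = n ^ DIM('a)" using CG[OF n, of K] by (simp add: Q_def)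
      have sep: "2 * \<delta> \<le> dist (?f S) (?f S')" if "S \<subseteq> G K n" "S' \<subseteq> G K n" "S \<noteq> S'" for S S'
      proof -
        have "2 * c K * real n powr (- ?b) \<le> norm (?f S - ?f S')"
          using CG[OF n, of K] that t unfolding Q_def by blast
        then show ?thesis using \<delta>(2) by (simp add: dist_norm)
      qed
      have "inj_on ?f (Pow (G K n))"
      proof (rule inj_onI, rule ccontr)
        fix S S' assume "S \<in> Pow (G K n)" "S' \<in> Pow (G K n)" "?f S = ?f S'" "S \<noteq> S'"
        then show False using sep[of S S'] \<delta>(1) by simp
      qed
      then have "2 ^ (n ^ DIM('a)) = card (?f ` Pow (G K n))"
        using fin[OF n] card by (simp add: card_image card_Pow)
      also have "\<dots> \<le> covering_number (L2 D) \<delta> (A \<omega>)"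
      proof (rule card_le_covering_number[OF _ _ _ _ \<delta>(1)])
        show "?f ` Pow (G K n) \<subseteq> A \<omega>" using elim(1) n K by auto
        show "A \<omega> \<subseteq> L2 D" using attr elim(3) by (simp add: weak_interval_random_attractor_def random_closed_set_def)
        fix x y assume "x \<in> ?f ` Pow (G K n)" "y \<in> ?f ` Pow (G K n)" "x \<noteq> y"
        then show "2 * \<delta> \<le> dist x y" using sep by auto
      qed (use elim(2) fin[OF n] in auto)
      finally have le: "2 ^ (n ^ DIM('a)) \<le> covering_number (L2 D) \<delta> (A \<omega>)" .
      have "real (n ^ DIM('a)) * ln 2 = ln ((2::real) ^ (n ^ DIM('a)))" by (simp add: ln_realpow)
      also have "\<dots> \<le> ln (real (covering_number (L2 D) \<delta> (A \<omega>)))"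
        using of_nat_mono[OF le, where 'a = real] by (intro ln_mono) (auto intro: less_le_trans)
      finally show ?thesis by (simp add: kolmogorov_entropy_def)
    qed
    then show ?case using c(1)[of K] by blast
  qed
qed

theorem theorem4p3:
  fixes D :: "(real ^ 'd) set"
    and \<alpha> \<eta> \<mu> :: real
    and Q :: "(real ^ 'd) l2 \<Rightarrow> (real ^ 'd) l2"
    and P :: "(real ^ 'd) path measure"
    and \<phi> :: "real \<Rightarrow> (real ^ 'd) path \<Rightarrow> (real ^ 'd) l2 \<Rightarrow> (real ^ 'd) l2"
    and \<A> :: "(real ^ 'd) path \<Rightarrow> (real ^ 'd) l2 set"
  assumes "bounded_smooth_domain D"
    and "\<alpha> > 2" and "\<eta> > 0" and "\<mu> \<ge> 0"
    and "canonical_noise_space D Q P"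
    and "is_rds_of_equation D \<alpha> \<eta> \<mu> \<phi>"
    and "weak_interval_random_attractor D P \<phi> \<A>"
  shows "(AE \<omega> in P. \<exists>C>0. \<forall>\<^sub>F \<delta> in at_right 0.
            kolmogorov_entropy (L2 D) \<delta> (\<A> \<omega>) \<ge>
              C * \<delta> powr (- (real CARD('d) * (\<alpha> - 2)) / (real CARD('d) * (\<alpha> - 2) + \<alpha>)))
       \<and> (AE \<omega> in P. fractal_dimension (L2 D) (\<A> \<omega>) = \<infinity>)"
proof -
  have D: "open D" "bounded D" "D \<noteq> {}" using assms(1) by (auto simp: bounded_smooth_domain_def)
  obtain lam q gam k where "barenblatt \<alpha> (real DIM(real ^ 'd)) lam q gam k"
    by (rule barenblatt_exists[OF assms(2), of "real DIM(real ^ 'd)"]) simp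
  moreover have "sobolev2 D \<alpha>" using D assms(2) by unfold_locales auto
  ultimately have "barenblatt_domain D \<alpha> lam q gam k" by (intro barenblatt_domain.intro)
  then interpret barenblatt_domain D \<alpha> lam q gam k .
  let ?d = "real CARD('d)" and ?\<kappa> = "(real CARD('d) * (\<alpha> - 2)) / (real CARD('d) * (\<alpha> - 2) + \<alpha>)"
  have d0: "0 < ?d" by simp
  define X where "X = ?d * (\<alpha> - 2)"
  have X: "0 < X" using d0 assms(2) by (simp add: X_def)
  have b0: "0 < \<alpha> / (\<alpha> - 2) + ?d / 2" using assms(2) d0 by (intro add_pos_pos) auto
  \<comment> \<open>With X = d (\<alpha> - 2) the packings give the exponent 2 X / (2 \<alpha> + X).
    It dominates the claimed X / (X + \<alpha>), because 2 (X + \<alpha>) \<ge> 2 \<alpha> +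
    X.\<close>
  have "?d / (\<alpha> / (\<alpha> - 2) + ?d / 2) = 2 * X / (2 * \<alpha> + X)"
    using assms(2) b0 X unfolding X_def by (simp add: divide_simps) (simp add: algebra_simps)
  moreover have "X / (X + \<alpha>) \<le> 2 * X / (2 * \<alpha> + X)"
    using X assms(2) by (intro frac_le[of "2 * X" "2 * X" "2 * \<alpha> + X" "2 * (X + \<alpha>)", THEN order_trans[rotated]]) (auto simp: field_simps)
  ultimately have \<kappa>: "?\<kappa> \<le> ?d / (\<alpha> / (\<alpha> - 2) + ?d / 2)" by (simp add: X_def)
  have \<kappa>0: "0 < ?\<kappa>" unfolding X_def[symmetric] using X assms(2) by simp
  have 1: "AE \<omega> in P. \<exists>C>0. \<forall>\<^sub>F \<delta> in at_right 0. C * \<delta> powr (- ?\<kappa>) \<le> kolmogorov_entropy (L2 D) \<delta> (\<A> \<omega>)"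
    using AE_entropy_lower_bound[OF assms(5,3) D(3) assms(6,7)]
  proof eventually_elim
    case (elim \<omega>)
    then obtain c where "0 < c" "\<And>n \<delta>. 0 < n \<Longrightarrow> 0 < \<delta> \<Longrightarrow> \<delta> \<le> c * real n powr (- (\<alpha> / (\<alpha> - 2) + ?d / 2)) \<Longrightarrow>
      real (n ^ CARD('d)) * ln 2 \<le> kolmogorov_entropy (L2 D) \<delta> (\<A> \<omega>)" by auto
    then show ?case by (rule powr_lower_bound_from_scales[OF _ b0 \<kappa>])
  qed
  moreover have "AE \<omega> in P. fractal_dimension (L2 D) (\<A> \<omega>) = \<infinity>"
    using 1
  proof eventually_elim
    case (elim \<omega>)
    then show ?case using fractal_dimension_infinite[OF _ \<kappa>0] by blast
  qed
  ultimately show ?thesis by simp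
qed

end
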